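(* Let $S$ be a closed sector in $\mathbb{C}$ of opening angle less than $\pi/3$ and let $H$ be a closed half-plane intersecting $S$ only in $0$ (that is, $H\cap S=\{0\}$). Let $f$ be a transcendental entire function of finite order. Suppose that all but finitely many zeros of $f$ are in $S$ while all but finitely many $1$-points of $f$ are in $H$. Then $f$ has the form $f(z)=P(z)e^{az}$, where $P$ is a polynomial and $a\in\mathbb{C}$.
   Context: A closed sector in $\mathbb{C}$ has its vertex at the origin, i.e. it is a set of the form $\{re^{it}\colon r\ge 0,\ \alpha\le t\le\beta\}$ with real $\alpha<\beta$, $\beta-\alpha<2\pi$; its opening angle is $\beta-\alpha$. A $1$-point of $f$ is a point $z$ with $f(z)=1$. An entire function is transcendental if it is not a polynomial. The order of an entire function $f$ is $\rho=\limsup_{r\to\infty}\frac{\log\log M(r)}{\log r}$, where $M(r)=\max_{|z|=r}|f(z)|$. The phrase "all but finitely many zeros (or $1$-points) are in a set" includes the case that there are only finitely many, or no, such points. *)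

theory Defs
  imports "HOL-Complex_Analysis.Complex_Analysis"
begin

definition closed_sector :: "real \<Rightarrow> real \<Rightarrow> complex set" where
  "closed_sector \<alpha> \<beta> = {complex_of_real r * cis t | r t. 0 \<le> r \<and> \<alpha> \<le> t \<and> t \<le> \<beta>}"

(* The boundary line is arbitrary; it is not required to pass through the origin. *)
definition closed_half_plane :: "complex set \<Rightarrow> bool" where
  "closed_half_plane H \<longleftrightarrow> (\<exists>u b. u \<noteq> 0 \<and> H = {z. inner u z \<le> b})"

definition transcendental_entire :: "(complex \<Rightarrow> complex) \<Rightarrow> bool" where
  "transcendental_entire f \<longleftrightarrow> f holomorphic_on UNIV \<and> \<not> (\<exists>p. \<forall>z. f z = poly p z)"

(* For r \<ge> 0 and continuous f the supremum is attained, so this is a maximum. *)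
definition max_modulus :: "(complex \<Rightarrow> complex) \<Rightarrow> real \<Rightarrow> real" where
  "max_modulus f r = (SUP z\<in>sphere 0 r. norm (f z))"

(* The value is in the extended reals, so that infinite order is possible.  It is only
   meaningful for non-constant entire f, where max_modulus f r > 1 for all large r and
   both logarithms are eventually taken of positive numbers. *)
definition growth_order :: "(complex \<Rightarrow> complex) \<Rightarrow> ereal" where
  "growth_order f = Limsup at_top (\<lambda>r::real. ereal (ln (ln (max_modulus f r)) / ln r))"

end

theory Submission
  imports Defs "HOL-Computational_Algebra.Fundamental_Theorem_Algebra"
begin

text \<open>After a rotation the half-plane is \<open>Re z \<le> 0\<close> and the sector is \<open>\<alpha> \<le> arg z \<le> \<beta>\<close> with
  \<open>-\<pi>/2 < \<alpha> < \<beta> < \<pi>/2\<close>. In the two sectors between them \<open>f\<close> eventually omits \<open>0\<close> and \<open>1\<close>, so Schottky's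
  and Harnack's inequalities control \<open>log |f|\<close> there. Together with a two-constants argument this gives
  \<open>A(r) := log M(r)\<close> the doubling property and shows that on each of the two sectors \<open>f\<close> tends to exactly
  one of \<open>0\<close>, \<open>1\<close>, \<open>\<infinity>\<close>, at the rate \<open>exp (-c A(r))\<close>; the limit is the same on both.

  Limit \<open>1\<close>: the opening angle below \<open>\<pi>/3\<close> bounds \<open>A(r)\<close> by \<open>r\<^sup>\<sigma>\<close> with \<open>\<sigma> < 3\<close>, and the Phragmen-Lindelof
  principle bounds \<open>f\<close> everywhere, which is absurd. Limit \<open>\<infinity>\<close>: the same principle for \<open>1 / (1 - f)\<close> keeps
  \<open>f\<close> large inside the given sector, so \<open>f\<close> has finitely many zeros and \<open>A(r) = O(r\<^sup>3\<^sup>/\<^sup>2)\<close>, whence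
  \<open>f = P exp Q\<close> with \<open>deg Q \<le> 1\<close>. Limit \<open>0\<close>: \<open>f\<close> is bounded on \<open>Re z \<ge> 0\<close>; with \<open>c\<close> maximal such that
  \<open>f exp (c z)\<close> is bounded there, this function has growth \<open>exp (o(|z|))\<close> on the negative axis and is
  therefore constant.\<close>

section \<open>Harnack and Schottky estimates\<close>

text \<open>Only 1 is omitted inside the sector and only 0 inside the half-plane, so both values are
  controlled just in the two gaps between them. Two logarithms carry information from gap to gap:
  log f exists off the sector and log (1 - f) off the half-plane, both outside a disc, and each of
  these regions contains both gaps. Limit 1 in one gap and 0 or \<infinity> in the other would make
  log |f| bounded here and of size A there; 0 against \<infinity> does the same to log |1 - f|. The
  two-constants principle excludes this.

  Origin of \<open>pi / 3\<close>: the gaps have total opening above 2/3 \<open>pi\<close>, so one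
  of them, after a reflection the upper one, is wider than \<open>pi / 3\<close>. A positive
  harmonic function of size A there forces growth below r^3, and this is what Phragmen-Lindelof
  admits in a sector of opening below \<open>pi / 3\<close>.

  Finite order enters the doubling property: it provides scales at which A does not jump. For limit
  0 the obstacle is the boundary of the half-plane, which may carry 1-points. A large value of f
  there would force a 1-point on the forbidden side.\<close>

lemma harnack_ball:
  assumes hol: "G holomorphic_on ball z r"
    and pos: "\<And>w. w \<in> ball z r \<Longrightarrow> 0 < Re (G w)"
    and w: "w \<in> ball z r"
  shows "Re (G w) \<le> (r + dist z w) / (r - dist z w) * Re (G z)"
    and "(r - dist z w) / (r + dist z w) * Re (G z) \<le> Re (G w)"
    and "norm (deriv G z) \<le> 2 * Re (G z) / r"
proof -
  have r: "0 < r" using w by (metis ball_eq_empty empty_iff not_less)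
  define p where "p = G z"
  define a where "a = Re p"
  have a: "0 < a" using pos[of z] r by (simp add: a_def p_def)
  have in_ball: "z + of_real r * \<xi> \<in> ball z r" if "norm \<xi> < 1" for \<xi> :: complex
    using that r by (simp add: dist_norm norm_mult)
  \<comment> \<open>The Moebius map taking u to \<open>(u - p) / (u + cnj p)\<close> sends the right
    half-plane to the unit disc and \<open>p = G z\<close> to 0, so the Schwarz lemma applies to
    \<open>h\<close>. Its bound for values gives both Harnack inequalities, its bound for
    \<open>deriv h 0\<close> the gradient estimate.\<close>
  define h where "h = (\<lambda>\<xi>. (G (z + of_real r * \<xi>) - p) / (G (z + of_real r * \<xi>) + cnj p))"
  have den: "G (z + of_real r * \<xi>) + cnj p \<noteq> 0" if "norm \<xi> < 1" for \<xi> :: complex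
  proof -
    have "0 < Re (G (z + of_real r * \<xi>) + cnj p)"
      using pos[OF in_ball[OF that]] a by (simp add: a_def)
    then show ?thesis by (metis less_irrefl zero_complex.simps(1))
  qed
  have holc: "(\<lambda>\<xi>. G (z + of_real r * \<xi>)) holomorphic_on ball 0 1"
  proof -
    have "(G \<circ> (\<lambda>\<xi>. z + of_real r * \<xi>)) holomorphic_on ball 0 1"
      by (rule holomorphic_on_compose_gen[OF _ hol]) (auto intro!: holomorphic_intros in_ball)
    then show ?thesis by (simp add: o_def)
  qed
  have holh: "h holomorphic_on ball 0 1"
    unfolding h_def by (intro holomorphic_intros holc) (use den in auto)
  have h0: "h 0 = 0" by (simp add: h_def p_def)
  have id4: "norm (u + cnj p) ^ 2 = norm (u - p) ^ 2 + 4 * Re u * a" for u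
    unfolding cmod_power2 by (simp add: a_def power2_eq_square algebra_simps)
  have h1: "norm (h \<xi>) < 1" if "norm \<xi> < 1" for \<xi>
  proof -
    let ?u = "G (z + of_real r * \<xi>)"
    have "0 < Re ?u" using pos[OF in_ball[OF that]] .
    then have "norm (?u - p) ^ 2 < norm (?u + cnj p) ^ 2"
      unfolding id4 using a by simp
    then have "norm (?u - p) < norm (?u + cnj p)"
      by (rule power2_less_imp_less) simp
    then show ?thesis
      by (simp add: h_def norm_divide divide_less_eq)
  qed
  define t where "t = dist z w / r"
  have t: "0 \<le> t" "t < 1" using w r by (auto simp: t_def)
  define \<xi> where "\<xi> = (w - z) / of_real r"
  have n\<xi>: "norm \<xi> = t" using r by (simp add: \<xi>_def t_def norm_divide dist_norm norm_minus_commute)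
  have zw: "z + of_real r * \<xi> = w" using r by (simp add: \<xi>_def)
  have le: "norm (h \<xi>) \<le> t"
    using Schwarz_Lemma(1)[OF holh h0 h1, of \<xi>] n\<xi> t by simp
  define x where "x = Re (G w)"
  have x: "0 < x" using pos[OF w] by (simp add: x_def)
  have "norm (G w + cnj p) > 0" using den[of \<xi>] n\<xi> t zw by simp
  then have "norm (G w - p) \<le> t * norm (G w + cnj p)"
    using le by (simp add: h_def zw norm_divide pos_divide_le_eq)
  then have "norm (G w - p) ^ 2 \<le> (t * norm (G w + cnj p)) ^ 2"
    by (rule power_mono) simp
  then have "norm (G w - p) ^ 2 \<le> t\<^sup>2 * (norm (G w - p) ^ 2 + 4 * x * a)"
    by (simp add: power_mult_distrib id4 x_def)
  then have A: "(1 - t\<^sup>2) * norm (G w - p) ^ 2 \<le> 4 * t\<^sup>2 * x * a"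
    by (simp add: algebra_simps)
  have "(x - a)\<^sup>2 \<le> norm (G w - p) ^ 2"
    by (simp add: cmod_power2 x_def a_def)
  moreover have "0 \<le> 1 - t\<^sup>2" using t by (simp add: power_le_one)
  ultimately have "(1 - t\<^sup>2) * (x - a)\<^sup>2 \<le> 4 * t\<^sup>2 * x * a"
    using A by (meson mult_left_mono order_trans)
  \<comment> \<open>As a quadratic in \<open>x\<close> this has the two Harnack bounds as its roots,
    so \<open>x\<close> lies between them.\<close>
  then have prod: "((1 - t) * x - (1 + t) * a) * ((1 + t) * x - (1 - t) * a) \<le> 0"
    by (simp add: power2_eq_square algebra_simps)
  have up: "(1 - t) * x \<le> (1 + t) * a"
  proof (rule ccontr)
    assume "\<not> ?thesis"
    then have *: "(1 - t) * x > (1 + t) * a" by simp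
    have "(1 + t) * x \<ge> (1 - t) * x" using t x by simp
    moreover have "(1 + t) * a \<ge> (1 - t) * a" using t a by simp
    ultimately have "(1 + t) * x - (1 - t) * a > 0" using * by linarith
    then show False using prod * by (smt (verit) mult_pos_pos)
  qed
  have lo: "(1 - t) * a \<le> (1 + t) * x"
  proof (rule ccontr)
    assume "\<not> ?thesis"
    then have *: "(1 + t) * x < (1 - t) * a" by simp
    have "(1 + t) * x \<ge> (1 - t) * x" using t x by simp
    moreover have "(1 + t) * a \<ge> (1 - t) * a" using t a by simp
    ultimately have "(1 - t) * x - (1 + t) * a < 0" using * by linarith
    then show False using prod * by (smt (verit) mult_neg_neg)
  qed
  have d: "dist z w < r" using w by simp
  have T: "(r + dist z w) = r * (1 + t)" "(r - dist z w) = r * (1 - t)"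
    using r by (auto simp: t_def field_simps)
  show "Re (G w) \<le> (r + dist z w) / (r - dist z w) * Re (G z)"
  proof -
    have "Re (G w) \<le> (1 + t) / (1 - t) * Re (G z)"
      using t up by (simp add: x_def a_def p_def field_simps)
    then show ?thesis unfolding T using r by simp
  qed
  show "(r - dist z w) / (r + dist z w) * Re (G z) \<le> Re (G w)"
  proof -
    have "(1 - t) / (1 + t) * Re (G z) \<le> Re (G w)"
      using t lo by (simp add: x_def a_def p_def field_simps)
    then show ?thesis unfolding T using r by simp
  qed
  have dG: "(G has_field_derivative deriv G z) (at z)"
    using hol r by (meson centre_in_ball holomorphic_derivI open_ball)
  have "((\<lambda>\<xi>. G (z + of_real r * \<xi>)) has_field_derivative deriv G z * of_real r) (at 0)"
    by (rule DERIV_chain'[where g = G, of "\<lambda>\<xi>. z + of_real r * \<xi>"])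
       (use dG in \<open>auto intro!: derivative_eq_intros\<close>)
  note d1 = this
  have "(h has_field_derivative
      (deriv G z * of_real r * (p + cnj p) - (p - p) * (deriv G z * of_real r)) / ((p + cnj p) * (p + cnj p))) (at 0)"
    unfolding h_def
    by (rule derivative_eq_intros d1 refl | use den[of 0] in \<open>simp add: p_def\<close>)+
  then have "deriv h 0 = deriv G z * of_real r * (p + cnj p) / ((p + cnj p) * (p + cnj p))"
    by (simp add: DERIV_imp_deriv)
  also have "p + cnj p = of_real (2 * a)" by (simp add: a_def complex_add_cnj)
  finally have "deriv h 0 = deriv G z * of_real r / of_real (2 * a)" using a by simp
  then have "norm (deriv h 0) = norm (deriv G z) * r / (2 * a)"
    using r a by (simp add: norm_divide norm_mult)
  moreover have "norm (deriv h 0) \<le> 1"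
    using Schwarz_Lemma(2)[OF holh h0 h1, of 0] by simp
  ultimately show "norm (deriv G z) \<le> 2 * Re (G z) / r"
    using r a by (simp add: a_def p_def field_simps)
qed

section \<open>Chains of discs in convex sets\<close>

lemma compact_convex_margin:
  fixes U K :: "'a::euclidean_space set"
  assumes "open U" "convex U" "compact K" "K \<subseteq> U"
  obtains \<delta> D where "0 < \<delta>" "0 < D" "\<And>x. x \<in> convex hull K \<Longrightarrow> ball x \<delta> \<subseteq> U"
    "\<And>x y. x \<in> convex hull K \<Longrightarrow> y \<in> convex hull K \<Longrightarrow> dist x y \<le> D"
proof -
  have c: "compact (convex hull K)" using assms by (simp add: compact_convex_hull)
  have s: "convex hull K \<subseteq> U" using assms by (simp add: subset_hull)
  obtain \<delta> where \<delta>: "0 < \<delta>" "(\<Union>x\<in>convex hull K. cball x \<delta>) \<subseteq> U"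
    using compact_subset_open_imp_cball_epsilon_subset[OF c \<open>open U\<close> s] by metis
  obtain D where D: "\<forall>x\<in>convex hull K. \<forall>y\<in>convex hull K. dist x y \<le> D"
    using compact_imp_bounded[OF c] bounded_two_points by metis
  show thesis
  proof (rule that[of \<delta> "max 1 D"])
    show "ball x \<delta> \<subseteq> U" if "x \<in> convex hull K" for x
      using \<delta> that ball_subset_cball by blast
    show "dist x y \<le> max 1 D" if "x \<in> convex hull K" "y \<in> convex hull K" for x y
      using D that by (meson max.coboundedI2)
  qed (use \<delta> in auto)
qed

text \<open>The segment from \<open>z\<close> to \<open>w\<close> is walked in \<open>n\<close>
  equal steps, each short against a disc inside \<open>U\<close>. Since \<open>n\<close> depends on
  \<open>U\<close> and \<open>K\<close> only, one \<open>n\<close> serves every \<open>p\<close> and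
  \<Lambda>, in particular the translates of a function to all scales.\<close>

lemma harnack_chain:
  fixes U K :: "'a::euclidean_space set"
  assumes "open U" "convex U" "compact K" "K \<subseteq> U"
  obtains n :: nat where
    "\<And>(p :: 'a \<Rightarrow> real) \<Lambda> z w. \<lbrakk>\<And>z w r. \<lbrakk>0 < r; ball z r \<subseteq> U; dist z w \<le> r / 8\<rbrakk> \<Longrightarrow> p w \<le> \<Lambda> * p z;
       0 \<le> \<Lambda>; z \<in> convex hull K; w \<in> convex hull K\<rbrakk> \<Longrightarrow> p w \<le> \<Lambda> ^ n * p z"
proof -
  obtain \<delta> D where \<delta>: "0 < \<delta>" and D: "0 < D"
    and ball: "\<And>x. x \<in> convex hull K \<Longrightarrow> ball x \<delta> \<subseteq> U"
    and dist: "\<And>x y. x \<in> convex hull K \<Longrightarrow> y \<in> convex hull K \<Longrightarrow> dist x y \<le> D"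
    using compact_convex_margin[OF assms] by metis
  obtain n :: nat where n: "8 * D / \<delta> < real n" using reals_Archimedean2 by blast
  have n0: "0 < real n" using n D \<delta> by (meson divide_pos_pos less_trans mult_pos_pos zero_less_numeral)
  show thesis
  proof (rule that[of n])
    fix p :: "'a \<Rightarrow> real" and \<Lambda> z w
    assume step: "\<And>z w r. \<lbrakk>0 < r; ball z r \<subseteq> U; dist z w \<le> r / 8\<rbrakk> \<Longrightarrow> p w \<le> \<Lambda> * p z"
      and L: "0 \<le> \<Lambda>" and z: "z \<in> convex hull K" and w: "w \<in> convex hull K"
    define x where "x = (\<lambda>i::nat. (1 - real i / real n) *\<^sub>R z + (real i / real n) *\<^sub>R w)"
    have xin: "x i \<in> convex hull K" if "i \<le> n" for i
      unfolding x_def using n0 that z w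
      by (intro convexD[OF convex_convex_hull]) (auto simp: field_simps)
    have d: "dist (x i) (x (Suc i)) \<le> \<delta> / 8" for i
    proof -
      have "x (Suc i) - x i = (1 / real n) *\<^sub>R (w - z)"
        by (simp add: x_def algebra_simps add_divide_distrib)
      then have "dist (x i) (x (Suc i)) = dist z w / real n"
        using n0 by (simp only: dist_commute[of "x i"] dist_commute[of z]) (simp add: dist_norm)
      also have "\<dots> \<le> D / real n" using dist[OF z w] n0 by (simp add: divide_right_mono)
      also have "\<dots> \<le> \<delta> / 8" using n n0 \<delta> by (simp add: field_simps)
      finally show ?thesis .
    qed
    have "p (x i) \<le> \<Lambda> ^ i * p z" if "i \<le> n" for i
      using that
    proof (induction i)
      case 0 then show ?case by (simp add: x_def)
    next
      case (Suc i)
      have "p (x (Suc i)) \<le> \<Lambda> * p (x i)"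
        using step[OF \<delta> ball[OF xin] d] Suc.prems by simp
      also have "\<dots> \<le> \<Lambda> * (\<Lambda> ^ i * p z)"
        using Suc L by (intro mult_left_mono) auto
      finally show ?case by (simp add: mult.assoc)
    qed
    from this[of n] show "p w \<le> \<Lambda> ^ n * p z" using n0 by (simp add: x_def)
  qed
qed

text \<open>The summand 1 keeps the value positive where log+ vanishes, so that a multiplicative
  Harnack inequality is possible. As \<open>ln 0 = 0\<close>, the value at 0 is 1.\<close>

definition logp :: "complex \<Rightarrow> real" where
  "logp w = 1 + max 0 (ln (norm w))"

lemma logp_ge_1: "1 \<le> logp w"
  by (simp add: logp_def)

lemma schottky_ball:
  obtains C where "1 \<le> C"
    "\<And>F z r w. \<lbrakk>F holomorphic_on ball z r; \<And>x. x \<in> ball z r \<Longrightarrow> F x \<noteq> 0 \<and> F x \<noteq> 1;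
       norm (F z) \<le> exp 1; dist z w \<le> r / 2; 0 < r\<rbrakk> \<Longrightarrow> norm (F w) \<le> C"
proof -
  \<comment> \<open>Schottky's theorem is applied on a closed unit disc, hence the ball is shrunk to
    radius 3/4 r. A point at distance at most r/2 then has relative distance at most (1/2) / (3/4) =
    2/3.\<close>
  define t :: real where "t = 2 / 3"
  show thesis
  proof (rule that[of "exp (pi * exp (pi * (2 + 2 * exp 1 + 12 * t / (1 - t))))"])
    fix F z r w
    assume hol: "F holomorphic_on ball z r" and om: "\<And>x. x \<in> ball z r \<Longrightarrow> F x \<noteq> 0 \<and> F x \<noteq> 1"
      and b: "norm (F z) \<le> exp 1" and w: "dist z w \<le> r / 2" and r: "0 < r"
    define g where "g = (\<lambda>\<xi>. F (z + of_real (3 / 4 * r) * \<xi>))"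
    have in_ball: "z + of_real (3 / 4 * r) * \<xi> \<in> ball z r" if "norm \<xi> \<le> 1" for \<xi> :: complex
    proof -
      have "3 / 4 * r * norm \<xi> \<le> 3 / 4 * r * 1" using that r by (intro mult_left_mono) auto
      also have "\<dots> < r" using r by simp
      finally show ?thesis using r by (simp add: dist_norm norm_mult)
    qed
    have "(F \<circ> (\<lambda>\<xi>. z + of_real (3 / 4 * r) * \<xi>)) holomorphic_on cball 0 1"
      by (rule holomorphic_on_compose_gen[OF _ hol]) (use in_ball in \<open>auto intro!: holomorphic_intros\<close>)
    then have holg: "g holomorphic_on cball 0 1" by (simp add: o_def g_def)
    define \<xi> where "\<xi> = (w - z) / of_real (3 / 4 * r)"
    have "norm \<xi> = dist z w / (3 / 4 * r)"
      using r by (simp only: \<xi>_def norm_divide norm_of_real dist_commute[of z]) (simp add: dist_norm)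
    also have "\<dots> \<le> t" using w r by (simp add: t_def field_simps)
    finally have n: "norm \<xi> \<le> t" .
    have "complex_of_real (3 / 4 * r) \<noteq> 0" using r by (simp only: of_real_eq_0_iff)
    then have "complex_of_real (3 / 4 * r) * \<xi> = w - z"
      unfolding \<xi>_def by (metis nonzero_mult_div_cancel_left times_divide_eq_right)
    then have "z + complex_of_real (3 / 4 * r) * \<xi> = w" by (simp only: add_diff_eq add_diff_cancel_left')
    then have gw: "g \<xi> = F w" by (simp only: g_def)
    have "norm (g \<xi>) \<le> exp (pi * exp (pi * (2 + 2 * exp 1 + 12 * t / (1 - t))))"
    proof (rule Schottky[OF holg _ _ _ _ n])
      show "norm (g 0) \<le> exp 1" using b by (simp add: g_def)
      show "\<not> (g x = 0 \<or> g x = 1)" if "x \<in> cball 0 1" for x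
        using om[OF in_ball[of x]] that by (simp add: g_def)
    qed (auto simp: t_def)
    then show "norm (F w) \<le> exp (pi * exp (pi * (2 + 2 * exp 1 + 12 * t / (1 - t))))"
      by (simp add: gw)
  qed simp
qed

text \<open>Near a point where \<open>\<bar>F\<bar>\<close> is small Schottky's theorem bounds \<open>F\<close>; otherwise \<open>log F\<close> has positive
  real part and Harnack's inequality applies.\<close>

lemma logp_harnack:
  obtains \<Lambda> where "1 \<le> \<Lambda>"
    "\<And>F z r w. \<lbrakk>F holomorphic_on ball z r; \<And>x. x \<in> ball z r \<Longrightarrow> F x \<noteq> 0 \<and> F x \<noteq> 1;
       dist z w \<le> r / 8; 0 < r\<rbrakk> \<Longrightarrow> logp (F w) \<le> \<Lambda> * logp (F z)"
proof -
  obtain C where C: "1 \<le> C" and schottky: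
    "\<And>F z r w. \<lbrakk>F holomorphic_on ball z r; \<And>x. x \<in> ball z r \<Longrightarrow> F x \<noteq> 0 \<and> F x \<noteq> 1;
       norm (F z) \<le> exp 1; dist z w \<le> r / 2; 0 < r\<rbrakk> \<Longrightarrow> norm (F w) \<le> C"
    using schottky_ball by metis
  \<comment> \<open>3 is the Harnack factor at distance r/8 in a ball of radius r/4;
    \<open>1 + ln C\<close> is Schottky's bound for \<open>logp\<close>, usable as a factor because
    \<open>logp\<close> is at least 1.\<close>
  define \<Lambda> where "\<Lambda> = max 3 (1 + ln C)"
  show thesis
  proof (rule that[of \<Lambda>])
    fix F z r w
    assume hol: "F holomorphic_on ball z r" and om: "\<And>x. x \<in> ball z r \<Longrightarrow> F x \<noteq> 0 \<and> F x \<noteq> 1"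
      and w: "dist z w \<le> r / 8" and r: "0 < r"
    show "logp (F w) \<le> \<Lambda> * logp (F z)"
    proof (cases "\<exists>a. dist z a \<le> r / 4 \<and> norm (F a) \<le> exp 1")
      case True
      then obtain a where a: "dist z a \<le> r / 4" "norm (F a) \<le> exp 1" by blast
      have sub: "ball a (3 / 4 * r) \<subseteq> ball z r"
      proof
        fix x assume "x \<in> ball a (3 / 4 * r)"
        then show "x \<in> ball z r" using a dist_triangle[of z x a] by (simp add: dist_commute)
      qed
      have "dist a w \<le> dist a z + dist z w" by (rule dist_triangle)
      then have aw: "dist a w \<le> 3 / 4 * r / 2" using a w by (simp add: dist_commute)
      have "norm (F w) \<le> C"
        by (rule schottky[OF holomorphic_on_subset[OF hol sub] _ a(2) aw]) (use om sub r in auto)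
      moreover have "w \<in> ball z r" using w r by simp
      then have "F w \<noteq> 0" using om by blast
      ultimately have "ln (norm (F w)) \<le> ln C" using C by simp
      then have "logp (F w) \<le> 1 + ln C" using C by (simp add: logp_def)
      also have "\<dots> \<le> \<Lambda> * 1" by (simp add: \<Lambda>_def)
      also have "\<dots> \<le> \<Lambda> * logp (F z)"
        using C by (intro mult_left_mono logp_ge_1) (simp add: \<Lambda>_def)
      finally show ?thesis .
    next
      case False
      have sub: "ball z (r / 4) \<subseteq> ball z r" using r by auto
      obtain G where G: "G holomorphic_on ball z (r/4)" "\<And>x. x \<in> ball z (r/4) \<Longrightarrow> F x = exp (G x)"
      proof (rule holomorphic_logarithm_exists[of "ball z (r/4)" F z])
        show "F holomorphic_on ball z (r/4)" by (rule holomorphic_on_subset[OF hol sub])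
      qed (use om sub r in auto)
      have ReG: "ln (norm (F x)) = Re (G x)" if "x \<in> ball z (r/4)" for x
        using G(2)[OF that] by simp
      have big: "1 < Re (G x)" if "x \<in> ball z (r/4)" for x
      proof -
        have "norm (F x) > exp 1" using False that by (simp add: not_le) (meson less_imp_le not_le)
        then show ?thesis using G(2)[OF that] by simp
      qed
      have wi: "w \<in> ball z (r/4)" using w r by simp
      have zi: "z \<in> ball z (r/4)" using r by simp
      have "Re (G w) \<le> (r/4 + dist z w) / (r/4 - dist z w) * Re (G z)"
        by (rule harnack_ball(1)[OF G(1) _ wi]) (use big in \<open>meson less_trans zero_less_one\<close>)
      also have "\<dots> \<le> 3 * Re (G z)"
      proof (rule mult_right_mono)
        show "(r/4 + dist z w) / (r/4 - dist z w) \<le> 3" using w r by (simp add: field_simps)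
      qed (use big[OF zi] in simp)
      finally have "Re (G w) \<le> 3 * Re (G z)" .
      then have "logp (F w) \<le> 3 * logp (F z)"
        unfolding logp_def ReG[OF zi] ReG[OF wi] using big[OF zi] big[OF wi] by simp
      also have "\<dots> \<le> \<Lambda> * logp (F z)"
        using logp_ge_1[of "F z"] by (intro mult_right_mono) (auto simp: \<Lambda>_def)
      finally show ?thesis .
    qed
  qed (simp add: \<Lambda>_def)
qed

text \<open>\<open>2 * M - G\<close> has positive real part, at most \<open>3 * M\<close> at the
  anchor \<open>z\<close>. The Harnack chain spreads this bound over the convex hull, the gradient
  estimate turns it into a bound for the derivative, and integration along a segment bounds the
  difference.\<close>

lemma borel_caratheodory_convex:
  assumes "open U" "convex U" "compact K" "K \<subseteq> U"
  obtains C where "0 < C"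
    "\<And>G M z w. \<lbrakk>G holomorphic_on U; \<And>x. x \<in> U \<Longrightarrow> Re (G x) \<le> M; 0 < M; z \<in> K; w \<in> K; - M \<le> Re (G z)\<rbrakk>
       \<Longrightarrow> norm (G w - G z) \<le> C * M"
proof -
  obtain \<delta> D where \<delta>: "0 < \<delta>" and D: "0 < D"
    and ball: "\<And>x. x \<in> convex hull K \<Longrightarrow> ball x \<delta> \<subseteq> U"
    and dist: "\<And>x y. x \<in> convex hull K \<Longrightarrow> y \<in> convex hull K \<Longrightarrow> dist x y \<le> D"
    using compact_convex_margin[OF assms] by metis
  obtain n :: nat where n:
    "\<And>(p :: complex \<Rightarrow> real) \<Lambda> z w. \<lbrakk>\<And>z w r. \<lbrakk>0 < r; ball z r \<subseteq> U; dist z w \<le> r / 8\<rbrakk> \<Longrightarrow> p w \<le> \<Lambda> * p z;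
       0 \<le> \<Lambda>; z \<in> convex hull K; w \<in> convex hull K\<rbrakk> \<Longrightarrow> p w \<le> \<Lambda> ^ n * p z"
    using harnack_chain[OF assms] by metis
  show thesis
  proof (rule that[of "2 * (2 ^ n * 3) / \<delta> * D"])
    show "0 < 2 * (2 ^ n * 3) / \<delta> * D" using \<delta> D by simp
    fix G M z w
    assume hol: "G holomorphic_on U" and le: "\<And>x. x \<in> U \<Longrightarrow> Re (G x) \<le> M" and M: "0 < (M::real)"
      and z: "z \<in> K" and w: "w \<in> K" and ge: "- M \<le> Re (G z)"
    define H where "H = (\<lambda>x. of_real (2 * M) - G x)"
    have holH: "H holomorphic_on U" unfolding H_def by (intro holomorphic_intros hol)
    have posH: "0 < Re (H x)" if "x \<in> U" for x using le[OF that] M by (simp add: H_def)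
    have step: "Re (H w) \<le> 2 * Re (H z)" if "0 < r" "ball z r \<subseteq> U" "dist z w \<le> r / 8" for z w r
    proof -
      have "Re (H w) \<le> (r + dist z w) / (r - dist z w) * Re (H z)"
        by (rule harnack_ball(1)[OF holomorphic_on_subset[OF holH that(2)]])
           (use posH that in auto)
      also have "\<dots> \<le> 2 * Re (H z)"
      proof (rule mult_right_mono)
        show "(r + dist z w) / (r - dist z w) \<le> 2" using that by (simp add: field_simps)
        show "0 \<le> Re (H z)" using posH[of z] that by (meson centre_in_ball less_imp_le subsetD)
      qed
      finally show ?thesis .
    qed
    have zc: "z \<in> convex hull K" and wc: "w \<in> convex hull K" using z w hull_subset by fast+
    have bd: "Re (H x) \<le> 2 ^ n * (3 * M)" if "x \<in> convex hull K" for x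
    proof -
      have "Re (H x) \<le> 2 ^ n * Re (H z)" by (rule n[OF step]) (use zc that in auto)
      also have "\<dots> \<le> 2 ^ n * (3 * M)" using ge by (intro mult_left_mono) (auto simp: H_def)
      finally show ?thesis .
    qed
    have dH: "norm (deriv H x) \<le> 2 * (2 ^ n * 3) / \<delta> * M" if "x \<in> convex hull K" for x
    proof -
      have "norm (deriv H x) \<le> 2 * Re (H x) / \<delta>"
        by (rule harnack_ball(3)[OF holomorphic_on_subset[OF holH ball[OF that]], of x])
           (use posH ball[OF that] \<delta> in auto)
      also have "\<dots> \<le> 2 * (2 ^ n * (3 * M)) / \<delta>"
        using bd[OF that] \<delta> by (intro divide_right_mono mult_left_mono) auto
      finally show ?thesis by (simp add: mult_ac)
    qed
    have "norm (H w - H z) \<le> 2 * (2 ^ n * 3) / \<delta> * M * norm (w - z)"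
    proof (rule field_differentiable_bound[OF convex_convex_hull _ dH wc zc])
      show "(H has_field_derivative deriv H x) (at x within convex hull K)" if "x \<in> convex hull K" for x
      proof (rule has_field_derivative_at_within[OF holomorphic_derivI[OF holH \<open>open U\<close>]])
        show "x \<in> U" using ball[OF that] \<delta> by auto
      qed
    qed
    also have "\<dots> \<le> 2 * (2 ^ n * 3) / \<delta> * M * D"
      using dist[OF wc zc] \<delta> M by (intro mult_left_mono) (auto simp: dist_norm)
    finally show "norm (G w - G z) \<le> 2 * (2 ^ n * 3) / \<delta> * D * M"
      by (simp add: H_def norm_minus_commute mult_ac)
  qed
qed

section \<open>Two constants and Phragmen-Lindelof\<close>

text \<open>A compactness argument takes the place of harmonic measure, since a two-sided conclusion
  is wanted from a one-sided bound on \<open>U\<close>. A sequence of counterexamples with \<delta>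
  tending to 0 is normal; its limit has real part 0 on the open set \<open>V\<close>, is constant by
  the open mapping theorem, and so has real part 0 on \<open>K\<close> too.\<close>

lemma two_constants:
  assumes U: "open U" "convex U" and V: "open V" "V \<subseteq> U" "V \<noteq> {}"
    and K: "compact K" "K \<subseteq> U" and \<epsilon>: "0 < \<epsilon>"
  obtains \<delta> where "0 < \<delta>"
    "\<And>G z. \<lbrakk>G holomorphic_on U; \<And>x. x \<in> U \<Longrightarrow> Re (G x) \<le> 1; \<And>x. x \<in> V \<Longrightarrow> \<bar>Re (G x)\<bar> \<le> \<delta>; z \<in> K\<rbrakk>
       \<Longrightarrow> \<bar>Re (G z)\<bar> \<le> \<epsilon>"
proof (rule ccontr)
  assume contra: "\<not> thesis"
  have "\<exists>G z. G holomorphic_on U \<and> (\<forall>x\<in>U. Re (G x) \<le> 1) \<and> (\<forall>x\<in>V. \<bar>Re (G x)\<bar> \<le> 1 / real (Suc n))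
          \<and> z \<in> K \<and> \<not> \<bar>Re (G z)\<bar> \<le> \<epsilon>" for n
    using that[of "1 / real (Suc n)"] contra by (metis of_nat_0_less_iff zero_less_Suc zero_less_divide_1_iff)
  then obtain G z where G: "\<And>n. G n holomorphic_on U" "\<And>n x. x \<in> U \<Longrightarrow> Re (G n x) \<le> 1"
    "\<And>n x. x \<in> V \<Longrightarrow> \<bar>Re (G n x)\<bar> \<le> 1 / real (Suc n)" "\<And>n. z n \<in> K" "\<And>n. \<not> \<bar>Re (G n (z n))\<bar> \<le> \<epsilon>"
    by metis
  obtain v0 where v0: "v0 \<in> V" using V by blast
  \<comment> \<open>Subtracting an imaginary constant does not change real parts but bounds the
    family at \<open>v0\<close>, from where Borel-Caratheodory bounds it on compact sets, as
    Montel's theorem demands.\<close>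
  define F where "F = (\<lambda>n x. G n x - \<i> * of_real (Im (G n v0)))"
  have ReF: "Re (F n x) = Re (G n x)" for n x by (simp add: F_def)
  have holF: "F n holomorphic_on U" for n unfolding F_def by (intro holomorphic_intros G)
  have le1: "\<bar>Re (G n v0)\<bar> \<le> 1" for n
  proof -
    have "1 / real (Suc n) \<le> 1" by simp
    then show ?thesis using G(3)[OF v0, of n] by linarith
  qed
  have nF: "norm (F n v0) \<le> 1" for n
  proof -
    have "F n v0 = of_real (Re (G n v0))" by (simp add: F_def complex_eq_iff)
    then show ?thesis using le1[of n] by simp
  qed
  have bnd: "\<exists>B. \<forall>h\<in>range F. \<forall>x\<in>K'. norm (h x) \<le> B" if K': "compact K'" "K' \<subseteq> U" for K'
  proof -
    have c: "compact (insert v0 K')" "insert v0 K' \<subseteq> U" using K' v0 V by auto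
    obtain C where C: "0 < C"
      "\<And>G M z w. \<lbrakk>G holomorphic_on U; \<And>x. x \<in> U \<Longrightarrow> Re (G x) \<le> M; 0 < M; z \<in> insert v0 K';
          w \<in> insert v0 K'; - M \<le> Re (G z)\<rbrakk> \<Longrightarrow> norm (G w - G z) \<le> C * M"
      using borel_caratheodory_convex[OF U c] by metis
    have "norm (F n x) \<le> C + 1" if "x \<in> K'" for n x
    proof -
      have "norm (F n x - F n v0) \<le> C * 1"
        by (rule C(2)[OF holF]) (use G(2) le1[of n] that in \<open>auto simp: ReF abs_le_iff\<close>)
      then show ?thesis using nF[of n] norm_triangle_sub[of "F n x" "F n v0"] by linarith
    qed
    then show ?thesis by blast
  qed
  obtain g r where g: "g holomorphic_on U" "strict_mono (r :: nat \<Rightarrow> nat)"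
      "\<And>x. x \<in> U \<Longrightarrow> ((\<lambda>n. F (r n) x) \<longlongrightarrow> g x) sequentially"
      "\<And>K. \<lbrakk>compact K; K \<subseteq> U\<rbrakk> \<Longrightarrow> uniform_limit K (F \<circ> r) g sequentially"
    using Montel[OF \<open>open U\<close>, of "range F" F] holF bnd by (smt (verit) imageE order_refl)
  have Re0: "Re (g x) = 0" if x: "x \<in> V" for x
  proof -
    have "(\<lambda>n. Re (F (r n) x)) \<longlonglongrightarrow> Re (g x)"
      using g(3) x V by (intro tendsto_Re) auto
    moreover have "(\<lambda>n. Re (F (r n) x)) \<longlonglongrightarrow> 0"
    proof (rule tendsto_rabs_zero_cancel, rule tendsto_sandwich[of "\<lambda>n. 0"])
      show "\<forall>\<^sub>F n in sequentially. \<bar>Re (F (r n) x)\<bar> \<le> inverse (real (Suc n))"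
      proof (rule always_eventually, rule allI)
        fix n
        have "\<bar>Re (F (r n) x)\<bar> \<le> 1 / real (Suc (r n))" using G(3)[OF x] by (simp add: ReF)
        also have "\<dots> \<le> 1 / real (Suc n)"
          using seq_suble[OF g(2), of n] by (intro divide_left_mono) auto
        finally show "\<bar>Re (F (r n) x)\<bar> \<le> inverse (real (Suc n))" by (simp add: inverse_eq_divide)
      qed
    qed (auto simp del: of_nat_Suc intro: LIMSEQ_inverse_real_of_nat)
    ultimately show ?thesis using LIMSEQ_unique by blast
  qed
  have const: "g constant_on U"
  proof (rule ccontr)
    assume "\<not> g constant_on U"
    then have "open (g ` V)"
      using open_mapping_thm[OF g(1) \<open>open U\<close> convex_connected[OF \<open>convex U\<close>] V(1,2)] by blast
    then obtain e where e: "0 < e" "ball (g v0) e \<subseteq> g ` V" using v0 by (meson imageI open_contains_ball)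
    have "g v0 + of_real (e/2) \<in> ball (g v0) e" using e by (simp add: dist_norm)
    then obtain x where "x \<in> V" "g v0 + of_real (e/2) = g x" using e by blast
    then have "Re (g v0) + e/2 = Re (g x)" by (metis Re_complex_of_real plus_complex.simps(1))
    then show False using Re0[OF v0] Re0[OF \<open>x \<in> V\<close>] e by simp
  qed
  then have Re0U: "Re (g x) = 0" if "x \<in> U" for x
    using that Re0[OF v0] v0 V unfolding constant_on_def by (metis subsetD)
  have "\<forall>\<^sub>F n in sequentially. \<forall>x\<in>K. dist ((F \<circ> r) n x) (g x) < \<epsilon>"
    using g(4)[OF K] \<epsilon> by (simp add: uniform_limit_iff)
  then obtain n where n: "\<forall>x\<in>K. dist ((F \<circ> r) n x) (g x) < \<epsilon>"
    by (auto simp: eventually_sequentially)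
  have "\<bar>Re (F (r n) (z (r n)) - g (z (r n)))\<bar> < \<epsilon>"
    using n G(4)[of "r n"] abs_Re_le_cmod order.strict_trans1 by (fastforce simp: dist_norm)
  then show False using G(5)[of "r n"] Re0U[of "z (r n)"] G(4)[of "r n"] K by (auto simp: ReF)
qed

text \<open>The Phragmen-Lindelof principle for a sector, in the coordinate log z:
  \<open>b - a\<close> is the opening and \<open>exp (\<sigma> * Re z)\<close> is r^\<sigma>. The
  damping factor is exp (- \<epsilon> exp (\<tau> (z - i m))) with \<tau> between \<sigma> and
  \<open>pi / (b - a)\<close>: it beats the growth of \<open>G\<close>, while the cosine in its
  modulus stays above a positive \<kappa> across the strip.\<close>

lemma phragmen_lindelof_half_strip:
  fixes a b S \<sigma> C M :: real
  assumes ab: "a < b" and \<sigma>: "\<sigma> * (b - a) < pi"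
    and hol: "G holomorphic_on {z. S \<le> Re z \<and> a \<le> Im z \<and> Im z \<le> b}"
    and growth: "\<And>z. \<lbrakk>S \<le> Re z; a \<le> Im z; Im z \<le> b\<rbrakk> \<Longrightarrow> norm (G z) \<le> exp (C * exp (\<sigma> * Re z))"
    and M: "0 < M"
    and edge: "\<And>z. \<lbrakk>S \<le> Re z; a \<le> Im z; Im z \<le> b; Re z = S \<or> Im z = a \<or> Im z = b\<rbrakk> \<Longrightarrow> norm (G z) \<le> M"
    and z: "S \<le> Re z" "a \<le> Im z" "Im z \<le> b"
  shows "norm (G z) \<le> M"
proof -
  define m where "m = (a + b) / 2"
  have "max 0 \<sigma> < pi / (b - a)" using ab \<sigma> by (simp add: field_simps)
  then obtain \<tau> where \<tau>: "max 0 \<sigma> < \<tau>" "\<tau> < pi / (b - a)" using dense by blast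
  define \<kappa> where "\<kappa> = cos (\<tau> * ((b - a) / 2))"
  have angle: "\<tau> * ((b - a) / 2) < pi / 2" using \<tau> ab by (simp add: field_simps)
  have \<kappa>: "0 < \<kappa>" unfolding \<kappa>_def
  proof (rule cos_gt_zero_pi[OF _ angle])
    have "0 \<le> \<tau> * ((b - a) / 2)" using \<tau> ab by simp
    then show "- (pi / 2) < \<tau> * ((b - a) / 2)" using pi_half_gt_zero by linarith
  qed
  have cos_ge: "\<kappa> \<le> cos (\<tau> * (y - m))" if "a \<le> y" "y \<le> b" for y
  proof -
    have "\<bar>y - m\<bar> \<le> (b - a) / 2" using that by (simp add: m_def abs_le_iff field_simps)
    then have "\<tau> * \<bar>y - m\<bar> \<le> \<tau> * ((b - a) / 2)" using \<tau> by (intro mult_left_mono) auto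
    moreover have "0 \<le> \<tau> * \<bar>y - m\<bar>" using \<tau> by simp
    ultimately have "cos (\<tau> * ((b - a) / 2)) \<le> cos (\<tau> * \<bar>y - m\<bar>)"
      using angle by (intro cos_monotone_0_pi_le) auto
    also have "\<dots> = cos (\<tau> * (y - m))" by (metis abs_mult abs_of_pos cos_abs_real \<tau>(1) max_less_iff_conj)
    finally show ?thesis by (simp add: \<kappa>_def)
  qed
  have key: "norm (G z) \<le> M * exp (\<epsilon> * exp (\<tau> * Re z))" if \<epsilon>: "0 < \<epsilon>" for \<epsilon>
  proof -
    define F where "F = (\<lambda>\<zeta>. G \<zeta> * exp (- of_real \<epsilon> * exp (of_real \<tau> * (\<zeta> - \<i> * of_real m))))"
    have nF: "norm (F \<zeta>) = norm (G \<zeta>) * exp (- \<epsilon> * (exp (\<tau> * Re \<zeta>) * cos (\<tau> * (Im \<zeta> - m))))" for \<zeta>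
      by (simp add: F_def norm_mult Re_exp)
    have holF: "F holomorphic_on {z. S \<le> Re z \<and> a \<le> Im z \<and> Im z \<le> b}"
      unfolding F_def by (intro holomorphic_intros hol)
    have nFle: "norm (F \<zeta>) \<le> norm (G \<zeta>) * exp (- \<epsilon> * (exp (\<tau> * Re \<zeta>) * \<kappa>))" if "a \<le> Im \<zeta>" "Im \<zeta> \<le> b" for \<zeta>
      unfolding nF using cos_ge[OF that] \<epsilon> by (intro mult_left_mono) auto
    have "filterlim (\<lambda>X. \<epsilon> * \<kappa> * exp (\<tau> * X) - C * exp (\<sigma> * X)) at_top at_top"
    proof -
      have "filterlim (\<lambda>X. exp (\<tau> * X) * (\<epsilon> * \<kappa> - C * exp (- ((\<tau> - \<sigma>) * X)))) at_top at_top"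
      proof (rule filterlim_at_top_mult_tendsto_pos[rotated, rotated])
        show "filterlim (\<lambda>X. exp (\<tau> * X)) at_top at_top"
          using \<tau> by (intro filterlim_compose[OF exp_at_top] filterlim_tendsto_pos_mult_at_top[OF tendsto_const _ filterlim_ident]) auto
        have "((\<lambda>X. exp (- ((\<tau> - \<sigma>) * X))) \<longlongrightarrow> 0) at_top"
          using \<tau> by (intro filterlim_compose[OF exp_at_bot] filterlim_compose[OF filterlim_uminus_at_bot_at_top] filterlim_tendsto_pos_mult_at_top[OF tendsto_const _ filterlim_ident]) auto
        then have "((\<lambda>X. \<epsilon> * \<kappa> - C * exp (- ((\<tau> - \<sigma>) * X))) \<longlongrightarrow> \<epsilon> * \<kappa> - C * 0) at_top"
          by (intro tendsto_intros)
        then show "((\<lambda>X. \<epsilon> * \<kappa> - C * exp (- ((\<tau> - \<sigma>) * X))) \<longlongrightarrow> \<epsilon> * \<kappa>) at_top" by simp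
        show "0 < \<epsilon> * \<kappa>" using \<epsilon> \<kappa> by simp
      qed
      moreover have "exp (\<tau> * X) * (\<epsilon> * \<kappa> - C * exp (- ((\<tau> - \<sigma>) * X))) = \<epsilon> * \<kappa> * exp (\<tau> * X) - C * exp (\<sigma> * X)" for X
        by (simp add: algebra_simps exp_diff exp_minus field_simps)
      ultimately show ?thesis by simp
    qed
    then have "\<forall>\<^sub>F X in at_top. - ln M \<le> \<epsilon> * \<kappa> * exp (\<tau> * X) - C * exp (\<sigma> * X)"
      by (simp add: filterlim_at_top)
    then have "\<forall>\<^sub>F X in at_top. - ln M \<le> \<epsilon> * \<kappa> * exp (\<tau> * X) - C * exp (\<sigma> * X) \<and> Re z < X"
      by (intro eventually_conj eventually_gt_at_top)
    then obtain X where X: "- ln M \<le> \<epsilon> * \<kappa> * exp (\<tau> * X) - C * exp (\<sigma> * X)" "Re z < X"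
      by (auto simp: eventually_at_top_linorder)
    let ?R = "cbox (Complex S a) (Complex X b)"
    have sub: "?R \<subseteq> {z. S \<le> Re z \<and> a \<le> Im z \<and> Im z \<le> b}"
      by (auto simp: in_cbox_complex_iff)
    have "norm (F z) \<le> M"
    proof (rule maximum_modulus_frontier[of F ?R])
      show "F holomorphic_on interior ?R"
        by (rule holomorphic_on_subset[OF holF]) (use sub interior_subset in blast)
      show "continuous_on (closure ?R) F"
        using holomorphic_on_imp_continuous_on[OF holomorphic_on_subset[OF holF sub]] by simp
      show "bounded ?R" by (rule bounded_cbox)
      show "z \<in> ?R" using z X by (auto simp: in_cbox_complex_iff)
      fix w assume "w \<in> frontier ?R"
      then have w: "w \<in> ?R" "w \<notin> box (Complex S a) (Complex X b)"
        by (auto simp: frontier_def interior_cbox)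
      then have bounds: "S \<le> Re w" "Re w \<le> X" "a \<le> Im w" "Im w \<le> b"
        by (auto simp: in_cbox_complex_iff)
      have "Re w = S \<or> Im w = a \<or> Im w = b \<or> Re w = X"
        using w bounds by (auto simp: in_box_complex_iff)
      then show "norm (F w) \<le> M"
      proof (elim disjE)
        assume "Re w = X"
        have "norm (F w) \<le> exp (C * exp (\<sigma> * Re w)) * exp (- \<epsilon> * (exp (\<tau> * Re w) * \<kappa>))"
          by (rule order_trans[OF nFle]) (use bounds growth[of w] in \<open>auto intro: mult_right_mono\<close>)
        also have "\<dots> = exp (- (\<epsilon> * \<kappa> * exp (\<tau> * X) - C * exp (\<sigma> * X)))"
          using \<open>Re w = X\<close> by (simp add: mult_exp_exp algebra_simps)
        also have "\<dots> \<le> exp (ln M)" using X by simp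
        finally show ?thesis using M by simp
      next
        assume "Re w = S"
        then have e: "norm (G w) \<le> M" using edge bounds by blast
        have "norm (F w) \<le> norm (G w) * 1"
          by (rule order_trans[OF nFle], use bounds in blast, use bounds in blast, rule mult_left_mono) (use \<epsilon> \<kappa> in auto)
        then show ?thesis using e by simp
      next
        assume "Im w = a"
        then have e: "norm (G w) \<le> M" using edge bounds by blast
        have "norm (F w) \<le> norm (G w) * 1"
          by (rule order_trans[OF nFle], use bounds in blast, use bounds in blast, rule mult_left_mono) (use \<epsilon> \<kappa> in auto)
        then show ?thesis using e by simp
      next
        assume "Im w = b"
        then have e: "norm (G w) \<le> M" using edge bounds by blast
        have "norm (F w) \<le> norm (G w) * 1"
          by (rule order_trans[OF nFle], use bounds in blast, use bounds in blast, rule mult_left_mono) (use \<epsilon> \<kappa> in auto)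
        then show ?thesis using e by simp
      qed
    qed
    then have "norm (G z) * exp (- \<epsilon> * (exp (\<tau> * Re z) * cos (\<tau> * (Im z - m)))) \<le> M" by (simp add: nF)
    then have "norm (G z) \<le> M * exp (\<epsilon> * (exp (\<tau> * Re z) * cos (\<tau> * (Im z - m))))"
      by (simp add: exp_minus field_simps)
    also have "\<dots> \<le> M * exp (\<epsilon> * exp (\<tau> * Re z))"
      using M \<epsilon> by (intro mult_left_mono) auto
    finally show ?thesis .
  qed
  have "((\<lambda>\<epsilon>. M * exp (\<epsilon> * exp (\<tau> * Re z))) \<longlongrightarrow> M * exp (0 * exp (\<tau> * Re z))) (at_right 0)"
    by (intro tendsto_intros)
  then have "((\<lambda>\<epsilon>. M * exp (\<epsilon> * exp (\<tau> * Re z))) \<longlongrightarrow> M) (at_right 0)" by simp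
  moreover have "\<forall>\<^sub>F \<epsilon> in at_right 0. norm (G z) \<le> M * exp (\<epsilon> * exp (\<tau> * Re z))"
    using key by (simp add: eventually_at_right_less eventually_mono[OF eventually_at_right_less])
  ultimately show ?thesis by (rule tendsto_lowerbound) simp
qed

text \<open>The map \<phi> carries a half-plane \<open>Re v > V\<close> into the half strip. In a
  half-plane a positive harmonic function grows at most linearly along the real axis, and the
  mid-line corresponds to \<open>v = exp (k * s)\<close>.\<close>

lemma positive_real_part_half_strip:
  fixes a b S :: real
  assumes ab: "a < b" and hol: "G holomorphic_on {z. S < Re z \<and> a < Im z \<and> Im z < b}"
    and pos: "\<And>z. \<lbrakk>S < Re z; a < Im z; Im z < b\<rbrakk> \<Longrightarrow> 0 < Re (G z)"
  obtains C S' where "\<And>s. S' \<le> s \<Longrightarrow> Re (G (Complex s ((a + b) / 2))) \<le> C * exp (pi / (b - a) * s)"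
proof -
  define k where "k = pi / (b - a)"
  have k: "0 < k" using ab by (simp add: k_def)
  define m where "m = (a + b) / 2"
  define V where "V = exp (k * S)"
  define \<phi> where "\<phi> = (\<lambda>v. Ln v / of_real k + \<i> * of_real m)"
  have \<phi>: "S < Re (\<phi> v) \<and> a < Im (\<phi> v) \<and> Im (\<phi> v) < b" if "V < Re v" for v
  proof -
    have V0: "0 < V" by (simp add: V_def)
    then have v: "0 < Re v" "v \<noteq> 0" using that by auto
    have "V < norm v" using that complex_Re_le_cmod[of v] by linarith
    then have "ln V < ln (norm v)" using V0 v by simp
    then have "S < Re (\<phi> v)" using k v by (simp add: \<phi>_def V_def field_simps Re_Ln)
    moreover have "\<bar>Im (Ln v)\<bar> < pi / 2" using Re_Ln_pos_lt[OF v(2)] v by simp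
    then have L: "\<bar>Im (Ln v)\<bar> / k < pi / 2 / k" using k by (rule divide_strict_right_mono)
    have "pi / 2 / k = (b - a) / 2" by (simp add: k_def)
    then have "\<bar>Im (Ln v) / k\<bar> < (b - a) / 2" using k L by (simp only: abs_divide abs_of_pos)
    then have "- ((b - a) / 2) < Im (Ln v) / k" "Im (Ln v) / k < (b - a) / 2" by linarith+
    then have "a < Im (\<phi> v)" "Im (\<phi> v) < b" by (simp_all add: \<phi>_def m_def field_simps)
    ultimately show ?thesis by simp
  qed
  define H where "H = (\<lambda>v. G (\<phi> v))"
  have holH: "H holomorphic_on {v. V < Re v}"
  proof -
    have "\<phi> holomorphic_on {v. V < Re v}" unfolding \<phi>_def
    proof (intro holomorphic_on_add holomorphic_on_divide holomorphic_on_const holomorphic_on_Ln holomorphic_on_ident)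
      have "0 < V" by (simp add: V_def)
      then show "{v. V < Re v} \<inter> \<real>\<^sub>\<le>\<^sub>0 = {}" by (force simp: complex_nonpos_Reals_iff)
    qed (use k in auto)
    then have "(G \<circ> \<phi>) holomorphic_on {v. V < Re v}"
      by (rule holomorphic_on_compose_gen[OF _ hol]) (use \<phi> in auto)
    then show ?thesis by (simp add: o_def H_def)
  qed
  define x0 where "x0 = V + 1"
  have Hb: "Re (H (of_real x)) \<le> 2 * x * Re (H (of_real x0))" if x: "x0 \<le> x" for x
  proof -
    \<comment> \<open>The largest disc about \<open>x\<close> in the half-plane. The point
      \<open>x0\<close> has distance 1 from its circle, so the Harnack factor is
      \<open>2 * \<rho> - 1\<close>, which is linear in \<open>x\<close>.\<close>
    define \<rho> where "\<rho> = x - V"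
    have \<rho>: "1 \<le> \<rho>" using x by (simp add: \<rho>_def x0_def)
    have sub: "ball (complex_of_real x) \<rho> \<subseteq> {v. V < Re v}"
    proof
      fix v assume "v \<in> ball (complex_of_real x) \<rho>"
      then have "norm (of_real x - v) < \<rho>" by (simp add: dist_norm)
      then have "Re (of_real x - v) < \<rho>" using complex_Re_le_cmod[of "of_real x - v"] by linarith
      then show "v \<in> {v. V < Re v}" by (simp add: \<rho>_def)
    qed
    have d: "dist (of_real x :: complex) (of_real x0) = \<rho> - 1"
    proof -
      have "dist (of_real x :: complex) (of_real x0) = \<bar>x - x0\<bar>" by (simp add: dist_norm flip: of_real_diff)
      then show ?thesis using x by (simp add: \<rho>_def x0_def)
    qed
    have "(\<rho> - (\<rho> - 1)) / (\<rho> + (\<rho> - 1)) * Re (H (of_real x)) \<le> Re (H (of_real x0))"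
      using harnack_ball(2)[OF holomorphic_on_subset[OF holH sub], of "of_real x0"] pos \<phi> sub d
      unfolding H_def by (smt (verit, best) mem_Collect_eq mem_ball subsetD)
    then have "Re (H (of_real x)) \<le> (2 * \<rho> - 1) * Re (H (of_real x0))"
      using \<rho> by (simp add: field_simps)
    also have "\<dots> \<le> 2 * x * Re (H (of_real x0))"
    proof (rule mult_right_mono)
      have "0 < V" by (simp add: V_def)
      then show "2 * \<rho> - 1 \<le> 2 * x" by (simp add: \<rho>_def)
      have "V < Re (of_real x0 :: complex)" by (simp add: x0_def)
      then show "0 \<le> Re (H (of_real x0))" using pos \<phi> unfolding H_def by (meson less_imp_le)
    qed
    finally show ?thesis .
  qed
  show thesis
  proof (rule that[of "ln x0 / k" "2 * Re (H (of_real x0))"])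
    fix s assume s: "ln x0 / k \<le> s"
    have "0 < x0" by (simp add: x0_def V_def add_pos_pos)
    then have "x0 \<le> exp (k * s)" using s k by (simp add: field_simps) (metis exp_le_cancel_iff exp_ln)
    then have "Re (H (of_real (exp (k * s)))) \<le> 2 * exp (k * s) * Re (H (of_real x0))" by (rule Hb)
    moreover have "\<phi> (of_real (exp (k * s))) = Complex s m"
      using k by (simp add: \<phi>_def Ln_of_real complex_eq_iff)
    ultimately show "Re (G (Complex s ((a + b) / 2))) \<le> 2 * Re (H (of_real x0)) * exp (pi / (b - a) * s)"
      by (simp add: H_def m_def k_def mult_ac)
  qed
qed

text \<open>For a function already known to be bounded, division by 1 + \<epsilon> w makes the far
  half circle harmless; then \<epsilon> tends to 0.\<close>

lemma bounded_half_plane_le: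
  assumes hol: "G holomorphic_on {z. 0 \<le> Re z}" and bd: "\<And>z. 0 \<le> Re z \<Longrightarrow> norm (G z) \<le> B"
    and M: "0 < M" and edge: "\<And>z. Re z = 0 \<Longrightarrow> norm (G z) \<le> M" and z: "0 \<le> Re z"
  shows "norm (G z) \<le> M"
proof -
  have ge1: "1 \<le> norm (1 + of_real \<epsilon> * w)" "\<epsilon> * norm w \<le> norm (1 + of_real \<epsilon> * w)"
    if "0 < \<epsilon>" "0 \<le> Re w" for \<epsilon> w
  proof -
    have "1 \<le> Re (1 + of_real \<epsilon> * w)" using that by simp
    then show "1 \<le> norm (1 + of_real \<epsilon> * w)" using complex_Re_le_cmod order_trans by blast
    have "(\<epsilon> * norm w)\<^sup>2 \<le> (norm (1 + of_real \<epsilon> * w))\<^sup>2"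
      unfolding power_mult_distrib cmod_power2
      using that by (simp add: power2_eq_square algebra_simps)
    then show "\<epsilon> * norm w \<le> norm (1 + of_real \<epsilon> * w)" by (rule power2_le_imp_le) simp
  qed
  have key: "norm (G z) \<le> M * (1 + \<epsilon> * norm z)" if \<epsilon>: "0 < \<epsilon>" for \<epsilon>
  proof -
    define F where "F = (\<lambda>w. G w / (1 + of_real \<epsilon> * w))"
    have nz: "1 + of_real \<epsilon> * w \<noteq> 0" if "0 \<le> Re w" for w
      using ge1(1)[OF \<epsilon> that] by auto
    have holF: "F holomorphic_on {z. 0 \<le> Re z}"
      unfolding F_def by (intro holomorphic_intros hol) (use nz in auto)
    define R where "R = max (norm z) (B / (\<epsilon> * M)) + 1"
    have R: "norm z < R" "B / (\<epsilon> * M) < R" "0 < R" using norm_ge_zero[of z] unfolding R_def by linarith+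
    let ?S = "{w. 0 \<le> Re w} \<inter> cball 0 R"
    have cl: "closed ?S" by (intro closed_Int closed_cball closed_halfspace_Re_ge)
    have "norm (F z) \<le> M"
    proof (rule maximum_modulus_frontier[of F ?S])
      show "F holomorphic_on interior ?S"
        by (rule holomorphic_on_subset[OF holF]) (use interior_subset in blast)
      show "continuous_on (closure ?S) F"
        unfolding closure_closed[OF cl] by (rule holomorphic_on_imp_continuous_on, rule holomorphic_on_subset[OF holF]) auto
      show "bounded ?S" by (simp add: bounded_Int)
      show "z \<in> ?S" using z R by simp
      fix w assume w: "w \<in> frontier ?S"
      have open': "open ({w. 0 < Re w} \<inter> ball 0 R)" by (intro open_Int open_ball open_halfspace_Re_gt)
      have "w \<in> ?S" using w frontier_subset_closed[OF cl] by blast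
      moreover have "w \<notin> {w. 0 < Re w} \<inter> ball 0 R"
        using w interior_maximal[OF _ open', of ?S] by (force simp: frontier_def simp del: interior_Int)
      ultimately have w: "0 \<le> Re w" "norm w \<le> R" "Re w = 0 \<or> norm w = R" by auto
      show "norm (F w) \<le> M"
      proof (cases "Re w = 0")
        case True
        then have "norm (G w) \<le> M" by (rule edge)
        also have "M * 1 \<le> M * norm (1 + of_real \<epsilon> * w)" using ge1(1)[OF \<epsilon> w(1)] M by (intro mult_left_mono) auto
        finally show ?thesis using nz[OF w(1)] by (simp add: F_def norm_divide divide_le_eq)
      next
        case False
        then have nw: "norm w = R" using w by blast
        have "norm (G w) \<le> B" using bd w by blast
        also have "B \<le> M * (\<epsilon> * R)" using R M \<epsilon> by (simp add: field_simps)
        also have "\<dots> \<le> M * norm (1 + of_real \<epsilon> * w)" using ge1(2)[OF \<epsilon> w(1)] nw M by (intro mult_left_mono) auto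
        finally show ?thesis using nz[OF w(1)] by (simp add: F_def norm_divide divide_le_eq)
      qed
    qed
    then have "norm (G z) \<le> M * norm (1 + of_real \<epsilon> * z)"
      using nz[OF z] by (simp add: F_def norm_divide divide_le_eq)
    also have "norm (1 + of_real \<epsilon> * z) \<le> 1 + \<epsilon> * norm z"
      using norm_triangle_ineq[of 1 "of_real \<epsilon> * z"] \<epsilon> by (simp add: norm_mult)
    finally show ?thesis using M by simp
  qed
  have "((\<lambda>\<epsilon>. M * (1 + \<epsilon> * norm z)) \<longlongrightarrow> M * (1 + 0 * norm z)) (at_right 0)"
    by (intro tendsto_intros)
  then have "((\<lambda>\<epsilon>. M * (1 + \<epsilon> * norm z)) \<longlongrightarrow> M) (at_right 0)" by simp
  moreover have "\<forall>\<^sub>F \<epsilon> in at_right 0. norm (G z) \<le> M * (1 + \<epsilon> * norm z)"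
    by (rule eventually_mono[OF eventually_at_right_less]) (use key in simp)
  ultimately show ?thesis by (rule tendsto_lowerbound) simp
qed

text \<open>The inversion \<open>w = 1 / z\<close> maps the disc of radius \<open>R\<close> around \<open>R\<close> to the half-plane
  \<open>Re w > 1 / (2R)\<close> and the arc to a segment of its boundary. The rational function \<open>Q\<close> of the proof
  has real part at most \<open>4 / b\<close> on this segment, at most \<open>0\<close> on the rest of the boundary line,
  and decays like \<open>1 / w\<close>.\<close>

lemma half_plane_decay:
  fixes \<theta>1 \<theta>2 :: real
  assumes \<theta>: "- (pi / 2) < \<theta>1" "\<theta>1 < \<theta>2" "\<theta>2 < pi / 2"
  obtains c \<eta> where "0 < c" "0 < \<eta>"
    "\<And>g R m x. \<lbrakk>g holomorphic_on {z. 0 < Re z}; \<And>z. 0 < Re z \<Longrightarrow> norm (g z) \<le> 1; 0 < R; 0 \<le> m;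
       \<And>t. \<lbrakk>\<theta>1 \<le> t; t \<le> \<theta>2\<rbrakk> \<Longrightarrow> norm (g (of_real (2 * R * cos t) * cis t)) \<le> exp (- m);
       0 < x; x \<le> \<eta> * R\<rbrakk> \<Longrightarrow> norm (g (of_real x)) \<le> exp (- (c * m * x / R))"
proof -
  \<comment> \<open>In the coordinate v = 2R / z - 1 the half-plane \<open>Re w > 1 / (2R)\<close>
    becomes \<open>Re v > 0\<close>, and the arc point \<open>2 * R * cos t * cis t\<close> becomes
    - i tan t. So the arc turns into the segment of the imaginary axis with centre \<open>t0\<close>
    and half-length \<open>b\<close>.\<close>
  define t0 where "t0 = - (tan \<theta>1 + tan \<theta>2) / 2"
  define b where "b = (tan \<theta>2 - tan \<theta>1) / 2"
  have b: "0 < b" using tan_monotone[OF \<theta>] by (simp add: b_def)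
  \<comment> \<open>Two poles behind the boundary at depths b/4 and b. On the axis the near one
    dominates close to \<open>t0\<close>; the far one has four times the depth and half the weight,
    hence twice the Poisson mass, and wins where \<bar>y - t0\<bar> \<ge> b. The residues 1 and -
    1/2 leave a positive multiple of 1/v at infinity.\<close>
  define Q where "Q = (\<lambda>v. 1 / (v + of_real (b / 4) - \<i> * of_real t0) - (1 / 2) / (v + of_real b - \<i> * of_real t0))"
  have Re_inv: "Re (1 / (Complex x y + of_real d - \<i> * of_real t0)) = (x + d) / ((x + d)\<^sup>2 + (y - t0)\<^sup>2)" for x y d
    by (simp add: Re_divide power2_eq_square)
  have ReQ: "Re (Q (Complex x y)) = (x + b/4) / ((x + b/4)\<^sup>2 + (y - t0)\<^sup>2) - (x + b) / ((x + b)\<^sup>2 + (y - t0)\<^sup>2) / 2" for x y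
  proof -
    have "Q (Complex x y) = 1 / (Complex x y + of_real (b/4) - \<i> * of_real t0)
        - of_real (1/2) * (1 / (Complex x y + of_real b - \<i> * of_real t0))" by (simp add: Q_def)
    then show ?thesis by (simp only: minus_complex.simps Re_inv Re_complex_of_real times_complex.simps Im_complex_of_real) simp
  qed
  have Q_out: "Re (Q (Complex 0 y)) \<le> 0" if "b \<le> \<bar>y - t0\<bar>" for y
  proof -
    define q where "q = (y - t0)\<^sup>2"
    have "b\<^sup>2 \<le> q" using that b by (simp add: q_def power2_le_iff_abs_le abs_le_square_iff[symmetric])
    have pos: "0 < (b/4)\<^sup>2 + q" "0 < b\<^sup>2 + q" using b by (auto simp: q_def add_pos_nonneg)
    have "b / 4 * (b\<^sup>2 + q) \<le> b / 2 * ((b/4)\<^sup>2 + q)"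
    proof -
      have "b / 2 * ((b/4)\<^sup>2 + q) - b / 4 * (b\<^sup>2 + q) = b / 4 * (q - 7 / 8 * b\<^sup>2)"
        by (simp add: power2_eq_square algebra_simps)
      also have "\<dots> \<ge> 0"
      proof (rule mult_nonneg_nonneg)
        show "0 \<le> q - 7 / 8 * b\<^sup>2" using \<open>b\<^sup>2 \<le> q\<close> zero_le_power2[of b] by linarith
      qed (use b in simp)
      finally show ?thesis by simp
    qed
    then have "b / 4 / ((b/4)\<^sup>2 + q) \<le> b / 2 / (b\<^sup>2 + q)"
      using pos by (simp add: frac_le_eq divide_le_eq pos_le_divide_eq mult_ac)
    then show ?thesis unfolding ReQ q_def by (simp add: field_simps)
  qed
  have Q_in: "Re (Q (Complex 0 y)) \<le> 4 / b" for y
  proof -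
    have "b / 4 / ((b/4)\<^sup>2 + (y - t0)\<^sup>2) \<le> b / 4 / ((b/4)\<^sup>2)"
      using b by (intro divide_left_mono) (auto simp: add_pos_nonneg)
    also have "\<dots> = 4 / b" using b by (simp add: power2_eq_square)
    finally have "b / 4 / ((b/4)\<^sup>2 + (y - t0)\<^sup>2) \<le> 4 / b" .
    moreover have "0 \<le> b / (b\<^sup>2 + (y - t0)\<^sup>2) / 2" using b by simp
    ultimately show ?thesis by (simp add: ReQ)
  qed
  have den: "v + of_real d - \<i> * of_real t0 \<noteq> 0" if "0 \<le> Re v" "0 < d" for v d
    using that by (auto simp: complex_eq_iff)
  have n_inv: "norm (1 / (v + of_real d - \<i> * of_real t0)) \<le> 1 / d" if "0 \<le> Re v" "0 < d" for v d
  proof -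
    have "d \<le> Re (v + of_real d - \<i> * of_real t0)" using that by simp
    also have "\<dots> \<le> norm (v + of_real d - \<i> * of_real t0)" by (rule complex_Re_le_cmod)
    finally have "d \<le> norm (v + of_real d - \<i> * of_real t0)" .
    then have "1 / norm (v + of_real d - \<i> * of_real t0) \<le> 1 / d"
      using that(2) by (intro divide_left_mono mult_pos_pos) linarith+
    then show ?thesis by (simp add: norm_divide)
  qed
  define B where "B = 4 / b + 1 / (2 * b)"
  have Q_bd: "Re (Q v) \<le> B" if "0 \<le> Re v" for v
  proof -
    have "norm (Q v) = norm (1 / (v + of_real (b/4) - \<i> * of_real t0) - (1 / 2) * (1 / (v + of_real b - \<i> * of_real t0)))"
      by (simp add: Q_def)
    also have "\<dots> \<le> norm (1 / (v + of_real (b/4) - \<i> * of_real t0)) + norm ((1 / 2) * (1 / (v + of_real b - \<i> * of_real t0)))"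
      by (rule norm_triangle_ineq4)
    also have "\<dots> \<le> 1 / (b/4) + 1 / 2 * (1 / b)"
      unfolding norm_mult
      by (intro add_mono mult_mono n_inv that) (use b in auto)
    also have "\<dots> = B" using b by (simp add: B_def)
    finally have "norm (Q v) \<le> B" .
    then show ?thesis using complex_Re_le_cmod[of "Q v"] by linarith
  qed
  have Q_low: "1 / (4 * (1 + b) * (x + 1)) \<le> Re (Q (of_real x))" if x: "\<bar>t0\<bar> + 1 \<le> x" for x
  proof -
    define u1 u2 T where "u1 = x + b/4" and "u2 = x + b" and "T = t0\<^sup>2"
    have u: "0 < u1" "u1 < u2" "\<bar>t0\<bar> \<le> u1" using b x by (auto simp: u1_def u2_def)
    have T: "0 \<le> T" by (simp add: T_def)
    have Tu1: "T \<le> u1\<^sup>2" using u power_mono[of "\<bar>t0\<bar>" u1 2] by (simp add: T_def)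
    have "u1\<^sup>2 \<le> u1 * u2" using u by (simp add: power2_eq_square)
    then have "0 \<le> (u2 - u1) * (u1 * u2 - T)" using u Tu1 by (intro mult_nonneg_nonneg) auto
    then have "u2 * (u1\<^sup>2 + T) \<le> u1 * (u2\<^sup>2 + T)" by (simp add: power2_eq_square algebra_simps)
    then have le: "u2 / (u2\<^sup>2 + T) \<le> u1 / (u1\<^sup>2 + T)"
      using u T by (simp add: divide_le_eq pos_le_divide_eq add_pos_nonneg mult_ac)
    have "1 / (4 * (1 + b) * (x + 1)) \<le> 1 / (4 * u1)"
    proof (rule divide_left_mono)
      have "u1 \<le> (1 + b) * (x + 1)" using b x by (simp add: u1_def algebra_simps)
      then show "4 * u1 \<le> 4 * (1 + b) * (x + 1)" by (simp only: mult.assoc)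
      show "0 < 4 * (1 + b) * (x + 1) * (4 * u1)" using b x u by simp
    qed simp
    also have "\<dots> = u1 / (2 * (2 * u1\<^sup>2))" using u by (simp add: power2_eq_square)
    also have "\<dots> \<le> u1 / (2 * (u1\<^sup>2 + T))" using u T Tu1 by (intro divide_left_mono) (auto simp: add_pos_nonneg)
    also have "\<dots> = u1 / (u1\<^sup>2 + T) / 2" by simp
    also have "\<dots> \<le> u1 / (u1\<^sup>2 + T) - u2 / (u2\<^sup>2 + T) / 2"
    proof -
      have "X / 2 \<le> X - Y / 2" if "Y \<le> X" for X Y :: real using that by simp
      then show ?thesis using le .
    qed
    also have "\<dots> = Re (Q (Complex x 0))" by (simp add: ReQ u1_def u2_def T_def)
    also have "Complex x 0 = of_real x" by (simp add: complex_eq_iff)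
    finally show ?thesis .
  qed
  show thesis
  \<comment> \<open>\<open>x\<close> corresponds to v with v + 1 = 2R / x. Substituting this in
    \<open>Q_low\<close> and multiplying by b/4 gives the rate; the bound on \<open>x / R\<close>
    ensures the hypothesis v \<ge> \<bar>t0\<bar> + 1 of \<open>Q_low\<close>.\<close>
  proof (rule that[of "b / (32 * (1 + b))" "2 / (\<bar>t0\<bar> + 2)"])
    show "0 < b / (32 * (1 + b))" using b by simp
    show "0 < 2 / (\<bar>t0\<bar> + 2)" by simp
    fix g R m x
    assume hol: "g holomorphic_on {z. 0 < Re z}" and le1: "\<And>z. 0 < Re z \<Longrightarrow> norm (g z) \<le> 1"
      and R: "0 < (R::real)" and m: "0 \<le> (m::real)"
      and arc: "\<And>t. \<lbrakk>\<theta>1 \<le> t; t \<le> \<theta>2\<rbrakk> \<Longrightarrow> norm (g (of_real (2 * R * cos t) * cis t)) \<le> exp (- m)"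
      and x: "0 < x" "x \<le> 2 / (\<bar>t0\<bar> + 2) * R"
    have map: "0 < Re (of_real (2 * R) / (1 + v))" if "0 \<le> Re v" for v
    proof -
      have "0 < Re (1 + v)" using that by simp
      moreover have "1 + v \<noteq> 0" using that by (auto simp: complex_eq_iff)
      ultimately have "0 < 2 * R * Re (1 + v) / (norm (1 + v))\<^sup>2" using R by (intro divide_pos_pos mult_pos_pos zero_less_power) auto
      then show ?thesis by (simp add: Re_divide cmod_power2)
    qed
    have nz: "1 + v \<noteq> 0" if "0 \<le> Re v" for v using that by (auto simp: complex_eq_iff)
    \<comment> \<open>The weight m b / 4 is chosen so that on the segment, where
      \<open>Re (Q v)\<close> is at most 4 / b, the exponential is at most exp m and is just
      compensated by the smallness of \<open>g\<close>.\<close>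
    define F where "F = (\<lambda>v. g (of_real (2 * R) / (1 + v)) * exp (of_real (m * b / 4) * Q v))"
    have "(g \<circ> (\<lambda>v. of_real (2 * R) / (1 + v))) holomorphic_on {v. 0 \<le> Re v}"
      by (rule holomorphic_on_compose_gen[OF _ hol]) (use map nz in \<open>auto intro!: holomorphic_intros\<close>)
    then have "(\<lambda>v. g (of_real (2 * R) / (1 + v))) holomorphic_on {v. 0 \<le> Re v}" by (simp add: o_def)
    moreover have "Q holomorphic_on {v. 0 \<le> Re v}"
      unfolding Q_def by (intro holomorphic_intros den) (use b in auto)
    ultimately have holF: "F holomorphic_on {v. 0 \<le> Re v}"
      unfolding F_def by (intro holomorphic_intros)
    have nF: "norm (F v) = norm (g (of_real (2 * R) / (1 + v))) * exp (m * b / 4 * Re (Q v))" for v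
      by (simp add: F_def norm_mult)
    define v where "v = 2 * R / x - 1"
    have v: "\<bar>t0\<bar> + 1 \<le> v" using x R by (simp add: v_def field_simps)
    have "norm (F (of_real v)) \<le> 1"
    proof (rule bounded_half_plane_le[OF holF])
      show "norm (F z) \<le> 1 * exp (m * b / 4 * B)" if "0 \<le> Re z" for z
        unfolding nF using le1[OF map[OF that]] Q_bd[OF that] m b by (intro mult_mono) (auto intro!: mult_left_mono)
      show "norm (F z) \<le> 1" if z: "Re z = 0" for z
      proof -
        define y where "y = Im z"
        have zy: "z = Complex 0 y" using z by (simp add: y_def complex_eq_iff)
        have g1: "norm (g (of_real (2 * R) / (1 + z))) \<le> 1" using le1 map z by simp
        show ?thesis
        proof (cases "b \<le> \<bar>y - t0\<bar>")
          case True
          have "m * b / 4 * Re (Q z) \<le> 0" using Q_out[OF True] zy m b by (simp add: mult_nonneg_nonpos)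
          then show ?thesis unfolding nF using g1 by (intro mult_le_one) auto
        next
          case False
          define t where "t = arctan (- y)"
          have "t0 + b = - tan \<theta>1" "t0 - b = - tan \<theta>2" by (simp_all add: t0_def b_def field_simps)
          then have "tan \<theta>1 \<le> - y" "- y \<le> tan \<theta>2" using False by linarith+
          then have t: "\<theta>1 \<le> t" "t \<le> \<theta>2"
            using \<theta> arctan_monotone'[of "tan \<theta>1" "- y"] arctan_monotone'[of "- y" "tan \<theta>2"]
            by (simp_all add: t_def arctan_tan)
          have ct: "0 < cos t" using t \<theta> by (intro cos_gt_zero_pi) auto
          have "y = - sin t / cos t" using tan_arctan[of "- y"] by (simp add: t_def tan_def)
          then have "of_real (2 * R) / (1 + z) = of_real (2 * R * cos t) * cis t"
            using ct nz[of z] z sin_cos_squared_add[of t]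
          proof -
            have yc: "y * cos t = - sin t" using \<open>y = - sin t / cos t\<close> ct by simp
            have "(1 + y * y) * (cos t * cos t) = cos t * cos t + (y * cos t) * (y * cos t)"
              by (simp add: algebra_simps)
            also have "\<dots> = 1" using sin_cos_squared_add[of t] by (simp add: yc power2_eq_square)
            finally have inv: "1 / (1 + y * y) = cos t * cos t" by (simp add: divide_eq_eq) (metis mult.commute mult_zero_left zero_neq_one)
            have "of_real (2 * R) / (1 + z) = Complex (2 * R * (1 / (1 + y * y))) (- (2 * R * (y * (1 / (1 + y * y)))))"
              by (simp add: zy complex_eq_iff Re_divide Im_divide power2_eq_square)
            also have "y * (1 / (1 + y * y)) = - (sin t * cos t)" unfolding inv using yc by (simp add: mult.assoc[symmetric])
            finally show ?thesis unfolding inv by (simp add: complex_eq_iff)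
          qed
          then have "norm (g (of_real (2 * R) / (1 + z))) \<le> exp (- m)" using arc[OF t] by simp
          moreover have "m * b / 4 * Re (Q z) \<le> m * b / 4 * (4 / b)"
            using Q_in[of y] zy m b by (intro mult_left_mono) auto
          then have "m * b / 4 * Re (Q z) \<le> m" using b by simp
          ultimately have "norm (F z) \<le> exp (- m) * exp m"
            unfolding nF by (intro mult_mono) auto
          then show ?thesis by (simp add: exp_minus)
        qed
      qed
      show "0 \<le> Re (of_real v)" using v by simp
    qed simp
    moreover have "of_real (2 * R) / (1 + of_real v) = (of_real x :: complex)"
    proof -
      have "1 + complex_of_real v = of_real (2 * R / x)" by (simp add: v_def)
      then show ?thesis using x R by simp
    qed
    ultimately have "norm (g (of_real x)) * exp (m * b / 4 * Re (Q (of_real v))) \<le> 1"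
      by (simp add: nF)
    then have "norm (g (of_real x)) \<le> exp (- (m * b / 4 * Re (Q (of_real v))))"
      by (simp add: exp_minus field_simps)
    also have "\<dots> \<le> exp (- (m * b / 4 * (1 / (4 * (1 + b) * (v + 1)))))"
      using Q_low[OF v] m b by (intro iffD2[OF exp_le_cancel_iff] le_imp_neg_le mult_left_mono) auto
    also have "m * b / 4 * (1 / (4 * (1 + b) * (v + 1))) = b / (32 * (1 + b)) * m * x / R"
      using x R b by (simp add: v_def field_simps)
    finally show "norm (g (of_real x)) \<le> exp (- (b / (32 * (1 + b)) * m * x / R))" .
  qed
qed

text \<open>Jensen's inequality in disguise: among \<open>n\<close> equidistributed rotations of a point of the circle
  at least one lies in the arc, so the product of the rotated functions is small on the whole circle.\<close>

lemma small_arc_bound: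
  assumes hol: "f holomorphic_on UNIV" and nz: "f z0 \<noteq> 0" and n: "0 < (n::nat)"
  obtains C where "\<And>r A m a b. \<lbrakk>1 \<le> r; 2 * pi / real n \<le> b - a; \<And>z. norm z = r \<Longrightarrow> norm (f z) \<le> exp A;
     \<And>t. \<lbrakk>a \<le> t; t \<le> b\<rbrakk> \<Longrightarrow> norm (f (of_real r * cis t)) \<le> exp (- m)\<rbrakk> \<Longrightarrow> m \<le> (real n - 1) * A + C"
proof -
  \<comment> \<open>\<open>f\<close> may vanish at 0, so the product of rotations is evaluated at a
    small positive real number instead of the centre.\<close>
  have "\<exists>\<rho>>0. \<forall>z. 0 < norm z \<and> norm z < \<rho> \<longrightarrow> f z \<noteq> 0"
  proof (cases "f 0 = 0")
    case True
    obtain \<rho> where "0 < \<rho>" "\<And>z. z \<in> ball 0 \<rho> - {0} \<Longrightarrow> f z \<noteq> 0"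
      using isolated_zeros[OF hol open_UNIV connected_UNIV UNIV_I True UNIV_I nz] by metis
    then show ?thesis by (intro exI[of _ \<rho>]) auto
  next
    case False
    have "continuous (at 0) f" using holomorphic_on_imp_continuous_on[OF hol] by (simp add: continuous_on_eq_continuous_at)
    then have "\<forall>\<^sub>F z in nhds 0. f z \<noteq> 0"
      using False by (metis isCont_def tendsto_at_iff_tendsto_nhds tendsto_imp_eventually_ne)
    then show ?thesis by (auto simp: eventually_nhds_metric)
  qed
  then obtain \<rho>0 where \<rho>0: "0 < \<rho>0" "\<And>z. 0 < norm z \<Longrightarrow> norm z < \<rho>0 \<Longrightarrow> f z \<noteq> 0" by blast
  define \<rho> where "\<rho> = min (\<rho>0 / 2) (1/2)"
  have \<rho>: "0 < \<rho>" "\<rho> < \<rho>0" "\<rho> < 1" using \<rho>0 by (auto simp: \<rho>_def)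
  define \<omega> where "\<omega> = (\<lambda>j::nat. cis (2 * pi * real j / real n))"
  define P where "P = (\<lambda>z. \<Prod>j<n. f (\<omega> j * z))"
  have holP: "P holomorphic_on UNIV"
  proof -
    have "(f \<circ> (\<lambda>z. \<omega> j * z)) holomorphic_on UNIV" for j
      by (rule holomorphic_on_compose_gen[OF _ hol]) (auto intro!: holomorphic_intros)
    then show ?thesis unfolding P_def by (intro holomorphic_on_prod) (simp add: o_def)
  qed
  have P\<rho>: "P (of_real \<rho>) \<noteq> 0"
    unfolding P_def using \<rho> \<rho>0 by (auto simp: \<omega>_def norm_mult)
  show thesis
  proof (rule that[of "- ln (norm (P (of_real \<rho>)))"])
    fix r A m a b
    assume r: "1 \<le> (r::real)" and ab: "2 * pi / real n \<le> b - a"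
      and A: "\<And>z. norm z = r \<Longrightarrow> norm (f z) \<le> exp A"
      and arc: "\<And>t. \<lbrakk>a \<le> t; t \<le> b\<rbrakk> \<Longrightarrow> norm (f (of_real r * cis t)) \<le> exp (- m)"
    have Ple: "norm (P z) \<le> exp ((real n - 1) * A - m)" if z: "norm z = r" for z
    proof -
      define \<phi> where "\<phi> = Arg z"
      have zr: "z = of_real r * cis \<phi>" using z r Arg_eq[of z] by (metis \<phi>_def cis_conv_exp norm_zero not_one_le_zero)
      \<comment> \<open>Rounding up puts the rotated argument \<open>\<phi> + 2 * pi * l / n\<close>
        between \<open>a\<close> and \<open>a + 2 * pi / n\<close>, hence into the arc;
        \<open>j\<close> is the residue of \<open>l\<close> modulo \<open>n\<close>.\<close>
      define l where "l = \<lceil>(a - \<phi>) * real n / (2 * pi)\<rceil>"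
      define j where "j = nat (l mod int n)"
      have j: "j < n" using n by (simp add: j_def nat_less_iff)
      obtain k where k: "l = int j + int n * k"
      proof -
        have "int j = l mod int n" using n by (simp add: j_def)
        then have "l = int j + int n * (l div int n)" by simp
        then show ?thesis using that by blast
      qed
      define \<kappa> where "\<kappa> = 2 * pi / real n"
      have \<kappa>: "0 < \<kappa>" "(a - \<phi>) * real n / (2 * pi) * \<kappa> = a - \<phi>" using n by (simp_all add: \<kappa>_def)
      have "(a - \<phi>) * real n / (2 * pi) \<le> of_int l" "of_int l \<le> (a - \<phi>) * real n / (2 * pi) + 1"
        unfolding l_def by linarith+
      then have "(a - \<phi>) * real n / (2 * pi) * \<kappa> \<le> of_int l * \<kappa>" "of_int l * \<kappa> \<le> ((a - \<phi>) * real n / (2 * pi) + 1) * \<kappa>"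
        using \<kappa>(1) by (auto intro!: mult_right_mono simp del: times_divide_eq_left)
      moreover have "2 * pi * of_int l / real n = of_int l * \<kappa>" by (simp add: \<kappa>_def)
      ultimately have l: "a \<le> \<phi> + 2 * pi * of_int l / real n" "\<phi> + 2 * pi * of_int l / real n \<le> a + 2 * pi / real n"
        unfolding \<kappa>_def[symmetric] distrib_right \<kappa>(2) by linarith+
      have "cis (\<phi> + 2 * pi * of_int l / real n) = cis (2 * pi * real j / real n + \<phi> + 2 * pi * of_int k)"
        using n by (simp add: k field_simps)
      also have "\<dots> = \<omega> j * cis \<phi>"
        by (simp add: \<omega>_def flip: cis_mult)
      finally have e: "\<omega> j * z = of_real r * cis (\<phi> + 2 * pi * of_int l / real n)"
        by (simp add: zr mult_ac)
      have "norm (f (\<omega> j * z)) \<le> exp (- m)"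
        unfolding e by (rule arc) (use l ab in linarith)+
      moreover have "(\<Prod>i\<in>{..<n}-{j}. norm (f (\<omega> i * z))) \<le> (\<Prod>i\<in>{..<n}-{j}. exp A)"
        by (rule prod_mono) (auto intro!: A simp: z norm_mult \<omega>_def)
      ultimately have "norm (f (\<omega> j * z)) * (\<Prod>i\<in>{..<n}-{j}. norm (f (\<omega> i * z))) \<le> exp (- m) * (\<Prod>i\<in>{..<n}-{j}. exp A)"
        by (intro mult_mono) (auto intro!: prod_nonneg)
      moreover have "norm (P z) = norm (f (\<omega> j * z)) * (\<Prod>i\<in>{..<n}-{j}. norm (f (\<omega> i * z)))"
        unfolding P_def prod_norm[symmetric] using j by (intro prod.remove) auto
      moreover have "(\<Prod>i\<in>{..<n}-{j}. exp A) = exp ((real n - 1) * A)"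
        using j by (simp add: card_Diff_singleton of_nat_diff flip: exp_of_nat_mult)
      ultimately show ?thesis by (simp add: mult_exp_exp algebra_simps)
    qed
    have "norm (P (of_real \<rho>)) \<le> exp ((real n - 1) * A - m)"
    proof (rule maximum_modulus_frontier[of P "cball 0 r"])
      show "P holomorphic_on interior (cball 0 r)" by (rule holomorphic_on_subset[OF holP]) simp
      show "continuous_on (closure (cball 0 r)) P"
        by (rule holomorphic_on_imp_continuous_on, rule holomorphic_on_subset[OF holP]) simp
    qed (use Ple r \<rho> in auto)
    then have "ln (norm (P (of_real \<rho>))) \<le> (real n - 1) * A - m"
      using P\<rho> by (metis ln_exp ln_le_cancel_iff exp_gt_zero zero_less_norm_iff)
    then show "m \<le> (real n - 1) * A + - ln (norm (P (of_real \<rho>)))" by simp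
  qed
qed

text \<open>\<open>exp (L x)\<close> stays off the negative axis, so \<open>L - Ln (exp L)\<close>
  is continuous with values in the discrete group 2 \<open>pi\<close> i \<int>, hence constant on a
  connected set. This controls the imaginary part of \<open>L\<close>, about which the hypothesis
  says nothing directly.\<close>

lemma log_near_1_bounded:
  fixes L :: "'a::topological_space \<Rightarrow> complex"
  assumes "connected X" "continuous_on X L" "\<And>x. x \<in> X \<Longrightarrow> norm (exp (L x) - 1) \<le> 1 / 2"
  obtains B where "\<And>x. x \<in> X \<Longrightarrow> norm (L x) \<le> B"
proof -
  have nn: "exp (L x) \<notin> \<real>\<^sub>\<le>\<^sub>0" if "x \<in> X" for x
  proof -
    have "\<bar>Re (exp (L x) - 1)\<bar> \<le> 1 / 2" using assms(3)[OF that] abs_Re_le_cmod order_trans by blast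
    then have "0 < Re (exp (L x))" unfolding minus_complex.simps one_complex.simps by linarith
    then show ?thesis by (auto simp: complex_nonpos_Reals_iff)
  qed
  define h where "h = (\<lambda>x. (L x - Ln (exp (L x))) / (2 * of_real pi * \<i>))"
  have ch: "continuous_on X h"
    unfolding h_def using assms(2) nn by (intro continuous_intros continuous_on_Ln) auto
  have hZ: "\<exists>n::int. h x = of_int n" for x
  proof -
    have "exp (L x) = exp (Ln (exp (L x)))" by simp
    then obtain n :: int where "L x = Ln (exp (L x)) + of_int (2 * n) * of_real pi * \<i>"
      unfolding exp_eq by auto
    then have "L x - Ln (exp (L x)) = of_int n * (2 * of_real pi * \<i>)"
      unfolding diff_eq_eq by (simp only: of_int_mult mult_ac of_int_numeral add.commute)
    then have "h x = of_int n" unfolding h_def by simp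
    then show ?thesis by blast
  qed
  have "h constant_on X"
  proof (rule continuous_discrete_range_constant[OF assms(1) ch])
    fix x assume "x \<in> X"
    show "\<exists>e>0. \<forall>y. y \<in> X \<and> h y \<noteq> h x \<longrightarrow> e \<le> norm (h y - h x)"
    proof (intro exI[of _ 1] conjI allI impI)
      fix y assume y: "y \<in> X \<and> h y \<noteq> h x"
      obtain n m :: int where nm: "h y = of_int n" "h x = of_int m" using hZ by metis
      then have "norm (h y - h x) = \<bar>of_int (n - m)\<bar>" by (simp flip: of_int_diff)
      moreover have "n \<noteq> m" using nm y by auto
      then have "1 \<le> \<bar>real_of_int (n - m)\<bar>" by linarith
      ultimately show "1 \<le> norm (h y - h x)" by simp
    qed simp
  qed
  then obtain k where k: "\<And>x. x \<in> X \<Longrightarrow> h x = k" by (auto simp: constant_on_def)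
  show thesis
  proof (rule that[of "2 + pi + norm (k * (2 * of_real pi * \<i>))"])
    fix x assume x: "x \<in> X"
    have "(L x - Ln (exp (L x))) / (2 * of_real pi * \<i>) * (2 * of_real pi * \<i>) = k * (2 * of_real pi * \<i>)"
      using k[OF x] unfolding h_def by simp
    then have "L x - Ln (exp (L x)) = k * (2 * of_real pi * \<i>)" by simp
    then have "L x = Ln (exp (L x)) + k * (2 * of_real pi * \<i>)" by (metis diff_add_cancel add.commute)
    then have "norm (L x) \<le> norm (Ln (exp (L x))) + norm (k * (2 * of_real pi * \<i>))"
      by (metis norm_triangle_ineq)
    moreover have "norm (Ln (exp (L x))) \<le> 2 + pi"
    proof -
      have n2: "\<bar>norm (exp (L x)) - 1\<bar> \<le> 1 / 2" using assms(3)[OF x] norm_triangle_ineq3[of "exp (L x)" 1] by simp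
      have "norm (Ln (exp (L x))) \<le> \<bar>Re (Ln (exp (L x)))\<bar> + \<bar>Im (Ln (exp (L x)))\<bar>" by (rule cmod_le)
      moreover have "\<bar>Im (Ln (exp (L x)))\<bar> \<le> pi" using mpi_less_Im_Ln[of "exp (L x)"] Im_Ln_le_pi[of "exp (L x)"] by simp
      moreover have "\<bar>Re (Ln (exp (L x)))\<bar> \<le> 2"
      proof -
        define u where "u = norm (exp (L x))"
        have e: "1 / 2 \<le> u" "u \<le> 3 / 2" using n2 unfolding u_def by linarith+
        have "ln u \<le> u - 1" using e by (intro ln_le_minus_one) auto
        moreover have "ln (1 / u) \<le> 1 / u - 1" using e by (intro ln_le_minus_one) auto
        then have "- ln u \<le> 1 / u - 1" using e by (simp add: ln_div)
        moreover have "1 / u \<le> 2" using e by (simp add: divide_le_eq)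
        ultimately have "\<bar>ln u\<bar> \<le> 2" using e by linarith
        moreover have "Re (Ln (exp (L x))) = ln u" unfolding u_def by (rule Re_Ln) simp
        ultimately show ?thesis by simp
      qed
      ultimately show ?thesis by linarith
    qed
    ultimately show "norm (L x) \<le> 2 + pi + norm (k * (2 * of_real pi * \<i>))" by linarith
  qed
qed

section \<open>Logarithmic coordinates\<close>

lemma harnack_convex:
  assumes "open U" "convex U" "compact K" "K \<subseteq> U"
  obtains C where "0 < C"
    "\<And>G z w. \<lbrakk>G holomorphic_on U; \<And>x. x \<in> U \<Longrightarrow> 0 < Re (G x); z \<in> K; w \<in> K\<rbrakk> \<Longrightarrow> Re (G w) \<le> C * Re (G z)"
proof -
  obtain n :: nat where n:
    "\<And>(p :: complex \<Rightarrow> real) \<Lambda> z w. \<lbrakk>\<And>z w r. \<lbrakk>0 < r; ball z r \<subseteq> U; dist z w \<le> r / 8\<rbrakk> \<Longrightarrow> p w \<le> \<Lambda> * p z;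
       0 \<le> \<Lambda>; z \<in> convex hull K; w \<in> convex hull K\<rbrakk> \<Longrightarrow> p w \<le> \<Lambda> ^ n * p z"
    using harnack_chain[OF assms] by metis
  show thesis
  proof (rule that[of "2 ^ n"])
    fix G z w
    assume hol: "G holomorphic_on U" and pos: "\<And>x. x \<in> U \<Longrightarrow> 0 < Re (G x)" and z: "z \<in> K" and w: "w \<in> K"
    have step: "Re (G w) \<le> 2 * Re (G z)" if "0 < r" "ball z r \<subseteq> U" "dist z w \<le> r / 8" for z w r
    proof -
      have "Re (G w) \<le> (r + dist z w) / (r - dist z w) * Re (G z)"
        by (rule harnack_ball(1)[OF holomorphic_on_subset[OF hol that(2)]]) (use pos that in auto)
      also have "\<dots> \<le> 2 * Re (G z)"
      proof (rule mult_right_mono)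
        show "(r + dist z w) / (r - dist z w) \<le> 2" using that by (simp add: field_simps)
        show "0 \<le> Re (G z)" using pos[of z] that by (meson centre_in_ball less_imp_le subsetD)
      qed
      finally show ?thesis .
    qed
    have "z \<in> convex hull K" "w \<in> convex hull K" using z w hull_subset by fast+
    then show "Re (G w) \<le> 2 ^ n * Re (G z)"
      using n[of "\<lambda>x. Re (G x)" 2 z w] step by simp
  qed simp
qed

text \<open>In the coordinate log z a strip is a truncated sector and dilations are real
  translations. Constants found by compactness on one fixed \<open>rect\<close> therefore hold at
  all scales.\<close>

definition strip :: "real \<Rightarrow> real \<Rightarrow> real \<Rightarrow> complex set" where
  "strip s a b = {z. s < Re z \<and> a < Im z \<and> Im z < b}"

definition rect :: "real \<Rightarrow> real \<Rightarrow> real \<Rightarrow> complex set" where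
  "rect W a b = {z. - W < Re z \<and> Re z < W \<and> a < Im z \<and> Im z < b}"

definition vseg :: "real \<Rightarrow> real \<Rightarrow> complex set" where
  "vseg a b = {z. Re z = 0 \<and> a \<le> Im z \<and> Im z \<le> b}"

lemma strip_iff: "z \<in> strip s a b \<longleftrightarrow> s < Re z \<and> a < Im z \<and> Im z < b"
  by (simp add: strip_def)

lemma rect_iff: "z \<in> rect W a b \<longleftrightarrow> - W < Re z \<and> Re z < W \<and> a < Im z \<and> Im z < b"
  by (simp add: rect_def)

lemma vseg_iff: "z \<in> vseg a b \<longleftrightarrow> Re z = 0 \<and> a \<le> Im z \<and> Im z \<le> b"
  by (simp add: vseg_def)

lemma open_convex_strip: "open (strip s a b)" "convex (strip s a b)"
proof -
  have eq: "strip s a b = {z. Re z > s} \<inter> {z. Im z > a} \<inter> {z. Im z < b}" by (auto simp: strip_def)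
  show "open (strip s a b)" unfolding eq
    by (intro open_Int open_halfspace_Re_gt open_halfspace_Im_gt open_halfspace_Im_lt)
  show "convex (strip s a b)" unfolding eq
    by (intro convex_Int convex_halfspace_Re_gt convex_halfspace_Im_gt convex_halfspace_Im_lt)
qed

lemma open_convex_rect: "open (rect W a b)" "convex (rect W a b)"
proof -
  have eq: "rect W a b = {z. Re z > - W} \<inter> {z. Re z < W} \<inter> {z. Im z > a} \<inter> {z. Im z < b}" by (auto simp: rect_def)
  show "open (rect W a b)" unfolding eq
    by (intro open_Int open_halfspace_Re_gt open_halfspace_Re_lt open_halfspace_Im_gt open_halfspace_Im_lt)
  show "convex (rect W a b)" unfolding eq
    by (intro convex_Int convex_halfspace_Re_gt convex_halfspace_Re_lt convex_halfspace_Im_gt convex_halfspace_Im_lt)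
qed

lemma compact_vseg: "compact (vseg a b)"
proof -
  have "vseg a b = cbox (Complex 0 a) (Complex 0 b)" by (auto simp: vseg_def in_cbox_complex_iff)
  then show ?thesis by simp
qed

lemma vseg_subset_rect: "0 < W \<Longrightarrow> a < c \<Longrightarrow> d < b \<Longrightarrow> vseg c d \<subseteq> rect W a b"
  by (auto simp: vseg_def rect_def)

lemma holomorphic_window:
  assumes "G holomorphic_on strip s0 a b" "s0 + W \<le> s"
  shows "(\<lambda>z. G (z + of_real s)) holomorphic_on rect W a b"
proof -
  have "(G \<circ> (\<lambda>z. z + of_real s)) holomorphic_on rect W a b"
    by (rule holomorphic_on_compose_gen[OF _ assms(1)])
       (use assms(2) in \<open>auto intro!: holomorphic_intros simp: strip_iff rect_iff\<close>)
  then show ?thesis by (simp add: o_def)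
qed

section \<open>The maximum modulus on a logarithmic scale\<close>

definition logmax :: "(complex \<Rightarrow> complex) \<Rightarrow> real \<Rightarrow> real" where
  "logmax f s = ln (max_modulus f (exp s))"

lemma max_modulus_facts:
  assumes "f holomorphic_on UNIV" "0 \<le> r"
  shows "norm z = r \<Longrightarrow> norm (f z) \<le> max_modulus f r"
    and "\<exists>z. norm z = r \<and> norm (f z) = max_modulus f r"
proof -
  have cont: "continuous_on (sphere 0 r) (\<lambda>z. norm (f z))"
    using assms by (intro continuous_on_norm holomorphic_on_imp_continuous_on) (auto intro: holomorphic_on_subset)
  have ne: "sphere 0 r \<noteq> ({} :: complex set)" using assms by simp
  obtain z where z: "z \<in> sphere 0 r" "\<And>y. y \<in> sphere 0 r \<Longrightarrow> norm (f y) \<le> norm (f z)"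
    using continuous_attains_sup[OF compact_sphere ne cont] by blast
  have eq: "max_modulus f r = norm (f z)"
    unfolding max_modulus_def using z by (intro cSup_eq_maximum) auto
  show "norm z = r \<Longrightarrow> norm (f z) \<le> max_modulus f r" for z
    using z eq by simp
  show "\<exists>z. norm z = r \<and> norm (f z) = max_modulus f r" using z eq by auto
qed

lemma max_modulus_mono:
  assumes "f holomorphic_on UNIV" "0 \<le> r" "r \<le> R"
  shows "max_modulus f r \<le> max_modulus f R"
proof -
  obtain z where z: "norm z = r" "norm (f z) = max_modulus f r" using max_modulus_facts(2)[OF assms(1,2)] by blast
  have "norm (f z) \<le> max_modulus f R"
  proof (cases "R = 0")
    case True
    then show ?thesis using z assms by simp
  next
    case False
    show ?thesis
    proof (rule maximum_modulus_frontier[of f "cball 0 R"])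
      show "f holomorphic_on interior (cball 0 R)" by (rule holomorphic_on_subset[OF assms(1)]) simp
      show "continuous_on (closure (cball 0 R)) f"
        by (rule holomorphic_on_imp_continuous_on, rule holomorphic_on_subset[OF assms(1)]) simp
      show "norm (f w) \<le> max_modulus f R" if "w \<in> frontier (cball 0 R)" for w
        using max_modulus_facts(1)[OF assms(1), of R w] that assms False by simp
    qed (use z assms in auto)
  qed
  then show ?thesis using z by simp
qed

lemma max_modulus_unbounded:
  assumes "f holomorphic_on UNIV" "\<not> f constant_on UNIV"
  shows "\<exists>R\<ge>0. \<forall>r\<ge>R. B < max_modulus f r"
proof (rule ccontr)
  assume "\<not> ?thesis"
  then have *: "\<And>R. 0 \<le> R \<Longrightarrow> \<exists>r\<ge>R. max_modulus f r \<le> B" by (meson not_less)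
  have "norm (f z) \<le> B" for z
  proof -
    obtain r where "norm z \<le> r" "max_modulus f r \<le> B" using *[of "norm z"] by auto
    then show ?thesis
      using max_modulus_facts(1)[OF assms(1), of "norm z" z] max_modulus_mono[OF assms(1), of "norm z" r] by simp
  qed
  then have "bounded (range f)" by (auto simp: bounded_iff)
  then show False using Liouville_theorem[OF assms(1)] assms(2) by blast
qed

text \<open>The right-hand side is large only if \<open>w\<close> is close to \<infinity>, 0 or 1,
  and these are the only values near which one of the two logarithms is large. The loss
  \<open>ln 2\<close> in comparing 1 - w with w is covered by the summand 1 of
  \<open>logp\<close>.\<close>

lemma logp_bounds:
  assumes "w \<noteq> 0" "w \<noteq> 1"
  shows "\<bar>ln (norm w)\<bar> \<le> logp w + logp (1 / w) + logp (1 / (1 - w))"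
    and "\<bar>ln (norm (1 - w))\<bar> \<le> logp w + logp (1 / w) + logp (1 / (1 - w))"
proof -
  show "\<bar>ln (norm w)\<bar> \<le> logp w + logp (1 / w) + logp (1 / (1 - w))"
    using assms by (simp add: logp_def norm_divide ln_div)
  have "ln (norm (1 - w)) \<le> logp w"
  proof (cases "norm w \<le> 1")
    case True
    have "norm (1 - w) \<le> 1 + 1" using norm_triangle_ineq4[of 1 w] True by simp
    then have "ln (norm (1 - w)) \<le> ln 2" using assms by simp
    also have "\<dots> \<le> 1" using ln_le_minus_one[of 2] by simp
    finally show ?thesis using logp_ge_1[of w] by linarith
  next
    case False
    have "norm (1 - w) \<le> 2 * norm w" using norm_triangle_ineq4[of 1 w] False by simp
    then have "ln (norm (1 - w)) \<le> ln (2 * norm w)" using assms by simp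
    also have "\<dots> = ln 2 + ln (norm w)" using assms by (simp add: ln_mult)
    also have "\<dots> \<le> 1 + ln (norm w)" using ln_le_minus_one[of 2] by simp
    finally show ?thesis by (simp add: logp_def)
  qed
  moreover have "- ln (norm (1 - w)) \<le> logp (1 / (1 - w))"
    using assms by (simp add: logp_def norm_divide ln_div)
  ultimately show "\<bar>ln (norm (1 - w))\<bar> \<le> logp w + logp (1 / w) + logp (1 / (1 - w))"
    using logp_ge_1[of w] logp_ge_1[of "1 / w"] logp_ge_1[of "1 / (1 - w)"] by linarith
qed

text \<open>In logarithmic coordinates \<open>z = exp \<zeta>\<close> the zeros of \<open>f\<close> outside a disc avoid the half strip
  \<open>\<beta> < Im \<zeta> < \<alpha> + 2\<pi>\<close> and the 1-points avoid \<open>\<bar>Im \<zeta>\<bar> < \<pi>/2\<close>; \<open>L\<close> and \<open>L1\<close> are the corresponding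
  branches of \<open>log f\<close> and \<open>log (1 - f)\<close>.\<close>

locale separated_values =
  fixes f L L1 :: "complex \<Rightarrow> complex" and \<alpha> \<beta> s0 N :: real
  assumes holf: "f holomorphic_on UNIV" and nonconst: "\<not> f constant_on UNIV"
    and angles: "- (pi / 2) < \<alpha>" "\<alpha> \<le> \<beta>" "\<beta> < pi / 2" and s0: "0 \<le> s0"
    and holL: "L holomorphic_on strip s0 \<beta> (\<alpha> + 2 * pi)"
    and expL: "\<And>z. z \<in> strip s0 \<beta> (\<alpha> + 2 * pi) \<Longrightarrow> exp (L z) = f (exp z)"
    and holL1: "L1 holomorphic_on strip s0 (- (pi / 2)) (pi / 2)"
    and expL1: "\<And>z. z \<in> strip s0 (- (pi / 2)) (pi / 2) \<Longrightarrow> exp (L1 z) = 1 - f (exp z)"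
    and A_ge_1: "\<And>s. s0 < s \<Longrightarrow> 1 \<le> logmax f s"
    and A_le: "\<And>s. s0 < s \<Longrightarrow> logmax f s \<le> exp (N * s)"
begin

abbreviation A :: "real \<Rightarrow> real" where "A \<equiv> logmax f"

definition E :: "complex \<Rightarrow> complex" where "E z = f (exp z)"

abbreviation T1 :: "complex set" where "T1 \<equiv> strip s0 \<beta> (pi / 2)"

definition \<theta>\<^sub>1 :: real where "\<theta>\<^sub>1 = (\<beta> + pi / 2) / 2"

text \<open>Small enough that the disc of this radius about
  \<open>Complex s \<theta>\<^sub>1\<close> lies in \<open>T1\<close> whenever
  \<open>s \<ge> s0 + 1\<close>; \<open>\<theta>\<^sub>1\<close> is the middle of the gap.\<close>

definition \<rho> :: real where "\<rho> = min 1 ((pi / 2 - \<beta>) / 2) / 2"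

lemma \<theta>\<^sub>1: "\<beta> < \<theta>\<^sub>1" "\<theta>\<^sub>1 < pi / 2" "0 < \<rho>" "\<rho> < 1" "\<beta> < \<theta>\<^sub>1 - \<rho>" "\<theta>\<^sub>1 + \<rho> < pi / 2"
  using angles by (auto simp: \<theta>\<^sub>1_def \<rho>_def min_def field_simps)

lemma A_pos: "s0 < s \<Longrightarrow> 0 < A s"
  using A_ge_1[of s] by linarith

lemma exp_A: "s0 < s \<Longrightarrow> exp (A s) = max_modulus f (exp s)"
proof -
  assume "s0 < s"
  then have "1 \<le> ln (max_modulus f (exp s))" using A_ge_1[of s] by (simp add: logmax_def)
  moreover have "0 \<le> max_modulus f (exp s)"
    using max_modulus_facts(2)[OF holf, of "exp s"] by (metis exp_ge_zero norm_ge_zero)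
  ultimately have "0 < max_modulus f (exp s)" by (metis less_eq_real_def ln_0 not_one_le_zero)
  then show ?thesis by (simp add: logmax_def)
qed

lemma A_mono: "s0 < s \<Longrightarrow> s \<le> t \<Longrightarrow> A s \<le> A t"
  using max_modulus_mono[OF holf, of "exp s" "exp t"] exp_A[of s] exp_A[of t]
  by (metis exp_ge_zero exp_le_cancel_iff less_le_trans)

lemma norm_f_le: "s0 < s \<Longrightarrow> norm z = exp s \<Longrightarrow> norm (f z) \<le> exp (A s)"
  using max_modulus_facts(1)[OF holf, of "exp s" z] exp_A[of s] by simp

lemma E_le: "s0 < Re z \<Longrightarrow> norm (E z) \<le> exp (A (Re z))"
  by (simp add: E_def norm_f_le)

lemma one_minus_le: "s0 < s \<Longrightarrow> norm (w :: complex) \<le> exp (A s) \<Longrightarrow> norm (1 - w) \<le> exp (A s + 1)"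
proof -
  assume s: "s0 < s" and w: "norm w \<le> exp (A s)"
  have "norm (1 - w) \<le> 1 + norm w" using norm_triangle_ineq4[of 1 w] by simp
  also have "\<dots> \<le> exp (A s) + exp (A s)" using w A_pos[OF s] by (intro add_mono) auto
  also have "\<dots> \<le> exp (A s) * exp 1" using exp_ge_add_one_self[of 1] by simp
  finally show ?thesis by (simp add: exp_add)
qed

lemma A_attained:
  assumes "s0 < s"
  shows "\<exists>t. c \<le> t \<and> t < c + 2 * pi \<and> norm (E (Complex s t)) = exp (A s)"
proof -
  obtain z where z: "norm z = exp s" "norm (f z) = exp (A s)"
    using max_modulus_facts(2)[OF holf, of "exp s"] exp_A[OF assms] by auto
  define t where "t = Arg2pi (z * cis (- c)) + c"
  have "z * cis (- c) = of_real (norm (z * cis (- c))) * exp (\<i> * of_real (Arg2pi (z * cis (- c))))"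
    by (rule Arg2pi_eq)
  then have "z * cis (- c) * cis c = of_real (exp s) * cis (Arg2pi (z * cis (- c))) * cis c"
    using z by (simp add: norm_mult cis_conv_exp)
  then have "z = of_real (exp s) * cis t"
    by (simp add: mult.assoc cis_mult t_def)
  also have "\<dots> = exp (Complex s t)" by (simp add: exp_eq_polar)
  finally have "norm (E (Complex s t)) = exp (A s)" using z by (simp add: E_def)
  then show ?thesis using Arg2pi_ge_0 Arg2pi_lt_2pi[of "z * cis (- c)"] by (intro exI[of _ t]) (auto simp: t_def)
qed

lemma A_at_top: "filterlim A at_top at_top"
  unfolding filterlim_at_top_ge[where c = 0]
proof safe
  fix B :: real
  obtain R where R: "0 \<le> R" "\<And>r. R \<le> r \<Longrightarrow> exp B < max_modulus f r"
    using max_modulus_unbounded[OF holf nonconst] by blast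
  have ge: "B \<le> A s" if "s0 < s" "R \<le> s" for s
  proof -
    have "R \<le> exp s" using that exp_ge_add_one_self[of s] by linarith
    then have "exp B < exp (A s)" using R exp_A[OF that(1)] by simp
    then show ?thesis by simp
  qed
  show "\<forall>\<^sub>F s in at_top. B \<le> A s"
    using eventually_gt_at_top[of s0] eventually_ge_at_top[of R] by eventually_elim (rule ge)
qed

lemma eventually_A_ge: "\<forall>\<^sub>F s in at_top. B \<le> A s"
  using A_at_top by (simp add: filterlim_at_top)

lemma Re_L: "z \<in> strip s0 \<beta> (\<alpha> + 2 * pi) \<Longrightarrow> Re (L z) = ln (norm (E z))"
  by (metis E_def expL ln_exp norm_exp_eq_Re)

lemma Re_L1: "z \<in> strip s0 (- (pi / 2)) (pi / 2) \<Longrightarrow> Re (L1 z) = ln (norm (1 - E z))"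
  by (metis E_def expL1 ln_exp norm_exp_eq_Re)

lemma Re_L_le: "z \<in> strip s0 \<beta> (\<alpha> + 2 * pi) \<Longrightarrow> Re (L z) \<le> A (Re z)"
  using E_le[of z] expL[of z] by (simp add: strip_iff E_def) (metis exp_le_cancel_iff norm_exp_eq_Re)

lemma Re_L1_le: "z \<in> strip s0 (- (pi / 2)) (pi / 2) \<Longrightarrow> Re (L1 z) \<le> A (Re z) + 1"
  using one_minus_le[OF _ E_le[of z]] expL1[of z] by (simp add: strip_iff E_def) (metis exp_le_cancel_iff norm_exp_eq_Re)

lemma T1_subset: "T1 \<subseteq> strip s0 \<beta> (\<alpha> + 2 * pi)" "T1 \<subseteq> strip s0 (- (pi / 2)) (pi / 2)"
  using angles by (auto simp: strip_iff)

lemma E_omits: "z \<in> T1 \<Longrightarrow> E z \<noteq> 0" "z \<in> T1 \<Longrightarrow> E z \<noteq> 1"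
proof -
  assume z: "z \<in> T1"
  show "E z \<noteq> 0" using expL[of z] z T1_subset by (metis E_def exp_not_eq_zero subsetD)
  show "E z \<noteq> 1" using expL1[of z] z T1_subset by (metis E_def exp_not_eq_zero subsetD right_minus_eq)
qed

lemma holE: "E holomorphic_on X"
proof -
  have "(f \<circ> exp) holomorphic_on X"
    by (rule holomorphic_on_compose_gen[OF _ holf]) (auto intro!: holomorphic_intros)
  then show ?thesis by (simp add: E_def[abs_def] o_def)
qed

definition adm :: "(complex \<Rightarrow> complex) \<Rightarrow> bool" where
  "adm g \<longleftrightarrow> g holomorphic_on T1 \<and> (\<forall>z\<in>T1. g z \<noteq> 0 \<and> g z \<noteq> 1)"

text \<open>The maps w to 1/w and 1/(1-w) permute 0, 1 and \<infinity>, so all three functions omit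
  0 and 1. Their \<open>logp\<close> measures the proximity of \<open>E\<close> to \<infinity>, 0
  and 1 respectively, and the sum \<open>Q\<close> the proximity to any of them.\<close>

lemma adm_E: "adm E" "adm (\<lambda>z. 1 / E z)" "adm (\<lambda>z. 1 / (1 - E z))"
  unfolding adm_def using E_omits by (auto intro!: holomorphic_intros holE)

definition Q :: "complex \<Rightarrow> real" where
  "Q z = logp (E z) + logp (1 / E z) + logp (1 / (1 - E z))"

lemma adm_harnack:
  obtains \<Lambda> where "1 \<le> \<Lambda>"
    "\<And>g z w r. \<lbrakk>adm g; 0 < r; ball z r \<subseteq> T1; dist z w \<le> r / 8\<rbrakk> \<Longrightarrow> logp (g w) \<le> \<Lambda> * logp (g z)"
    "\<And>z w r. \<lbrakk>0 < r; ball z r \<subseteq> T1; dist z w \<le> r / 8\<rbrakk> \<Longrightarrow> Q w \<le> \<Lambda> * Q z"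
proof -
  obtain \<Lambda> where \<Lambda>: "1 \<le> \<Lambda>"
    "\<And>F z r w. \<lbrakk>F holomorphic_on ball z r; \<And>x. x \<in> ball z r \<Longrightarrow> F x \<noteq> 0 \<and> F x \<noteq> 1;
       dist z w \<le> r / 8; 0 < r\<rbrakk> \<Longrightarrow> logp (F w) \<le> \<Lambda> * logp (F z)"
    using logp_harnack by metis
  have *: "logp (g w) \<le> \<Lambda> * logp (g z)" if "adm g" "0 < r" "ball z r \<subseteq> T1" "dist z w \<le> r / 8" for g z w r
    by (rule \<Lambda>(2)[of g z r]) (use that in \<open>auto simp: adm_def intro: holomorphic_on_subset\<close>)
  have **: "Q w \<le> \<Lambda> * Q z" if "0 < r" "ball z r \<subseteq> T1" "dist z w \<le> r / 8" for z w r
    using *[OF adm_E(1) that] *[OF adm_E(2) that] *[OF adm_E(3) that] by (simp add: Q_def distrib_left)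
  show thesis by (rule that[of \<Lambda>]) (use \<Lambda>(1) * ** in blast)+
qed

lemma ball_T1: "s0 + 1 \<le> s \<Longrightarrow> ball (Complex s \<theta>\<^sub>1) \<rho> \<subseteq> T1"
proof
  fix z assume s: "s0 + 1 \<le> s" and z: "z \<in> ball (Complex s \<theta>\<^sub>1) \<rho>"
  then have "\<bar>s - Re z\<bar> < \<rho>" "\<bar>\<theta>\<^sub>1 - Im z\<bar> < \<rho>"
    using abs_Re_le_cmod[of "Complex s \<theta>\<^sub>1 - z"] abs_Im_le_cmod[of "Complex s \<theta>\<^sub>1 - z"] by (simp_all add: dist_norm)
  then show "z \<in> T1" using s \<theta>\<^sub>1 by (auto simp: strip_iff abs_less_iff)
qed

lemma dist_Complex: "dist (Complex s t) (Complex s' t') \<le> \<bar>s - s'\<bar> + \<bar>t - t'\<bar>"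
  using cmod_le[of "Complex s t - Complex s' t'"] by (simp add: dist_norm)

lemma logp_large: "1 < x \<Longrightarrow> x \<le> logp w \<Longrightarrow> exp (x - 1) \<le> norm w"
proof -
  assume x: "1 < x" "x \<le> logp w"
  then have "x - 1 \<le> ln (norm w)" by (simp add: logp_def max_def split: if_splits)
  moreover from this have "0 < norm w" using x by (cases "w = 0") auto
  ultimately show ?thesis by (simp add: ln_ge_iff)
qed

text \<open>If \<open>1 / h\<close> is very large at one point of the ray, Harnack's inequality
  makes \<open>h\<close> small on an arc of fixed length, and \<open>small_arc_bound\<close> limits
  this smallness by a multiple of A.\<close>

lemma small_arc_adm:
  assumes hol: "h holomorphic_on UNIV" and nz: "h z0 \<noteq> 0"
    and bd: "\<And>s z. s0 < s \<Longrightarrow> norm z = exp s \<Longrightarrow> norm (h z) \<le> exp (A s + 1)"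
    and adm: "adm (\<lambda>z. 1 / h (exp z))"
  shows "\<exists>C>0. \<forall>s\<ge>s0 + 1. logp (1 / h (exp (Complex s \<theta>\<^sub>1))) \<le> C * A s"
proof -
  obtain \<Lambda> where \<Lambda>: "1 \<le> \<Lambda>"
    "\<And>g z w r. \<lbrakk>adm g; 0 < r; ball z r \<subseteq> T1; dist z w \<le> r / 8\<rbrakk> \<Longrightarrow> logp (g w) \<le> \<Lambda> * logp (g z)"
    using adm_harnack by metis
  obtain n :: nat where n: "16 * pi / \<rho> < real n" using reals_Archimedean2 by blast
  have "0 < 16 * pi / \<rho>" using \<theta>\<^sub>1(3) by simp
  then have n0: "0 < n" using n by simp
  \<comment> \<open>The arc has length \<rho>/8, so its points are within \<rho>/16 of the centre;
    this is one eighth of the radius \<rho>/2 of a disc about such a point that still lies in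
    \<open>T1\<close>.\<close>
  have arc: "2 * pi / real n \<le> (\<theta>\<^sub>1 + \<rho> / 16) - (\<theta>\<^sub>1 - \<rho> / 16)"
    using n n0 \<theta>\<^sub>1(3) by (simp add: field_simps)
  obtain C where C: "\<And>r A m a b. \<lbrakk>1 \<le> r; 2 * pi / real n \<le> b - a; \<And>z. norm z = r \<Longrightarrow> norm (h z) \<le> exp A;
     \<And>t. \<lbrakk>a \<le> t; t \<le> b\<rbrakk> \<Longrightarrow> norm (h (of_real r * cis t)) \<le> exp (- m)\<rbrakk> \<Longrightarrow> m \<le> (real n - 1) * A + C"
    using small_arc_bound[OF hol nz n0] by metis
  define D where "D = \<Lambda> * (2 * real n + \<bar>C\<bar> + 1)"
  have D0: "0 < D" using \<Lambda>(1) by (simp add: D_def add_nonneg_pos)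
  have "logp (1 / h (exp (Complex s \<theta>\<^sub>1))) \<le> D * A s" if s: "s0 + 1 \<le> s" for s
  proof -
    have s': "s0 < s" using s by simp
    note A1 = A_ge_1[OF s']
    define p where "p = logp (1 / h (exp (Complex s \<theta>\<^sub>1)))"
    have "p / \<Lambda> - 1 \<le> (real n - 1) * (A s + 1) + \<bar>C\<bar>"
    proof (cases "p / \<Lambda> \<le> 1")
      case True
      have "0 \<le> (real n - 1) * (A s + 1)" using n0 A1 by (intro mult_nonneg_nonneg) auto
      then show ?thesis using True by linarith
    next
      case False
      have "p / \<Lambda> - 1 \<le> (real n - 1) * (A s + 1) + C"
      proof (rule C[OF _ arc])
        show "1 \<le> exp s" using s s0 by simp
        show "norm (h z) \<le> exp (A s + 1)" if "norm z = exp s" for z by (rule bd[OF s' that])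
        fix t assume t: "\<theta>\<^sub>1 - \<rho> / 16 \<le> t" "t \<le> \<theta>\<^sub>1 + \<rho> / 16"
        have d: "dist (Complex s t) (Complex s \<theta>\<^sub>1) \<le> \<rho> / 16"
          using dist_Complex[of s t s \<theta>\<^sub>1] t by (auto simp: abs_le_iff)
        have "ball (Complex s t) (\<rho> / 2) \<subseteq> ball (Complex s \<theta>\<^sub>1) \<rho>"
        proof
          fix x assume "x \<in> ball (Complex s t) (\<rho> / 2)"
          then show "x \<in> ball (Complex s \<theta>\<^sub>1) \<rho>"
            using d dist_triangle[of "Complex s \<theta>\<^sub>1" x "Complex s t"] \<theta>\<^sub>1(3)
            by (simp only: mem_ball dist_commute)
        qed
        then have "ball (Complex s t) (\<rho> / 2) \<subseteq> T1" using ball_T1[OF s] by blast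
        then have "p \<le> \<Lambda> * logp (1 / h (exp (Complex s t)))"
          unfolding p_def by (intro \<Lambda>(2)[OF adm, of "\<rho> / 2"]) (use \<theta>\<^sub>1(3) d in auto)
        then have "p / \<Lambda> \<le> logp (1 / h (exp (Complex s t)))"
          using \<Lambda>(1) by (simp add: divide_le_eq mult.commute)
        then have "exp (p / \<Lambda> - 1) \<le> norm (1 / h (exp (Complex s t)))"
          using False by (intro logp_large) auto
        moreover have "0 < norm (1 / h (exp (Complex s t)))"
          using calculation exp_gt_zero less_le_trans by blast
        ultimately have "norm (h (exp (Complex s t))) \<le> 1 / exp (p / \<Lambda> - 1)"
          by (simp add: norm_divide field_simps)
        then have "norm (h (exp (Complex s t))) \<le> exp (- (p / \<Lambda> - 1))"
          by (simp only: exp_minus inverse_eq_divide)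
        then show "norm (h (of_real (exp s) * cis t)) \<le> exp (- (p / \<Lambda> - 1))"
          by (simp add: exp_eq_polar)
      qed
      then show ?thesis by linarith
    qed
    then have "p / \<Lambda> \<le> (real n - 1) * (A s + 1) + \<bar>C\<bar> + 1" by linarith
    also have "(real n - 1) * (A s + 1) \<le> real n * (2 * A s)"
      using A1 n0 by (intro mult_mono) auto
    also have "real n * (2 * A s) + \<bar>C\<bar> + 1 \<le> (2 * real n + \<bar>C\<bar> + 1) * A s"
      using mult_left_mono[OF A1, of "\<bar>C\<bar> + 1"] by (simp add: algebra_simps)
    finally have "p / \<Lambda> \<le> (2 * real n + \<bar>C\<bar> + 1) * A s" by simp
    then have "p \<le> \<Lambda> * ((2 * real n + \<bar>C\<bar> + 1) * A s)"
      using \<Lambda>(1) by (simp add: divide_le_eq mult.commute)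
    then show ?thesis by (simp add: p_def D_def mult.assoc)
  qed
  then show ?thesis using D0 by blast
qed

text \<open>The maximum modulus controls the first summand of \<open>Q\<close>; the other two are
  \<open>small_arc_adm\<close> for \<open>h = f\<close> and \<open>h = 1 - f\<close>.\<close>

lemma Q_le_A: "\<exists>C>0. \<forall>s\<ge>s0 + 1. Q (Complex s \<theta>\<^sub>1) \<le> C * A s"
proof -
  obtain z0 where z0: "f z0 \<noteq> 0" using nonconst by (auto simp: constant_on_def)
  obtain z1 where z1: "1 - f z1 \<noteq> 0" using nonconst by (auto simp: constant_on_def)
  obtain C0 where C0: "0 < C0" "\<And>s. s0 + 1 \<le> s \<Longrightarrow> logp (1 / f (exp (Complex s \<theta>\<^sub>1))) \<le> C0 * A s"
  proof -
    have "norm (f z) \<le> exp (A s + 1)" if "s0 < s" "norm z = exp s" for s z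
      using norm_f_le[OF that] by (rule order_trans) simp
    then show ?thesis using small_arc_adm[OF holf z0] adm_E(2) that unfolding E_def by blast
  qed
  obtain C1 where C1: "0 < C1" "\<And>s. s0 + 1 \<le> s \<Longrightarrow> logp (1 / (1 - f (exp (Complex s \<theta>\<^sub>1)))) \<le> C1 * A s"
  proof -
    have "(\<lambda>z. 1 - f z) holomorphic_on UNIV" by (intro holomorphic_intros holf)
    moreover have "norm (1 - f z) \<le> exp (A s + 1)" if "s0 < s" "norm z = exp s" for s z
      using one_minus_le[OF that(1) norm_f_le[OF that]] .
    ultimately show ?thesis using small_arc_adm[of "\<lambda>z. 1 - f z", OF _ z1] adm_E(3) that unfolding E_def by blast
  qed
  have "Q (Complex s \<theta>\<^sub>1) \<le> (2 + C0 + C1) * A s" if s: "s0 + 1 \<le> s" for s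
  proof -
    have s': "s0 < s" using s by simp
    have "Complex s \<theta>\<^sub>1 \<in> T1" using s' \<theta>\<^sub>1 by (simp add: strip_iff)
    then have "E (Complex s \<theta>\<^sub>1) \<noteq> 0" by (rule E_omits(1))
    moreover have "norm (E (Complex s \<theta>\<^sub>1)) \<le> exp (A s)" using E_le[of "Complex s \<theta>\<^sub>1"] s' by simp
    ultimately have "ln (norm (E (Complex s \<theta>\<^sub>1))) \<le> A s" by (metis ln_exp ln_le_cancel_iff exp_gt_zero zero_less_norm_iff)
    then have "logp (E (Complex s \<theta>\<^sub>1)) \<le> 2 * A s" using A_ge_1[OF s'] by (simp add: logp_def)
    then show ?thesis using C0(2)[OF s] C1(2)[OF s] by (simp add: Q_def E_def algebra_simps)
  qed
  then show ?thesis using C0(1) C1(1) by (intro exI[of _ "2 + C0 + C1"]) auto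
qed

end

section \<open>The growth of log M(r) and the three states\<close>

text \<open>\<open>two_constants\<close> on a fixed window, after translation by \<open>s\<close>
  and division by \<open>M\<close>. The point is that \<delta> depends neither on the scale nor on
  \<open>M\<close>.\<close>

lemma two_constants_window:
  assumes \<theta>: "a < \<theta>" "\<theta> < b" and r: "0 < r" and cd: "a < c" "d < b" and \<epsilon>: "0 < \<epsilon>"
  obtains \<delta> where "0 < \<delta>"
    "\<And>G s0 s M t. \<lbrakk>G holomorphic_on strip s0 a b; s0 + 1 \<le> s; 0 < M;
       \<And>z. \<lbrakk>z \<in> strip s0 a b; \<bar>Re z - s\<bar> < 1\<rbrakk> \<Longrightarrow> Re (G z) \<le> M;
       \<And>z. \<lbrakk>z \<in> strip s0 a b; dist (Complex s \<theta>) z < r\<rbrakk> \<Longrightarrow> \<bar>Re (G z)\<bar> \<le> \<delta> * M; c \<le> t; t \<le> d\<rbrakk>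
       \<Longrightarrow> \<bar>Re (G (Complex s t))\<bar> \<le> \<epsilon> * M"
proof -
  define V where "V = ball (Complex 0 \<theta>) r \<inter> rect 1 a b"
  have V: "open V" "V \<subseteq> rect 1 a b" "V \<noteq> {}"
  proof -
    show "open V" unfolding V_def by (intro open_Int open_ball open_convex_rect)
    have "Complex 0 \<theta> \<in> V" using r \<theta> by (simp add: V_def rect_iff)
    then show "V \<noteq> {}" by blast
  qed (simp add: V_def)
  obtain \<delta> where \<delta>: "0 < \<delta>"
    "\<And>G z. \<lbrakk>G holomorphic_on rect 1 a b; \<And>x. x \<in> rect 1 a b \<Longrightarrow> Re (G x) \<le> 1;
        \<And>x. x \<in> V \<Longrightarrow> \<bar>Re (G x)\<bar> \<le> \<delta>; z \<in> vseg c d\<rbrakk> \<Longrightarrow> \<bar>Re (G z)\<bar> \<le> \<epsilon>"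
    using two_constants[OF open_convex_rect V compact_vseg vseg_subset_rect[OF zero_less_one cd] \<epsilon>] by metis
  show thesis
  proof (rule that[OF \<delta>(1)])
    fix G s0 s M t
    assume hol: "G holomorphic_on strip s0 a b" and s: "s0 + 1 \<le> s" and M: "0 < (M::real)"
      and le: "\<And>z. \<lbrakk>z \<in> strip s0 a b; \<bar>Re z - s\<bar> < 1\<rbrakk> \<Longrightarrow> Re (G z) \<le> M"
      and small: "\<And>z. \<lbrakk>z \<in> strip s0 a b; dist (Complex s \<theta>) z < r\<rbrakk> \<Longrightarrow> \<bar>Re (G z)\<bar> \<le> \<delta> * M"
      and t: "c \<le> t" "t \<le> d"
    define G' where "G' = (\<lambda>z. of_real (1 / M) * G (z + of_real s))"
    have hol': "G' holomorphic_on rect 1 a b"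
      unfolding G'_def by (intro holomorphic_intros holomorphic_window[OF hol s])
    have ReG': "Re (G' z) = Re (G (z + of_real s)) / M" for z by (simp add: G'_def)
    have in_strip: "z + of_real s \<in> strip s0 a b" "\<bar>Re (z + of_real s) - s\<bar> < 1" if "z \<in> rect 1 a b" for z
      using that s by (auto simp: strip_iff rect_iff)
    have "\<bar>Re (G' (Complex 0 t))\<bar> \<le> \<epsilon>"
    proof (rule \<delta>(2)[OF hol'])
      show "Re (G' x) \<le> 1" if "x \<in> rect 1 a b" for x
        using le[OF in_strip[OF that]] M by (simp add: ReG')
      show "\<bar>Re (G' x)\<bar> \<le> \<delta>" if "x \<in> V" for x
      proof -
        have x: "x \<in> rect 1 a b" "dist (Complex 0 \<theta>) x < r" using that by (auto simp: V_def)
        have "Complex s \<theta> - (x + of_real s) = Complex 0 \<theta> - x" by (simp add: complex_eq_iff)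
        then have "dist (Complex s \<theta>) (x + of_real s) = dist (Complex 0 \<theta>) x" by (simp only: dist_norm)
        then have "\<bar>Re (G (x + of_real s))\<bar> \<le> \<delta> * M" using small in_strip x by simp
        then show ?thesis using M by (simp add: ReG' abs_divide divide_le_eq)
      qed
      show "Complex 0 t \<in> vseg c d" using t by (simp add: vseg_iff)
    qed
    moreover have "Complex 0 t + of_real s = Complex s t" by (simp add: complex_eq_iff)
    ultimately show "\<bar>Re (G (Complex s t))\<bar> \<le> \<epsilon> * M" using M by (simp add: ReG' abs_divide divide_le_eq)
  qed
qed

lemma logmax_cnj: "logmax (\<lambda>z. cnj (f (cnj z))) = logmax f"
proof -
  have "max_modulus (\<lambda>z. cnj (f (cnj z))) r = max_modulus f r" for r
  proof -
    have "(\<lambda>z. norm (cnj (f (cnj z)))) ` sphere 0 r = (\<lambda>z. norm (f z)) ` sphere 0 r" (is "?l = ?r")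
    proof
      show "?l \<subseteq> ?r" by auto
      show "?r \<subseteq> ?l"
      proof
        fix x assume "x \<in> ?r"
        then obtain z where "z \<in> sphere 0 r" "x = norm (f z)" by blast
        then show "x \<in> ?l" by (intro image_eqI[of _ _ "cnj z"]) auto
      qed
    qed
    then show ?thesis by (simp add: max_modulus_def)
  qed
  then show ?thesis by (simp add: logmax_def fun_eq_iff)
qed

context separated_values
begin

text \<open>Conjugation swaps the two gaps, so that results for the gap from \<beta> to
  \<open>pi / 2\<close> transfer to the gap from \<open>- (pi / 2)\<close> to \<alpha>. The shift by
  2 \<open>pi\<close> i returns the reflected domain of \<open>L\<close> to the interval that the
  locale prescribes.\<close>

lemma reflected:
  "separated_values (\<lambda>z. cnj (f (cnj z))) (\<lambda>z. cnj (L (cnj (z - 2 * pi * \<i>)))) (\<lambda>z. cnj (L1 (cnj z))) (- \<beta>) (- \<alpha>) s0 N"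
proof
  have hol: "(\<lambda>z. cnj (g (cnj z))) holomorphic_on X" if "g holomorphic_on S" "open X" "cnj ` X \<subseteq> S" for g X S
    using holomorphic_on_compose_cnj_cnj[OF holomorphic_on_subset[OF that(1,3)] that(2)] by (simp add: o_def)
  show "(\<lambda>z. cnj (f (cnj z))) holomorphic_on UNIV" by (rule hol[OF holf]) auto
  show "\<not> (\<lambda>z. cnj (f (cnj z))) constant_on UNIV"
  proof
    assume "(\<lambda>z. cnj (f (cnj z))) constant_on UNIV"
    then obtain c where "\<And>z. cnj (f (cnj z)) = c" by (auto simp: constant_on_def)
    then have "f z = cnj c" for z by (metis complex_cnj_cnj)
    then show False using nonconst by (auto simp: constant_on_def)
  qed
  show "- (pi / 2) < - \<beta>" "- \<beta> \<le> - \<alpha>" "- \<alpha> < pi / 2" "0 \<le> s0" using angles s0 by auto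
  show "(\<lambda>z. cnj (L1 (cnj z))) holomorphic_on strip s0 (- (pi / 2)) (pi / 2)"
    by (rule hol[OF holL1 open_convex_strip(1)]) (auto simp: strip_iff)
  show "exp (cnj (L1 (cnj z))) = 1 - cnj (f (cnj (exp z)))" if "z \<in> strip s0 (- (pi / 2)) (pi / 2)" for z
  proof -
    have "exp (L1 (cnj z)) = 1 - f (exp (cnj z))" by (rule expL1) (use that in \<open>auto simp: strip_iff\<close>)
    then show ?thesis by (simp flip: exp_cnj)
  qed
  have sh: "(\<lambda>z. L (z + 2 * pi * \<i>)) holomorphic_on strip s0 (\<beta> - 2 * pi) \<alpha>"
  proof -
    have "(L \<circ> (\<lambda>z. z + 2 * pi * \<i>)) holomorphic_on strip s0 (\<beta> - 2 * pi) \<alpha>"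
      by (rule holomorphic_on_compose_gen[OF _ holL]) (auto intro!: holomorphic_intros simp: strip_iff)
    then show ?thesis by (simp add: o_def)
  qed
  have "(\<lambda>z. cnj (L (cnj z + 2 * pi * \<i>))) holomorphic_on strip s0 (- \<alpha>) (- \<beta> + 2 * pi)"
    by (rule hol[OF sh open_convex_strip(1)]) (auto simp: strip_iff)
  then show "(\<lambda>z. cnj (L (cnj (z - 2 * pi * \<i>)))) holomorphic_on strip s0 (- \<alpha>) (- \<beta> + 2 * pi)"
    by simp
  show "exp (cnj (L (cnj (z - 2 * pi * \<i>)))) = cnj (f (cnj (exp z)))" if "z \<in> strip s0 (- \<alpha>) (- \<beta> + 2 * pi)" for z
  proof -
    have "exp (L (cnj z + 2 * pi * \<i>)) = f (exp (cnj z + 2 * pi * \<i>))" by (rule expL) (use that in \<open>auto simp: strip_iff\<close>)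
    then show ?thesis by (simp add: exp_add flip: exp_cnj)
  qed
  show "1 \<le> logmax (\<lambda>z. cnj (f (cnj z))) s" "logmax (\<lambda>z. cnj (f (cnj z))) s \<le> exp (N * s)" if "s0 < s" for s
    using A_ge_1[OF that] A_le[OF that] by (simp_all add: logmax_cnj)
qed

lemma E_period: "E (z + 2 * pi * \<i>) = E z"
  by (simp add: E_def exp_add)

lemma E_period': "E (Complex s (t + 2 * pi)) = E (Complex s t)"
  using E_period[of "Complex s t"] by (simp add: Complex_eq algebra_simps)

text \<open>If \<open>E\<close> stays away from \<open>0\<close>, \<open>1\<close>, \<open>\<infinity>\<close> near \<open>T1\<close> at some scale, then by the two-constants
  principle \<open>log |f|\<close> and \<open>log |1 - f|\<close> are small on the whole circle, so \<open>A\<close> must jump at this scale.\<close>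

lemma A_le_Q_if_no_jump:
  assumes K: "1 \<le> K"
  shows "\<exists>\<delta>>0. \<exists>S. \<forall>s\<ge>S. A (s + 1) \<le> K * A s \<longrightarrow> \<delta> * A s \<le> Q (Complex s \<theta>\<^sub>1)"
proof -
  \<comment> \<open>Without a jump the majorant in the window is \<open>K * A s\<close>, and
    \<epsilon> turns it into a quarter of \<open>A s\<close>.\<close>
  define \<epsilon> where "\<epsilon> = 1 / (4 * K)"
  have \<epsilon>: "0 < \<epsilon>" "\<epsilon> * K = 1 / 4" "\<epsilon> \<le> 1 / 4" using K by (auto simp: \<epsilon>_def field_simps)
  define \<theta>2 where "\<theta>2 = (\<alpha> - pi / 2) / 2"
  have \<theta>2: "- (pi / 2) < \<theta>2" "\<theta>2 < \<alpha>" using angles by (auto simp: \<theta>2_def)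
  have r: "0 < \<rho> / 8" using \<theta>\<^sub>1 by simp
  have g1: "\<beta> < \<theta>\<^sub>1" "\<theta>\<^sub>1 < \<alpha> + 2 * pi" "- (pi / 2) < \<theta>\<^sub>1" "\<theta>\<^sub>1 < pi / 2" "\<theta>2 + 2 * pi < \<alpha> + 2 * pi"
    using \<theta>\<^sub>1 \<theta>2 angles by auto
  obtain \<delta>u where \<delta>u: "0 < \<delta>u"
    "\<And>G s0 s M t. \<lbrakk>G holomorphic_on strip s0 \<beta> (\<alpha> + 2 * pi); s0 + 1 \<le> s; 0 < M;
       \<And>z. \<lbrakk>z \<in> strip s0 \<beta> (\<alpha> + 2 * pi); \<bar>Re z - s\<bar> < 1\<rbrakk> \<Longrightarrow> Re (G z) \<le> M;
       \<And>z. \<lbrakk>z \<in> strip s0 \<beta> (\<alpha> + 2 * pi); dist (Complex s \<theta>\<^sub>1) z < \<rho> / 8\<rbrakk> \<Longrightarrow> \<bar>Re (G z)\<bar> \<le> \<delta>u * M; \<theta>\<^sub>1 \<le> t; t \<le> \<theta>2 + 2 * pi\<rbrakk>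
       \<Longrightarrow> \<bar>Re (G (Complex s t))\<bar> \<le> \<epsilon> * M"
    using two_constants_window[OF g1(1,2) r g1(1,5) \<epsilon>(1)] by metis
  obtain \<delta>v where \<delta>v: "0 < \<delta>v"
    "\<And>G s0 s M t. \<lbrakk>G holomorphic_on strip s0 (- (pi / 2)) (pi / 2); s0 + 1 \<le> s; 0 < M;
       \<And>z. \<lbrakk>z \<in> strip s0 (- (pi / 2)) (pi / 2); \<bar>Re z - s\<bar> < 1\<rbrakk> \<Longrightarrow> Re (G z) \<le> M;
       \<And>z. \<lbrakk>z \<in> strip s0 (- (pi / 2)) (pi / 2); dist (Complex s \<theta>\<^sub>1) z < \<rho> / 8\<rbrakk> \<Longrightarrow> \<bar>Re (G z)\<bar> \<le> \<delta>v * M; \<theta>2 \<le> t; t \<le> \<theta>\<^sub>1\<rbrakk>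
       \<Longrightarrow> \<bar>Re (G (Complex s t))\<bar> \<le> \<epsilon> * M"
    using two_constants_window[OF g1(3,4) r \<theta>2(1) g1(4) \<epsilon>(1)] by metis
  obtain \<Lambda> where \<Lambda>: "1 \<le> \<Lambda>"
    "\<And>z w r. \<lbrakk>0 < r; ball z r \<subseteq> T1; dist z w \<le> r / 8\<rbrakk> \<Longrightarrow> Q w \<le> \<Lambda> * Q z"
    using adm_harnack by metis
  define \<delta> where "\<delta> = min \<delta>u \<delta>v / \<Lambda>"
  have \<delta>: "0 < \<delta>" "\<Lambda> * \<delta> = min \<delta>u \<delta>v" using \<delta>u(1) \<delta>v(1) \<Lambda>(1) by (auto simp: \<delta>_def)
  obtain S where S: "\<And>s. S \<le> s \<Longrightarrow> 4 \<le> A s" using eventually_A_ge[of 4] by (auto simp: eventually_at_top_linorder)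
  have "\<delta> * A s \<le> Q (Complex s \<theta>\<^sub>1)" if s: "max S (s0 + 2) \<le> s" and nj: "A (s + 1) \<le> K * A s" for s
  proof (rule ccontr)
    assume "\<not> ?thesis"
    then have Qs: "Q (Complex s \<theta>\<^sub>1) < \<delta> * A s" by simp
    have s1: "s0 + 1 \<le> s" and A4: "4 \<le> A s" using s S by auto
    have Q_small: "Q z \<le> min \<delta>u \<delta>v * A s" if "dist (Complex s \<theta>\<^sub>1) z < \<rho> / 8" for z
    proof -
      have "Q z \<le> \<Lambda> * Q (Complex s \<theta>\<^sub>1)"
        by (rule \<Lambda>(2)[OF _ ball_T1[OF s1]]) (use that \<theta>\<^sub>1 in auto)
      also have "\<dots> \<le> \<Lambda> * (\<delta> * A s)" using Qs \<Lambda>(1) by (intro mult_left_mono) auto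
      finally show ?thesis using \<delta>(2) by (simp add: mult.assoc[symmetric])
    qed
    have inT1: "z \<in> T1" if "dist (Complex s \<theta>\<^sub>1) z < \<rho> / 8" for z
      using ball_T1[OF s1] that \<theta>\<^sub>1(3) by auto
    have Are: "A (Re z) \<le> K * A s" if "s0 < Re z" "\<bar>Re z - s\<bar> < 1" for z
      using A_mono[of "Re z" "s + 1"] that nj by linarith
    have KA: "A s \<le> K * A s" using K A4 by (intro mult_right_mono[of 1 K "A s", simplified]) auto
    have pos: "0 < K * A s" "0 < K * A s + 1" using KA A4 by linarith+
    have u: "\<bar>Re (L (Complex s t))\<bar> \<le> A s / 4" if "\<theta>\<^sub>1 \<le> t" "t \<le> \<theta>2 + 2 * pi" for t
    proof -
      have "\<bar>Re (L (Complex s t))\<bar> \<le> \<epsilon> * (K * A s)"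
      proof (rule \<delta>u(2)[OF holL s1 pos(1) _ _ that])
        show "Re (L z) \<le> K * A s" if "z \<in> strip s0 \<beta> (\<alpha> + 2 * pi)" "\<bar>Re z - s\<bar> < 1" for z
          using Re_L_le[OF that(1)] Are[of z] that by (simp add: strip_iff)
        show "\<bar>Re (L z)\<bar> \<le> \<delta>u * (K * A s)" if z: "z \<in> strip s0 \<beta> (\<alpha> + 2 * pi)" "dist (Complex s \<theta>\<^sub>1) z < \<rho> / 8" for z
        proof -
          have "\<bar>Re (L z)\<bar> \<le> Q z"
            unfolding Re_L[OF z(1)] Q_def using E_omits inT1[OF z(2)] by (intro logp_bounds(1)) auto
          also have "\<dots> \<le> min \<delta>u \<delta>v * A s" by (rule Q_small[OF z(2)])
          also have "\<dots> \<le> \<delta>u * (K * A s)" using KA A4 \<delta>u(1) \<delta>v(1) by (intro mult_mono) auto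
          finally show ?thesis .
        qed
      qed
      then show ?thesis using \<epsilon>(2) by (simp add: mult.assoc[symmetric])
    qed
    have v: "\<bar>Re (L1 (Complex s t))\<bar> \<le> A s / 2" if "\<theta>2 \<le> t" "t \<le> \<theta>\<^sub>1" for t
    proof -
      have "\<bar>Re (L1 (Complex s t))\<bar> \<le> \<epsilon> * (K * A s + 1)"
      proof (rule \<delta>v(2)[OF holL1 s1 pos(2) _ _ that])
        show "Re (L1 z) \<le> K * A s + 1" if "z \<in> strip s0 (- (pi / 2)) (pi / 2)" "\<bar>Re z - s\<bar> < 1" for z
          using Re_L1_le[OF that(1)] Are[of z] that by (simp add: strip_iff)
        show "\<bar>Re (L1 z)\<bar> \<le> \<delta>v * (K * A s + 1)" if z: "z \<in> strip s0 (- (pi / 2)) (pi / 2)" "dist (Complex s \<theta>\<^sub>1) z < \<rho> / 8" for z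
        proof -
          have "\<bar>Re (L1 z)\<bar> \<le> Q z"
            unfolding Re_L1[OF z(1)] Q_def using E_omits inT1[OF z(2)] by (intro logp_bounds(2)) auto
          also have "\<dots> \<le> min \<delta>u \<delta>v * A s" by (rule Q_small[OF z(2)])
          also have "\<dots> \<le> \<delta>v * (K * A s + 1)"
          proof (rule mult_mono)
            show "A s \<le> K * A s + 1" using KA by linarith
          qed (use A4 \<delta>v(1) in auto)
          finally show ?thesis .
        qed
      qed
      also have "\<dots> = \<epsilon> * K * A s + \<epsilon>" by (simp add: algebra_simps)
      also have "\<dots> = A s / 4 + \<epsilon>" unfolding \<epsilon>(2) by simp
      also have "\<dots> \<le> A s / 2" using \<epsilon>(3) A4 by linarith
      finally show ?thesis .
    qed
    \<comment> \<open>The angles up to \<open>\<theta>\<^sub>1\<close> are covered by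
      \<open>v\<close>, the others by \<open>u\<close>, and together they make up a full period from
      \<open>\<theta>2\<close>. So the point of maximum modulus falls under one of the two
      estimates, and either contradicts \<open>norm (E (Complex s t)) = exp (A s)\<close>.\<close>
    obtain t where t: "\<theta>2 \<le> t" "t < \<theta>2 + 2 * pi" "norm (E (Complex s t)) = exp (A s)"
      using A_attained[of s \<theta>2] s1 by auto
    show False
    proof (cases "t \<le> \<theta>\<^sub>1")
      case True
      have z: "Complex s t \<in> strip s0 (- (pi / 2)) (pi / 2)" using True t \<theta>2 \<theta>\<^sub>1 s1 by (simp add: strip_iff)
      have "norm (1 - E (Complex s t)) \<le> exp (A s / 2)"
        using v[OF t(1) True] Re_L1[OF z] expL1[OF z]
        by (metis E_def abs_le_iff exp_le_cancel_iff norm_exp_eq_Re)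
      moreover have "norm (E (Complex s t)) \<le> 1 + norm (1 - E (Complex s t))"
        using norm_triangle_ineq4[of 1 "1 - E (Complex s t)"] by simp
      ultimately have "exp (A s) \<le> 1 + exp (A s / 2)" using t(3) by linarith
      also have "\<dots> \<le> exp (A s / 2) + exp (A s / 2)" using A4 by simp
      also have "\<dots> < exp (A s / 2) * exp (A s / 2)"
      proof -
        have "2 < exp (A s / 2)" using A4 exp_ge_add_one_self[of "A s / 2"] by linarith
        then show ?thesis by (simp add: mult_2[symmetric])
      qed
      also have "\<dots> = exp (A s)" by (simp add: exp_add[symmetric])
      finally show False by simp
    next
      case False
      have z: "Complex s t \<in> strip s0 \<beta> (\<alpha> + 2 * pi)" using False t \<theta>2 \<theta>\<^sub>1 s1 by (simp add: strip_iff)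
      have "A s = Re (L (Complex s t))" using Re_L[OF z] t(3) by simp
      then show False using u[of t] False t A4 by linarith
    qed
  qed
  then show ?thesis using \<delta>(1) by blast
qed

lemma Q_ge_1: "1 \<le> Q z"
  using logp_ge_1[of "E z"] logp_ge_1[of "1 / E z"] logp_ge_1[of "1 / (1 - E z)"] by (simp add: Q_def)

text \<open>Harnack's inequality is iterated along the ray in steps of length at most \<rho>/8. This
  gives the exponent \<open>8 * ln \<Lambda> / \<rho>\<close>; the extra factor \<Lambda> comes from
  rounding up the number of steps.\<close>

lemma Q_slow:
  "\<exists>\<Lambda>\<ge>1. \<exists>\<sigma>\<ge>0. \<forall>s s'. s0 + 1 \<le> s \<longrightarrow> s0 + 1 \<le> s' \<longrightarrow> Q (Complex s' \<theta>\<^sub>1) \<le> \<Lambda> * exp (\<sigma> * \<bar>s - s'\<bar>) * Q (Complex s \<theta>\<^sub>1)"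
proof -
  obtain \<Lambda> where \<Lambda>: "1 \<le> \<Lambda>"
    "\<And>z w r. \<lbrakk>0 < r; ball z r \<subseteq> T1; dist z w \<le> r / 8\<rbrakk> \<Longrightarrow> Q w \<le> \<Lambda> * Q z"
    using adm_harnack by metis
  have step: "Q (Complex s' \<theta>\<^sub>1) \<le> \<Lambda> ^ k * Q (Complex s \<theta>\<^sub>1)"
    if "s0 + 1 \<le> s" "s0 + 1 \<le> s'" "\<bar>s - s'\<bar> \<le> real k * (\<rho> / 8)" for s s' k
    using that
  proof (induction k arbitrary: s')
    case 0
    then show ?case by simp
  next
    case (Suc k)
    define u where "u = s + real k / real (Suc k) * (s' - s)"
    have "\<bar>s - u\<bar> = real k / real (Suc k) * \<bar>s - s'\<bar>" by (simp add: u_def abs_mult abs_minus_commute)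
    also have "\<dots> \<le> real k / real (Suc k) * (real (Suc k) * (\<rho> / 8))"
      using Suc.prems by (intro mult_left_mono) auto
    also have "\<dots> = real k * (\<rho> / 8)" by simp
    finally have su: "\<bar>s - u\<bar> \<le> real k * (\<rho> / 8)" .
    have "u - s' = (s - s') / real (Suc k)" by (simp add: u_def field_simps)
    then have "\<bar>u - s'\<bar> = \<bar>s - s'\<bar> / real (Suc k)" by (simp add: abs_divide)
    also have "\<dots> \<le> \<rho> / 8" using Suc.prems by (simp add: divide_le_eq mult.commute)
    finally have us: "\<bar>u - s'\<bar> \<le> \<rho> / 8" .
    have u0: "s0 + 1 \<le> u"
    proof -
      define q where "q = real k / real (Suc k)"
      have q: "0 \<le> q" "q \<le> 1" by (auto simp: q_def)
      have "u = (1 - q) * s + q * s'" unfolding u_def q_def[symmetric] by (simp add: algebra_simps)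
      moreover have "(1 - q) * (s0 + 1) + q * (s0 + 1) \<le> (1 - q) * s + q * s'"
        using Suc.prems q by (intro add_mono mult_left_mono) auto
      ultimately show ?thesis by (simp add: algebra_simps)
    qed
    have "Q (Complex s' \<theta>\<^sub>1) \<le> \<Lambda> * Q (Complex u \<theta>\<^sub>1)"
      by (rule \<Lambda>(2)[OF _ ball_T1[OF u0]]) (use \<theta>\<^sub>1 us dist_Complex[of u \<theta>\<^sub>1 s' \<theta>\<^sub>1] in auto)
    also have "\<dots> \<le> \<Lambda> * (\<Lambda> ^ k * Q (Complex s \<theta>\<^sub>1))"
      using Suc.IH[OF Suc.prems(1) u0 su] \<Lambda>(1) by (intro mult_left_mono) auto
    finally show ?case by (simp add: mult.assoc)
  qed
  define \<sigma> where "\<sigma> = 8 * ln \<Lambda> / \<rho>"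
  have \<sigma>: "0 \<le> \<sigma>" using \<Lambda>(1) \<theta>\<^sub>1(3) by (simp add: \<sigma>_def)
  have "Q (Complex s' \<theta>\<^sub>1) \<le> \<Lambda> * exp (\<sigma> * \<bar>s - s'\<bar>) * Q (Complex s \<theta>\<^sub>1)"
    if "s0 + 1 \<le> s" "s0 + 1 \<le> s'" for s s'
  proof -
    define k where "k = nat \<lceil>8 * \<bar>s - s'\<bar> / \<rho>\<rceil>"
    have nn: "0 \<le> 8 * \<bar>s - s'\<bar> / \<rho>" using \<theta>\<^sub>1(3) by simp
    have k: "8 * \<bar>s - s'\<bar> / \<rho> \<le> real k" "real k \<le> 8 * \<bar>s - s'\<bar> / \<rho> + 1"
      using nn unfolding k_def by linarith+
    have "\<bar>s - s'\<bar> \<le> real k * (\<rho> / 8)" using k(1) \<theta>\<^sub>1(3) by (simp add: field_simps)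
    then have "Q (Complex s' \<theta>\<^sub>1) \<le> \<Lambda> ^ k * Q (Complex s \<theta>\<^sub>1)" by (rule step[OF that])
    also have "\<Lambda> ^ k = exp (real k * ln \<Lambda>)" using \<Lambda>(1) by (simp add: exp_of_nat_mult)
    also have "exp (real k * ln \<Lambda>) * Q (Complex s \<theta>\<^sub>1) \<le> exp ((8 * \<bar>s - s'\<bar> / \<rho> + 1) * ln \<Lambda>) * Q (Complex s \<theta>\<^sub>1)"
      using k(2) \<Lambda>(1) Q_ge_1[of "Complex s \<theta>\<^sub>1"] by (intro mult_right_mono) (auto intro!: mult_right_mono)
    also have "(8 * \<bar>s - s'\<bar> / \<rho> + 1) * ln \<Lambda> = ln \<Lambda> + \<sigma> * \<bar>s - s'\<bar>"
      by (simp add: \<sigma>_def algebra_simps)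
    also have "exp (ln \<Lambda> + \<sigma> * \<bar>s - s'\<bar>) = \<Lambda> * exp (\<sigma> * \<bar>s - s'\<bar>)"
      using \<Lambda>(1) by (simp only: exp_add exp_ln)
    finally show ?thesis .
  qed
  then show ?thesis using \<Lambda>(1) \<sigma> by blast
qed

text \<open>At a near-maximum \<open>s*\<close> of \<open>A s \<cdot> exp (-\<mu>s)\<close> on \<open>s \<ge> s1\<close> there is no jump, hence \<open>A\<close> and \<open>Q\<close> are
  comparable at \<open>s*\<close>; since \<open>Q\<close> varies slowly and \<open>Q \<le> C A\<close>, this bounds \<open>A\<close> by its value at \<open>s1\<close>.\<close>

lemma A_doubling: "\<exists>C>0. \<exists>\<mu>>0. \<exists>S. \<forall>s\<ge>S. \<forall>t\<ge>0. A (s + t) \<le> C * exp (\<mu> * t) * A s"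
proof -
  obtain \<Lambda> \<sigma> where \<Lambda>: "1 \<le> \<Lambda>" and \<sigma>: "0 \<le> \<sigma>"
    and slow: "\<And>s s'. s0 + 1 \<le> s \<Longrightarrow> s0 + 1 \<le> s' \<Longrightarrow> Q (Complex s' \<theta>\<^sub>1) \<le> \<Lambda> * exp (\<sigma> * \<bar>s - s'\<bar>) * Q (Complex s \<theta>\<^sub>1)"
    using Q_slow by metis
  obtain C where C: "0 < C" "\<And>s. s0 + 1 \<le> s \<Longrightarrow> Q (Complex s \<theta>\<^sub>1) \<le> C * A s" using Q_le_A by blast
  \<comment> \<open>Above \<open>N\<close>, so that A s exp (- \<mu> s) is bounded, which is where
    finite order enters; above \<sigma>, so that the variation of \<open>Q\<close> between two
    scales is absorbed by the exponential in the conclusion.\<close>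
  define \<mu> where "\<mu> = max N \<sigma> + 1"
  have \<mu>: "N < \<mu>" "\<sigma> < \<mu>" "0 < \<mu>" using \<sigma> by (auto simp: \<mu>_def)
  have "1 \<le> exp \<mu>" using \<mu> by simp
  \<comment> \<open>The supremum is approached only up to a factor 2. At such a near-maximum A grows
    over one unit by at most \<open>2 * exp \<mu>\<close>, which is therefore the admissible
    jump.\<close>
  then have K1: "1 \<le> 2 * exp \<mu>" by linarith
  obtain \<delta> S where \<delta>: "0 < \<delta>" and S: "\<And>s. S \<le> s \<Longrightarrow> A (s + 1) \<le> 2 * exp \<mu> * A s \<Longrightarrow> \<delta> * A s \<le> Q (Complex s \<theta>\<^sub>1)"
    using A_le_Q_if_no_jump[OF K1] by metis
  define D where "D = 2 * \<Lambda> * C / \<delta>"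
  have D: "0 < D" using \<Lambda> C(1) \<delta> by (simp add: D_def)
  have "A (s1 + t) \<le> D * exp (\<mu> * t) * A s1" if s1: "max S (s0 + 1) \<le> s1" and t: "0 \<le> t" for s1 t
  proof -
    have s1': "S \<le> s1" "s0 + 1 \<le> s1" "s0 < s1" "0 \<le> s1" using s1 s0 by auto
    define X where "X = (\<lambda>s. A s * exp (- \<mu> * s)) ` {s1..}"
    have bdd: "bdd_above X"
    proof (rule bdd_aboveI)
      fix x assume "x \<in> X"
      then obtain s where s: "s1 \<le> s" "x = A s * exp (- \<mu> * s)" by (auto simp: X_def)
      have "x \<le> exp (N * s) * exp (- \<mu> * s)" unfolding s(2) using A_le[of s] s s1' by (intro mult_right_mono) auto
      also have "\<dots> = exp ((N - \<mu>) * s)" by (simp add: exp_add[symmetric] algebra_simps)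
      also have "\<dots> \<le> 1" using \<mu> s s1' by (simp add: mult_nonpos_nonneg)
      finally show "x \<le> 1" .
    qed
    have ne: "X \<noteq> {}" by (auto simp: X_def)
    have "0 < A s1 * exp (- \<mu> * s1)" using A_pos[OF s1'(3)] by simp
    also have "\<dots> \<le> Sup X" by (rule cSup_upper[OF _ bdd]) (auto simp: X_def)
    finally have supX: "0 < Sup X" .
    then have "Sup X / 2 < Sup X" by simp
    then obtain x where "x \<in> X" "Sup X / 2 < x" using less_cSup_iff[OF ne bdd] by blast
    then obtain s' where s': "s1 \<le> s'" "Sup X / 2 < A s' * exp (- \<mu> * s')" by (auto simp: X_def)
    have near: "A s * exp (- \<mu> * s) \<le> 2 * (A s' * exp (- \<mu> * s'))" if "s1 \<le> s" for s
    proof -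
      have "A s * exp (- \<mu> * s) \<le> Sup X" by (rule cSup_upper[OF _ bdd]) (use that in \<open>auto simp: X_def\<close>)
      then show ?thesis using s'(2) by linarith
    qed
    have near': "A s \<le> 2 * exp (\<mu> * (s - s')) * A s'" if "s1 \<le> s" for s
    proof -
      have "A s = A s * exp (- \<mu> * s) * exp (\<mu> * s)" by (simp add: exp_minus)
      also have "\<dots> \<le> 2 * (A s' * exp (- \<mu> * s')) * exp (\<mu> * s)"
        by (rule mult_right_mono[OF near[OF that]]) simp
      also have "\<dots> = 2 * exp (\<mu> * (s - s')) * A s'" by (simp add: exp_diff exp_minus right_diff_distrib field_simps)
      finally show ?thesis .
    qed
    have "A (s' + 1) \<le> 2 * exp \<mu> * A s'" using near'[of "s' + 1"] s'(1) by simp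
    then have "\<delta> * A s' \<le> Q (Complex s' \<theta>\<^sub>1)" using S[of s'] s1' s' by simp
    also have "\<dots> \<le> \<Lambda> * exp (\<sigma> * \<bar>s1 - s'\<bar>) * Q (Complex s1 \<theta>\<^sub>1)" using slow[of s1 s'] s1' s' by simp
    also have "\<dots> \<le> \<Lambda> * exp (\<sigma> * \<bar>s1 - s'\<bar>) * (C * A s1)"
      using C(2)[OF s1'(2)] \<Lambda> by (intro mult_left_mono) auto
    also have "\<dots> \<le> \<Lambda> * exp (\<mu> * (s' - s1)) * (C * A s1)"
      using \<Lambda> C(1) A_pos[OF s1'(3)] \<mu> s' by (intro mult_right_mono mult_left_mono) (auto intro!: mult_right_mono)
    finally have "A s' \<le> \<Lambda> * C / \<delta> * exp (\<mu> * (s' - s1)) * A s1"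
      using \<delta> by (simp add: field_simps)
    then have "2 * exp (\<mu> * (s1 + t - s')) * A s' \<le> 2 * exp (\<mu> * (s1 + t - s')) * (\<Lambda> * C / \<delta> * exp (\<mu> * (s' - s1)) * A s1)"
      by (intro mult_left_mono) auto
    also have "\<dots> = D * (exp (\<mu> * (s1 + t - s')) * exp (\<mu> * (s' - s1))) * A s1" by (simp add: D_def)
    also have "exp (\<mu> * (s1 + t - s')) * exp (\<mu> * (s' - s1)) = exp (\<mu> * t)"
      by (simp add: exp_add[symmetric] algebra_simps)
    finally show ?thesis using near'[of "s1 + t"] t by simp
  qed
  then show ?thesis using D \<mu>(3) by blast
qed

lemma A_shift: "\<exists>C\<ge>1. \<forall>\<^sub>F s in at_top. A (s + W) \<le> C * A s"
proof -
  obtain C \<mu> S where C: "0 < C" "0 < \<mu>" "\<And>s t. S \<le> s \<Longrightarrow> 0 \<le> t \<Longrightarrow> A (s + t) \<le> C * exp (\<mu> * t) * A s"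
    using A_doubling by metis
  define K where "K = max 1 (C * exp (\<mu> * max 0 W))"
  have "\<forall>\<^sub>F s in at_top. A (s + W) \<le> K * A s"
    using eventually_ge_at_top[of S] eventually_gt_at_top[of "s0 - W"] eventually_gt_at_top[of s0]
  proof eventually_elim
    case (elim s)
    have "A (s + W) \<le> A (s + max 0 W)" using elim by (intro A_mono) auto
    also have "\<dots> \<le> C * exp (\<mu> * max 0 W) * A s" using C(3) elim by simp
    also have "\<dots> \<le> K * A s" using A_pos[of s] elim by (intro mult_right_mono) (auto simp: K_def)
    finally show ?case .
  qed
  then show ?thesis by (intro exI[of _ K]) (auto simp: K_def)
qed

text \<open>By doubling no large scale carries a jump, so \<open>A_le_Q_if_no_jump\<close> applies
  at every one of them.\<close>

lemma Q_ge_A: "\<exists>\<delta>>0. \<forall>\<^sub>F s in at_top. \<delta> * A s \<le> Q (Complex s \<theta>\<^sub>1)"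
proof -
  obtain K where K: "1 \<le> K" "\<forall>\<^sub>F s in at_top. A (s + 1) \<le> K * A s" using A_shift by blast
  obtain \<delta> S where \<delta>: "0 < \<delta>" "\<And>s. S \<le> s \<Longrightarrow> A (s + 1) \<le> K * A s \<Longrightarrow> \<delta> * A s \<le> Q (Complex s \<theta>\<^sub>1)"
    using A_le_Q_if_no_jump[OF K(1)] by metis
  have "\<forall>\<^sub>F s in at_top. \<delta> * A s \<le> Q (Complex s \<theta>\<^sub>1)"
    using K(2) eventually_ge_at_top[of S] by eventually_elim (rule \<delta>(2))
  then show ?thesis using \<delta>(1) by blast
qed

definition big :: "(complex \<Rightarrow> complex) \<Rightarrow> bool" where
  "big g \<longleftrightarrow> (\<exists>c>0. \<forall>\<^sub>F s in at_top. c * A s \<le> logp (g (Complex s \<theta>\<^sub>1)))"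

text \<open>For large \<open>s\<close> the value \<open>E (s + i \<theta>\<^sub>1)\<close> lies in one of three disjoint open sets, and by
  connectedness always in the same one.\<close>

lemma trichotomy: "big E \<or> big (\<lambda>z. 1 / E z) \<or> big (\<lambda>z. 1 / (1 - E z))"
proof -
  obtain \<delta> where \<delta>: "0 < \<delta>" "\<forall>\<^sub>F s in at_top. \<delta> * A s \<le> Q (Complex s \<theta>\<^sub>1)" using Q_ge_A by blast
  have "\<forall>\<^sub>F s in at_top. \<delta> * A s \<le> Q (Complex s \<theta>\<^sub>1) \<and> 9 / \<delta> \<le> A s \<and> s0 < s"
    using \<delta>(2) eventually_A_ge eventually_gt_at_top by (intro eventually_conj)
  then obtain S where S: "\<And>s. S \<le> s \<Longrightarrow> \<delta> * A s \<le> Q (Complex s \<theta>\<^sub>1) \<and> 9 / \<delta> \<le> A s \<and> s0 < s"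
    by (auto simp: eventually_at_top_linorder)
  \<comment> \<open>The threshold 9 / \<delta> makes \<open>Q\<close> at least 9, so one of its
    three summands is at least 3. That forces the function in question to have modulus above 2,
    because exp 2 > 2, and places \<open>E\<close> in one of these sets.\<close>
  define O1 O2 O3 where "O1 = {w::complex. 2 < norm w}" and "O2 = {w::complex. norm w < 1/2}" and "O3 = {w::complex. norm (1 - w) < 1/2}"
  have op: "open O1" "open O2" "open O3"
    unfolding O1_def O2_def O3_def by (intro open_Collect_less continuous_intros)+
  have disj: "O1 \<inter> O2 = {}" "O1 \<inter> O3 = {}" "O2 \<inter> O3 = {}"
  proof -
    show "O1 \<inter> O2 = {}" by (auto simp: O1_def O2_def)
    have tri: "norm w \<le> 1 + norm (1 - w)" "1 \<le> norm w + norm (1 - w)" for w :: complex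
      using norm_triangle_ineq4[of 1 "1 - w"] norm_triangle_ineq[of w "1 - w"] by auto
    have "w \<notin> O3" if "w \<in> O1" for w using that tri(1)[of w] unfolding O1_def O3_def mem_Collect_eq by linarith
    then show "O1 \<inter> O3 = {}" by blast
    have "w \<notin> O3" if "w \<in> O2" for w using that tri(2)[of w] unfolding O2_def O3_def mem_Collect_eq by linarith
    then show "O2 \<inter> O3 = {}" by blast
  qed
  have ln2: "ln 2 \<le> (1::real)" using ln_le_minus_one[of 2] by simp
  have three: "3 \<le> logp w \<Longrightarrow> 2 < norm w" for w
  proof -
    assume "3 \<le> logp w"
    then have "exp (3 - 1) \<le> norm w" by (intro logp_large) auto
    moreover have "2 < exp (3 - 1 :: real)" using exp_ge_add_one_self[of "2::real"] by simp
    ultimately show ?thesis by linarith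
  qed
  have inv2: "norm w < 1 / 2" if "2 < norm (1 / w)" for w :: complex
  proof -
    have "0 < norm w" using that by (cases "w = 0") auto
    then show ?thesis using that by (simp add: norm_divide field_simps)
  qed
  define X where "X = (\<lambda>s. E (Complex s \<theta>\<^sub>1)) ` {S..}"
  have conn: "connected X"
    unfolding X_def
  proof (rule connected_continuous_image)
    have "continuous_on {S..} (E \<circ> (\<lambda>s. Complex s \<theta>\<^sub>1))"
      by (intro continuous_on_compose continuous_intros holomorphic_on_imp_continuous_on holE)
    then show "continuous_on {S..} (\<lambda>s. E (Complex s \<theta>\<^sub>1))" by (simp add: o_def)
  qed (simp add: connected_iff_interval)
  have cover: "X \<subseteq> O1 \<union> O2 \<union> O3"
  proof
    fix w assume "w \<in> X"
    then obtain s where s: "S \<le> s" "w = E (Complex s \<theta>\<^sub>1)" by (auto simp: X_def)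
    have z: "Complex s \<theta>\<^sub>1 \<in> T1" using S[OF s(1)] \<theta>\<^sub>1 by (simp add: strip_iff)
    have "\<delta> * (9 / \<delta>) \<le> \<delta> * A s" using S[OF s(1)] \<delta>(1) by (intro mult_left_mono) auto
    then have "9 \<le> Q (Complex s \<theta>\<^sub>1)" using S[OF s(1)] \<delta>(1) by simp
    then consider "3 \<le> logp w" | "3 \<le> logp (1 / w)" | "3 \<le> logp (1 / (1 - w))"
      unfolding Q_def s(2) by linarith
    then show "w \<in> O1 \<union> O2 \<union> O3"
    proof cases
      case 1 then show ?thesis using three by (simp add: O1_def)
    next
      case 2
      then have "2 < norm (1 / w)" by (rule three)
      then have "norm w < 1 / 2" by (rule inv2)
      then show ?thesis by (simp add: O2_def)
    next
      case 3
      then have "2 < norm (1 / (1 - w))" by (rule three)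
      then have "norm (1 - w) < 1 / 2" by (rule inv2)
      then show ?thesis by (simp add: O3_def)
    qed
  qed
  have XS: "E (Complex s \<theta>\<^sub>1) \<in> X" if "S \<le> s" for s using that by (auto simp: X_def)
  have whole: "X \<subseteq> U" if "X \<inter> U \<noteq> {}" "open U" "open V" "U \<inter> V = {}" "X \<subseteq> U \<union> V" for U V
    using connectedD[OF conn that(2,3)] that by blast
  \<comment> \<open>In each state the two other summands are at most 2 each, which 6 covers. Since
    \<delta> A \<ge> 9, subtracting 6 still leaves a third of \<delta> A.\<close>
  have concl: "big g" if "\<And>s. S \<le> s \<Longrightarrow> Q (Complex s \<theta>\<^sub>1) \<le> logp (g (Complex s \<theta>\<^sub>1)) + 6" for g
  proof -
    have "\<forall>\<^sub>F s in at_top. \<delta> / 3 * A s \<le> logp (g (Complex s \<theta>\<^sub>1))"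
      using eventually_ge_at_top[of S]
    proof eventually_elim
      case (elim s)
      have "\<delta> * (9 / \<delta>) \<le> \<delta> * A s" using S[OF elim] \<delta>(1) by (intro mult_left_mono) auto
      then have "9 \<le> \<delta> * A s" using \<delta>(1) by simp
      moreover have "\<delta> * A s - 6 \<le> logp (g (Complex s \<theta>\<^sub>1))" using that[OF elim] S[OF elim] by linarith
      ultimately show ?case by simp
    qed
    then show ?thesis unfolding big_def using \<delta>(1) by (intro exI[of _ "\<delta> / 3"]) auto
  qed
  have lp1: "logp w = 1" if "norm w \<le> 1" for w
    using that by (cases "w = 0") (auto simp: logp_def)
  have lp2: "logp w \<le> 2" if "norm w \<le> 2" for w
  proof (cases "w = 0")
    case False
    then have "ln (norm w) \<le> ln 2" using that by simp
    then show ?thesis using ln2 by (simp add: logp_def)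
  qed (simp add: logp_def)
  have X_ne: "E (Complex S \<theta>\<^sub>1) \<in> X" by (rule XS) simp
  then consider "X \<inter> O1 \<noteq> {}" | "X \<inter> O2 \<noteq> {}" | "X \<inter> O3 \<noteq> {}" using cover by blast
  then show ?thesis
  proof cases
    case 1
    then have sub: "X \<subseteq> O1" by (rule whole[of _ "O2 \<union> O3"]) (use op disj cover in auto)
    have "big E"
    proof (rule concl)
      fix s assume "S \<le> s"
      then have "2 < norm (E (Complex s \<theta>\<^sub>1))" using XS sub by (auto simp: O1_def)
      moreover from this have "1 \<le> norm (1 - E (Complex s \<theta>\<^sub>1))"
        using norm_triangle_ineq4[of 1 "1 - E (Complex s \<theta>\<^sub>1)"] by simp
      ultimately have "logp (1 / E (Complex s \<theta>\<^sub>1)) \<le> 2" "logp (1 / (1 - E (Complex s \<theta>\<^sub>1))) \<le> 2"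
        by (auto intro!: lp2 simp: norm_divide divide_le_eq)
      then show "Q (Complex s \<theta>\<^sub>1) \<le> logp (E (Complex s \<theta>\<^sub>1)) + 6" by (simp add: Q_def)
    qed
    then show ?thesis by blast
  next
    case 2
    then have sub: "X \<subseteq> O2" by (rule whole[of _ "O1 \<union> O3"]) (use op disj cover in auto)
    have "big (\<lambda>z. 1 / E z)"
    proof (rule concl)
      fix s assume "S \<le> s"
      then have "norm (E (Complex s \<theta>\<^sub>1)) < 1/2" using XS sub by (auto simp: O2_def)
      moreover from this have "1/2 \<le> norm (1 - E (Complex s \<theta>\<^sub>1))"
        using norm_triangle_ineq[of "E (Complex s \<theta>\<^sub>1)" "1 - E (Complex s \<theta>\<^sub>1)"] by simp
      ultimately have "logp (E (Complex s \<theta>\<^sub>1)) \<le> 2" "logp (1 / (1 - E (Complex s \<theta>\<^sub>1))) \<le> 2"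
        by (auto intro!: lp2 simp: norm_divide divide_le_eq)
      then show "Q (Complex s \<theta>\<^sub>1) \<le> logp (1 / E (Complex s \<theta>\<^sub>1)) + 6" by (simp add: Q_def)
    qed
    then show ?thesis by blast
  next
    case 3
    then have sub: "X \<subseteq> O3" by (rule whole[of _ "O1 \<union> O2"]) (use op disj cover in auto)
    have "big (\<lambda>z. 1 / (1 - E z))"
    proof (rule concl)
      fix s assume "S \<le> s"
      then have n: "norm (1 - E (Complex s \<theta>\<^sub>1)) < 1/2" using XS sub by (auto simp: O3_def)
      have "1/2 \<le> norm (E (Complex s \<theta>\<^sub>1))"
        using norm_triangle_ineq[of "E (Complex s \<theta>\<^sub>1)" "1 - E (Complex s \<theta>\<^sub>1)"] n by simp
      moreover have "norm (E (Complex s \<theta>\<^sub>1)) \<le> 2"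
        using norm_triangle_ineq4[of 1 "1 - E (Complex s \<theta>\<^sub>1)"] n by simp
      ultimately have "logp (E (Complex s \<theta>\<^sub>1)) \<le> 2" "logp (1 / E (Complex s \<theta>\<^sub>1)) \<le> 2"
        by (auto intro!: lp2 simp: norm_divide divide_le_eq)
      then show "Q (Complex s \<theta>\<^sub>1) \<le> logp (1 / (1 - E (Complex s \<theta>\<^sub>1))) + 6" by (simp add: Q_def)
    qed
    then show ?thesis by blast
  qed
qed

text \<open>The Harnack chain runs from \<open>t\<close> to \<open>\<theta>\<^sub>1\<close>, so
  largeness at \<open>\<theta>\<^sub>1\<close> forces largeness at every angle of a compact part of
  the gap.\<close>

lemma big_sector:
  assumes adm: "adm g" and big: "big g" and ab: "\<beta> < a" "b < pi / 2"
  shows "\<exists>c>0. \<forall>\<^sub>F s in at_top. \<forall>t\<in>{a..b}. c * A s \<le> ln (norm (g (Complex s t)))"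
proof -
  obtain c where c: "0 < c" "\<forall>\<^sub>F s in at_top. c * A s \<le> logp (g (Complex s \<theta>\<^sub>1))" using big by (auto simp: big_def)
  obtain \<Lambda> where \<Lambda>: "1 \<le> \<Lambda>"
    "\<And>g z w r. \<lbrakk>adm g; 0 < r; ball z r \<subseteq> T1; dist z w \<le> r / 8\<rbrakk> \<Longrightarrow> logp (g w) \<le> \<Lambda> * logp (g z)"
    using adm_harnack by metis
  define a' b' where "a' = min a \<theta>\<^sub>1" and "b' = max b \<theta>\<^sub>1"
  have ab': "\<beta> < a'" "b' < pi / 2" "a' \<le> \<theta>\<^sub>1" "\<theta>\<^sub>1 \<le> b'" using ab \<theta>\<^sub>1 by (auto simp: a'_def b'_def)
  obtain n :: nat where n:
    "\<And>(p :: complex \<Rightarrow> real) \<Lambda> z w. \<lbrakk>\<And>z w r. \<lbrakk>0 < r; ball z r \<subseteq> rect 1 \<beta> (pi / 2); dist z w \<le> r / 8\<rbrakk> \<Longrightarrow> p w \<le> \<Lambda> * p z;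
       0 \<le> \<Lambda>; z \<in> convex hull (vseg a' b'); w \<in> convex hull (vseg a' b')\<rbrakk> \<Longrightarrow> p w \<le> \<Lambda> ^ n * p z"
    using harnack_chain[OF open_convex_rect compact_vseg vseg_subset_rect[OF zero_less_one ab'(1,2)]] by metis
  \<comment> \<open>The halving pays for the summand 1 in \<open>logp\<close>.\<close>
  define c' where "c' = c / \<Lambda> ^ n / 2"
  have c': "0 < c'" using c(1) \<Lambda>(1) by (simp add: c'_def)
  have "\<forall>\<^sub>F s in at_top. \<forall>t\<in>{a..b}. c' * A s \<le> ln (norm (g (Complex s t)))"
    using c(2) eventually_A_ge[of "2 / c'"] eventually_ge_at_top[of "s0 + 1"]
  proof eventually_elim
    case (elim s)
    show ?case
    proof
      fix t assume t: "t \<in> {a..b}"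
      have in_hull: "Complex 0 \<theta>\<^sub>1 \<in> convex hull (vseg a' b')" "Complex 0 t \<in> convex hull (vseg a' b')"
        using t ab' by (auto intro!: hull_inc simp: vseg_iff a'_def b'_def)
      have "logp (g (Complex 0 \<theta>\<^sub>1 + of_real s)) \<le> \<Lambda> ^ n * logp (g (Complex 0 t + of_real s))"
      proof (rule n[of "\<lambda>z. logp (g (z + of_real s))" \<Lambda> "Complex 0 t" "Complex 0 \<theta>\<^sub>1", OF _ _ in_hull(2,1)])
        fix z w :: complex and r :: real assume r: "0 < r" "ball z r \<subseteq> rect 1 \<beta> (pi / 2)" "dist z w \<le> r / 8"
        have "ball (z + of_real s) r \<subseteq> T1"
        proof
          fix x assume "x \<in> ball (z + of_real s) r"
          then have "x - of_real s \<in> ball z r" by (simp add: dist_norm algebra_simps)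
          then have "x - of_real s \<in> rect 1 \<beta> (pi / 2)" using r(2) by blast
          then show "x \<in> T1" using elim(3) by (simp add: rect_iff strip_iff)
        qed
        moreover have "dist (z + of_real s) (w + of_real s) \<le> r / 8" using r(3) by (simp add: dist_norm)
        ultimately show "logp (g (w + of_real s)) \<le> \<Lambda> * logp (g (z + of_real s))"
          using \<Lambda>(2)[OF adm r(1)] by blast
      qed (use \<Lambda>(1) in simp)
      moreover have "Complex 0 \<theta>\<^sub>1 + of_real s = Complex s \<theta>\<^sub>1" "Complex 0 t + of_real s = Complex s t" by (simp_all add: complex_eq_iff)
      ultimately have "c * A s \<le> \<Lambda> ^ n * logp (g (Complex s t))" using elim(1) by simp
      then have "2 * c' * A s \<le> logp (g (Complex s t))" using \<Lambda>(1) by (simp add: c'_def field_simps)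
      moreover have "2 \<le> c' * A s" using elim(2) c' by (simp add: field_simps)
      ultimately show "c' * A s \<le> ln (norm (g (Complex s t)))" by (simp add: logp_def)
    qed
  qed
  then show ?thesis using c' by blast
qed

end

lemma ln_norm_one_minus_large:
  assumes "1 \<le> ln (norm w)"
  shows "ln (norm w) - 1 \<le> ln (norm (1 - w :: complex))"
proof -
  have w: "0 < norm w" using assms by (cases "w = 0") auto
  then have e: "exp 1 \<le> norm w" using assms by (simp add: ln_ge_iff)
  have e2: "2 \<le> exp (1::real)" using exp_ge_add_one_self[of "1::real"] by simp
  have "norm w / exp 1 \<le> norm w / 2" using e2 w by (intro divide_left_mono) auto
  also have "\<dots> \<le> norm w - 1" using e e2 by simp
  also have "\<dots> \<le> norm (1 - w)" using norm_triangle_ineq2[of w 1] by (simp add: norm_minus_commute)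
  finally have "ln (norm w / exp 1) \<le> ln (norm (1 - w))" using w by (intro ln_mono) auto
  then show ?thesis using w by (simp add: ln_div)
qed

lemma ln_norm_inverse_large:
  assumes "1 \<le> ln (norm (1 / w))"
  shows "norm w \<le> 1 / 2" and "\<bar>ln (norm (1 - w :: complex))\<bar> \<le> 1"
proof -
  have w: "0 < norm w" using assms by (cases "w = 0") auto
  then have "exp 1 \<le> 1 / norm w" using assms by (simp add: norm_divide ln_ge_iff)
  moreover have "2 \<le> exp (1::real)" using exp_ge_add_one_self[of "1::real"] by simp
  ultimately have "2 \<le> 1 / norm w" by linarith
  then show w2: "norm w \<le> 1 / 2" using w by (simp add: field_simps)
  have lo: "1 / 2 \<le> norm (1 - w)" using norm_triangle_ineq2[of 1 w] w2 by simp
  have "norm (1 - w) \<le> 1 + 1 / 2" using norm_triangle_ineq4[of 1 w] w2 by simp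
  then have "ln (norm (1 - w)) \<le> 1" using ln_le_minus_one[of "norm (1 - w)"] lo by linarith
  moreover have "ln (1 / norm (1 - w)) \<le> 1 / norm (1 - w) - 1" using lo by (intro ln_le_minus_one) auto
  moreover have "1 / norm (1 - w) \<le> 2" using lo by (intro divide_le_eq[THEN iffD2]) auto
  moreover have "ln (1 / norm (1 - w)) = - ln (norm (1 - w))" using lo by (simp add: ln_div)
  ultimately show "\<bar>ln (norm (1 - w))\<bar> \<le> 1" by linarith
qed

section \<open>Transport of estimates across half strips\<close>

lemma half_strip_bounded:
  fixes a b \<sigma> C M :: real
  assumes ab: "a < b" "\<sigma> * (b - a) < pi" and hol: "G holomorphic_on strip s1 a' b'" and sub: "a' < a" "b < b'"
    and growth: "\<forall>\<^sub>F s in at_top. \<forall>t\<in>{a..b}. norm (G (Complex s t)) \<le> exp (C * exp (\<sigma> * s))"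
    and rays: "\<forall>\<^sub>F s in at_top. norm (G (Complex s a)) \<le> M" "\<forall>\<^sub>F s in at_top. norm (G (Complex s b)) \<le> M"
  shows "\<exists>M. \<forall>\<^sub>F s in at_top. \<forall>t\<in>{a..b}. norm (G (Complex s t)) \<le> M"
proof -
  have "\<forall>\<^sub>F s in at_top. (\<forall>t\<in>{a..b}. norm (G (Complex s t)) \<le> exp (C * exp (\<sigma> * s))) \<and>
      norm (G (Complex s a)) \<le> M \<and> norm (G (Complex s b)) \<le> M \<and> s1 < s"
    using growth rays eventually_gt_at_top by (intro eventually_conj)
  then obtain S where S: "\<And>s. S \<le> s \<Longrightarrow> (\<forall>t\<in>{a..b}. norm (G (Complex s t)) \<le> exp (C * exp (\<sigma> * s))) \<and>
      norm (G (Complex s a)) \<le> M \<and> norm (G (Complex s b)) \<le> M \<and> s1 < s"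
    by (auto simp: eventually_at_top_linorder)
  have sub': "{z. S \<le> Re z \<and> a \<le> Im z \<and> Im z \<le> b} \<subseteq> strip s1 a' b'"
    using S sub by (fastforce simp: strip_iff)
  have holS: "G holomorphic_on {z. S \<le> Re z \<and> a \<le> Im z \<and> Im z \<le> b}"
    by (rule holomorphic_on_subset[OF hol sub'])
  have comp: "compact (cbox (Complex S a) (Complex S b))" by (rule compact_cbox)
  have "continuous_on (cbox (Complex S a) (Complex S b)) (\<lambda>z. norm (G z))"
    by (intro continuous_on_norm holomorphic_on_imp_continuous_on holomorphic_on_subset[OF holS])
       (auto simp: in_cbox_complex_iff)
  then have "bounded ((\<lambda>z. norm (G z)) ` cbox (Complex S a) (Complex S b))"
    using compact_continuous_image[OF _ comp] compact_imp_bounded by blast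
  then obtain B where B: "\<And>z. z \<in> cbox (Complex S a) (Complex S b) \<Longrightarrow> norm (G z) \<le> B"
    by (auto simp: bounded_iff)
  define M' where "M' = max 1 (max M B)"
  have "norm (G (Complex s t)) \<le> M'" if "S \<le> s" "t \<in> {a..b}" for s t
  proof (rule phragmen_lindelof_half_strip[OF ab holS])
    show "norm (G z) \<le> exp (C * exp (\<sigma> * Re z))" if "S \<le> Re z" "a \<le> Im z" "Im z \<le> b" for z
      using S[OF that(1)] that by (metis atLeastAtMost_iff complex.collapse)
    show "0 < M'" by (simp add: M'_def)
    show "norm (G z) \<le> M'" if z: "S \<le> Re z" "a \<le> Im z" "Im z \<le> b" "Re z = S \<or> Im z = a \<or> Im z = b" for z
      using z(4)
    proof (elim disjE)
      assume "Re z = S"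
      then have "norm (G z) \<le> B" using z by (intro B) (auto simp: in_cbox_complex_iff)
      then show ?thesis by (simp add: M'_def)
    next
      assume "Im z = a"
      then have "norm (G z) \<le> M" using S[OF z(1)] by (metis complex.collapse)
      then show ?thesis by (simp add: M'_def)
    next
      assume "Im z = b"
      then have "norm (G z) \<le> M" using S[OF z(1)] by (metis complex.collapse)
      then show ?thesis by (simp add: M'_def)
    qed
  qed (use that in auto)
  then show ?thesis unfolding eventually_at_top_linorder by blast
qed

lemma borel_caratheodory_window:
  assumes "a < c" "d < b"
  obtains C where "0 < C"
    "\<And>G s0 s M t t'. \<lbrakk>G holomorphic_on strip s0 a b; s0 + 1 \<le> s; 0 < M;
       \<And>z. \<lbrakk>z \<in> strip s0 a b; \<bar>Re z - s\<bar> < 1\<rbrakk> \<Longrightarrow> Re (G z) \<le> M;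
       c \<le> t; t \<le> d; c \<le> t'; t' \<le> d; - M \<le> Re (G (Complex s t'))\<rbrakk>
       \<Longrightarrow> norm (G (Complex s t) - G (Complex s t')) \<le> C * M"
proof -
  obtain C where C: "0 < C"
    "\<And>G M z w. \<lbrakk>G holomorphic_on rect 1 a b; \<And>x. x \<in> rect 1 a b \<Longrightarrow> Re (G x) \<le> M; 0 < M;
       z \<in> vseg c d; w \<in> vseg c d; - M \<le> Re (G z)\<rbrakk> \<Longrightarrow> norm (G w - G z) \<le> C * M"
    using borel_caratheodory_convex[OF open_convex_rect compact_vseg vseg_subset_rect[OF zero_less_one assms]] by metis
  show thesis
  proof (rule that[OF C(1)])
    fix G s0 s M t t'
    assume hol: "G holomorphic_on strip s0 a b" and s: "s0 + 1 \<le> s" and M: "0 < (M::real)"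
      and le: "\<And>z. \<lbrakk>z \<in> strip s0 a b; \<bar>Re z - s\<bar> < 1\<rbrakk> \<Longrightarrow> Re (G z) \<le> M"
      and t: "c \<le> t" "t \<le> d" "c \<le> t'" "t' \<le> d" and ge: "- M \<le> Re (G (Complex s t'))"
    have eq: "Complex 0 u + of_real s = Complex s u" for u by (simp add: complex_eq_iff)
    have "norm (G (Complex 0 t + of_real s) - G (Complex 0 t' + of_real s)) \<le> C * M"
    proof (rule C(2)[OF holomorphic_window[OF hol s] _ M])
      show "Re (G (x + of_real s)) \<le> M" if "x \<in> rect 1 a b" for x
        by (rule le) (use that s in \<open>auto simp: strip_iff rect_iff\<close>)
    qed (use t ge eq in \<open>auto simp: vseg_iff\<close>)
    then show "norm (G (Complex s t) - G (Complex s t')) \<le> C * M" by (simp only: eq)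
  qed
qed

context separated_values
begin

text \<open>The summand 1 is there for \<open>L1\<close>, whose real part is bounded by A + 1
  only.\<close>

lemma A_window:
  obtains K where "1 \<le> K" "\<forall>\<^sub>F s in at_top. \<forall>u. s0 < u \<longrightarrow> \<bar>u - s\<bar> < 1 \<longrightarrow> A u + 1 \<le> K * A s"
proof -
  obtain K where K: "1 \<le> K" "\<forall>\<^sub>F s in at_top. A (s + 1) \<le> K * A s" using A_shift by blast
  have "\<forall>\<^sub>F s in at_top. \<forall>u. s0 < u \<longrightarrow> \<bar>u - s\<bar> < 1 \<longrightarrow> A u + 1 \<le> (K + 1) * A s"
    using K(2) eventually_A_ge[of 1]
  proof eventually_elim
    case (elim s)
    show ?case
    proof safe
      fix u assume u: "s0 < u" "\<bar>u - s\<bar> < 1"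
      have "A u \<le> A (s + 1)" using u by (intro A_mono) auto
      then show "A u + 1 \<le> (K + 1) * A s" using elim by (simp add: algebra_simps)
    qed
  qed
  then show thesis using that[of "K + 1"] K(1) by simp
qed

text \<open>By finite order A is at most a power of r = exp s, and so far below exp (r^(1/8)). The
  rate 1/8 is admissible in \<open>phragmen_lindelof_half_strip\<close> for every width below 8
  \<open>pi\<close>, hence for all strips that occur.\<close>

lemma A_exp_exp: "\<forall>\<^sub>F s in at_top. B + C * A s \<le> exp (exp (s / 8))"
proof -
  define k where "k = \<bar>B\<bar> + \<bar>C\<bar> + \<bar>N\<bar>"
  show ?thesis using eventually_gt_at_top[of s0] eventually_ge_at_top[of "256 * k + 1"]
  proof eventually_elim
    case (elim s)
    have k0: "0 \<le> k" by (simp add: k_def)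
    then have s1: "1 \<le> s" using elim(2) by linarith
    have eN: "1 \<le> exp (\<bar>N\<bar> * s)" using s1 by simp
    have "A s \<le> exp (N * s)" by (rule A_le[OF elim(1)])
    also have "\<dots> \<le> exp (\<bar>N\<bar> * s)" using s1 by (simp add: mult_right_mono)
    finally have "A s \<le> exp (\<bar>N\<bar> * s)" .
    then have "C * A s \<le> \<bar>C\<bar> * exp (\<bar>N\<bar> * s)" using A_pos[OF elim(1)] by (intro mult_mono) auto
    moreover have "B \<le> \<bar>B\<bar> * exp (\<bar>N\<bar> * s)" using mult_left_mono[OF eN, of "\<bar>B\<bar>"] by linarith
    ultimately have "B + C * A s \<le> (\<bar>B\<bar> + \<bar>C\<bar>) * exp (\<bar>N\<bar> * s)" by (simp add: distrib_right)
    also have "\<dots> \<le> exp (\<bar>B\<bar> + \<bar>C\<bar>) * exp (\<bar>N\<bar> * s)"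
    proof (rule mult_right_mono)
      show "\<bar>B\<bar> + \<bar>C\<bar> \<le> exp (\<bar>B\<bar> + \<bar>C\<bar>)"
        using exp_ge_add_one_self[of "\<bar>B\<bar> + \<bar>C\<bar>"] by linarith
    qed simp
    also have "\<dots> = exp (\<bar>B\<bar> + \<bar>C\<bar> + \<bar>N\<bar> * s)" by (simp add: exp_add)
    also have "\<dots> \<le> exp (exp (s / 8))"
    proof -
      have "\<bar>B\<bar> + \<bar>C\<bar> + \<bar>N\<bar> * s \<le> (\<bar>B\<bar> + \<bar>C\<bar>) * s + \<bar>N\<bar> * s"
        using mult_left_mono[OF s1, of "\<bar>B\<bar> + \<bar>C\<bar>"] by simp
      also have "\<dots> = k * s" by (simp add: k_def algebra_simps)
      also have "\<dots> \<le> s / 256 * s" using elim(2) s1 by (intro mult_right_mono) auto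
      also have "\<dots> = (s / 16) ^ 2" by (simp add: power2_eq_square)
      also have "\<dots> \<le> exp (s / 16) ^ 2"
        using exp_ge_add_one_self[of "s / 16"] s1 by (intro power_mono) linarith+
      also have "\<dots> = exp (s / 8)" by (simp flip: exp_of_nat_mult)
      finally show ?thesis by simp
    qed
    finally show ?case .
  qed
qed

lemma window_growth:
  assumes hol: "G holomorphic_on strip s0 a b" and le: "\<And>z. z \<in> strip s0 a b \<Longrightarrow> Re (G z) \<le> A (Re z) + 1"
    and cd: "a < c" "d < b" and t0: "c \<le> t0" "t0 \<le> d"
    and ge: "\<forall>\<^sub>F s in at_top. - A s \<le> Re (G (Complex s t0))"
  shows "\<exists>C>0. \<forall>\<^sub>F s in at_top. \<forall>t\<in>{c..d}. norm (G (Complex s t) - G (Complex s t0)) \<le> C * A s"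
proof -
  obtain C where C: "0 < C"
    "\<And>G s0 s M t t'. \<lbrakk>G holomorphic_on strip s0 a b; s0 + 1 \<le> s; 0 < M;
       \<And>z. \<lbrakk>z \<in> strip s0 a b; \<bar>Re z - s\<bar> < 1\<rbrakk> \<Longrightarrow> Re (G z) \<le> M;
       c \<le> t; t \<le> d; c \<le> t'; t' \<le> d; - M \<le> Re (G (Complex s t'))\<rbrakk>
       \<Longrightarrow> norm (G (Complex s t) - G (Complex s t')) \<le> C * M"
    using borel_caratheodory_window[OF cd] by metis
  obtain K where K: "1 \<le> K" "\<forall>\<^sub>F s in at_top. \<forall>u. s0 < u \<longrightarrow> \<bar>u - s\<bar> < 1 \<longrightarrow> A u + 1 \<le> K * A s"
    using A_window by blast
  have "\<forall>\<^sub>F s in at_top. \<forall>t\<in>{c..d}. norm (G (Complex s t) - G (Complex s t0)) \<le> (C * K) * A s"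
    using K(2) ge eventually_ge_at_top[of "s0 + 1"] eventually_A_ge[of 1]
  proof eventually_elim
    case (elim s)
    have KA: "A s \<le> K * A s" using K(1) elim(4) mult_right_mono[of 1 K "A s"] by simp
    show ?case
    proof
      fix t assume t: "t \<in> {c..d}"
      have "norm (G (Complex s t) - G (Complex s t0)) \<le> C * (K * A s)"
      proof (rule C(2)[OF hol elim(3)])
        show "0 < K * A s" using KA elim(4) by linarith
        show "Re (G z) \<le> K * A s" if "z \<in> strip s0 a b" "\<bar>Re z - s\<bar> < 1" for z
          using le[OF that(1)] elim(1) that by (force simp: strip_iff)
        show "- (K * A s) \<le> Re (G (Complex s t0))" using elim(2) KA by linarith
      qed (use t t0 in auto)
      then show "norm (G (Complex s t) - G (Complex s t0)) \<le> C * K * A s" by (simp add: mult.assoc)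
    qed
  qed
  then show ?thesis using C(1) K(1) by (intro exI[of _ "C * K"]) auto
qed

text \<open>Phragmen-Lindelof will be applied to the logarithms \<open>L\<close> and
  \<open>L1\<close> themselves instead of \<open>f\<close>. A bounded ray anchors the
  Borel-Caratheodory estimate, which makes their modulus O(A), so that the opening angle imposes no
  restriction.\<close>

lemma bounded_ray_growth:
  assumes hol: "G holomorphic_on strip s0 a b" and le: "\<And>z. z \<in> strip s0 a b \<Longrightarrow> Re (G z) \<le> A (Re z) + 1"
    and cd: "a < c" "d < b" and t0: "c \<le> t0" "t0 \<le> d"
    and bd: "\<forall>\<^sub>F s in at_top. norm (G (Complex s t0)) \<le> B"
  shows "\<forall>\<^sub>F s in at_top. \<forall>t\<in>{c..d}. norm (G (Complex s t)) \<le> exp (1 * exp (1 / 8 * s))"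
proof -
  have "\<forall>\<^sub>F s in at_top. - A s \<le> Re (G (Complex s t0))"
    using bd eventually_A_ge[of B]
  proof eventually_elim
    case (elim s)
    then show ?case using abs_Re_le_cmod[of "G (Complex s t0)"] by linarith
  qed
  then obtain C where C: "0 < C" "\<forall>\<^sub>F s in at_top. \<forall>t\<in>{c..d}. norm (G (Complex s t) - G (Complex s t0)) \<le> C * A s"
    using window_growth[OF hol le cd t0] by blast
  show ?thesis using C(2) bd A_exp_exp[of B C]
  proof eventually_elim
    case (elim s)
    show ?case
    proof
      fix t assume "t \<in> {c..d}"
      then have "norm (G (Complex s t) - G (Complex s t0)) \<le> C * A s" using elim(1) by blast
      then have "norm (G (Complex s t)) \<le> C * A s + B"
        using norm_triangle_sub[of "G (Complex s t)" "G (Complex s t0)"] elim(2) by linarith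
      then show "norm (G (Complex s t)) \<le> exp (1 * exp (1 / 8 * s))" using elim(3) by simp
    qed
  qed
qed

text \<open>A bound near one ray is o(A), and A is a majorant up to a constant in the whole window
  by doubling. The two-constants principle thus propagates o(A) to every other ray of the
  strip.\<close>

lemma small_spreads:
  assumes hol: "G holomorphic_on strip s0 a b" and le: "\<And>z. z \<in> strip s0 a b \<Longrightarrow> Re (G z) \<le> A (Re z) + 1"
    and \<theta>: "a < \<theta>" "\<theta> < b" "a < \<theta>'" "\<theta>' < b" and r: "0 < r"
    and small: "\<forall>\<^sub>F s in at_top. \<forall>t\<in>{\<theta> - r..\<theta> + r}. \<bar>Re (G (Complex s t))\<bar> \<le> B" and \<epsilon>: "0 < \<epsilon>"
  shows "\<forall>\<^sub>F s in at_top. \<bar>Re (G (Complex s \<theta>'))\<bar> \<le> \<epsilon> * A s"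
proof -
  obtain K where K: "1 \<le> K" "\<forall>\<^sub>F s in at_top. \<forall>u. s0 < u \<longrightarrow> \<bar>u - s\<bar> < 1 \<longrightarrow> A u + 1 \<le> K * A s"
    using A_window by blast
  have eK: "0 < \<epsilon> / K" using \<epsilon> K(1) by simp
  have r1: "0 < min r 1" using r by simp
  obtain \<delta> where \<delta>: "0 < \<delta>"
    "\<And>G s0 s M t. \<lbrakk>G holomorphic_on strip s0 a b; s0 + 1 \<le> s; 0 < M;
       \<And>z. \<lbrakk>z \<in> strip s0 a b; \<bar>Re z - s\<bar> < 1\<rbrakk> \<Longrightarrow> Re (G z) \<le> M;
       \<And>z. \<lbrakk>z \<in> strip s0 a b; dist (Complex s \<theta>) z < min r 1\<rbrakk> \<Longrightarrow> \<bar>Re (G z)\<bar> \<le> \<delta> * M; \<theta>' \<le> t; t \<le> \<theta>'\<rbrakk>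
       \<Longrightarrow> \<bar>Re (G (Complex s t))\<bar> \<le> \<epsilon> / K * M"
    using two_constants_window[OF \<theta>(1,2) r1 \<theta>(3,4) eK] by metis
  obtain S where S: "\<And>s t. S \<le> s \<Longrightarrow> t \<in> {\<theta> - r..\<theta> + r} \<Longrightarrow> \<bar>Re (G (Complex s t))\<bar> \<le> B"
    using small unfolding eventually_at_top_linorder by blast
  show ?thesis
    using K(2) eventually_ge_at_top[of "s0 + 1"] eventually_ge_at_top[of "S + 1"] eventually_A_ge[of 1] eventually_A_ge[of "B / \<delta>"]
  proof eventually_elim
    case (elim s)
    have KA: "A s \<le> K * A s" using K(1) elim(4) mult_right_mono[of 1 K "A s"] by simp
    have "\<bar>Re (G (Complex s \<theta>'))\<bar> \<le> \<epsilon> / K * (K * A s)"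
    proof (rule \<delta>(2)[OF hol elim(2)])
      show "0 < K * A s" using KA elim(4) by linarith
      show "Re (G z) \<le> K * A s" if "z \<in> strip s0 a b" "\<bar>Re z - s\<bar> < 1" for z
        using le[OF that(1)] elim(1) that by (force simp: strip_iff)
      show "\<bar>Re (G z)\<bar> \<le> \<delta> * (K * A s)" if z: "z \<in> strip s0 a b" "dist (Complex s \<theta>) z < min r 1" for z
      proof -
        have "\<bar>s - Re z\<bar> < 1" "\<bar>\<theta> - Im z\<bar> < r"
          using z(2) abs_Re_le_cmod[of "Complex s \<theta> - z"] abs_Im_le_cmod[of "Complex s \<theta> - z"] by (simp_all add: dist_norm)
        then have "S \<le> Re z" "Im z \<in> {\<theta> - r..\<theta> + r}" using elim(3) by (auto simp: abs_less_iff)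
        then have "\<bar>Re (G (Complex (Re z) (Im z)))\<bar> \<le> B" by (rule S)
        then have "\<bar>Re (G z)\<bar> \<le> B" by simp
        also have "B \<le> \<delta> * A s" using elim(5) \<delta>(1) by (simp add: field_simps)
        also have "\<dots> \<le> \<delta> * (K * A s)" using KA \<delta>(1) by (intro mult_left_mono) auto
        finally show ?thesis .
      qed
    qed simp_all
    then show ?case using K(1) by simp
  qed
qed

text \<open>A positive harmonic function in a sector of opening \<open>b - a\<close> grows at most
  like r^(\<open>pi / (b - a)\<close>) on the bisector; a lower bound by a multiple of A transfers
  this growth to A.\<close>

lemma A_growth:
  assumes ab: "a < b" and hol: "G holomorphic_on strip S a b"
    and pos: "\<And>z. z \<in> strip S a b \<Longrightarrow> 0 < Re (G z)"
    and ge: "0 < c" "\<forall>\<^sub>F s in at_top. c * A s \<le> Re (G (Complex s ((a + b) / 2)))"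
  shows "\<exists>C>0. \<forall>\<^sub>F s in at_top. A s \<le> C * exp (pi / (b - a) * s)"
proof -
  obtain C S' where C: "\<And>s. S' \<le> s \<Longrightarrow> Re (G (Complex s ((a + b) / 2))) \<le> C * exp (pi / (b - a) * s)"
    using positive_real_part_half_strip[OF ab, of G S] hol pos by (metis strip_def strip_iff)
  have "\<forall>\<^sub>F s in at_top. A s \<le> (\<bar>C\<bar> / c + 1) * exp (pi / (b - a) * s)"
    using ge(2) eventually_ge_at_top[of S']
  proof eventually_elim
    case (elim s)
    have "c * A s \<le> C * exp (pi / (b - a) * s)" using C[OF elim(2)] elim(1) by linarith
    also have "\<dots> \<le> \<bar>C\<bar> * exp (pi / (b - a) * s)" by (intro mult_right_mono) auto
    finally have "A s \<le> \<bar>C\<bar> / c * exp (pi / (b - a) * s)" using ge(1) by (simp add: field_simps)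
    then show ?case by (simp add: distrib_right) (smt (verit) exp_gt_zero)
  qed
  then show ?thesis using ge(1) by (intro exI[of _ "\<bar>C\<bar> / c + 1"]) (auto simp: add_nonneg_pos)
qed

definition large :: "(complex \<Rightarrow> complex) \<Rightarrow> real \<Rightarrow> real \<Rightarrow> bool" where
  "large g a b \<longleftrightarrow> (\<exists>c>0. \<forall>\<^sub>F s in at_top. \<forall>t\<in>{a..b}. c * A s \<le> ln (norm (g (Complex s t))))"

text \<open>For \<open>g\<close> equal to \<open>E\<close>, \<open>1 / E\<close> and
  \<open>1 / (1 - E)\<close> this says that f tends to \<infinity>, 0 and 1 in the gap between
  \<beta> and \<open>pi / 2\<close>, locally uniformly in the angle. \<open>state2\<close> is the
  counterpart for the gap between \<open>- (pi / 2)\<close> and \<alpha>.\<close>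

definition state1 :: "(complex \<Rightarrow> complex) \<Rightarrow> bool" where
  "state1 g \<longleftrightarrow> (\<forall>a b. \<beta> < a \<longrightarrow> b < pi / 2 \<longrightarrow> large g a b)"

definition state2 :: "(complex \<Rightarrow> complex) \<Rightarrow> bool" where
  "state2 g \<longleftrightarrow> (\<forall>a b. - (pi / 2) < a \<longrightarrow> b < \<alpha> \<longrightarrow> large g a b)"

lemma state1_cases: "state1 E \<or> state1 (\<lambda>z. 1 / E z) \<or> state1 (\<lambda>z. 1 / (1 - E z))"
proof -
  have "state1 g" if "adm g" "big g" for g
    unfolding state1_def large_def using big_sector[OF that] by blast
  then show ?thesis using trichotomy adm_E by blast
qed

end

section \<open>The second gap by reflection\<close>

context separated_values
begin

interpretation R: separated_values "\<lambda>z. cnj (f (cnj z))" "\<lambda>z. cnj (L (cnj (z - 2 * pi * \<i>)))" "\<lambda>z. cnj (L1 (cnj z))" "- \<beta>" "- \<alpha>" s0 N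
  by (rule reflected)

lemma reflected_E: "R.E z = cnj (E (cnj z))"
  by (simp add: R.E_def E_def exp_cnj)

lemma reflected_state:
  assumes "R.state1 g'" "\<And>z. norm (g' z) = norm (g (cnj z))"
  shows "state2 g"
  unfolding state2_def
proof safe
  fix a b assume ab: "- (pi / 2) < a" "b < \<alpha>"
  have "R.large g' (- b) (- a)" using assms(1) ab by (simp add: R.state1_def)
  then obtain c where c: "0 < c" "\<forall>\<^sub>F s in at_top. \<forall>t\<in>{- b..- a}. c * A s \<le> ln (norm (g' (Complex s t)))"
    by (auto simp: R.large_def logmax_cnj)
  from c(2) have "\<forall>\<^sub>F s in at_top. \<forall>t\<in>{a..b}. c * A s \<le> ln (norm (g (Complex s t)))"
  proof eventually_elim
    case (elim s)
    show ?case
    proof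
      fix t assume "t \<in> {a..b}"
      then have "- t \<in> {- b..- a}" by auto
      then have "c * A s \<le> ln (norm (g' (Complex s (- t))))" using elim by blast
      moreover have "cnj (Complex s (- t)) = Complex s t" by (simp add: complex_eq_iff)
      ultimately show "c * A s \<le> ln (norm (g (Complex s t)))" by (simp add: assms(2))
    qed
  qed
  then show "large g a b" using c(1) by (auto simp: large_def)
qed

lemma state2_cases: "state2 E \<or> state2 (\<lambda>z. 1 / E z) \<or> state2 (\<lambda>z. 1 / (1 - E z))"
proof -
  have "norm (1 - cnj w) = norm (1 - w)" for w by (metis complex_cnj_diff complex_cnj_one complex_mod_cnj)
  then show ?thesis
    using R.state1_cases reflected_state[of R.E E] reflected_state[of "\<lambda>z. 1 / R.E z" "\<lambda>z. 1 / E z"]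
      reflected_state[of "\<lambda>z. 1 / (1 - R.E z)" "\<lambda>z. 1 / (1 - E z)"]
    by (auto simp: reflected_E norm_divide)
qed

end

context separated_values
begin

definition \<theta>\<^sub>2 :: real where "\<theta>\<^sub>2 = (\<alpha> - pi / 2) / 2"

definition \<rho>\<^sub>2 :: real where "\<rho>\<^sub>2 = (\<alpha> + pi / 2) / 4"

lemma \<theta>\<^sub>2: "- (pi / 2) < \<theta>\<^sub>2" "\<theta>\<^sub>2 < \<alpha>" "0 < \<rho>\<^sub>2" "- (pi / 2) < \<theta>\<^sub>2 - \<rho>\<^sub>2" "\<theta>\<^sub>2 + \<rho>\<^sub>2 < \<alpha>"
  using angles by (auto simp: \<theta>\<^sub>2_def \<rho>\<^sub>2_def field_simps)

lemma large_eventually: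
  assumes "large g a b"
  obtains c where "0 < c" "\<forall>\<^sub>F s in at_top. s0 + 1 < s \<and> (\<forall>t\<in>{a..b}. c * A s \<le> ln (norm (g (Complex s t))) \<and> B \<le> ln (norm (g (Complex s t))))"
proof -
  obtain c where c: "0 < c" "\<forall>\<^sub>F s in at_top. \<forall>t\<in>{a..b}. c * A s \<le> ln (norm (g (Complex s t)))"
    using assms by (auto simp: large_def)
  have "\<forall>\<^sub>F s in at_top. s0 + 1 < s \<and> (\<forall>t\<in>{a..b}. c * A s \<le> ln (norm (g (Complex s t))) \<and> B \<le> ln (norm (g (Complex s t))))"
    using c(2) eventually_A_ge[of "B / c"] eventually_gt_at_top[of "s0 + 1"]
  proof eventually_elim
    case (elim s)
    have "B \<le> c * A s" using elim(2) c(1) by (simp add: field_simps)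
    then show ?case using elim by force
  qed
  then show thesis using that c(1) by blast
qed

text \<open>This and the next lemmas tabulate how the logarithms see the states. For \<infinity> and
  0 the modulus of \<open>Re L\<close> is of size A, for 1 it is bounded. \<open>Re L1\<close> is
  large positive for \<infinity>, large negative for 1 and bounded for 0.\<close>

lemma large_L:
  assumes "large E a b \<or> large (\<lambda>z. 1 / E z) a b" "\<beta> < a" "b < \<alpha> + 2 * pi"
  shows "\<exists>c>0. \<forall>\<^sub>F s in at_top. \<forall>t\<in>{a..b}. c * A s \<le> \<bar>Re (L (Complex s t))\<bar>"
proof -
  obtain g where g: "large g a b" "\<And>z. ln (norm (g z)) \<le> \<bar>ln (norm (E z))\<bar>"
  proof -
    have "ln (norm (1 / E z)) \<le> \<bar>ln (norm (E z))\<bar>" for z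
      by (cases "E z = 0") (auto simp: norm_divide ln_div)
    then show ?thesis using assms(1) that[of E] that[of "\<lambda>z. 1 / E z"] by force
  qed
  obtain c where c: "0 < c" "\<forall>\<^sub>F s in at_top. s0 + 1 < s \<and> (\<forall>t\<in>{a..b}. c * A s \<le> ln (norm (g (Complex s t))) \<and> 1 \<le> ln (norm (g (Complex s t))))"
    by (rule large_eventually[OF g(1), where B = 1])
  from c(2) have "\<forall>\<^sub>F s in at_top. \<forall>t\<in>{a..b}. c * A s \<le> \<bar>Re (L (Complex s t))\<bar>"
  proof eventually_elim
    case (elim s)
    show ?case
    proof
      fix t assume t: "t \<in> {a..b}"
      have "Complex s t \<in> strip s0 \<beta> (\<alpha> + 2 * pi)" using t elim assms by (auto simp: strip_iff)
      then have "Re (L (Complex s t)) = ln (norm (E (Complex s t)))" by (rule Re_L)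
      moreover have "c * A s \<le> ln (norm (g (Complex s t)))" using elim t by blast
      ultimately show "c * A s \<le> \<bar>Re (L (Complex s t))\<bar>" using g(2)[of "Complex s t"] by linarith
    qed
  qed
  then show ?thesis using c(1) by blast
qed

lemma bounded_L:
  assumes "large (\<lambda>z. 1 / (1 - E z)) a b" "\<beta> < a" "b < \<alpha> + 2 * pi"
  shows "\<forall>\<^sub>F s in at_top. \<forall>t\<in>{a..b}. \<bar>Re (L (Complex s t))\<bar> \<le> 1 \<and> norm (E (Complex s t) - 1) \<le> 1 / 2"
proof -
  obtain c where c: "0 < c" "\<forall>\<^sub>F s in at_top. s0 + 1 < s \<and> (\<forall>t\<in>{a..b}. c * A s \<le> ln (norm (1 / (1 - E (Complex s t)))) \<and> 1 \<le> ln (norm (1 / (1 - E (Complex s t)))))"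
    by (rule large_eventually[OF assms(1), where B = 1])
  from c(2) show ?thesis
  proof eventually_elim
    case (elim s)
    show ?case
    proof
      fix t assume t: "t \<in> {a..b}"
      have "Complex s t \<in> strip s0 \<beta> (\<alpha> + 2 * pi)" using t elim assms by (auto simp: strip_iff)
      then have "Re (L (Complex s t)) = ln (norm (E (Complex s t)))" by (rule Re_L)
      moreover have "1 \<le> ln (norm (1 / (1 - E (Complex s t))))" using elim t by blast
      from ln_norm_inverse_large[OF this] have "\<bar>ln (norm (E (Complex s t)))\<bar> \<le> 1" "norm (1 - E (Complex s t)) \<le> 1 / 2" by simp_all
      ultimately show "\<bar>Re (L (Complex s t))\<bar> \<le> 1 \<and> norm (E (Complex s t) - 1) \<le> 1 / 2"
        by (simp add: norm_minus_commute)
    qed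
  qed
qed

lemma large_L1:
  assumes "large E a b" "- (pi / 2) < a" "b < pi / 2"
  shows "\<exists>c>0. \<forall>\<^sub>F s in at_top. \<forall>t\<in>{a..b}. c * A s \<le> Re (L1 (Complex s t))"
proof -
  obtain c where c: "0 < c" "\<forall>\<^sub>F s in at_top. s0 + 1 < s \<and> (\<forall>t\<in>{a..b}. c * A s \<le> ln (norm (E (Complex s t))) \<and> 2 \<le> ln (norm (E (Complex s t))))"
    by (rule large_eventually[OF assms(1), where B = 2])
  from c(2) have "\<forall>\<^sub>F s in at_top. \<forall>t\<in>{a..b}. c / 2 * A s \<le> Re (L1 (Complex s t))"
  proof eventually_elim
    case (elim s)
    show ?case
    proof
      fix t assume t: "t \<in> {a..b}"
      have "Complex s t \<in> strip s0 (- (pi / 2)) (pi / 2)" using t elim assms by (auto simp: strip_iff)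
      then have "Re (L1 (Complex s t)) = ln (norm (1 - E (Complex s t)))" by (rule Re_L1)
      moreover have "c * A s \<le> ln (norm (E (Complex s t)))" "2 \<le> ln (norm (E (Complex s t)))" using elim t by blast+
      moreover from this have "ln (norm (E (Complex s t))) - 1 \<le> ln (norm (1 - E (Complex s t)))"
        by (intro ln_norm_one_minus_large) simp
      ultimately show "c / 2 * A s \<le> Re (L1 (Complex s t))" by simp
    qed
  qed
  then show ?thesis using c(1) by (intro exI[of _ "c / 2"]) auto
qed

lemma large_neg_L1:
  assumes "large (\<lambda>z. 1 / (1 - E z)) a b" "- (pi / 2) < a" "b < pi / 2"
  shows "\<exists>c>0. \<forall>\<^sub>F s in at_top. \<forall>t\<in>{a..b}. c * A s \<le> - Re (L1 (Complex s t))"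
proof -
  obtain c where c: "0 < c" "\<forall>\<^sub>F s in at_top. s0 + 1 < s \<and> (\<forall>t\<in>{a..b}. c * A s \<le> ln (norm (1 / (1 - E (Complex s t)))) \<and> 1 \<le> ln (norm (1 / (1 - E (Complex s t)))))"
    by (rule large_eventually[OF assms(1), where B = 1])
  from c(2) have "\<forall>\<^sub>F s in at_top. \<forall>t\<in>{a..b}. c * A s \<le> - Re (L1 (Complex s t))"
  proof eventually_elim
    case (elim s)
    show ?case
    proof
      fix t assume t: "t \<in> {a..b}"
      have z: "Complex s t \<in> strip s0 (- (pi / 2)) (pi / 2)" using t elim assms by (auto simp: strip_iff)
      then have "Re (L1 (Complex s t)) = ln (norm (1 - E (Complex s t)))" by (rule Re_L1)
      moreover have "1 - E (Complex s t) \<noteq> 0" using expL1[OF z] by (metis E_def exp_not_eq_zero)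
      moreover have "c * A s \<le> ln (norm (1 / (1 - E (Complex s t))))" using elim t by blast
      ultimately show "c * A s \<le> - Re (L1 (Complex s t))" by (simp add: norm_divide ln_div)
    qed
  qed
  then show ?thesis using c(1) by blast
qed

lemma bounded_L1:
  assumes "large (\<lambda>z. 1 / E z) a b" "- (pi / 2) < a" "b < pi / 2"
  shows "\<forall>\<^sub>F s in at_top. \<forall>t\<in>{a..b}. \<bar>Re (L1 (Complex s t))\<bar> \<le> 1 \<and> norm (E (Complex s t)) \<le> 1 / 2"
proof -
  obtain c where c: "0 < c" "\<forall>\<^sub>F s in at_top. s0 + 1 < s \<and> (\<forall>t\<in>{a..b}. c * A s \<le> ln (norm (1 / E (Complex s t))) \<and> 1 \<le> ln (norm (1 / E (Complex s t))))"
    by (rule large_eventually[OF assms(1), where B = 1])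
  from c(2) show ?thesis
  proof eventually_elim
    case (elim s)
    show ?case
    proof
      fix t assume t: "t \<in> {a..b}"
      have "Complex s t \<in> strip s0 (- (pi / 2)) (pi / 2)" using t elim assms by (auto simp: strip_iff)
      then have "Re (L1 (Complex s t)) = ln (norm (1 - E (Complex s t)))" by (rule Re_L1)
      moreover have "1 \<le> ln (norm (1 / E (Complex s t)))" using elim t by blast
      ultimately show "\<bar>Re (L1 (Complex s t))\<bar> \<le> 1 \<and> norm (E (Complex s t)) \<le> 1 / 2"
        using ln_norm_inverse_large[of "E (Complex s t)"] by simp
    qed
  qed
qed

text \<open>The domain of \<open>L\<close> meets the second gap only after a full turn, at angles
  increased by 2 \<open>pi\<close>.\<close>

lemma large_shift:
  assumes "large g a b" "\<And>s t. norm (g (Complex s (t + 2 * pi))) = norm (g (Complex s t))"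
  shows "large g (a + 2 * pi) (b + 2 * pi)"
proof -
  obtain c where c: "0 < c" "\<forall>\<^sub>F s in at_top. \<forall>t\<in>{a..b}. c * A s \<le> ln (norm (g (Complex s t)))"
    using assms(1) by (auto simp: large_def)
  from c(2) have "\<forall>\<^sub>F s in at_top. \<forall>t\<in>{a + 2 * pi..b + 2 * pi}. c * A s \<le> ln (norm (g (Complex s t)))"
  proof eventually_elim
    case (elim s)
    show ?case
    proof
      fix t assume "t \<in> {a + 2 * pi..b + 2 * pi}"
      then have "t - 2 * pi \<in> {a..b}" by auto
      then have "c * A s \<le> ln (norm (g (Complex s (t - 2 * pi))))" using elim by blast
      then show "c * A s \<le> ln (norm (g (Complex s t)))" using assms(2)[of s "t - 2 * pi"] by simp
    qed
  qed
  then show ?thesis using c(1) by (auto simp: large_def)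
qed

lemma no_mixed_size:
  assumes "G holomorphic_on strip s0 a b" "\<And>z. z \<in> strip s0 a b \<Longrightarrow> Re (G z) \<le> A (Re z) + 1"
    and "a < \<theta>" "\<theta> < b" "a < \<theta>'" "\<theta>' < b" "0 < r"
    and "\<forall>\<^sub>F s in at_top. \<forall>t\<in>{\<theta> - r..\<theta> + r}. \<bar>Re (G (Complex s t))\<bar> \<le> 1"
    and "\<exists>c>0. \<forall>\<^sub>F s in at_top. c * A s \<le> \<bar>Re (G (Complex s \<theta>'))\<bar>"
  shows False
proof -
  obtain c where c: "0 < c" "\<forall>\<^sub>F s in at_top. c * A s \<le> \<bar>Re (G (Complex s \<theta>'))\<bar>" using assms(9) by blast
  have "\<forall>\<^sub>F s in at_top. \<bar>Re (G (Complex s \<theta>'))\<bar> \<le> c / 2 * A s"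
    by (rule small_spreads[OF assms(1-8)]) (use c in auto)
  then have "\<forall>\<^sub>F s::real in at_top. False"
    using c(2) eventually_A_ge[of 1]
  proof eventually_elim
    case (elim s)
    then have "c * A s \<le> c / 2 * A s" by linarith
    then show ?case using c(1) elim(3) by simp
  qed
  then show False by simp
qed

text \<open>\<open>L\<close> and \<open>L1\<close> are both defined across the two gaps. State 1 on
  one side with 0 or \<infinity> on the other makes \<open>Re L\<close> bounded near one ray and of
  size A on another, against \<open>small_spreads\<close>; the mixture of 0 and \<infinity> does the
  same to \<open>Re L1\<close>.\<close>

lemma same_state:
  "(state1 E \<and> state2 E) \<or> (state1 (\<lambda>z. 1 / E z) \<and> state2 (\<lambda>z. 1 / E z)) \<or>
   (state1 (\<lambda>z. 1 / (1 - E z)) \<and> state2 (\<lambda>z. 1 / (1 - E z)))"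
proof -
  let ?I = "\<lambda>z. 1 / E z" and ?J = "\<lambda>z. 1 / (1 - E z)"
  have ranges: "\<beta> < \<theta>\<^sub>1" "\<theta>\<^sub>1 < \<alpha> + 2 * pi" "\<beta> < \<theta>\<^sub>2 + 2 * pi" "\<theta>\<^sub>2 + 2 * pi < \<alpha> + 2 * pi"
    "- (pi / 2) < \<theta>\<^sub>1" "\<theta>\<^sub>1 < pi / 2" "- (pi / 2) < \<theta>\<^sub>2" "\<theta>\<^sub>2 < pi / 2"
    using \<theta>\<^sub>1 \<theta>\<^sub>2 angles by auto
  have lg1: "large g (\<theta>\<^sub>1 - \<rho>) (\<theta>\<^sub>1 + \<rho>)" if "state1 g" for g
    using that \<theta>\<^sub>1 by (simp add: state1_def)
  have lg2: "large g (\<theta>\<^sub>2 - \<rho>\<^sub>2) (\<theta>\<^sub>2 + \<rho>\<^sub>2)" if "state2 g" for g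
    using that \<theta>\<^sub>2 by (simp add: state2_def)
  have lg2': "large g (\<theta>\<^sub>2 + 2 * pi - \<rho>\<^sub>2) (\<theta>\<^sub>2 + 2 * pi + \<rho>\<^sub>2)"
    if "state2 g" "\<And>s t. norm (g (Complex s (t + 2 * pi))) = norm (g (Complex s t))" for g
    using large_shift[OF lg2[OF that(1)] that(2)] by (simp add: algebra_simps)
  have at_mid: "\<exists>c>0. \<forall>\<^sub>F s in at_top. c * A s \<le> \<bar>Re (G (Complex s \<theta>))\<bar>"
    if "\<exists>c>0. \<forall>\<^sub>F s in at_top. \<forall>t\<in>{\<theta> - r..\<theta> + r}. c * A s \<le> \<bar>Re (G (Complex s t))\<bar>" "0 < r"
    for G :: "complex \<Rightarrow> complex" and \<theta> r
  proof -
    have mem: "\<theta> \<in> {\<theta> - r..\<theta> + r}" using that(2) by simp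
    show ?thesis
      using that(1) by (elim ex_forward conj_forward eventually_mono) (use mem in blast)+
  qed
  have at_mid': "\<exists>c>0. \<forall>\<^sub>F s in at_top. c * A s \<le> \<bar>Re (G (Complex s \<theta>))\<bar>"
    if "\<exists>c>0. \<forall>\<^sub>F s in at_top. \<forall>t\<in>{\<theta> - r..\<theta> + r}. c * A s \<le> Re (G (Complex s t))" "0 < r"
    for G :: "complex \<Rightarrow> complex" and \<theta> r
  proof -
    have mem: "\<theta> \<in> {\<theta> - r..\<theta> + r}" using that(2) by simp
    show ?thesis
      using that(1) by (elim ex_forward conj_forward eventually_mono) (use mem abs_ge_self order_trans in blast)+
  qed
  have L_le: "Re (L z) \<le> A (Re z) + 1" if "z \<in> strip s0 \<beta> (\<alpha> + 2 * pi)" for z using Re_L_le[OF that] by simp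
  have in1: "\<beta> < \<theta>\<^sub>1 - \<rho>" "\<theta>\<^sub>1 + \<rho> < \<alpha> + 2 * pi" "- (pi / 2) < \<theta>\<^sub>1 - \<rho>" "\<theta>\<^sub>1 + \<rho> < pi / 2"
    "\<beta> < \<theta>\<^sub>2 + 2 * pi - \<rho>\<^sub>2" "\<theta>\<^sub>2 + 2 * pi + \<rho>\<^sub>2 < \<alpha> + 2 * pi" "- (pi / 2) < \<theta>\<^sub>2 - \<rho>\<^sub>2" "\<theta>\<^sub>2 + \<rho>\<^sub>2 < pi / 2"
    using \<theta>\<^sub>1 \<theta>\<^sub>2 angles by auto
  have L12: False if "state1 ?J" "state2 E \<or> state2 ?I"
  proof -
    have "\<exists>c>0. \<forall>\<^sub>F s in at_top. \<forall>t\<in>{\<theta>\<^sub>2 + 2 * pi - \<rho>\<^sub>2..\<theta>\<^sub>2 + 2 * pi + \<rho>\<^sub>2}. c * A s \<le> \<bar>Re (L (Complex s t))\<bar>"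
      using that(2) lg2'[of E] lg2'[of ?I] in1 by (intro large_L) (auto simp: E_period')
    note big = at_mid[OF this \<theta>\<^sub>2(3)]
    have "\<forall>\<^sub>F s in at_top. \<forall>t\<in>{\<theta>\<^sub>1 - \<rho>..\<theta>\<^sub>1 + \<rho>}. \<bar>Re (L (Complex s t))\<bar> \<le> 1"
      using bounded_L[OF lg1[OF that(1)] in1(1,2)] by (rule eventually_mono) blast
    from no_mixed_size[OF holL L_le ranges(1-4) \<theta>\<^sub>1(3) this big] show False .
  qed
  have L21: False if "state2 ?J" "state1 E \<or> state1 ?I"
  proof -
    have "\<exists>c>0. \<forall>\<^sub>F s in at_top. \<forall>t\<in>{\<theta>\<^sub>1 - \<rho>..\<theta>\<^sub>1 + \<rho>}. c * A s \<le> \<bar>Re (L (Complex s t))\<bar>"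
      using that(2) lg1[of E] lg1[of ?I] in1 by (intro large_L) auto
    note big = at_mid[OF this \<theta>\<^sub>1(3)]
    have "large ?J (\<theta>\<^sub>2 + 2 * pi - \<rho>\<^sub>2) (\<theta>\<^sub>2 + 2 * pi + \<rho>\<^sub>2)" by (rule lg2'[OF that(1)]) (simp add: E_period')
    from bounded_L[OF this in1(5,6)]
    have "\<forall>\<^sub>F s in at_top. \<forall>t\<in>{\<theta>\<^sub>2 + 2 * pi - \<rho>\<^sub>2..\<theta>\<^sub>2 + 2 * pi + \<rho>\<^sub>2}. \<bar>Re (L (Complex s t))\<bar> \<le> 1"
      by (rule eventually_mono) blast
    from no_mixed_size[OF holL L_le ranges(3,4,1,2) \<theta>\<^sub>2(3) this big] show False .
  qed
  have M12: False if "state1 ?I" "state2 E"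
  proof -
    note big = at_mid'[of \<theta>\<^sub>2 \<rho>\<^sub>2 L1, OF large_L1[OF lg2[OF that(2)] in1(7,8)] \<theta>\<^sub>2(3)]
    have "\<forall>\<^sub>F s in at_top. \<forall>t\<in>{\<theta>\<^sub>1 - \<rho>..\<theta>\<^sub>1 + \<rho>}. \<bar>Re (L1 (Complex s t))\<bar> \<le> 1"
      using bounded_L1[OF lg1[OF that(1)] in1(3,4)] by (rule eventually_mono) blast
    from no_mixed_size[OF holL1 Re_L1_le ranges(5-8) \<theta>\<^sub>1(3) this big] show False .
  qed
  have M21: False if "state2 ?I" "state1 E"
  proof -
    note big = at_mid'[of \<theta>\<^sub>1 \<rho> L1, OF large_L1[OF lg1[OF that(2)] in1(3,4)] \<theta>\<^sub>1(3)]
    have "\<forall>\<^sub>F s in at_top. \<forall>t\<in>{\<theta>\<^sub>2 - \<rho>\<^sub>2..\<theta>\<^sub>2 + \<rho>\<^sub>2}. \<bar>Re (L1 (Complex s t))\<bar> \<le> 1"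
      using bounded_L1[OF lg2[OF that(1)] in1(7,8)] by (rule eventually_mono) blast
    from no_mixed_size[OF holL1 Re_L1_le ranges(7,8,5,6) \<theta>\<^sub>2(3) this big] show False .
  qed
  show ?thesis using state1_cases state2_cases L12 L21 M12 M21 by blast
qed

end

section \<open>The states 1 and infinity\<close>

text \<open>The polynomial with the zeros of \<open>f\<close> and their multiplicities has the same
  order as \<open>f\<close> at every point, so the quotient is entire without zeros and has a
  logarithm.\<close>

lemma entire_finite_zeros_factor:
  assumes hol: "f holomorphic_on UNIV" and fin: "finite {z. f z = 0}"
  obtains p Q where "Q holomorphic_on UNIV" "p \<noteq> 0" "\<And>z. f z = poly p z * exp (Q z)"
proof -
  define Z where "Z = {z. f z = 0}"
  define m where "m = (\<lambda>a. nat (zorder f a))"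
  define p where "p = (\<Prod>a\<in>Z. [:- a, 1:] ^ m a)"
  have finZ: "finite Z" using fin by (simp add: Z_def)
  have ev: "eventually (\<lambda>w. f w \<noteq> 0) (at z)" for z
  proof -
    have "open (- (Z - {z}))" using finZ by (intro open_Compl finite_imp_closed) auto
    then have "eventually (\<lambda>w. w \<in> - (Z - {z})) (nhds z)" by (rule eventually_nhds_in_open) simp
    then show ?thesis unfolding eventually_at_filter by (rule eventually_mono) (auto simp: Z_def)
  qed
  have ana: "f analytic_on {z}" for z
    using hol by (metis analytic_on_holomorphic open_UNIV subset_UNIV)
  have pos: "0 < zorder f a" if "a \<in> Z" for a
    using zorder_pos_iff[OF hol open_UNIV UNIV_I eventually_frequently[OF _ ev]] that
    by (auto simp: Z_def)
  have polyp: "poly p z = (\<Prod>a\<in>Z. (z - a) ^ m a)" for z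
    by (simp add: p_def poly_prod)
  have holp: "poly p holomorphic_on UNIV"
  proof -
    have "(\<lambda>z. \<Prod>a\<in>Z. (z - a) ^ m a) holomorphic_on UNIV" by (intro holomorphic_intros)
    then show ?thesis by (simp add: polyp[abs_def])
  qed
  have p0: "poly p z = 0 \<longleftrightarrow> f z = 0" for z
    using finZ pos by (auto simp: polyp Z_def m_def)
  have zo: "zorder (poly p) z = zorder f z" for z
  proof (cases "z \<in> Z")
    case False
    have "poly p analytic_on {z}" using holp by (metis analytic_on_holomorphic open_UNIV subset_UNIV)
    then have "zorder (poly p) z = 0" by (rule zorder_eq_0I) (use False p0 in \<open>simp add: Z_def\<close>)
    moreover have "zorder f z = 0"
      by (rule zorder_eq_0I[OF ana]) (use False in \<open>simp add: Z_def\<close>)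
    ultimately show ?thesis by simp
  next
    case True
    show ?thesis
    proof (rule zorder_eqI[of UNIV z "\<lambda>w. \<Prod>a\<in>Z-{z}. (w - a) ^ m a"])
      show "(\<lambda>w. \<Prod>a\<in>Z-{z}. (w - a) ^ m a) holomorphic_on UNIV" by (intro holomorphic_intros)
      show "(\<Prod>a\<in>Z-{z}. (z - a) ^ m a) \<noteq> 0" using finZ by auto
      fix w :: complex assume "w \<noteq> z"
      have "poly p w = (w - z) ^ m z * (\<Prod>a\<in>Z-{z}. (w - a) ^ m a)"
        unfolding polyp by (rule prod.remove[OF finZ True])
      also have "(w - z) ^ m z = (w - z) powi (zorder f z)"
        using pos[OF True] by (simp add: m_def power_int_def)
      finally show "poly p w = (\<Prod>a\<in>Z-{z}. (w - a) ^ m a) * (w - z) powi (zorder f z)"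
        by (simp add: mult.commute)
    qed auto
  qed
  obtain h where h: "h holomorphic_on UNIV" "\<And>z. h z \<noteq> 0" "\<And>z. f z = h z * poly p z"
  proof (rule holomorphic_zorder_factorization[OF hol open_UNIV connected_UNIV holp])
    show "poly p z = 0 \<longleftrightarrow> f z = 0" for z by (rule p0)
    show "zorder (poly p) z = zorder f z" for z by (rule zo)
  qed (use that in auto)
  obtain Q where Q: "Q holomorphic_on UNIV" "\<And>z. exp (Q z) = h z"
    using holomorphic_logarithm_exists[OF convex_UNIV open_UNIV h(1) h(2) UNIV_I] by auto
  have "p \<noteq> 0"
  proof -
    have "infinite (UNIV :: complex set)" by (rule infinite_UNIV_char_0)
    then obtain z where "z \<notin> Z" using finZ ex_new_if_finite by blast
    then show ?thesis using p0[of z] by (auto simp: Z_def)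
  qed
  then show thesis using that[OF Q(1)] h(3) Q(2) by (simp add: mult.commute)
qed

lemma poly_bounded_below:
  fixes p :: "complex poly"
  assumes "p \<noteq> 0"
  obtains R c where "0 < c" "\<And>z. R \<le> norm z \<Longrightarrow> c \<le> norm (poly p z)"
proof (cases p)
  case (pCons a q)
  show thesis
  proof (cases "q = 0")
    case True
    then have "a \<noteq> 0" using assms pCons by simp
    then show thesis using that[of "norm a" 0] pCons True by simp
  next
    case False
    then obtain R where "\<And>z. R \<le> norm z \<Longrightarrow> 1 \<le> norm (poly (pCons a q) z)"
      using poly_infinity[OF False, of 1 a] by blast
    then show thesis using that[of 1 R] pCons by simp
  qed
qed

text \<open>A one-sided bound O(r^(3/2)) for \<open>Re Q\<close> makes \<open>M + 1 - Q\<close>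
  positive in a disc of radius 2r. Harnack's gradient estimate then gives Q' = O(sqrt r), and
  Cauchy's inequality for Q' gives Q'' = 0.\<close>

lemma entire_affine:
  assumes hol: "Q holomorphic_on UNIV" and R: "1 \<le> R" and C: "0 \<le> C"
    and le: "\<And>z. R \<le> norm z \<Longrightarrow> Re (Q z) \<le> C * norm z * sqrt (norm z)"
  obtains a b where "\<And>z. Q z = a * z + b"
proof -
  define D where "D = 1 + \<bar>Re (Q 0)\<bar>"
  have dQ: "norm (deriv Q w) \<le> 12 * (2 * C + D) * sqrt r" if r: "R \<le> r" and w: "norm w \<le> r" for r w
  proof -
    have r1: "1 \<le> r" using R r by linarith
    then have sq1: "1 \<le> sqrt r" by simp
    define M where "M = C * (2 * r) * sqrt (2 * r)"
    have M0: "0 \<le> M" using C r1 by (simp add: M_def)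
    have ReQ: "Re (Q x) \<le> M" if "x \<in> ball 0 (2 * r)" for x
    proof (rule maximum_real_frontier[of Q "cball 0 (2 * r)"])
      show "Q holomorphic_on interior (cball 0 (2 * r))" by (rule holomorphic_on_subset[OF hol]) simp
      show "continuous_on (closure (cball 0 (2 * r))) Q"
        by (rule holomorphic_on_imp_continuous_on, rule holomorphic_on_subset[OF hol]) simp
      show "Re (Q z) \<le> M" if "z \<in> frontier (cball 0 (2 * r))" for z
      proof -
        have "norm z = 2 * r" using that r1 by simp
        then show ?thesis using le[of z] r r1 by (simp add: M_def)
      qed
    qed (use that in auto)
    define H where "H = (\<lambda>x. of_real (M + 1) - Q x)"
    have holH: "H holomorphic_on S" for S
      unfolding H_def by (intro holomorphic_intros holomorphic_on_subset[OF hol]) auto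
    have posH: "0 < Re (H x)" if "x \<in> ball 0 (2 * r)" for x using ReQ[OF that] by (simp add: H_def)
    have H0: "Re (H 0) \<le> M + D" by (simp add: H_def D_def)
    have wb: "w \<in> ball 0 (2 * r)" using w r1 by simp
    have "Re (H w) \<le> (2 * r + dist 0 w) / (2 * r - dist 0 w) * Re (H 0)"
      by (rule harnack_ball(1)[OF holH posH wb])
    also have "\<dots> \<le> 3 * Re (H 0)"
    proof (rule mult_right_mono)
      show "(2 * r + dist 0 w) / (2 * r - dist 0 w) \<le> 3" using w r1 by (simp add: divide_le_eq)
      show "0 \<le> Re (H 0)" using posH[of 0] r1 by simp
    qed
    finally have Hw0: "Re (H w) \<le> 3 * Re (H 0)" .
    have Hw: "Re (H w) \<le> 3 * (M + D)" by (rule order_trans[OF Hw0]) (use H0 in simp)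
    have sub: "ball w r \<subseteq> ball 0 (2 * r)"
    proof
      fix x assume "x \<in> ball w r"
      then show "x \<in> ball 0 (2 * r)" using w norm_triangle_sub[of x w] by (simp add: dist_norm norm_minus_commute)
    qed
    have "norm (deriv H w) \<le> 2 * Re (H w) / r"
      by (rule harnack_ball(3)[OF holH _ centre_in_ball[THEN iffD2]]) (use posH sub r1 in auto)
    also have "\<dots> \<le> 2 * (3 * (M + D)) / r" using Hw r1 by (intro divide_right_mono) auto
    also have "\<dots> \<le> 12 * (2 * C + D) * sqrt r"
    proof -
      have s2: "sqrt 2 \<le> 2" by (rule real_le_lsqrt) auto
      have "M \<le> C * (2 * r) * (2 * sqrt r)"
        unfolding M_def real_sqrt_mult using C r1 s2 by (intro mult_left_mono mult_right_mono) auto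
      moreover have "D * 1 \<le> D * (r * sqrt r)"
        using mult_mono[OF r1 sq1] r1 by (intro mult_left_mono) (auto simp: D_def)
      ultimately have "M + D \<le> (4 * C + D) * (r * sqrt r)" by (simp add: algebra_simps)
      also have "\<dots> \<le> 2 * (2 * C + D) * (r * sqrt r)" using r1 by (intro mult_right_mono) (auto simp: D_def)
      finally have "2 * (3 * (M + D)) \<le> 12 * (2 * C + D) * sqrt r * r" by (simp add: algebra_simps)
      then show ?thesis using r1 by (simp add: divide_le_eq)
    qed
    also have "deriv H w = - deriv Q w"
    proof -
      have "(Q has_field_derivative deriv Q w) (at w)" using hol by (intro holomorphic_derivI[of Q UNIV]) auto
      then show ?thesis unfolding H_def by (intro DERIV_imp_deriv) (auto intro!: derivative_eq_intros)
    qed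
    finally show ?thesis by simp
  qed
  define K where "K = 12 * (2 * C + D)"
  have K0: "0 \<le> K" using C by (simp add: K_def D_def)
  have hold: "deriv Q holomorphic_on UNIV" by (intro holomorphic_deriv hol open_UNIV)
  have dd: "deriv (deriv Q) x = 0" for x
  proof (rule ccontr)
    assume nz: "deriv (deriv Q) x \<noteq> 0"
    define e where "e = norm (deriv (deriv Q) x)"
    have e: "0 < e" using nz by (simp add: e_def)
    \<comment> \<open>Cauchy's inequality reads \<open>e * r \<le> K * sqrt (2 * r)\<close>, which
      fails as soon as r exceeds 2 (K / e)^2. The other entries make the circle of radius
      \<open>r\<close> about \<open>x\<close> fit into the disc of radius 2r in which
      \<open>dQ\<close> applies.\<close>
    define r where "r = max (max R (norm x)) (2 * (K / e)\<^sup>2 + 1)"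
    have r: "R \<le> r" "norm x \<le> r" "2 * (K / e)\<^sup>2 < r" "0 < r" using R by (auto simp: r_def)
    have "norm ((deriv ^^ 1) (deriv Q) x) \<le> fact 1 * (K * sqrt (2 * r)) / r ^ 1"
    proof (rule Cauchy_inequality)
      show "deriv Q holomorphic_on ball x r" by (rule holomorphic_on_subset[OF hold]) simp
      show "continuous_on (cball x r) (deriv Q)"
        by (rule holomorphic_on_imp_continuous_on, rule holomorphic_on_subset[OF hold]) simp
      fix w assume "norm (x - w) = r"
      then have "norm w \<le> 2 * r" using r(2) norm_triangle_sub[of w x] by (simp add: norm_minus_commute)
      then show "norm (deriv Q w) \<le> K * sqrt (2 * r)" using dQ[of "2 * r" w] r by (simp add: K_def)
    qed (rule r(4))
    then have "e * r \<le> K * sqrt (2 * r)" using r(4) by (simp add: e_def field_simps)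
    then have "(e * r)\<^sup>2 \<le> (K * sqrt (2 * r))\<^sup>2" using e r(4) by (intro power_mono) auto
    then have "e\<^sup>2 * r * r \<le> K\<^sup>2 * 2 * r" using r(4) by (simp add: power_mult_distrib) (simp add: power2_eq_square mult_ac)
    then have "e\<^sup>2 * r \<le> K\<^sup>2 * 2" using r(4) by simp
    then have "r \<le> 2 * (K / e)\<^sup>2" using e by (simp add: power_divide field_simps)
    then show False using r(3) by simp
  qed
  obtain a where a: "\<And>x. deriv Q x = a"
  proof -
    have "(deriv Q has_field_derivative 0) (at x)" for x
      using holomorphic_derivI[OF hold open_UNIV UNIV_I, of x] dd by simp
    then have "\<exists>c. \<forall>x\<in>UNIV. deriv Q x = c"
      by (intro has_field_derivative_zero_constant) auto
    then show ?thesis using that by blast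
  qed
  have "((\<lambda>x. Q x - a * x) has_field_derivative 0) (at x)" for x
  proof -
    have "(Q has_field_derivative a) (at x)" using holomorphic_derivI[OF hol open_UNIV UNIV_I, of x] a by simp
    then show ?thesis by (auto intro!: derivative_eq_intros)
  qed
  then have "\<exists>b. \<forall>x\<in>UNIV. Q x - a * x = b"
    by (intro has_field_derivative_zero_constant) auto
  then obtain b where "\<And>x. Q x - a * x = b" by blast
  then show thesis using that[of a b] by (metis diff_eq_eq add.commute)
qed

context separated_values
begin

lemma E_not_bounded: "\<not> (\<forall>\<^sub>F s in at_top. \<forall>t\<in>{a..a + 2 * pi}. norm (E (Complex s t)) \<le> M)"
proof
  assume "\<forall>\<^sub>F s in at_top. \<forall>t\<in>{a..a + 2 * pi}. norm (E (Complex s t)) \<le> M"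
  then have "\<forall>\<^sub>F s::real in at_top. False"
    using eventually_A_ge[of "\<bar>M\<bar>"] eventually_gt_at_top[of s0]
  proof eventually_elim
    case (elim s)
    obtain t where t: "a \<le> t" "t < a + 2 * pi" "norm (E (Complex s t)) = exp (A s)"
      using A_attained[OF elim(3)] by blast
    then have "exp (A s) \<le> M" using elim(1) by force
    moreover have "1 + A s \<le> exp (A s)" by (rule exp_ge_add_one_self)
    ultimately show ?case using elim(2) by linarith
  qed
  then show False by simp
qed

text \<open>On the ray f stays within 1/2 of the value 1 and cannot wind around 0. Hence the
  imaginary part of \<open>L\<close> is bounded as well, which the bound for \<open>Re L\<close>
  alone would not give.\<close>

lemma ray_L_bounded:
  assumes "large (\<lambda>z. 1 / (1 - E z)) t t" "\<beta> < t" "t < \<alpha> + 2 * pi"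
  shows "\<exists>B. \<forall>\<^sub>F s in at_top. norm (L (Complex s t)) \<le> B"
proof -
  have "\<forall>\<^sub>F s in at_top. s0 < s \<and> norm (E (Complex s t) - 1) \<le> 1 / 2"
    using bounded_L[OF assms] eventually_gt_at_top[of s0] by eventually_elim auto
  then obtain S where S: "\<And>s. S \<le> s \<Longrightarrow> s0 < s \<and> norm (E (Complex s t) - 1) \<le> 1 / 2"
    by (auto simp: eventually_at_top_linorder)
  have in_s: "Complex s t \<in> strip s0 \<beta> (\<alpha> + 2 * pi)" if "S \<le> s" for s
    using S[OF that] assms by (simp add: strip_iff)
  have "continuous_on {S..} (L \<circ> (\<lambda>s. Complex s t))"
    by (rule continuous_on_compose, intro continuous_intros,
        rule holomorphic_on_imp_continuous_on, rule holomorphic_on_subset[OF holL]) (use in_s in auto)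
  then have cont: "continuous_on {S..} (\<lambda>s. L (Complex s t))" by (simp add: o_def)
  obtain B where "\<And>s. s \<in> {S..} \<Longrightarrow> norm (L (Complex s t)) \<le> B"
  proof (rule log_near_1_bounded[of "{S..}" "\<lambda>s. L (Complex s t)"])
    show "norm (exp (L (Complex s t)) - 1) \<le> 1 / 2" if "s \<in> {S..}" for s
      using S[of s] expL[OF in_s, of s] that by (simp add: E_def)
  qed (use cont in \<open>auto simp: connected_iff_interval\<close>)
  then show ?thesis unfolding eventually_at_top_linorder by (intro exI[of _ B] exI[of _ S]) auto
qed

lemma ray_L1_bounded:
  assumes "large (\<lambda>z. 1 / E z) t t" "- (pi / 2) < t" "t < pi / 2"
  shows "\<exists>B. \<forall>\<^sub>F s in at_top. norm (L1 (Complex s t)) \<le> B"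
proof -
  have "\<forall>\<^sub>F s in at_top. s0 < s \<and> norm (E (Complex s t)) \<le> 1 / 2"
    using bounded_L1[OF assms] eventually_gt_at_top[of s0] by eventually_elim auto
  then obtain S where S: "\<And>s. S \<le> s \<Longrightarrow> s0 < s \<and> norm (E (Complex s t)) \<le> 1 / 2"
    by (auto simp: eventually_at_top_linorder)
  have in_s: "Complex s t \<in> strip s0 (- (pi / 2)) (pi / 2)" if "S \<le> s" for s
    using S[OF that] assms by (simp add: strip_iff)
  have "continuous_on {S..} (L1 \<circ> (\<lambda>s. Complex s t))"
    by (rule continuous_on_compose, intro continuous_intros,
        rule holomorphic_on_imp_continuous_on, rule holomorphic_on_subset[OF holL1]) (use in_s in auto)
  then have cont: "continuous_on {S..} (\<lambda>s. L1 (Complex s t))" by (simp add: o_def)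
  obtain B where "\<And>s. s \<in> {S..} \<Longrightarrow> norm (L1 (Complex s t)) \<le> B"
  proof (rule log_near_1_bounded[of "{S..}" "\<lambda>s. L1 (Complex s t)"])
    show "norm (exp (L1 (Complex s t)) - 1) \<le> 1 / 2" if "s \<in> {S..}" for s
      using S[of s] expL1[OF in_s, of s] that by (simp add: E_def)
  qed (use cont in \<open>auto simp: connected_iff_interval\<close>)
  then show ?thesis unfolding eventually_at_top_linorder by (intro exI[of _ B] exI[of _ S]) auto
qed

text \<open>The gap from \<beta> to \<open>pi / 2\<close> is wider than \<open>pi / 3\<close>, and
  \<open>Re G\<close> is there a positive harmonic function of size at least a multiple of A;
  \<open>A_growth\<close> yields an exponent below 3.\<close>

lemma order_lt_3:
  assumes wide: "\<beta> < pi / 6" and hol: "G holomorphic_on strip s0 (- (pi / 2)) (pi / 2)"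
    and ge: "\<And>a b. \<lbrakk>\<beta> < a; b < pi / 2\<rbrakk> \<Longrightarrow> \<exists>c>0. \<forall>\<^sub>F s in at_top. \<forall>t\<in>{a..b}. c * A s \<le> Re (G (Complex s t))"
  shows "\<exists>\<sigma>>0. \<sigma> < 3 \<and> (\<exists>C>0. \<forall>\<^sub>F s in at_top. A s \<le> C * exp (\<sigma> * s))"
proof -
  \<comment> \<open>A third of the excess of the width \<open>pi / 2 - \<beta>\<close> over
    \<open>pi / 3\<close>: with \<open>d\<close> cut off at both ends, the width still exceeds
    \<open>pi / 3\<close> by \<open>d\<close>.\<close>
  define d where "d = (pi / 6 - \<beta>) / 3"
  define a b where "a = \<beta> + d" and "b = pi / 2 - d"
  have d: "0 < d" using wide by (simp add: d_def)
  have ba: "b - a = pi / 3 + d" by (simp add: a_def b_def d_def field_simps)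
  have ab: "a < b" "pi / 3 < b - a" using ba d pi_gt_zero by linarith+
  obtain c where c: "0 < c" "\<forall>\<^sub>F s in at_top. \<forall>t\<in>{a..b}. c * A s \<le> Re (G (Complex s t))"
    using ge[of a b] d by (auto simp: a_def b_def)
  have "\<forall>\<^sub>F s in at_top. s0 < s \<and> (\<forall>t\<in>{a..b}. c * A s \<le> Re (G (Complex s t)))"
    using c(2) eventually_gt_at_top[of s0] by eventually_elim auto
  then obtain S where S: "\<And>s. S \<le> s \<Longrightarrow> s0 < s \<and> (\<forall>t\<in>{a..b}. c * A s \<le> Re (G (Complex s t)))"
    unfolding eventually_at_top_linorder by blast
  have "\<exists>C>0. \<forall>\<^sub>F s in at_top. A s \<le> C * exp (pi / (b - a) * s)"
  proof (rule A_growth[OF ab(1), of G S])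
    have "strip S a b \<subseteq> strip s0 (- (pi / 2)) (pi / 2)"
      using S[of S] angles d by (auto simp: strip_iff a_def b_def)
    then show "G holomorphic_on strip S a b" by (rule holomorphic_on_subset[OF hol])
    show "0 < Re (G z)" if z: "z \<in> strip S a b" for z
    proof -
      have zz: "S \<le> Re z" "Im z \<in> {a..b}" using z by (auto simp: strip_iff)
      have "c * A (Re z) \<le> Re (G (Complex (Re z) (Im z)))" using S[OF zz(1)] zz(2) by blast
      moreover have "0 < c * A (Re z)" using c(1) A_pos S[OF zz(1)] by simp
      ultimately show ?thesis by simp
    qed
    show "\<forall>\<^sub>F s in at_top. c * A s \<le> Re (G (Complex s ((a + b) / 2)))"
      using c(2) by eventually_elim (use ab in auto)
  qed (rule c(1))
  moreover have "0 < pi / (b - a)" "pi / (b - a) < 3" using ab by (auto simp: field_simps)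
  ultimately show ?thesis by blast
qed

text \<open>Phragmen-Lindelof for exp (- G) across the given sector, slightly enlarged. It applies
  because \<sigma> < 3 and the opening is below \<open>pi / 3\<close>, so that their product is
  below \<open>pi\<close>.\<close>

lemma inner_lower_bound:
  assumes ab: "- (pi / 2) < a" "a < b" "b < pi / 2" "b - a < pi / 3"
    and \<sigma>: "0 < \<sigma>" "\<sigma> < 3" and C: "0 < C" "\<forall>\<^sub>F s in at_top. A s \<le> C * exp (\<sigma> * s)"
    and hol: "G holomorphic_on strip s0 (- (pi / 2)) (pi / 2)"
    and rays: "\<forall>\<^sub>F s in at_top. 0 \<le> Re (G (Complex s a))" "\<forall>\<^sub>F s in at_top. 0 \<le> Re (G (Complex s b))"
    and growth: "0 < K" "\<forall>\<^sub>F s in at_top. \<forall>t\<in>{a..b}. - Re (G (Complex s t)) \<le> K * A s"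
  shows "\<exists>M\<ge>0. \<forall>\<^sub>F s in at_top. \<forall>t\<in>{a..b}. - M \<le> Re (G (Complex s t))"
proof -
  have w: "\<sigma> * (b - a) < pi"
  proof -
    have "\<sigma> * (b - a) \<le> 3 * (b - a)" using \<sigma> ab by (intro mult_right_mono) auto
    also have "\<dots> < pi" using ab(4) by simp
    finally show ?thesis .
  qed
  have "\<exists>M. \<forall>\<^sub>F s in at_top. \<forall>t\<in>{a..b}. norm (exp (- G (Complex s t))) \<le> M"
  proof (rule half_strip_bounded[OF ab(2) w _ ab(1,3)])
    show "(\<lambda>z. exp (- G z)) holomorphic_on strip s0 (- (pi / 2)) (pi / 2)" by (intro holomorphic_intros hol)
    show "\<forall>\<^sub>F s in at_top. \<forall>t\<in>{a..b}. norm (exp (- G (Complex s t))) \<le> exp (K * C * exp (\<sigma> * s))"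
      using growth(2) C(2)
    proof eventually_elim
      case (elim s)
      have "K * A s \<le> K * (C * exp (\<sigma> * s))" using elim(2) growth(1) by (intro mult_left_mono) auto
      then show ?case using elim(1) by (force simp: mult.assoc)
    qed
    show "\<forall>\<^sub>F s in at_top. norm (exp (- G (Complex s a))) \<le> 1" "\<forall>\<^sub>F s in at_top. norm (exp (- G (Complex s b))) \<le> 1"
      using rays by (auto elim: eventually_mono)
  qed
  then obtain M where M: "\<forall>\<^sub>F s in at_top. \<forall>t\<in>{a..b}. norm (exp (- G (Complex s t))) \<le> M" by blast
  have "\<forall>\<^sub>F s in at_top. \<forall>t\<in>{a..b}. - ln (max 1 M) \<le> Re (G (Complex s t))"
    using M
  proof eventually_elim
    case (elim s)
    show ?case
    proof
      fix t assume "t \<in> {a..b}"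
      then have "exp (- Re (G (Complex s t))) \<le> max 1 M" using elim by force
      then have "- Re (G (Complex s t)) \<le> ln (max 1 M)" by (simp add: ln_ge_iff)
      then show "- ln (max 1 M) \<le> Re (G (Complex s t))" by simp
    qed
  qed
  then show ?thesis by (intro exI[of _ "ln (max 1 M)"]) auto
qed

lemma inner_angles:
  assumes "\<beta> - \<alpha> < pi / 3"
  obtains a b where "- (pi / 2) < a" "a < \<alpha>" "\<beta> < b" "b < pi / 2" "b - a < pi / 3"
proof -
  define d where "d = min ((pi / 3 - (\<beta> - \<alpha>)) / 3) (min ((\<alpha> + pi / 2) / 2) ((pi / 2 - \<beta>) / 2))"
  have d: "0 < d" "3 * d \<le> pi / 3 - (\<beta> - \<alpha>)" "2 * d \<le> \<alpha> + pi / 2" "2 * d \<le> pi / 2 - \<beta>"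
    using assms angles unfolding d_def by (auto simp: min_def field_simps)
  show thesis by (rule that[of "\<alpha> - d" "\<beta> + d"]) (use d in linarith)+
qed

text \<open>f would be bounded on full circles. Around the sector \<open>inner_lower_bound\<close>
  for - L1 bounds 1 - f; on the rest \<open>L\<close> is bounded on the two limiting rays and has
  small growth, so Phragmen-Lindelof bounds \<open>L\<close> and with it f.\<close>

lemma not_state_one:
  assumes wide: "\<beta> < pi / 6" and narrow: "\<beta> - \<alpha> < pi / 3"
    and st: "state1 (\<lambda>z. 1 / (1 - E z))" "state2 (\<lambda>z. 1 / (1 - E z))"
  shows False
proof -
  let ?J = "\<lambda>z. 1 / (1 - E z)"
  have holG: "(\<lambda>z. - L1 z) holomorphic_on strip s0 (- (pi / 2)) (pi / 2)" by (intro holomorphic_intros holL1)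
  have neg1: "\<exists>c>0. \<forall>\<^sub>F s in at_top. \<forall>t\<in>{a..b}. c * A s \<le> - Re (L1 (Complex s t))" if "\<beta> < a" "b < pi / 2" for a b
    by (rule large_neg_L1) (use st(1) that angles in \<open>auto simp: state1_def\<close>)
  have neg2: "\<exists>c>0. \<forall>\<^sub>F s in at_top. \<forall>t\<in>{a..b}. c * A s \<le> - Re (L1 (Complex s t))" if "- (pi / 2) < a" "b < \<alpha>" for a b
    by (rule large_neg_L1) (use st(2) that angles in \<open>auto simp: state2_def\<close>)
  obtain \<sigma> C where \<sigma>: "0 < \<sigma>" "\<sigma> < 3" and C: "0 < C" "\<forall>\<^sub>F s in at_top. A s \<le> C * exp (\<sigma> * s)"
    using order_lt_3[OF wide holG] neg1 by auto
  obtain a b where ab: "- (pi / 2) < a" "a < \<alpha>" "\<beta> < b" "b < pi / 2" "b - a < pi / 3"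
    using inner_angles[OF narrow] by blast
  have aleb: "a < b" using ab angles by linarith
  have nonneg: "\<forall>\<^sub>F s in at_top. 0 \<le> - Re (L1 (Complex s t))"
    if "\<exists>c>0. \<forall>\<^sub>F s in at_top. \<forall>u\<in>{t..t}. c * A s \<le> - Re (L1 (Complex s u))" for t
  proof -
    from that obtain c where c: "0 < c" "\<forall>\<^sub>F s in at_top. \<forall>u\<in>{t..t}. c * A s \<le> - Re (L1 (Complex s u))" by blast
    show ?thesis using c(2) eventually_A_ge[of 1]
    proof eventually_elim
      case (elim s)
      have "0 < c * A s" using c(1) elim(2) by simp
      then show ?case using elim(1) by simp
    qed
  qed
  have "\<exists>M\<ge>0. \<forall>\<^sub>F s in at_top. \<forall>t\<in>{a..b}. - M \<le> Re (- L1 (Complex s t))"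
  proof (rule inner_lower_bound[OF ab(1) aleb ab(4,5) \<sigma> C holG])
    show "\<forall>\<^sub>F s in at_top. 0 \<le> Re (- L1 (Complex s a))" using nonneg[OF neg2] ab by simp
    show "\<forall>\<^sub>F s in at_top. 0 \<le> Re (- L1 (Complex s b))" using nonneg[OF neg1] ab by simp
    show "\<forall>\<^sub>F s in at_top. \<forall>t\<in>{a..b}. - Re (- L1 (Complex s t)) \<le> 2 * A s"
      using eventually_A_ge[of 1] eventually_gt_at_top[of s0]
    proof eventually_elim
      case (elim s)
      show ?case
      proof
        fix t assume "t \<in> {a..b}"
        then have "Re (L1 (Complex s t)) \<le> A s + 1"
          using Re_L1_le[of "Complex s t"] elim ab by (auto simp: strip_iff)
        then show "- Re (- L1 (Complex s t)) \<le> 2 * A s" using elim(1) by simp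
      qed
    qed
  qed simp
  then obtain M where M: "\<forall>\<^sub>F s in at_top. \<forall>t\<in>{a..b}. - M \<le> Re (- L1 (Complex s t))" by blast
  have E1: "\<forall>\<^sub>F s in at_top. \<forall>t\<in>{a..b}. norm (E (Complex s t)) \<le> 1 + exp M"
    using M eventually_gt_at_top[of s0]
  proof eventually_elim
    case (elim s)
    show ?case
    proof
      fix t assume t: "t \<in> {a..b}"
      have "exp (L1 (Complex s t)) = 1 - E (Complex s t)"
        unfolding E_def by (rule expL1) (use t ab elim in \<open>auto simp: strip_iff\<close>)
      moreover have "Re (L1 (Complex s t)) \<le> M" using elim t by force
      ultimately have "norm (1 - E (Complex s t)) \<le> exp M" by (metis exp_le_cancel_iff norm_exp_eq_Re)
      then show "norm (E (Complex s t)) \<le> 1 + exp M"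
        using norm_triangle_ineq4[of 1 "1 - E (Complex s t)"] by simp
    qed
  qed
  have per: "norm (?J (Complex s (t + 2 * pi))) = norm (?J (Complex s t))" for s t by (simp add: E_period')
  have Jb: "large ?J b b" using st(1) ab by (simp add: state1_def)
  have "large ?J a a" using st(2) ab by (simp add: state2_def)
  from large_shift[OF this per] have Ja: "large ?J (a + 2 * pi) (a + 2 * pi)" .
  have rng: "\<beta> < b" "b < \<alpha> + 2 * pi" "\<beta> < a + 2 * pi" "a + 2 * pi < \<alpha> + 2 * pi" "b < a + 2 * pi"
    using ab angles by auto
  obtain B1 where B1: "\<forall>\<^sub>F s in at_top. norm (L (Complex s b)) \<le> B1" using ray_L_bounded[OF Jb rng(1,2)] by blast
  obtain B2 where B2: "\<forall>\<^sub>F s in at_top. norm (L (Complex s (a + 2 * pi))) \<le> B2" using ray_L_bounded[OF Ja rng(3,4)] by blast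
  have L_le: "Re (L z) \<le> A (Re z) + 1" if "z \<in> strip s0 \<beta> (\<alpha> + 2 * pi)" for z using Re_L_le[OF that] by simp
  have "\<exists>M. \<forall>\<^sub>F s in at_top. \<forall>t\<in>{b..a + 2 * pi}. norm (L (Complex s t)) \<le> M"
  proof (rule half_strip_bounded[OF rng(5) _ holL rng(1,4)])
    have "a + 2 * pi - b < 8 * pi" using ab angles pi_gt_zero by linarith
    then show "1 / 8 * (a + 2 * pi - b) < pi" by simp
    show "\<forall>\<^sub>F s in at_top. \<forall>t\<in>{b..a + 2 * pi}. norm (L (Complex s t)) \<le> exp (1 * exp (1 / 8 * s))"
      by (rule bounded_ray_growth[OF holL L_le rng(1,4) order_refl _ B1]) (use rng in auto)
    show "\<forall>\<^sub>F s in at_top. norm (L (Complex s b)) \<le> max B1 B2" using B1 by (rule eventually_mono) simp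
    show "\<forall>\<^sub>F s in at_top. norm (L (Complex s (a + 2 * pi))) \<le> max B1 B2" using B2 by (rule eventually_mono) simp
  qed
  then obtain M2 where M2: "\<forall>\<^sub>F s in at_top. \<forall>t\<in>{b..a + 2 * pi}. norm (L (Complex s t)) \<le> M2" by blast
  have "\<forall>\<^sub>F s in at_top. \<forall>t\<in>{a..a + 2 * pi}. norm (E (Complex s t)) \<le> max (1 + exp M) (exp M2)"
    using E1 M2 eventually_gt_at_top[of s0]
  proof eventually_elim
    case (elim s)
    show ?case
    proof
      fix t assume t: "t \<in> {a..a + 2 * pi}"
      show "norm (E (Complex s t)) \<le> max (1 + exp M) (exp M2)"
      proof (cases "t \<le> b")
        case True
        then show ?thesis using elim(1) t by force
      next
        case False
        have "exp (L (Complex s t)) = E (Complex s t)"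
          unfolding E_def by (rule expL) (use False t rng elim in \<open>auto simp: strip_iff\<close>)
        moreover have "norm (L (Complex s t)) \<le> M2" using elim False t by auto
        then have "Re (L (Complex s t)) \<le> M2" using complex_Re_le_cmod order_trans by blast
        ultimately have "norm (E (Complex s t)) \<le> exp M2" by (metis exp_le_cancel_iff norm_exp_eq_Re)
        then show ?thesis by simp
      qed
    qed
  qed
  then show False using E_not_bounded by blast
qed

lemma polar_coordinates:
  assumes "z \<noteq> 0"
  obtains t where "c \<le> t" "t < c + 2 * pi" "z = exp (Complex (ln (norm z)) t)"
proof -
  define t where "t = Arg2pi (z * cis (- c)) + c"
  have "z * cis (- c) = of_real (norm (z * cis (- c))) * exp (\<i> * of_real (Arg2pi (z * cis (- c))))"
    by (rule Arg2pi_eq)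
  then have "z * cis (- c) * cis c = of_real (norm z) * cis (Arg2pi (z * cis (- c))) * cis c"
    by (simp add: norm_mult cis_conv_exp)
  then have "z = exp (Complex (ln (norm z)) t)"
    using assms by (simp add: mult.assoc cis_mult t_def exp_eq_polar)
  then show thesis
    using that[of t] Arg2pi_ge_0 Arg2pi_lt_2pi[of "z * cis (- c)"] by (simp add: t_def)
qed

text \<open>\<open>Re L1\<close> is nonnegative on both sides of the sector and, by
  \<open>inner_lower_bound\<close>, bounded below inside it. After adding a constant it is positive
  on a strip of half-width \<open>b2\<close>, so Harnack's inequality spreads its size A from
  \<open>\<theta>\<^sub>1\<close> to all angles up to \<open>b1\<close>. There |1 - f| > 1 and f has
  no zeros; \<open>L\<close> excludes zeros elsewhere.\<close>

lemma state_infinity: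
  assumes wide: "\<beta> < pi / 6" and narrow: "\<beta> - \<alpha> < pi / 3" and st: "state1 E" "state2 E"
  shows "\<exists>R. \<forall>z. R \<le> norm z \<longrightarrow> f z \<noteq> 0" "\<exists>C>0. \<forall>\<^sub>F s in at_top. A s \<le> C * exp (3 / 2 * s)"
proof -
  have pos1: "\<exists>c>0. \<forall>\<^sub>F s in at_top. \<forall>t\<in>{a..b}. c * A s \<le> Re (L1 (Complex s t))" if "\<beta> < a" "b < pi / 2" for a b
    by (rule large_L1) (use st(1) that angles in \<open>auto simp: state1_def\<close>)
  have pos2: "\<exists>c>0. \<forall>\<^sub>F s in at_top. \<forall>t\<in>{a..b}. c * A s \<le> Re (L1 (Complex s t))" if "- (pi / 2) < a" "b < \<alpha>" for a b
    by (rule large_L1) (use st(2) that angles in \<open>auto simp: state2_def\<close>)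
  obtain \<sigma> C where \<sigma>: "0 < \<sigma>" "\<sigma> < 3" and C: "0 < C" "\<forall>\<^sub>F s in at_top. A s \<le> C * exp (\<sigma> * s)"
    using order_lt_3[OF wide holL1] pos1 by auto
  obtain a b where ab: "- (pi / 2) < a" "a < \<alpha>" "\<beta> < b" "b < pi / 2" "b - a < pi / 3"
    using inner_angles[OF narrow] by blast
  have aleb: "a < b" using ab angles by linarith
  \<comment> \<open>The entry \<open>pi / 3\<close> makes the strip at least 2/3 \<open>pi\<close>
    wide, which gives the growth exponent 3/2 and in the end a polynomial Q of degree below 2. The
    other entries make the strip contain \<open>a\<close>, \<open>b\<close> and
    \<open>\<theta>\<^sub>1\<close>.\<close>
  define b1 where "b1 = max (max b \<theta>\<^sub>1) (max (- a) (pi / 3))"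
  define b2 where "b2 = (b1 + pi / 2) / 2"
  have b1h: "b1 < pi / 2" unfolding b1_def max_less_iff_conj using ab \<theta>\<^sub>1 pi_gt_zero by linarith
  have b1: "b \<le> b1" "\<theta>\<^sub>1 \<le> b1" "- b1 \<le> a" "pi / 3 \<le> b1" "b1 < pi / 2" "b1 < b2" "b2 < pi / 2" "0 < b1"
  proof -
    show "b \<le> b1" "\<theta>\<^sub>1 \<le> b1" "pi / 3 \<le> b1" by (simp_all add: b1_def)
    have "- a \<le> b1" by (simp add: b1_def)
    then show "- b1 \<le> a" by linarith
    have "0 < pi / 3" by simp
    then show "0 < b1" using \<open>pi / 3 \<le> b1\<close> by linarith
  qed (use b1h in \<open>simp_all add: b2_def\<close>)
  have nonneg: "\<forall>\<^sub>F s in at_top. \<forall>u\<in>{x..y}. 0 \<le> Re (L1 (Complex s u))"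
    if "\<exists>c>0. \<forall>\<^sub>F s in at_top. \<forall>u\<in>{x..y}. c * A s \<le> Re (L1 (Complex s u))" for x y
  proof -
    from that obtain c where c: "0 < c" "\<forall>\<^sub>F s in at_top. \<forall>u\<in>{x..y}. c * A s \<le> Re (L1 (Complex s u))" by blast
    show ?thesis using c(2) eventually_A_ge[of 1]
    proof eventually_elim
      case (elim s)
      have "0 < c * A s" using c(1) elim(2) by simp
      then show ?case using elim(1) by (meson less_imp_le order_trans)
    qed
  qed
  have n1: "\<forall>\<^sub>F s in at_top. \<forall>u\<in>{b..b2}. 0 \<le> Re (L1 (Complex s u))"
    by (rule nonneg[OF pos1]) (use ab b1 in auto)
  have n2: "\<forall>\<^sub>F s in at_top. \<forall>u\<in>{- b2..a}. 0 \<le> Re (L1 (Complex s u))"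
    by (rule nonneg[OF pos2]) (use ab b1 in auto)
  \<comment> \<open>Phragmen-Lindelof for exp (- L1) needs a lower bound of size - K A for
    \<open>Re L1\<close>, while only an upper bound is known so far. Borel-Caratheodory, anchored at
    the ray \<open>b\<close> where \<open>Re L1\<close> is nonnegative, supplies it.\<close>
  obtain K where K: "0 < K" "\<forall>\<^sub>F s in at_top. \<forall>t\<in>{a..b1}. norm (L1 (Complex s t) - L1 (Complex s b)) \<le> K * A s"
  proof -
    have "\<forall>\<^sub>F s in at_top. - A s \<le> Re (L1 (Complex s b))"
      using n1 eventually_A_ge[of 0] by eventually_elim (use b1 ab in force)
    then show ?thesis
      using window_growth[OF holL1 Re_L1_le ab(1) b1(5), of b] aleb b1(1) that by auto
  qed
  have "\<exists>M\<ge>0. \<forall>\<^sub>F s in at_top. \<forall>t\<in>{a..b}. - M \<le> Re (L1 (Complex s t))"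
  proof (rule inner_lower_bound[OF ab(1) aleb ab(4,5) \<sigma> C holL1])
    show "\<forall>\<^sub>F s in at_top. 0 \<le> Re (L1 (Complex s a))" using n2 by eventually_elim (use b1 in auto)
    show "\<forall>\<^sub>F s in at_top. 0 \<le> Re (L1 (Complex s b))" using n1 by eventually_elim (use b1 in auto)
    show "\<forall>\<^sub>F s in at_top. \<forall>t\<in>{a..b}. - Re (L1 (Complex s t)) \<le> K * A s"
      using K(2) n1
    proof eventually_elim
      case (elim s)
      show ?case
      proof
        fix t assume t: "t \<in> {a..b}"
        then have "norm (L1 (Complex s t) - L1 (Complex s b)) \<le> K * A s" using elim(1) b1 by auto
        then have "\<bar>Re (L1 (Complex s t) - L1 (Complex s b))\<bar> \<le> K * A s" using abs_Re_le_cmod order_trans by blast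
        moreover have "0 \<le> Re (L1 (Complex s b))" using elim(2) b1 by auto
        ultimately show "- Re (L1 (Complex s t)) \<le> K * A s" by simp
      qed
    qed
  qed (rule K(1))
  then obtain M where M: "0 \<le> M" "\<forall>\<^sub>F s in at_top. \<forall>t\<in>{a..b}. - M \<le> Re (L1 (Complex s t))" by blast
  have "\<forall>\<^sub>F s in at_top. s0 < s \<and> (\<forall>t\<in>{- b2..b2}. - M \<le> Re (L1 (Complex s t)))"
    using M(2) n1 n2 eventually_gt_at_top[of s0]
  proof eventually_elim
    case (elim s)
    have "- M \<le> Re (L1 (Complex s t))" if t: "t \<in> {- b2..b2}" for t
    proof -
      consider "t \<le> a" | "t \<in> {a..b}" | "b \<le> t" by fastforce
      then show ?thesis
      proof cases
        case 1 then show ?thesis using elim(3) t M(1) by force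
      next
        case 2 then show ?thesis using elim(1) by blast
      next
        case 3 then show ?thesis using elim(2) t M(1) by force
      qed
    qed
    then show ?case using elim(4) by blast
  qed
  then obtain S where S: "\<And>s. S \<le> s \<Longrightarrow> s0 < s \<and> (\<forall>t\<in>{- b2..b2}. - M \<le> Re (L1 (Complex s t)))"
    unfolding eventually_at_top_linorder by blast
  define G where "G = (\<lambda>z. L1 z + of_real (M + 1))"
  have holG: "G holomorphic_on strip S (- b2) b2"
    unfolding G_def by (intro holomorphic_intros holomorphic_on_subset[OF holL1])
      (use S[of S] b1 in \<open>auto simp: strip_iff\<close>)
  have posG: "0 < Re (G z)" if z: "z \<in> strip S (- b2) b2" for z
  proof -
    have zz: "S \<le> Re z" "Im z \<in> {- b2..b2}" using z by (auto simp: strip_iff)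
    have "- M \<le> Re (L1 (Complex (Re z) (Im z)))" using S[OF zz(1)] zz(2) by blast
    then show ?thesis by (simp add: G_def)
  qed
  have sub: "- b2 < - b1" using b1 by simp
  obtain D where D: "0 < D"
    "\<And>G z w. \<lbrakk>G holomorphic_on rect 1 (- b2) b2; \<And>x. x \<in> rect 1 (- b2) b2 \<Longrightarrow> 0 < Re (G x);
        z \<in> vseg (- b1) b1; w \<in> vseg (- b1) b1\<rbrakk> \<Longrightarrow> Re (G w) \<le> D * Re (G z)"
    using harnack_convex[OF open_convex_rect compact_vseg vseg_subset_rect[OF zero_less_one sub b1(6)]] by metis
  obtain c where c: "0 < c" "\<forall>\<^sub>F s in at_top. \<forall>t\<in>{\<theta>\<^sub>1..\<theta>\<^sub>1}. c * A s \<le> Re (L1 (Complex s t))"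
    using pos1[OF \<theta>\<^sub>1(1,2)] by auto
  define c' where "c' = c / D / 2"
  have c': "0 < c'" using c(1) D(1) by (simp add: c'_def)
  have low: "\<forall>\<^sub>F s in at_top. \<forall>t\<in>{- b1..b1}. c' * A s \<le> Re (L1 (Complex s t))"
    using c(2) eventually_ge_at_top[of "S + 1"] eventually_A_ge[of "(M + 1) / c'"]
  proof eventually_elim
    case (elim s)
    show ?case
    proof
      fix t assume t: "t \<in> {- b1..b1}"
      have eq: "Complex 0 u + of_real s = Complex s u" for u by (simp add: complex_eq_iff)
      have "Re (G (Complex 0 \<theta>\<^sub>1 + of_real s)) \<le> D * Re (G (Complex 0 t + of_real s))"
      proof (rule D(2)[OF holomorphic_window[OF holG elim(2)]])
        show "0 < Re (G (x + of_real s))" if "x \<in> rect 1 (- b2) b2" for x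
          by (rule posG) (use that elim(2) in \<open>auto simp: strip_iff rect_iff\<close>)
      qed (use t b1 \<theta>\<^sub>1 angles ab in \<open>auto simp: vseg_iff\<close>)
      then have "Re (G (Complex s \<theta>\<^sub>1)) \<le> D * Re (G (Complex s t))" by (simp only: eq)
      moreover have "c * A s \<le> Re (G (Complex s \<theta>\<^sub>1))" using elim(1) M(1) by (simp add: G_def)
      ultimately have "c * A s \<le> D * Re (G (Complex s t))" by linarith
      then have "2 * c' * A s \<le> Re (G (Complex s t))" using D(1) by (simp add: c'_def field_simps)
      moreover have "M + 1 \<le> c' * A s" using elim(3) c' by (simp add: field_simps)
      ultimately show "c' * A s \<le> Re (L1 (Complex s t))" by (simp add: G_def)
    qed
  qed
  have "\<forall>\<^sub>F s in at_top. s0 < s \<and> (\<forall>t\<in>{- b1..b1}. c' * A s \<le> Re (L1 (Complex s t)))"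
    using low eventually_gt_at_top[of s0] by eventually_elim auto
  then obtain S1 where S1: "\<And>s. S1 \<le> s \<Longrightarrow> s0 < s \<and> (\<forall>t\<in>{- b1..b1}. c' * A s \<le> Re (L1 (Complex s t)))"
    unfolding eventually_at_top_linorder by blast
  have pos: "0 < Re (L1 (Complex s t))" if "S1 \<le> s" "- b1 \<le> t" "t \<le> b1" for s t
  proof -
    have "0 < c' * A s" using c' A_pos S1[OF that(1)] by simp
    then show ?thesis using S1[OF that(1)] that by force
  qed
  show "\<exists>C>0. \<forall>\<^sub>F s in at_top. A s \<le> C * exp (3 / 2 * s)"
  proof -
    have "\<exists>C>0. \<forall>\<^sub>F s in at_top. A s \<le> C * exp (pi / (b1 - (- b1)) * s)"
    proof (rule A_growth[of "- b1" b1 L1 S1, OF _ _ _ c'])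
      show "L1 holomorphic_on strip S1 (- b1) b1"
        by (rule holomorphic_on_subset[OF holL1]) (use S1[of S1] b1 in \<open>auto simp: strip_iff\<close>)
      show "0 < Re (L1 z)" if "z \<in> strip S1 (- b1) b1" for z
        using pos[of "Re z" "Im z"] that by (simp add: strip_iff)
      show "\<forall>\<^sub>F s in at_top. c' * A s \<le> Re (L1 (Complex s ((- b1 + b1) / 2)))"
        using low by eventually_elim (use b1 in auto)
    qed (use b1 in auto)
    then obtain C' where C': "0 < C'" "\<forall>\<^sub>F s in at_top. A s \<le> C' * exp (pi / (b1 - (- b1)) * s)" by blast
    have "\<forall>\<^sub>F s in at_top. A s \<le> C' * exp (3 / 2 * s)"
      using C'(2) eventually_ge_at_top[of 0]
    proof eventually_elim
      case (elim s)
      have "pi / (b1 - (- b1)) \<le> 3 / 2" using b1(4,8) by (simp add: field_simps)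
      then have "pi / (b1 - (- b1)) * s \<le> 3 / 2 * s" using elim(2) by (rule mult_right_mono)
      then have "C' * exp (pi / (b1 - (- b1)) * s) \<le> C' * exp (3 / 2 * s)" using C'(1) by (intro mult_left_mono) auto
      then show ?case using elim(1) by linarith
    qed
    then show ?thesis using C'(1) by blast
  qed
  have "f z \<noteq> 0" if z: "exp S1 \<le> norm z" for z
  proof -
    have z0: "z \<noteq> 0" using z exp_gt_zero[of S1] by (metis norm_zero not_le)
    obtain t where t: "\<alpha> \<le> t" "t < \<alpha> + 2 * pi" "z = exp (Complex (ln (norm z)) t)"
      using polar_coordinates[OF z0] by blast
    define s where "s = ln (norm z)"
    have s: "S1 \<le> s" using z z0 by (simp add: s_def ln_ge_iff)
    have zE: "f z = E (Complex s t)" using t(3) by (simp add: E_def s_def)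
    show ?thesis
    proof (cases "t \<le> \<beta>")
      case True
      have tb: "- b1 \<le> t" "t \<le> b1" using True t ab b1 by linarith+
      have "0 < Re (L1 (Complex s t))" by (rule pos[OF s tb])
      moreover have "exp (L1 (Complex s t)) = 1 - E (Complex s t)"
        unfolding E_def by (rule expL1) (use S1[OF s] tb b1 in \<open>auto simp: strip_iff\<close>)
      ultimately have "1 < norm (1 - E (Complex s t))" by (metis norm_exp_eq_Re one_less_exp_iff)
      then show ?thesis using zE by auto
    next
      case False
      have "exp (L (Complex s t)) = E (Complex s t)"
        unfolding E_def by (rule expL) (use S1[OF s] False t in \<open>auto simp: strip_iff\<close>)
      then show ?thesis using zE by (metis exp_not_eq_zero)
    qed
  qed
  then show "\<exists>R. \<forall>z. R \<le> norm z \<longrightarrow> f z \<noteq> 0" by blast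
qed

lemma conclusion_infinity:
  assumes "\<beta> < pi / 6" "\<beta> - \<alpha> < pi / 3" "state1 E" "state2 E"
  shows "\<exists>P a. \<forall>z. f z = poly P z * exp (a * z)"
proof -
  obtain R0 where R0: "\<And>z. R0 \<le> norm z \<Longrightarrow> f z \<noteq> 0" using state_infinity(1)[OF assms] by blast
  obtain C where C: "0 < C" "\<forall>\<^sub>F s in at_top. A s \<le> C * exp (3 / 2 * s)" using state_infinity(2)[OF assms] by blast
  obtain S where S: "\<And>s. S \<le> s \<Longrightarrow> A s \<le> C * exp (3 / 2 * s)" using C(2) by (auto simp: eventually_at_top_linorder)
  have "finite {z\<in>cball 0 R0. f z = 0}"
    by (rule holomorphic_compact_finite_zeros[OF holf open_UNIV connected_UNIV]) (use nonconst in auto)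
  moreover have "{z. f z = 0} \<subseteq> {z\<in>cball 0 R0. f z = 0}" using R0 by force
  ultimately have fin: "finite {z. f z = 0}" by (rule finite_subset[rotated])
  obtain p Q where pQ: "Q holomorphic_on UNIV" "p \<noteq> 0" "\<And>z. f z = poly p z * exp (Q z)"
    by (rule entire_finite_zeros_factor[OF holf fin]) (rule that)
  obtain R1 c where c: "0 < c" "\<And>z. R1 \<le> norm z \<Longrightarrow> c \<le> norm (poly p z)"
    by (rule poly_bounded_below[OF pQ(2)]) (rule that)
  define R where "R = max 1 (max R1 (exp (max S (s0 + 1))))"
  have R: "1 \<le> R" "R1 \<le> R" "exp (max S (s0 + 1)) \<le> R" by (auto simp: R_def)
  have growth: "Re (Q z) \<le> (C + \<bar>ln c\<bar>) * norm z * sqrt (norm z)" if z: "R \<le> norm z" for z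
  proof -
    define s where "s = ln (norm z)"
    have nz: "1 \<le> norm z" using R z by linarith
    have "0 < norm z" using nz by linarith
    then have es: "exp s = norm z" unfolding s_def by (rule exp_ln)
    have "exp (max S (s0 + 1)) \<le> exp s" using R(3) z es by linarith
    then have s: "S \<le> s" "s0 < s" by auto
    have "norm (f z) \<le> exp (A s)" by (rule norm_f_le[OF s(2)]) (simp add: es)
    then have fz: "norm (poly p z) * exp (Re (Q z)) \<le> exp (A s)" by (simp add: pQ(3) norm_mult)
    have "c \<le> norm (poly p z)" using c(2) R z by simp
    then have "c * exp (Re (Q z)) \<le> norm (poly p z) * exp (Re (Q z))" by (rule mult_right_mono) simp
    then have "c * exp (Re (Q z)) \<le> exp (A s)" using fz by linarith
    then have "ln (c * exp (Re (Q z))) \<le> A s" using c(1) by (metis exp_gt_zero ln_exp ln_mono mult_pos_pos)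
    then have "Re (Q z) \<le> A s - ln c" using c(1) by (simp add: ln_mult)
    also have "A s \<le> C * exp (3 / 2 * s)" by (rule S[OF s(1)])
    also have "exp (3 / 2 * s) = norm z * sqrt (norm z)"
    proof -
      have "sqrt (exp s) = exp (s / 2)" by (rule real_sqrt_unique) (simp_all add: power2_eq_square flip: exp_add)
      then show ?thesis unfolding es[symmetric] by (simp flip: exp_add)
    qed
    also have "C * (norm z * sqrt (norm z)) - ln c \<le> C * (norm z * sqrt (norm z)) + \<bar>ln c\<bar> * (norm z * sqrt (norm z))"
    proof -
      have "1 * 1 \<le> norm z * sqrt (norm z)" using nz by (intro mult_mono) auto
      then have "\<bar>ln c\<bar> * 1 \<le> \<bar>ln c\<bar> * (norm z * sqrt (norm z))" by (intro mult_left_mono) auto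
      then show ?thesis by linarith
    qed
    finally show ?thesis by (simp add: algebra_simps)
  qed
  obtain a b where Q: "\<And>z. Q z = a * z + b"
    by (rule entire_affine[OF pQ(1) R(1) _ growth]) (use C(1) in auto)
  have "f z = poly (smult (exp b) p) z * exp (a * z)" for z
    by (simp add: pQ(3) Q exp_add)
  then show ?thesis by blast
qed

end

section \<open>The state 0\<close>

text \<open>If \<open>log f\<close> has real part above \<open>1\<close> at the top point of a disc in which it is very negative at the
  centre, then enlarging a smaller disc until it touches \<open>Re log f = 0\<close>, Hopf's lemma bounds the
  derivative of \<open>log f\<close> below at the touching point. So \<open>log f\<close> is nearly affine there and takes a value in
  \<open>2\<pi>i\<int>\<close> on either side of the touching point along its level curve; one of the two lies below.\<close>

lemma unit_point_below:
  assumes r: "0 < r" and B: "0 < B" and \<kappa>: "0 < \<kappa>"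
  shows "\<exists>A0. \<forall>L c A. A0 \<le> A \<longrightarrow> L holomorphic_on ball c (3 * r) \<longrightarrow>
    (\<forall>z\<in>ball c (3 * r). norm (L z - L c) \<le> B * A) \<longrightarrow> Re (L c) \<le> - \<kappa> * A \<longrightarrow>
    1 < Re (L (c + \<i> * of_real r)) \<longrightarrow> (\<exists>z\<in>ball c (3 * r). Im z < Im c + r \<and> exp (L z) = 1)"
proof -
  \<comment> \<open>\<open>C1 * A\<close> and \<open>C2 * A\<close> are Cauchy bounds, from discs of
    radius r/2, for the first two derivatives of L; \<open>\<mu> * A\<close> is the lower bound for
    the first derivative at the touching point, and \<open>C4 / A\<close> bounds the displacement
    from there.\<close>
  define C1 where "C1 = 2 * B / r"
  define C2 where "C2 = 8 * B / r\<^sup>2"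
  define \<mu> where "\<mu> = \<kappa> / (4 * r)"
  define C4 where "C4 = 2 * pi / \<mu> + 1 / (2 * C1)"
  have pos: "0 < C1" "0 < C2" "0 < \<mu>" "0 < C4"
    using r B \<kappa> by (auto simp: C1_def C2_def \<mu>_def C4_def intro!: add_pos_pos)
  define A0 where "A0 = max 1 (max (C4 / r) (2 * C1 * C2 * C4\<^sup>2 / \<mu>))"
  show ?thesis
  proof (intro exI[of _ A0] allI impI)
    fix L :: "complex \<Rightarrow> complex" and c A
    assume A0: "A0 \<le> A" and hol: "L holomorphic_on ball c (3 * r)"
      and bd: "\<forall>z\<in>ball c (3 * r). norm (L z - L c) \<le> B * A"
      and ctr: "Re (L c) \<le> - \<kappa> * A" and top: "1 < Re (L (c + \<i> * of_real r))"
    have A: "1 \<le> A" "C4 / r \<le> A" "2 * C1 * C2 * C4\<^sup>2 / \<mu> \<le> A" "0 < A" using A0 by (auto simp: A0_def)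
    have sub: "cball z (r / 2) \<subseteq> ball c (3 * r)" if "z \<in> cball c (2 * r)" for z
    proof
      fix x assume "x \<in> cball z (r / 2)"
      then show "x \<in> ball c (3 * r)" using that dist_triangle[of c x z] r by simp
    qed
    have der: "norm ((deriv ^^ n) (\<lambda>z. L z - L c) z) \<le> fact n * (B * A) / (r / 2) ^ n"
      if z: "z \<in> cball c (2 * r)" for n z
    proof (rule Cauchy_inequality)
      have h: "(\<lambda>z. L z - L c) holomorphic_on cball z (r / 2)"
        by (intro holomorphic_intros holomorphic_on_subset[OF hol sub[OF z]])
      show "(\<lambda>z. L z - L c) holomorphic_on ball z (r / 2)" by (rule holomorphic_on_subset[OF h]) auto
      show "continuous_on (cball z (r / 2)) (\<lambda>z. L z - L c)" by (rule holomorphic_on_imp_continuous_on[OF h])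
      show "norm (L x - L c) \<le> B * A" if "norm (z - x) = r / 2" for x
        using bd sub[OF z] that by (auto simp: dist_norm)
    qed (use r in simp)
    define G where "G = (\<lambda>z. L z - L c)"
    have holG: "G holomorphic_on ball c (3 * r)" unfolding G_def by (intro holomorphic_intros hol)
    have d1: "norm (deriv G z) \<le> C1 * A" if "z \<in> cball c (2 * r)" for z
      using der[OF that, of 1] r by (simp add: C1_def G_def field_simps)
    have d2: "norm (deriv (deriv G) z) \<le> C2 * A" if "z \<in> cball c (2 * r)" for z
      using der[OF that, of 2] r by (simp add: C2_def G_def field_simps numeral_2_eq_2 power2_eq_square)
    have in3: "z \<in> ball c (3 * r)" if "z \<in> cball c (2 * r)" for z using that r by auto
    have dG: "(G has_field_derivative deriv G z) (at z)" if "z \<in> cball c (2 * r)" for z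
      by (rule holomorphic_derivI[OF holG open_ball in3[OF that]])
    have ddG: "(deriv G has_field_derivative deriv (deriv G) z) (at z)" if "z \<in> cball c (2 * r)" for z
      by (rule holomorphic_derivI[OF holomorphic_deriv[OF holG open_ball] open_ball in3[OF that]])
    have lip: "norm (L w - L z) \<le> C1 * A * norm (w - z)" if "z \<in> cball c (2 * r)" "w \<in> cball c (2 * r)" for z w
    proof -
      have "norm (G w - G z) \<le> C1 * A * norm (w - z)"
        by (rule field_differentiable_bound[OF convex_cball _ d1 that(2,1)])
           (use dG has_field_derivative_at_within in blast)+
      then show ?thesis by (simp add: G_def)
    qed
    have taylor: "norm (L w - L z - deriv G z * (w - z)) \<le> C2 * A * (norm (w - z))\<^sup>2"
      if z: "z \<in> cball c (2 * r)" and w: "w \<in> cball c (2 * r)" for z w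
    proof -
      have "norm ((\<lambda>i. (deriv ^^ i) G) 0 w - (\<Sum>i\<le>1. (\<lambda>i. (deriv ^^ i) G) i z * (w - z) ^ i / fact i))
          \<le> C2 * A * norm (w - z) ^ Suc 1 / fact 1"
      proof (rule complex_Taylor[OF convex_cball _ _ z w])
        fix i x assume x: "x \<in> cball c (2 * r)" and i: "i \<le> (1::nat)"
        have "((deriv ^^ i) G has_field_derivative (deriv ^^ Suc i) G x) (at x)"
          using dG[OF x] ddG[OF x] i by (cases i) auto
        then show "((deriv ^^ i) G has_field_derivative (deriv ^^ Suc i) G x) (at x within cball c (2 * r))"
          by (rule has_field_derivative_at_within)
      next
        fix x assume x: "x \<in> cball c (2 * r)"
        show "norm ((deriv ^^ Suc 1) G x) \<le> C2 * A" using d2[OF x] by simp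
      qed
      then show ?thesis by (simp add: G_def algebra_simps power2_eq_square)
    qed
    define Z where "Z = {z \<in> cball c r. 0 \<le> Re (L z)}"
    have contL: "continuous_on (cball c r) (\<lambda>z. Re (L z))"
      by (intro continuous_on_Re holomorphic_on_imp_continuous_on holomorphic_on_subset[OF hol]) (use r in auto)
    have "closed Z"
    proof -
      have "Z = cball c r \<inter> (\<lambda>z. Re (L z)) -` {0..}" by (auto simp: Z_def)
      then show ?thesis using continuous_closed_preimage[OF contL closed_cball closed_atLeast] by simp
    qed
    moreover have "c + \<i> * of_real r \<in> Z" using top r by (simp add: Z_def dist_norm norm_mult)
    ultimately obtain \<zeta> where \<zeta>: "\<zeta> \<in> Z" "\<And>y. y \<in> Z \<Longrightarrow> dist c \<zeta> \<le> dist c y"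
      using distance_attains_inf[of Z c] by blast
    define p where "p = dist c \<zeta>"
    have \<zeta>r: "p \<le> r" "0 \<le> Re (L \<zeta>)" using \<zeta>(1) by (auto simp: Z_def p_def)
    have neg: "Re (L z) < 0" if "dist c z < p" for z
    proof (rule ccontr)
      assume "\<not> Re (L z) < 0"
      then have "z \<in> Z" using that \<zeta>r by (simp add: Z_def)
      then show False using \<zeta>(2) that by (simp add: p_def leD)
    qed
    have "\<not> 0 \<le> Re (L c)" using ctr mult_pos_pos[OF \<kappa> A(4)] by simp
    then have p: "0 < p" using \<zeta>r(2) by (auto simp: p_def)
    have nonpos: "Re (L z) \<le> 0" if z: "dist c z \<le> p" for z
    proof (rule field_le_epsilon)
      fix e :: real assume e: "0 < e"
      define u where "u = min 1 (e / (C1 * A * p))"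
      have u: "0 < u" "u \<le> 1" "C1 * A * (u * p) \<le> e"
      proof -
        show "0 < u" "u \<le> 1" using e pos A p by (auto simp: u_def)
        have "u \<le> e / (C1 * A * p)" by (simp add: u_def)
        then show "C1 * A * (u * p) \<le> e" using pos A p by (simp add: field_simps)
      qed
      define w where "w = z + of_real u * (c - z)"
      have "c - w = of_real (1 - u) * (c - z)" by (simp add: w_def algebra_simps)
      then have cw: "dist c w = (1 - u) * dist c z" using u by (simp add: dist_norm norm_mult del: of_real_diff)
      have "(1 - u) * dist c z \<le> (1 - u) * p" using z u by (intro mult_left_mono) auto
      also have "\<dots> < p" using u p by (simp add: algebra_simps)
      finally have wp: "dist c w < p" unfolding cw .
      have "norm (z - w) = u * dist c z" using u by (simp add: w_def norm_mult dist_norm norm_minus_commute)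
      also have "\<dots> \<le> u * p" using z u by (intro mult_left_mono) auto
      finally have zw: "norm (z - w) \<le> u * p" .
      have "Re (L z) - Re (L w) \<le> norm (L z - L w)" using complex_Re_le_cmod[of "L z - L w"] by simp
      also have "\<dots> \<le> C1 * A * norm (z - w)" by (rule lip) (use z wp \<zeta>r r in auto)
      also have "\<dots> \<le> C1 * A * (u * p)" using zw pos A by (intro mult_left_mono) auto
      also have "\<dots> \<le> e" by (rule u(3))
      finally show "Re (L z) \<le> 0 + e" using neg[OF wp] by simp
    qed
    have Re\<zeta>: "Re (L \<zeta>) = 0" using nonpos[of \<zeta>] \<zeta>r by (simp add: p_def)
    \<comment> \<open>\<open>Re L\<close> rises from at most 0 at height p to above 1 at height r
      with slope at most \<open>C1 * A\<close>; this is the room left for the displacement.\<close>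
    have gap: "1 / (C1 * A) < r - p"
    proof -
      have i1: "dist c (c + \<i> * of_real p) \<le> p" using p by (simp add: dist_norm norm_mult)
      have "Re (L (c + \<i> * of_real r)) - Re (L (c + \<i> * of_real p)) \<le> norm (L (c + \<i> * of_real r) - L (c + \<i> * of_real p))"
        using complex_Re_le_cmod[of "L (c + \<i> * of_real r) - L (c + \<i> * of_real p)"] by simp
      also have "\<dots> \<le> C1 * A * norm ((c + \<i> * of_real r) - (c + \<i> * of_real p))"
        by (rule lip) (use r p \<zeta>r in \<open>auto simp: dist_norm norm_mult\<close>)
      also have "(c + \<i> * of_real r) - (c + \<i> * of_real p) = \<i> * of_real (r - p)" by (simp add: algebra_simps)
      also have "norm (\<i> * of_real (r - p)) = r - p" using \<zeta>r(1) by (simp only: norm_mult norm_of_real) simp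
      finally have "1 < C1 * A * (r - p)" using top nonpos[OF i1] by linarith
      then show ?thesis using pos A by (simp add: divide_less_eq mult.commute)
    qed
    have \<zeta>2: "\<zeta> \<in> cball c (2 * r)" using \<zeta>r r by (simp add: p_def)
    define D where "D = deriv G \<zeta>"
    have Dlow: "\<mu> * A \<le> norm D"
    proof -
      \<comment> \<open>Quantitative Hopf lemma: Harnack from the centre gives - Re L \<ge> u
        \<kappa> A / 2 at relative distance u from the touching point, and u is so small that the
        Taylor remainder consumes at most half of it. The rest bounds the derivative from
        below.\<close>
      define u where "u = min 1 (\<kappa> / (4 * C2 * r\<^sup>2))"
      have u: "0 < u" "u \<le> 1" "C2 * u * r\<^sup>2 \<le> \<kappa> / 4"
      proof -
        show "0 < u" "u \<le> 1" using \<kappa> pos r by (auto simp: u_def)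
        have "u \<le> \<kappa> / (4 * C2 * r\<^sup>2)" by (simp add: u_def)
        then show "C2 * u * r\<^sup>2 \<le> \<kappa> / 4" using pos r by (simp add: field_simps)
      qed
      define w where "w = \<zeta> + of_real u * (c - \<zeta>)"
      have "c - w = of_real (1 - u) * (c - \<zeta>)" by (simp add: w_def algebra_simps)
      then have cw: "dist c w = (1 - u) * p" using u by (simp add: dist_norm norm_mult p_def del: of_real_diff)
      have wp: "w \<in> ball c p" using cw mult_pos_pos[OF p u(1)] by (simp add: algebra_simps)
      have holL: "(\<lambda>z. - L z) holomorphic_on ball c p"
        by (intro holomorphic_intros holomorphic_on_subset[OF hol]) (use \<zeta>r r in auto)
      have "(p - dist c w) / (p + dist c w) * Re (- L c) \<le> Re (- L w)"
        by (rule harnack_ball(2)[OF holL _ wp]) (use neg in auto)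
      moreover have "u / 2 * (\<kappa> * A) \<le> (p - dist c w) / (p + dist c w) * Re (- L c)"
      proof (rule mult_mono)
        have eq: "(p - dist c w) / (p + dist c w) = u / (2 - u)"
          using p u unfolding cw by (simp add: field_simps)
        show "u / 2 \<le> (p - dist c w) / (p + dist c w)" unfolding eq using u by (intro divide_left_mono) auto
        show "\<kappa> * A \<le> Re (- L c)" using ctr by simp
        show "0 \<le> (p - dist c w) / (p + dist c w)" unfolding eq using u by simp
      qed (use \<kappa> A in simp)
      ultimately have a: "u / 2 * (\<kappa> * A) \<le> - Re (L w)" by simp
      have zw: "norm (w - \<zeta>) = u * p" using u by (simp add: w_def norm_mult dist_norm p_def)
      have w2: "w \<in> cball c (2 * r)" using wp \<zeta>r r by simp
      have "- Re (L w) = Re (L \<zeta> - L w)" using Re\<zeta> by simp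
      also have "\<dots> \<le> norm (L \<zeta> - L w)" by (rule complex_Re_le_cmod)
      also have "\<dots> = norm (L w - L \<zeta>)" by (rule norm_minus_commute)
      also have "\<dots> \<le> norm (deriv G \<zeta> * (w - \<zeta>)) + norm (L w - L \<zeta> - deriv G \<zeta> * (w - \<zeta>))"
        using norm_triangle_ineq[of "deriv G \<zeta> * (w - \<zeta>)" "L w - L \<zeta> - deriv G \<zeta> * (w - \<zeta>)"] by simp
      also have "\<dots> \<le> norm D * (u * p) + C2 * A * (u * p)\<^sup>2"
        using taylor[OF \<zeta>2 w2] by (simp add: norm_mult zw D_def)
      finally have "u * (\<kappa> * A / 2) \<le> u * (norm D * p + C2 * A * u * p\<^sup>2)"
        using a by (simp add: power2_eq_square algebra_simps)
      then have "\<kappa> * A / 2 \<le> norm D * p + C2 * A * u * p\<^sup>2" using u by simp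
      moreover have "C2 * A * u * p\<^sup>2 \<le> \<kappa> / 4 * A"
      proof -
        have "C2 * A * u * p\<^sup>2 \<le> C2 * A * u * r\<^sup>2"
          using pos A u p \<zeta>r by (intro mult_left_mono power_mono) auto
        also have "\<dots> = C2 * u * r\<^sup>2 * A" by simp
        also have "\<dots> \<le> \<kappa> / 4 * A" using u(3) A by (intro mult_right_mono) auto
        finally show ?thesis .
      qed
      moreover have "norm D * p \<le> norm D * r" using \<zeta>r by (intro mult_left_mono) auto
      ultimately have "\<kappa> / 4 * A \<le> norm D * r" by (simp add: field_simps)
      then show ?thesis using r by (simp add: \<mu>_def field_simps)
    qed
    have muA: "0 < \<mu> * A" using pos A by simp
    have D0: "D \<noteq> 0" using Dlow muA by auto
    define \<tau> where "\<tau> = Im (L \<zeta>)"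
    have L\<zeta>: "L \<zeta> = \<i> * of_real \<tau>" using Re\<zeta> by (simp add: complex_eq_iff \<tau>_def)
    define n0 where "n0 = \<lfloor>\<tau> / (2 * pi)\<rfloor>"
    have fl: "of_int n0 \<le> \<tau> / (2 * pi)" "\<tau> / (2 * pi) < of_int n0 + 1" unfolding n0_def by linarith+
    \<comment> \<open>The level curve \<open>Re L = 0\<close> leaves \<zeta> in the direction i / D.
      Of the two multiples of 2 \<open>pi\<close> next to \<tau> that one is taken whose first-order
      displacement \<open>h0\<close> has nonpositive imaginary part.\<close>
    define n where "n = (if 0 \<le> Re (1 / D) then n0 else n0 + 1)"
    define t where "t = 2 * pi * of_int n - \<tau>"
    have t: "\<bar>t\<bar> \<le> 2 * pi" "t * Re (1 / D) \<le> 0"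
    proof -
      have x: "2 * pi * of_int n0 \<le> \<tau>" "\<tau> < 2 * pi * of_int n0 + 2 * pi"
        using fl by (auto simp: field_simps)
      show "\<bar>t\<bar> \<le> 2 * pi" using x by (auto simp: t_def n_def abs_le_iff algebra_simps)
      show "t * Re (1 / D) \<le> 0"
      proof (cases "0 \<le> Re (1 / D)")
        case True
        then have "t \<le> 0" using x by (simp add: t_def n_def)
        then show ?thesis using True by (rule mult_nonpos_nonneg)
      next
        case False
        then have "0 \<le> t" using x by (simp add: t_def n_def algebra_simps)
        then show ?thesis using False by (intro mult_nonneg_nonpos) auto
      qed
    qed
    define h0 where "h0 = \<i> * of_real t / D"
    have "h0 = of_real t * (\<i> * (1 / D))" by (simp add: h0_def)
    then have "Im h0 = t * Re (1 / D)" by (simp add: Im_divide Re_divide del: times_divide_eq_right)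
    then have Imh0: "Im h0 \<le> 0" using t(2) by simp
    have "norm h0 = \<bar>t\<bar> / norm D" by (simp add: h0_def norm_divide norm_mult)
    also have "\<dots> \<le> 2 * pi / (\<mu> * A)" using t(1) Dlow muA by (intro frac_le) auto
    finally have nh0: "norm h0 \<le> 2 * pi / (\<mu> * A)" .
    \<comment> \<open>Half the lower bound in \<open>gap\<close>: a displacement within \<epsilon>
      of \<open>h0\<close> cannot reach the height of the top point.\<close>
    define \<epsilon> where "\<epsilon> = 1 / (2 * C1 * A)"
    have \<epsilon>: "0 < \<epsilon>" using pos A by (simp add: \<epsilon>_def)
    have nh: "norm h \<le> C4 / A" if "h \<in> cball h0 \<epsilon>" for h
    proof -
      have "norm (h - h0) \<le> \<epsilon>" using that by (simp add: dist_norm norm_minus_commute)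
      then have "norm h \<le> norm h0 + \<epsilon>" using norm_triangle_sub[of h h0] by linarith
      also have "\<dots> \<le> 2 * pi / (\<mu> * A) + \<epsilon>" using nh0 by simp
      also have "\<dots> = C4 / A" by (simp add: C4_def \<epsilon>_def add_divide_distrib)
      finally show ?thesis .
    qed
    have C4r: "C4 / A \<le> r" using A(2) A(4) r by (simp add: field_simps)
    have in2: "\<zeta> + h \<in> cball c (2 * r)" if "h \<in> cball h0 \<epsilon>" for h
    proof -
      have "dist c (\<zeta> + h) \<le> dist c \<zeta> + dist \<zeta> (\<zeta> + h)" by (rule dist_triangle)
      also have "\<dots> \<le> r + r" using \<zeta>r nh[OF that] C4r by (simp add: p_def dist_norm)
      finally show ?thesis by simp
    qed
    \<comment> \<open>A Newton step with the derivative frozen at \<zeta>; its fixed points solve L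
      (\<zeta> + h) = 2 \<open>pi\<close> i n. By Taylor's formula the disc about \<open>h0\<close>
      is mapped to itself, so Brouwer's theorem applies.\<close>
    define \<phi> where "\<phi> = (\<lambda>h. h - (L (\<zeta> + h) - 2 * pi * of_int n * \<i>) / D)"
    have \<phi>: "\<phi> h \<in> cball h0 \<epsilon>" if h: "h \<in> cball h0 \<epsilon>" for h
    proof -
      define e where "e = L (\<zeta> + h) - L \<zeta> - deriv G \<zeta> * h"
      have "norm e \<le> C2 * A * (norm h)\<^sup>2" using taylor[OF \<zeta>2 in2[OF h]] by (simp add: e_def)
      also have "\<dots> \<le> C2 * A * (C4 / A)\<^sup>2" using nh[OF h] pos A by (intro mult_left_mono power_mono) auto
      finally have ne: "norm e \<le> C2 * A * (C4 / A)\<^sup>2" .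
      have "L (\<zeta> + h) - 2 * pi * of_int n * \<i> = D * h + e - \<i> * of_real t"
        by (simp add: e_def D_def L\<zeta> t_def algebra_simps)
      then have "\<phi> h = h0 - e / D" using D0 by (simp add: \<phi>_def h0_def field_simps)
      then have "dist h0 (\<phi> h) = norm e / norm D" by (simp add: dist_norm norm_divide)
      also have "\<dots> \<le> C2 * A * (C4 / A)\<^sup>2 / (\<mu> * A)" using ne Dlow muA order_trans[OF norm_ge_zero ne] by (intro frac_le)
      also have "\<dots> = C2 * C4\<^sup>2 / (\<mu> * A * A)" using A(4) by (simp add: power2_eq_square)
      also have "\<dots> \<le> \<epsilon>"
      proof -
        have "2 * C1 * C2 * C4\<^sup>2 \<le> \<mu> * A" using A(3) pos by (simp add: field_simps)
        then have "2 * C1 * C2 * C4\<^sup>2 * A \<le> \<mu> * A * A" using A(4) by (intro mult_right_mono) auto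
        then have "C2 * C4\<^sup>2 * (2 * C1 * A) \<le> 1 * (\<mu> * A * A)" by (simp add: mult_ac)
        then show ?thesis unfolding \<epsilon>_def using pos A(4) by (intro frac_le_eq[THEN iffD2] divide_nonpos_pos) (auto simp: mult_ac)
      qed
      finally show ?thesis by simp
    qed
    have "continuous_on (cball h0 \<epsilon>) (\<lambda>h. L (\<zeta> + h))"
    proof (rule continuous_on_compose2[OF holomorphic_on_imp_continuous_on[OF hol]])
      show "continuous_on (cball h0 \<epsilon>) ((+) \<zeta>)" by (intro continuous_intros)
      show "(+) \<zeta> ` cball h0 \<epsilon> \<subseteq> ball c (3 * r)" using in3[OF in2] by blast
    qed
    then have "continuous_on (cball h0 \<epsilon>) \<phi>"
      unfolding \<phi>_def by (intro continuous_intros) (use D0 in auto)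
    then obtain h where h: "h \<in> cball h0 \<epsilon>" "\<phi> h = h"
      using brouwer_ball[OF \<epsilon>, of h0 \<phi>] \<phi> by blast
    have "L (\<zeta> + h) = 2 * pi * of_int n * \<i>" using h(2) D0 by (simp add: \<phi>_def)
    then have "exp (L (\<zeta> + h)) = 1" by (simp add: exp_eq_1)
    moreover have "Im (\<zeta> + h) < Im c + r"
    proof -
      have "Im \<zeta> - Im c \<le> p" using abs_Im_le_cmod[of "\<zeta> - c"] by (simp add: p_def dist_norm norm_minus_commute)
      moreover have "Im h - Im h0 \<le> \<epsilon>"
        using abs_Im_le_cmod[of "h - h0"] h(1) by (simp add: dist_norm norm_minus_commute)
      moreover have "\<epsilon> < 1 / (C1 * A)" using pos A by (simp add: \<epsilon>_def field_simps)
      ultimately show ?thesis using Imh0 gap by simp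
    qed
    ultimately show "\<exists>z\<in>ball c (3 * r). Im z < Im c + r \<and> exp (L z) = 1"
      using in3[OF in2[OF h(1)]] by blast
  qed
qed

context separated_values
begin

text \<open>The ball reaches across the ray \<open>Im z = pi / 2\<close>, where \<open>L\<close> is
  still holomorphic. The lower bound for \<open>Re L\<close> that Borel-Caratheodory requires at an
  anchor comes from \<open>Q_le_A\<close> at \<open>\<theta>\<^sub>1\<close>.\<close>

lemma L_window_ball:
  assumes r: "0 < r" "r \<le> 1 / 8" "8 * r \<le> pi / 2 - \<beta>"
  shows "\<exists>B>0. \<forall>\<^sub>F s in at_top. \<forall>z\<in>ball (Complex s (pi / 2 - r)) (3 * r).
    norm (L z - L (Complex s (pi / 2 - r))) \<le> B * A s"
proof -
  define c where "c = Complex 0 (pi / 2 - r)"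
  define K where "K = insert (Complex 0 \<theta>\<^sub>1) (cball c (3 * r))"
  have bpi: "pi / 2 + 2 * r < \<alpha> + 2 * pi" using angles r pi_gt3 by linarith
  have K: "compact K" "K \<subseteq> rect 1 \<beta> (\<alpha> + 2 * pi)"
  proof -
    show "compact K" by (simp add: K_def)
    have "Complex 0 \<theta>\<^sub>1 \<in> rect 1 \<beta> (\<alpha> + 2 * pi)" using \<theta>\<^sub>1 angles by (simp add: rect_iff)
    moreover have "z \<in> rect 1 \<beta> (\<alpha> + 2 * pi)" if "z \<in> cball c (3 * r)" for z
    proof -
      have "\<bar>Re (c - z)\<bar> \<le> 3 * r" "\<bar>Im (c - z)\<bar> \<le> 3 * r"
        using that abs_Re_le_cmod[of "c - z"] abs_Im_le_cmod[of "c - z"] by (simp_all add: dist_norm)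
      then have "\<bar>Re z\<bar> \<le> 3 * r" "\<bar>pi / 2 - r - Im z\<bar> \<le> 3 * r" by (simp_all add: c_def)
      then have "- 1 < Re z" "Re z < 1" "\<beta> < Im z" "Im z < \<alpha> + 2 * pi"
        using r bpi unfolding abs_le_iff by linarith+
      then show ?thesis by (simp add: rect_iff)
    qed
    ultimately show "K \<subseteq> rect 1 \<beta> (\<alpha> + 2 * pi)" by (auto simp: K_def)
  qed
  obtain C where C: "0 < C"
    "\<And>G M z w. \<lbrakk>G holomorphic_on rect 1 \<beta> (\<alpha> + 2 * pi); \<And>x. x \<in> rect 1 \<beta> (\<alpha> + 2 * pi) \<Longrightarrow> Re (G x) \<le> M; 0 < M;
       z \<in> K; w \<in> K; - M \<le> Re (G z)\<rbrakk> \<Longrightarrow> norm (G w - G z) \<le> C * M"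
    using borel_caratheodory_convex[OF open_convex_rect K] by metis
  obtain C' where C': "0 < C'" "\<And>s. s0 + 1 \<le> s \<Longrightarrow> Q (Complex s \<theta>\<^sub>1) \<le> C' * A s" using Q_le_A by blast
  obtain W where W: "1 \<le> W" "\<forall>\<^sub>F s in at_top. \<forall>u. s0 < u \<longrightarrow> \<bar>u - s\<bar> < 1 \<longrightarrow> A u + 1 \<le> W * A s"
    using A_window by blast
  define M0 where "M0 = max W C'"
  have M0: "0 < M0" "W \<le> M0" "C' \<le> M0" using W(1) by (auto simp: M0_def)
  have "\<forall>\<^sub>F s in at_top. \<forall>z\<in>ball (Complex s (pi / 2 - r)) (3 * r).
    norm (L z - L (Complex s (pi / 2 - r))) \<le> (2 * C * M0) * A s"
    using W(2) eventually_ge_at_top[of "s0 + 1"] eventually_A_ge[of 1]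
  proof eventually_elim
    case (elim s)
    have Apos: "0 < A s" using elim(3) by linarith
    have M: "0 < M0 * A s" using M0 Apos by simp
    have base: "- (M0 * A s) \<le> Re (L (Complex 0 \<theta>\<^sub>1 + of_real s))"
    proof -
      have eq: "Complex 0 \<theta>\<^sub>1 + of_real s = Complex s \<theta>\<^sub>1" by (simp add: complex_eq_iff)
      have inT: "Complex s \<theta>\<^sub>1 \<in> T1" using elim(2) \<theta>\<^sub>1 by (simp add: strip_iff)
      then have "\<bar>Re (L (Complex s \<theta>\<^sub>1))\<bar> \<le> Q (Complex s \<theta>\<^sub>1)"
        using Re_L[of "Complex s \<theta>\<^sub>1"] T1_subset logp_bounds(1)[OF E_omits[OF inT]] by (auto simp: Q_def)
      also have "\<dots> \<le> C' * A s" by (rule C'(2)[OF elim(2)])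
      also have "\<dots> \<le> M0 * A s" using M0 Apos by (intro mult_right_mono) auto
      finally show ?thesis unfolding eq by linarith
    qed
    have bd: "norm (L (w + of_real s) - L (Complex 0 \<theta>\<^sub>1 + of_real s)) \<le> C * (M0 * A s)" if "w \<in> K" for w
    proof (rule C(2)[OF holomorphic_window[OF holL elim(2)] _ M _ that base])
      show "Re (L (x + of_real s)) \<le> M0 * A s" if x: "x \<in> rect 1 \<beta> (\<alpha> + 2 * pi)" for x
      proof -
        have "x + of_real s \<in> strip s0 \<beta> (\<alpha> + 2 * pi)" using x elim(2) by (auto simp: strip_iff rect_iff)
        then have "Re (L (x + of_real s)) \<le> A (Re (x + of_real s))" by (rule Re_L_le)
        also have "\<dots> \<le> W * A s"
        proof -
          have "s0 < Re (x + of_real s)" "\<bar>Re (x + of_real s) - s\<bar> < 1"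
            using x elim(2) by (auto simp: rect_iff abs_less_iff)
          then have "A (Re (x + of_real s)) + 1 \<le> W * A s" using elim(1) by blast
          then show ?thesis by linarith
        qed
        also have "\<dots> \<le> M0 * A s" using M0 Apos by (intro mult_right_mono) auto
        finally show ?thesis .
      qed
    qed (simp add: K_def)
    show ?case
    proof
      fix z assume z: "z \<in> ball (Complex s (pi / 2 - r)) (3 * r)"
      have "Complex s (pi / 2 - r) - z = c - (z - of_real s)" by (simp add: c_def complex_eq_iff)
      then have "dist (Complex s (pi / 2 - r)) z = dist c (z - of_real s)" by (simp only: dist_norm)
      then have "dist c (z - of_real s) < 3 * r" using z by simp
      then have "z - of_real s \<in> K" by (simp add: K_def)
      from bd[OF this] have b1: "norm (L z - L (Complex 0 \<theta>\<^sub>1 + of_real s)) \<le> C * (M0 * A s)" by simp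
      have "c \<in> K" using r by (simp add: K_def)
      from bd[OF this] have b2: "norm (L (c + of_real s) - L (Complex 0 \<theta>\<^sub>1 + of_real s)) \<le> C * (M0 * A s)" .
      have "c + of_real s = Complex s (pi / 2 - r)" by (simp add: c_def complex_eq_iff)
      then show "norm (L z - L (Complex s (pi / 2 - r))) \<le> 2 * C * M0 * A s"
        using b1 b2 norm_triangle_ineq4[of "L z - L (Complex 0 \<theta>\<^sub>1 + of_real s)" "L (c + of_real s) - L (Complex 0 \<theta>\<^sub>1 + of_real s)"]
        by simp
    qed
  qed
  then show ?thesis using C(1) M0 by (intro exI[of _ "2 * C * M0"]) auto
qed

text \<open>If |f| > e at a point of the ray, \<open>unit_point_below\<close> applies with a disc
  centred slightly below, where \<open>Re L\<close> is at most - \<kappa> A. It produces a 1-point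
  with argument below \<open>pi / 2\<close>, that is in \<open>T1\<close>, where there is
  none.\<close>

lemma bounded_on_imaginary_ray:
  assumes st: "state1 (\<lambda>z. 1 / E z)"
  shows "\<forall>\<^sub>F s in at_top. norm (E (Complex s (pi / 2))) \<le> exp 1"
proof -
  define r where "r = min (1 / 8) ((pi / 2 - \<beta>) / 8)"
  have r: "0 < r" "r \<le> 1 / 8" "8 * r \<le> pi / 2 - \<beta>" using angles by (auto simp: r_def min_def)
  obtain B where B: "0 < B" "\<forall>\<^sub>F s in at_top. \<forall>z\<in>ball (Complex s (pi / 2 - r)) (3 * r).
    norm (L z - L (Complex s (pi / 2 - r))) \<le> B * A s" using L_window_ball[OF r] by blast
  have rng: "\<beta> < pi / 2 - r" "pi / 2 - r < pi / 2" "pi / 2 - r < \<alpha> + 2 * pi" "pi / 2 < \<alpha> + 2 * pi"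
    using r angles pi_gt3 by linarith+
  obtain \<kappa> where \<kappa>: "0 < \<kappa>" "\<forall>\<^sub>F s in at_top. \<forall>t\<in>{pi / 2 - r..pi / 2 - r}. \<kappa> * A s \<le> ln (norm (1 / E (Complex s t)))"
  proof -
    have "large (\<lambda>z. 1 / E z) (pi / 2 - r) (pi / 2 - r)" using st rng unfolding state1_def by blast
    then show ?thesis using that unfolding large_def by blast
  qed
  obtain A0 where A0: "\<And>L c A. \<lbrakk>A0 \<le> A; L holomorphic_on ball c (3 * r);
    \<forall>z\<in>ball c (3 * r). norm (L z - L c) \<le> B * A; Re (L c) \<le> - \<kappa> * A;
    1 < Re (L (c + \<i> * of_real r))\<rbrakk> \<Longrightarrow> \<exists>z\<in>ball c (3 * r). Im z < Im c + r \<and> exp (L z) = 1"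
    using unit_point_below[OF r(1) B(1) \<kappa>(1)] by blast
  show ?thesis
    using B(2) \<kappa>(2) eventually_A_ge[of A0] eventually_ge_at_top[of "s0 + 1"]
  proof eventually_elim
    case (elim s)
    define c where "c = Complex s (pi / 2 - r)"
    have box: "s0 < Re z" "\<beta> < Im z" "Im z < \<alpha> + 2 * pi" if "z \<in> ball c (3 * r)" for z
    proof -
      have "\<bar>Re (c - z)\<bar> < 3 * r" "\<bar>Im (c - z)\<bar> < 3 * r"
        using that abs_Re_le_cmod[of "c - z"] abs_Im_le_cmod[of "c - z"] by (simp_all add: dist_norm)
      then have "\<bar>s - Re z\<bar> < 3 * r" "\<bar>pi / 2 - r - Im z\<bar> < 3 * r" by (simp_all add: c_def)
      then show "s0 < Re z" "\<beta> < Im z" "Im z < \<alpha> + 2 * pi"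
        using r elim(4) angles pi_gt3 unfolding abs_less_iff by linarith+
    qed
    have ci: "c \<in> strip s0 \<beta> (\<alpha> + 2 * pi)" using rng elim(4) by (simp add: c_def strip_iff)
    have "Re (L c) \<le> - \<kappa> * A s"
    proof -
      have "E c \<noteq> 0" using expL[OF ci] by (metis E_def exp_not_eq_zero)
      moreover have "\<kappa> * A s \<le> ln (norm (1 / E c))" using elim(2) by (simp add: c_def)
      ultimately show ?thesis using Re_L[OF ci] by (simp add: norm_divide ln_div)
    qed
    moreover have "c + \<i> * of_real r = Complex s (pi / 2)" by (simp add: c_def complex_eq_iff)
    moreover have "L holomorphic_on ball c (3 * r)"
      by (rule holomorphic_on_subset[OF holL]) (use box in \<open>auto simp: strip_iff\<close>)
    moreover have "\<not> (\<exists>z\<in>ball c (3 * r). Im z < Im c + r \<and> exp (L z) = 1)"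
    proof safe
      fix z assume z: "z \<in> ball c (3 * r)" "Im z < Im c + r" "exp (L z) = 1"
      have "z \<in> T1" using box[OF z(1)] z(2) by (simp add: strip_iff c_def)
      then have "E z \<noteq> 1" by (rule E_omits(2))
      moreover have "E z = 1" using expL[of z] z(3) box[OF z(1)] by (simp add: E_def strip_iff)
      ultimately show False by simp
    qed
    ultimately have "Re (L (Complex s (pi / 2))) \<le> 1"
      using A0[of "A s" L c] elim(1,3) by (force simp: c_def)
    moreover have "exp (L (Complex s (pi / 2))) = E (Complex s (pi / 2))"
      unfolding E_def by (rule expL) (use rng elim(4) angles in \<open>auto simp: strip_iff\<close>)
    ultimately show ?case by (metis exp_le_cancel_iff norm_exp_eq_Re)
  qed
qed

lemma bounded_near_imaginary_ray:
  assumes st: "state1 (\<lambda>z. 1 / E z)"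
  shows "\<exists>b>\<beta>. b < pi / 2 \<and> (\<exists>M. \<forall>\<^sub>F s in at_top. \<forall>t\<in>{b..pi / 2}. norm (E (Complex s t)) \<le> M)"
proof -
  \<comment> \<open>f itself satisfies only the bound with exponent \<open>N\<close>, so the half
    strip at the imaginary ray is taken so narrow that N times its width is below
    \<open>pi\<close>.\<close>
  define d where "d = min ((pi / 2 - \<beta>) / 2) (1 / (\<bar>N\<bar> + 1))"
  have d: "0 < d" "2 * d \<le> pi / 2 - \<beta>" "d \<le> 1 / (\<bar>N\<bar> + 1)" using angles by (auto simp: d_def min_def)
  define b where "b = pi / 2 - d"
  have b: "\<beta> < b" "b < pi / 2" using d by (auto simp: b_def)
  have "N * d \<le> \<bar>N\<bar> * d" using d by (intro mult_right_mono) auto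
  also have "\<dots> \<le> \<bar>N\<bar> * (1 / (\<bar>N\<bar> + 1))" using d by (intro mult_left_mono) auto
  also have "\<dots> \<le> 1" by (simp add: divide_le_eq)
  finally have Nd: "N * (pi / 2 - b) < pi" using pi_gt3 by (simp add: b_def)
  have "\<exists>M. \<forall>\<^sub>F s in at_top. \<forall>t\<in>{b..pi / 2}. norm (E (Complex s t)) \<le> M"
  proof (rule half_strip_bounded[OF b(2) Nd])
    show "E holomorphic_on strip s0 \<beta> (\<alpha> + 2 * pi)" by (rule holE)
    show "\<beta> < b" "pi / 2 < \<alpha> + 2 * pi" using b angles pi_gt3 by linarith+
    show "\<forall>\<^sub>F s in at_top. \<forall>t\<in>{b..pi / 2}. norm (E (Complex s t)) \<le> exp (1 * exp (N * s))"
      using eventually_gt_at_top[of s0]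
    proof eventually_elim
      case (elim s)
      have "exp (A s) \<le> exp (1 * exp (N * s))" using A_le[OF elim] by simp
      then show ?case using E_le[of "Complex s _"] elim by (auto intro: order_trans)
    qed
    show "\<forall>\<^sub>F s in at_top. norm (E (Complex s b)) \<le> exp 1"
    proof -
      have "large (\<lambda>z. 1 / E z) b b" using st b by (simp add: state1_def)
      then have "\<forall>\<^sub>F s in at_top. \<forall>t\<in>{b..b}. \<bar>Re (L1 (Complex s t))\<bar> \<le> 1 \<and> norm (E (Complex s t)) \<le> 1 / 2"
        by (rule bounded_L1) (use b angles in auto)
      then show ?thesis
      proof eventually_elim
        case (elim s)
        then have "norm (E (Complex s b)) \<le> 1 / 2" by simp
        moreover have "(1::real) \<le> exp 1" by simp
        ultimately show ?case by linarith
      qed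
    qed
    show "\<forall>\<^sub>F s in at_top. norm (E (Complex s (pi / 2))) \<le> exp 1" by (rule bounded_on_imaginary_ray[OF st])
  qed
  then show ?thesis using b by blast
qed

text \<open>On the two rays f is close to 0, so \<open>L1\<close>, a logarithm of a function close
  to 1, is bounded there. Phragmen-Lindelof is applied to \<open>L1\<close>, whose growth O(A)
  admits any opening angle.\<close>

lemma bounded_inner:
  assumes st: "state1 (\<lambda>z. 1 / E z)" "state2 (\<lambda>z. 1 / E z)"
    and ab: "- (pi / 2) < a" "a < \<alpha>" "\<beta> < b" "b < pi / 2"
  shows "\<exists>M. \<forall>\<^sub>F s in at_top. \<forall>t\<in>{a..b}. norm (E (Complex s t)) \<le> M"
proof -
  have lt: "a < b" "a < pi / 2" "- (pi / 2) < b" using ab angles by linarith+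
  have "large (\<lambda>z. 1 / E z) a a" "large (\<lambda>z. 1 / E z) b b" using st ab by (auto simp: state1_def state2_def)
  then obtain B1 B2 where B: "\<forall>\<^sub>F s in at_top. norm (L1 (Complex s a)) \<le> B1" "\<forall>\<^sub>F s in at_top. norm (L1 (Complex s b)) \<le> B2"
    using ray_L1_bounded ab lt by meson
  have "\<exists>M. \<forall>\<^sub>F s in at_top. \<forall>t\<in>{a..b}. norm (L1 (Complex s t)) \<le> M"
  proof (rule half_strip_bounded[OF lt(1) _ holL1 ab(1,4)])
    have "b - a < 8 * pi" using ab pi_gt_zero by linarith
    then show "1 / 8 * (b - a) < pi" by simp
    show "\<forall>\<^sub>F s in at_top. \<forall>t\<in>{a..b}. norm (L1 (Complex s t)) \<le> exp (1 * exp (1 / 8 * s))"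
      by (rule bounded_ray_growth[OF holL1 Re_L1_le ab(1,4) order_refl _ B(1)]) (use lt in auto)
    show "\<forall>\<^sub>F s in at_top. norm (L1 (Complex s a)) \<le> max B1 B2" using B(1) by (rule eventually_mono) simp
    show "\<forall>\<^sub>F s in at_top. norm (L1 (Complex s b)) \<le> max B1 B2" using B(2) by (rule eventually_mono) simp
  qed
  then obtain M where M: "\<forall>\<^sub>F s in at_top. \<forall>t\<in>{a..b}. norm (L1 (Complex s t)) \<le> M" by blast
  have "\<forall>\<^sub>F s in at_top. \<forall>t\<in>{a..b}. norm (E (Complex s t)) \<le> 1 + exp M"
    using M eventually_gt_at_top[of s0]
  proof eventually_elim
    case (elim s)
    show ?case
    proof
      fix t assume t: "t \<in> {a..b}"
      have "exp (L1 (Complex s t)) = 1 - E (Complex s t)"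
        unfolding E_def by (rule expL1) (use t ab elim in \<open>auto simp: strip_iff\<close>)
      moreover have "norm (L1 (Complex s t)) \<le> M" using elim t by blast
      then have "Re (L1 (Complex s t)) \<le> M" using complex_Re_le_cmod order_trans by blast
      ultimately have "norm (1 - E (Complex s t)) \<le> exp M" by (metis exp_le_cancel_iff norm_exp_eq_Re)
      then show "norm (E (Complex s t)) \<le> 1 + exp M"
        using norm_triangle_ineq4[of 1 "1 - E (Complex s t)"] by simp
    qed
  qed
  then show ?thesis by blast
qed

end

context separated_values
begin

interpretation R: separated_values "\<lambda>z. cnj (f (cnj z))" "\<lambda>z. cnj (L (cnj (z - 2 * pi * \<i>)))" "\<lambda>z. cnj (L1 (cnj z))" "- \<beta>" "- \<alpha>" s0 N
  by (rule reflected)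

lemma bounded_near_negative_imaginary_ray:
  assumes st: "state2 (\<lambda>z. 1 / E z)"
  shows "\<exists>a<\<alpha>. - (pi / 2) < a \<and> (\<exists>M. \<forall>\<^sub>F s in at_top. \<forall>t\<in>{- (pi / 2)..a}. norm (E (Complex s t)) \<le> M)"
proof -
  have nE: "norm (R.E (Complex s t)) = norm (E (Complex s (- t)))" for s t
  proof -
    have "cnj (Complex s t) = Complex s (- t)" by (simp add: complex_eq_iff)
    then show ?thesis by (simp add: R.E_def E_def exp_cnj)
  qed
  have "R.state1 (\<lambda>z. 1 / R.E z)"
    unfolding R.state1_def
  proof safe
    fix a b assume "- \<alpha> < a" "b < pi / 2"
    then have "large (\<lambda>z. 1 / E z) (- b) (- a)" using st by (simp add: state2_def)
    then obtain c where c: "0 < c" "\<forall>\<^sub>F s in at_top. \<forall>t\<in>{- b..- a}. c * A s \<le> ln (norm (1 / E (Complex s t)))"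
      by (auto simp: large_def)
    from c(2) have "\<forall>\<^sub>F s in at_top. \<forall>t\<in>{a..b}. c * A s \<le> ln (norm (1 / R.E (Complex s t)))"
    proof eventually_elim
      case (elim s)
      show ?case
      proof
        fix t assume "t \<in> {a..b}"
        then have "- t \<in> {- b..- a}" by auto
        then have "c * A s \<le> ln (norm (1 / E (Complex s (- t))))" using elim by blast
        then show "c * A s \<le> ln (norm (1 / R.E (Complex s t)))" by (simp add: norm_divide nE)
      qed
    qed
    then show "R.large (\<lambda>z. 1 / R.E z) a b" using c(1) by (auto simp: R.large_def logmax_cnj)
  qed
  then obtain b M where b: "- \<alpha> < b" "b < pi / 2" "\<forall>\<^sub>F s in at_top. \<forall>t\<in>{b..pi / 2}. norm (R.E (Complex s t)) \<le> M"
    using R.bounded_near_imaginary_ray by blast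
  from b(3) have "\<forall>\<^sub>F s in at_top. \<forall>t\<in>{- (pi / 2)..- b}. norm (E (Complex s t)) \<le> M"
  proof eventually_elim
    case (elim s)
    show ?case
    proof
      fix t assume "t \<in> {- (pi / 2)..- b}"
      then have "- t \<in> {b..pi / 2}" by auto
      then have "norm (R.E (Complex s (- t))) \<le> M" using elim by blast
      then show "norm (E (Complex s t)) \<le> M" by (simp add: nE)
    qed
  qed
  then show ?thesis using b by (intro exI[of _ "- b"]) auto
qed

end

context separated_values
begin

lemma bounded_right_half_plane:
  assumes st: "state1 (\<lambda>z. 1 / E z)" "state2 (\<lambda>z. 1 / E z)"
  shows "\<exists>M\<ge>1. \<forall>z. 0 \<le> Re z \<longrightarrow> norm (f z) \<le> M"
proof -
  obtain b M1 where b: "\<beta> < b" "b < pi / 2" "\<forall>\<^sub>F s in at_top. \<forall>t\<in>{b..pi / 2}. norm (E (Complex s t)) \<le> M1"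
    using bounded_near_imaginary_ray[OF st(1)] by blast
  obtain a M2 where a: "- (pi / 2) < a" "a < \<alpha>" "\<forall>\<^sub>F s in at_top. \<forall>t\<in>{- (pi / 2)..a}. norm (E (Complex s t)) \<le> M2"
    using bounded_near_negative_imaginary_ray[OF st(2)] by blast
  obtain M3 where M3: "\<forall>\<^sub>F s in at_top. \<forall>t\<in>{a..b}. norm (E (Complex s t)) \<le> M3"
    using bounded_inner[OF st a(1,2) b(1,2)] by blast
  have "\<forall>\<^sub>F s in at_top. \<forall>t\<in>{- (pi / 2)..pi / 2}. norm (E (Complex s t)) \<le> max M1 (max M2 M3)"
    using b(3) a(3) M3
  proof eventually_elim
    case (elim s)
    show ?case
    proof
      fix t assume t: "t \<in> {- (pi / 2)..pi / 2}"
      consider "t \<le> a" | "a \<le> t" "t \<le> b" | "b \<le> t" by linarith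
      then show "norm (E (Complex s t)) \<le> max M1 (max M2 M3)"
      proof cases
        case 1 then show ?thesis using elim(2) t by force
      next
        case 2 then show ?thesis using elim(3) t by force
      next
        case 3 then show ?thesis using elim(1) t by force
      qed
    qed
  qed
  then obtain S where S: "\<And>s t. S \<le> s \<Longrightarrow> t \<in> {- (pi / 2)..pi / 2} \<Longrightarrow> norm (E (Complex s t)) \<le> max M1 (max M2 M3)"
    unfolding eventually_at_top_linorder by blast
  have "bounded (f ` cball 0 (exp S))"
    by (intro compact_imp_bounded compact_continuous_image holomorphic_on_imp_continuous_on
        holomorphic_on_subset[OF holf]) auto
  then obtain M0 where M0: "\<And>z. norm z \<le> exp S \<Longrightarrow> norm (f z) \<le> M0"
    unfolding bounded_iff by (metis image_eqI mem_cball_0)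
  define M where "M = max (max 1 M0) (max M1 (max M2 M3))"
  have "norm (f z) \<le> M" if z: "0 \<le> Re z" for z
  proof (cases "norm z \<le> exp S")
    case True
    then show ?thesis using M0[OF True] by (simp add: M_def)
  next
    case False
    then have z0: "z \<noteq> 0" using exp_gt_zero[of S] by auto
    define t where "t = Im (Ln z)"
    have t: "t \<in> {- (pi / 2)..pi / 2}" using Re_Ln_pos_le[OF z0] z by (auto simp: t_def abs_le_iff)
    have "z = exp (Complex (ln (norm z)) t)"
    proof -
      have "Ln z = Complex (ln (norm z)) t" using z0 by (simp add: complex_eq_iff t_def Re_Ln)
      then show ?thesis using z0 exp_Ln by metis
    qed
    then have fz: "f z = E (Complex (ln (norm z)) t)" by (simp add: E_def)
    have "S \<le> ln (norm z)" using False z0 by (simp add: ln_ge_iff)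
    then have "norm (f z) \<le> max M1 (max M2 M3)" using S[OF _ t] fz by simp
    then show ?thesis by (simp add: M_def le_max_iff_disj)
  qed
  then show ?thesis by (intro exI[of _ M]) (auto simp: M_def)
qed

end

section \<open>Functions of exponential type in a half-plane\<close>

text \<open>Growth of order 1 is too much for a half-plane but admissible in the two quadrants, for
  which the ray supplies the missing edge. This gives some bound, and
  \<open>bounded_half_plane_le\<close> improves it to \<open>M\<close>.\<close>

lemma phragmen_lindelof_half_plane:
  fixes C M B :: real
  assumes hol: "h holomorphic_on UNIV"
    and growth: "\<And>z. 0 \<le> Re z \<Longrightarrow> norm (h z) \<le> exp (C * (1 + norm z))"
    and M: "0 < M" and edge: "\<And>z. Re z = 0 \<Longrightarrow> norm (h z) \<le> M"
    and ray: "\<And>x. 0 \<le> x \<Longrightarrow> norm (h (of_real x)) \<le> B"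
    and z: "0 \<le> Re z"
  shows "norm (h z) \<le> M"
proof -
  define B' where "B' = max (exp (\<bar>C\<bar> * 2)) (max M B)"
  have B': "0 < B'" "M \<le> B'" "B \<le> B'" using M by (auto simp: B'_def)
  have unit: "norm (h w) \<le> B'" if w: "0 \<le> Re w" "norm w \<le> 1" for w
  proof -
    have "C * (1 + norm w) \<le> \<bar>C\<bar> * 2" using w by (intro mult_mono) auto
    then have "exp (C * (1 + norm w)) \<le> B'" by (simp add: B'_def le_max_iff_disj)
    then show ?thesis using growth[OF w(1)] by linarith
  qed
  have Re_exp_nonneg: "0 \<le> Re (exp \<zeta>)" if "- (pi / 2) \<le> Im \<zeta>" "Im \<zeta> \<le> pi / 2" for \<zeta>
    using that by (simp add: Re_exp cos_ge_zero)
  have quadrant: "norm (h (exp \<zeta>)) \<le> B'"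
    if ab: "(a, b) = (0, pi / 2) \<or> (a, b) = (- (pi / 2), 0)" and \<zeta>: "0 \<le> Re \<zeta>" "a \<le> Im \<zeta>" "Im \<zeta> \<le> b" for a b \<zeta>
  proof (rule phragmen_lindelof_half_strip[where G = "\<lambda>\<zeta>. h (exp \<zeta>)" and \<sigma> = 1 and C = "2 * \<bar>C\<bar>", OF _ _ _ _ B'(1) _ \<zeta>])
    have le: "- (pi / 2) \<le> a" "b \<le> pi / 2" using ab by auto
    show "a < b" "1 * (b - a) < pi" using ab pi_gt_zero by (auto simp del: pi_gt_zero)
    have "(h \<circ> exp) holomorphic_on {z. 0 \<le> Re z \<and> a \<le> Im z \<and> Im z \<le> b}"
      by (intro holomorphic_on_compose holomorphic_intros holomorphic_on_subset[OF hol]) auto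
    then show "(\<lambda>\<zeta>. h (exp \<zeta>)) holomorphic_on {z. 0 \<le> Re z \<and> a \<le> Im z \<and> Im z \<le> b}" by (simp add: o_def)
    show "norm (h (exp w)) \<le> exp (2 * \<bar>C\<bar> * exp (1 * Re w))" if w: "0 \<le> Re w" "a \<le> Im w" "Im w \<le> b" for w
    proof -
      have "norm (h (exp w)) \<le> exp (C * (1 + norm (exp w)))"
        by (rule growth[OF Re_exp_nonneg]) (use w le in auto)
      moreover have "C * (1 + norm (exp w)) \<le> \<bar>C\<bar> * (2 * exp (Re w))" using w by (intro mult_mono) auto
      moreover have "\<bar>C\<bar> * (2 * exp (Re w)) = 2 * \<bar>C\<bar> * exp (1 * Re w)" by simp
      ultimately show ?thesis by (metis exp_le_cancel_iff order_trans)
    qed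
    show "norm (h (exp w)) \<le> B'"
      if w: "0 \<le> Re w" "a \<le> Im w" "Im w \<le> b" "Re w = 0 \<or> Im w = a \<or> Im w = b" for w
    proof -
      consider "Re w = 0" | "Im w = 0" | "Im w = pi / 2 \<or> Im w = - (pi / 2)" using w(4) ab by auto
      then show ?thesis
      proof cases
        case 1
        then show ?thesis by (intro unit Re_exp_nonneg) (use w le in auto)
      next
        case 2
        then have "exp w = of_real (exp (Re w))" by (simp add: complex_eq_iff Re_exp Im_exp)
        then show ?thesis using ray[of "exp (Re w)"] B' by simp
      next
        case 3
        then have "cos (Im w) = 0" using cos_pi_half by (metis cos_minus)
        then have "Re (exp w) = 0" by (simp add: Re_exp)
        then show ?thesis using edge[of "exp w"] B' by linarith
      qed
    qed
  qed
  have bd: "norm (h w) \<le> B'" if w: "0 \<le> Re w" for w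
  proof (cases "norm w \<le> 1")
    case True
    then show ?thesis using unit w by blast
  next
    case False
    then have w0: "w \<noteq> 0" by auto
    have e: "exp (Ln w) = w" using w0 by simp
    have r: "0 \<le> Re (Ln w)" using False w0 by simp
    have i: "\<bar>Im (Ln w)\<bar> \<le> pi / 2" using Re_Ln_pos_le[OF w0] w by simp
    show ?thesis
    proof (cases "0 \<le> Im (Ln w)")
      case True
      then show ?thesis using quadrant[of 0 "pi / 2" "Ln w"] r i e by simp
    next
      case False
      then show ?thesis using quadrant[of "- (pi / 2)" 0 "Ln w"] r i e by simp
    qed
  qed
  show ?thesis by (rule bounded_half_plane_le[OF holomorphic_on_subset[OF hol] bd M edge z]) auto
qed

text \<open>Here smallness is required on a box of angles and logarithmic moduli, the form in which
  Harnack's inequality delivers it; the box contains the arc of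
  \<open>half_plane_decay\<close>.\<close>

lemma half_plane_decay_log:
  fixes \<theta>1 \<theta>2 :: real
  assumes \<theta>: "- (pi / 2) < \<theta>1" "\<theta>1 < \<theta>2" "\<theta>2 < pi / 2"
  obtains \<kappa> W where "0 < \<kappa>" "0 < W"
    "\<And>g s m x. \<lbrakk>g holomorphic_on {z. 0 < Re z}; \<And>z. 0 < Re z \<Longrightarrow> norm (g z) \<le> 1; 0 \<le> m;
       \<And>u t. \<lbrakk>s \<le> u; u \<le> s + W; \<theta>1 \<le> t; t \<le> \<theta>2\<rbrakk> \<Longrightarrow> norm (g (exp (Complex u t))) \<le> exp (- m);
       0 < x; x \<le> \<kappa> * exp s\<rbrakk> \<Longrightarrow> norm (g (of_real x)) \<le> exp (- (\<kappa> * m * x / exp s))"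
proof -
  obtain c \<eta> where c: "0 < c" "0 < \<eta>"
    "\<And>g R m x. \<lbrakk>g holomorphic_on {z. 0 < Re z}; \<And>z. 0 < Re z \<Longrightarrow> norm (g z) \<le> 1; 0 < R; 0 \<le> m;
       \<And>t. \<lbrakk>\<theta>1 \<le> t; t \<le> \<theta>2\<rbrakk> \<Longrightarrow> norm (g (of_real (2 * R * cos t) * cis t)) \<le> exp (- m);
       0 < x; x \<le> \<eta> * R\<rbrakk> \<Longrightarrow> norm (g (of_real x)) \<le> exp (- (c * m * x / R))"
    using half_plane_decay[OF \<theta>] by blast
  have "\<exists>t0\<in>{\<theta>1..\<theta>2}. \<forall>t\<in>{\<theta>1..\<theta>2}. cos t0 \<le> cos t"
    by (rule continuous_attains_inf) (use \<theta> in \<open>auto intro!: continuous_intros\<close>)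
  then obtain t0 where t0: "t0 \<in> {\<theta>1..\<theta>2}" "\<And>t. t \<in> {\<theta>1..\<theta>2} \<Longrightarrow> cos t0 \<le> cos t" by blast
  define k where "k = cos t0"
  have k: "0 < k" "k \<le> 1" using t0(1) \<theta> by (auto simp: k_def intro!: cos_gt_zero_pi)
  define \<kappa> where "\<kappa> = min (\<eta> / (2 * k)) (2 * k * c)"
  have \<kappa>: "0 < \<kappa>" "\<kappa> \<le> \<eta> / (2 * k)" "\<kappa> \<le> 2 * k * c" using c k by (auto simp: \<kappa>_def)
  show thesis
  proof (rule that[of \<kappa> "1 - ln k"])
    show "0 < \<kappa>" by (rule \<kappa>(1))
    show "0 < 1 - ln k" using k by (smt (verit) ln_le_zero_iff)
    fix g s m and x :: real
    assume hol: "g holomorphic_on {z. 0 < Re z}" and le: "\<And>z. 0 < Re z \<Longrightarrow> norm (g z) \<le> 1" and m: "0 \<le> m"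
      and arc: "\<And>u t. \<lbrakk>s \<le> u; u \<le> s + (1 - ln k); \<theta>1 \<le> t; t \<le> \<theta>2\<rbrakk> \<Longrightarrow> norm (g (exp (Complex u t))) \<le> exp (- m)"
      and x: "0 < x" "x \<le> \<kappa> * exp s"
    \<comment> \<open>With \<open>k\<close> the least cosine on the interval, the arc points have
      modulus exp s cos t / k, which lies between exp s and exp s / k; so their logarithmic moduli
      lie between s and s - ln k.\<close>
    define R where "R = exp s / (2 * k)"
    have R: "0 < R" using k by (simp add: R_def)
    have "norm (g (of_real x)) \<le> exp (- (c * m * x / R))"
    proof (rule c(3)[OF hol le R m _ x(1)])
      fix t assume t: "\<theta>1 \<le> t" "t \<le> \<theta>2"
      have ct: "k \<le> cos t" "cos t \<le> 1" using t0(2)[of t] t by (auto simp: k_def)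
      define u where "u = ln (2 * R * cos t)"
      have eu: "exp u = 2 * R * cos t" using R ct k by (simp add: u_def)
      have "exp u = exp s * (cos t / k)" using eu k by (simp add: R_def)
      then have "u = s + ln (cos t / k)" using ct k by (metis exp_add exp_ln exp_inj_iff divide_pos_pos less_le_trans)
      then have us: "u = s + ln (cos t) - ln k" using ct k by (simp add: ln_div)
      have "ln k \<le> ln (cos t)" "ln (cos t) \<le> 0" using ct k by auto
      then have "norm (g (exp (Complex u t))) \<le> exp (- m)" using us t by (intro arc) auto
      moreover have "exp (Complex u t) = of_real (2 * R * cos t) * cis t"
        by (simp add: exp_eq_polar eu[symmetric])
      ultimately show "norm (g (of_real (2 * R * cos t) * cis t)) \<le> exp (- m)" by simp
    next
      have "\<kappa> * exp s \<le> \<eta> / (2 * k) * exp s" using \<kappa>(2) by (intro mult_right_mono) auto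
      then show "x \<le> \<eta> * R" using x(2) by (simp add: R_def)
    qed
    also have "\<dots> \<le> exp (- (\<kappa> * m * x / exp s))"
    proof -
      have "\<kappa> * (m * x / exp s) \<le> 2 * k * c * (m * x / exp s)" using \<kappa>(3) m x by (intro mult_right_mono) auto
      also have "\<dots> = c * m * x / R" using k by (simp add: R_def)
      finally show ?thesis by simp
    qed
    finally show "norm (g (of_real x)) \<le> exp (- (\<kappa> * m * x / exp s))" .
  qed
qed

lemma nonconstant_nonzero_positive_real:
  assumes hol: "f holomorphic_on UNIV" and nc: "\<not> f constant_on UNIV"
  obtains x :: real where "0 < x" "f (of_real x) \<noteq> 0"
proof (rule ccontr)
  assume "\<not> thesis"
  then have z: "\<And>x :: real. 0 < x \<Longrightarrow> f (of_real x) = 0" using that by blast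
  have lim: "(1 :: complex) islimpt of_real ` {0<..}"
    unfolding islimpt_approachable
  proof (intro allI impI)
    fix e :: real assume e: "0 < e"
    have "of_real (1 + e / 2) \<noteq> (1 :: complex)" using e by (simp add: complex_eq_iff)
    moreover have "dist (of_real (1 + e / 2)) (1 :: complex) < e" using e by (simp add: dist_norm)
    moreover have "of_real (1 + e / 2) \<in> (of_real ` {0<..} :: complex set)" using e by (intro imageI) auto
    ultimately show "\<exists>x'\<in>of_real ` {0<..}. x' \<noteq> (1 :: complex) \<and> dist x' 1 < e" by blast
  qed
  have "f w = 0" for w
    by (rule analytic_continuation[OF hol open_UNIV connected_UNIV subset_UNIV _ lim]) (use z in auto)
  then show False using nc by (auto simp: constant_on_def)
qed

context separated_values
begin

text \<open>In the gap |f| \<le> exp (- c A(s)) at scale exp s. By the decay estimate |f(x)| is then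
  at most M exp (- const A(s) x / exp s) for a fixed \<open>x > 0\<close>. Since f (x) is a fixed
  nonzero number, A(s) is O(exp s).\<close>

lemma exponential_type:
  assumes st: "state1 (\<lambda>z. 1 / E z)" and M: "1 \<le> M" "\<And>z. 0 \<le> Re z \<Longrightarrow> norm (f z) \<le> M"
  shows "\<exists>C\<ge>0. \<forall>z. norm (f z) \<le> exp (C * (1 + norm z))"
proof -
  have ang: "- (pi / 2) < \<theta>\<^sub>1 - \<rho>" "\<theta>\<^sub>1 - \<rho> < \<theta>\<^sub>1 + \<rho>" "\<theta>\<^sub>1 + \<rho> < pi / 2" using \<theta>\<^sub>1 angles by linarith+
  obtain \<kappa> W where \<kappa>: "0 < \<kappa>" "0 < W"
    "\<And>g s m x. \<lbrakk>g holomorphic_on {z. 0 < Re z}; \<And>z. 0 < Re z \<Longrightarrow> norm (g z) \<le> 1; 0 \<le> m;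
       \<And>u t. \<lbrakk>s \<le> u; u \<le> s + W; \<theta>\<^sub>1 - \<rho> \<le> t; t \<le> \<theta>\<^sub>1 + \<rho>\<rbrakk> \<Longrightarrow> norm (g (exp (Complex u t))) \<le> exp (- m);
       0 < x; x \<le> \<kappa> * exp s\<rbrakk> \<Longrightarrow> norm (g (of_real x)) \<le> exp (- (\<kappa> * m * x / exp s))"
    using half_plane_decay_log[OF ang] by blast
  have "large (\<lambda>z. 1 / E z) (\<theta>\<^sub>1 - \<rho>) (\<theta>\<^sub>1 + \<rho>)" using st \<theta>\<^sub>1 by (auto simp: state1_def)
  then obtain c where c: "0 < c" "\<forall>\<^sub>F s in at_top. \<forall>t\<in>{\<theta>\<^sub>1 - \<rho>..\<theta>\<^sub>1 + \<rho>}. c * A s \<le> ln (norm (1 / E (Complex s t)))"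
    unfolding large_def by blast
  obtain S where S: "\<And>s t. S \<le> s \<Longrightarrow> \<theta>\<^sub>1 - \<rho> \<le> t \<Longrightarrow> t \<le> \<theta>\<^sub>1 + \<rho> \<Longrightarrow> c * A s \<le> ln (norm (1 / E (Complex s t)))"
    using c(2) unfolding eventually_at_top_linorder by (meson atLeastAtMost_iff)
  obtain x where x: "0 < x" "f (of_real x) \<noteq> 0" using nonconstant_nonzero_positive_real[OF holf nonconst] .
  define D where "D = - ln (norm (f (of_real x)) / M)"
  define C1 where "C1 = max 1 (D / (\<kappa> * c * x))"
  define S1 where "S1 = max (max S (s0 + 1)) (ln (x / \<kappa>))"
  have A_lin: "A s \<le> C1 * exp s" if s: "S1 \<le> s" for s
  proof -
    have s': "S \<le> s" "s0 + 1 \<le> s" "ln (x / \<kappa>) \<le> s" using s by (auto simp: S1_def)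
    have xs: "x \<le> \<kappa> * exp s"
    proof -
      have "x / \<kappa> \<le> exp s" using s'(3) x \<kappa> by (metis divide_pos_pos exp_le_cancel_iff exp_ln)
      then show ?thesis using \<kappa> by (simp add: field_simps)
    qed
    have As: "0 < A s" using A_pos s' by simp
    have "norm (f (of_real x) / of_real M) \<le> exp (- (\<kappa> * (c * A s) * x / exp s))"
    proof (rule \<kappa>(3)[where g = "\<lambda>z. f z / of_real M"])
      show "(\<lambda>z. f z / of_real M) holomorphic_on {z. 0 < Re z}"
        using M by (intro holomorphic_intros holomorphic_on_subset[OF holf]) auto
      show "norm (f z / of_real M) \<le> 1" if "0 < Re z" for z
        using M(2)[of z] M(1) that by (simp add: norm_divide)
      show "0 \<le> c * A s" using c As by simp
      fix u t assume ut: "s \<le> u" "u \<le> s + W" "\<theta>\<^sub>1 - \<rho> \<le> t" "t \<le> \<theta>\<^sub>1 + \<rho>"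
      have "Complex u t \<in> T1" using ut s' \<theta>\<^sub>1 by (simp add: strip_iff)
      then have E0: "E (Complex u t) \<noteq> 0" by (rule E_omits)
      have "c * A s \<le> c * A u" using c A_mono[of s u] ut s' by simp
      also have "\<dots> \<le> ln (norm (1 / E (Complex u t)))" using S[of u t] ut s' by simp
      also have "\<dots> = - ln (norm (E (Complex u t)))" using E0 by (simp add: norm_divide ln_div)
      finally have "ln (norm (E (Complex u t))) \<le> - (c * A s)" by simp
      then have "norm (E (Complex u t)) \<le> exp (- (c * A s))" using E0 by (metis exp_le_cancel_iff exp_ln zero_less_norm_iff)
      moreover have "norm (E (Complex u t)) / M \<le> norm (E (Complex u t))" using M(1) by (simp add: divide_le_eq mult_le_cancel_left1)
      ultimately show "norm (f (exp (Complex u t)) / of_real M) \<le> exp (- (c * A s))"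
        using M(1) by (simp add: norm_divide E_def)
    qed (use x xs in auto)
    then have "norm (f (of_real x)) / M \<le> exp (- (\<kappa> * (c * A s) * x / exp s))" using M(1) by (simp add: norm_divide)
    moreover have "0 < norm (f (of_real x)) / M" using x M by simp
    ultimately have "ln (norm (f (of_real x)) / M) \<le> - (\<kappa> * (c * A s) * x / exp s)"
      by (metis ln_exp ln_le_cancel_iff exp_gt_zero)
    then have "\<kappa> * (c * A s) * x / exp s \<le> D" by (simp add: D_def)
    then have "A s \<le> D / (\<kappa> * c * x) * exp s" using \<kappa> c x by (simp add: field_simps)
    also have "\<dots> \<le> C1 * exp s" by (intro mult_right_mono) (auto simp: C1_def)
    finally show ?thesis .
  qed
  have "bounded (f ` cball 0 (exp S1))"
    by (intro compact_imp_bounded compact_continuous_image holomorphic_on_imp_continuous_on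
        holomorphic_on_subset[OF holf]) auto
  then obtain M0 where M0: "\<And>z. norm z \<le> exp S1 \<Longrightarrow> norm (f z) \<le> M0"
    unfolding bounded_iff by (metis image_eqI mem_cball_0)
  define C where "C = max C1 (ln (max 1 M0))"
  have C: "C1 \<le> C" "0 \<le> C1" "ln (max 1 M0) \<le> C" by (auto simp: C_def C1_def)
  have "norm (f z) \<le> exp (C * (1 + norm z))" for z
  proof (cases "norm z \<le> exp S1")
    case True
    have "norm (f z) \<le> max 1 M0" using M0[OF True] by simp
    also have "\<dots> = exp (ln (max 1 M0))" by simp
    also have "\<dots> \<le> exp (C * (1 + norm z))"
    proof -
      have "C * 1 \<le> C * (1 + norm z)" using C by (intro mult_left_mono) auto
      then show ?thesis using C by (simp del: exp_ln)
    qed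
    finally show ?thesis .
  next
    case False
    then have z0: "0 < norm z" using exp_gt_zero[of S1] by linarith
    have z: "S1 \<le> ln (norm z)" using False z0 by (simp add: ln_ge_iff)
    have "s0 < ln (norm z)" using z by (simp add: S1_def)
    then have "norm (f z) \<le> exp (A (ln (norm z)))" using z0 by (intro norm_f_le) auto
    also have "A (ln (norm z)) \<le> C1 * norm z" using A_lin[OF z] z0 by simp
    also have "C1 * norm z \<le> C * (1 + norm z)" using C by (intro mult_mono) auto
    finally show ?thesis by simp
  qed
  moreover have "0 \<le> C" using C by linarith
  ultimately show ?thesis by blast
qed

text \<open>The supremum of the admissible exponents is attained because they form a closed set,
  which is bounded because f is nonzero at some positive real. Maximality is what later forbids any
  further decay of f exp (c z).\<close>

lemma maximal_decay:
  assumes M: "1 \<le> M" "\<And>z. 0 \<le> Re z \<Longrightarrow> norm (f z) \<le> M"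
  shows "\<exists>c\<ge>0. (\<forall>z. 0 \<le> Re z \<longrightarrow> norm (f z) * exp (c * Re z) \<le> M) \<and>
    (\<forall>c'>c. \<exists>z. 0 \<le> Re z \<and> M < norm (f z) * exp (c' * Re z))"
proof -
  define X where "X = {c :: real. 0 \<le> c \<and> (\<forall>z. 0 \<le> Re z \<longrightarrow> norm (f z) * exp (c * Re z) \<le> M)}"
  have "closed X" unfolding X_def
    by (intro closed_Collect_conj closed_Collect_all closed_Collect_imp closed_Collect_le continuous_intros) simp
  moreover have "0 \<in> X" using M by (simp add: X_def)
  moreover have "bdd_above X"
  proof -
    obtain x where x: "0 < x" "f (of_real x) \<noteq> 0" using nonconstant_nonzero_positive_real[OF holf nonconst] .
    have "c \<le> M / norm (f (of_real x)) / x" if "c \<in> X" for c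
    proof -
      have "norm (f (of_real x)) * exp (c * Re (of_real x)) \<le> M" using that x unfolding X_def by (metis (mono_tags, lifting) Re_complex_of_real less_imp_le mem_Collect_eq)
      then have "exp (c * x) \<le> M / norm (f (of_real x))" using x by (simp add: field_simps)
      moreover have "c * x \<le> exp (c * x)" using exp_ge_add_one_self[of "c * x"] by linarith
      ultimately have "c * x \<le> M / norm (f (of_real x))" by linarith
      then show ?thesis using x(1) by (subst pos_le_divide_eq)
    qed
    then show ?thesis by (rule bdd_aboveI)
  qed
  ultimately have c: "Sup X \<in> X" by (intro closed_contains_Sup) auto
  have "\<exists>z. 0 \<le> Re z \<and> M < norm (f z) * exp (c' * Re z)" if "Sup X < c'" for c'
  proof (rule ccontr)
    assume "\<not> ?thesis"
    then have "c' \<in> X" using c that by (fastforce simp: X_def not_less)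
    then show False using cSup_upper[OF _ \<open>bdd_above X\<close>] that by fastforce
  qed
  then show ?thesis using c by (intro exI[of _ "Sup X"]) (auto simp: X_def)
qed

text \<open>Suppose log |f exp (c z)| is below - \<epsilon> exp s at arbitrarily large scales.
  Harnack's inequality spreads this over a box, and the decay estimate gives an extra factor exp (-
  \<delta> x) on the whole positive axis. Then f exp ((c + \<delta>) z) is bounded on that axis, so
  by Phragmen-Lindelof at most \<open>M\<close> in the half-plane, against the maximality of
  \<open>c\<close>.\<close>

lemma decay_sharp:
  assumes M: "1 \<le> M" and c: "0 \<le> c" "\<And>z. 0 \<le> Re z \<Longrightarrow> norm (f z) * exp (c * Re z) \<le> M"
    and sharp: "\<And>c'. c < c' \<Longrightarrow> \<exists>z. 0 \<le> Re z \<and> M < norm (f z) * exp (c' * Re z)"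
    and C: "0 \<le> C" "\<And>z. norm (f z) \<le> exp (C * (1 + norm z))" and \<epsilon>: "0 < \<epsilon>"
  shows "\<forall>\<^sub>F s in at_top. \<forall>t\<in>{\<theta>\<^sub>1 - \<rho>..\<theta>\<^sub>1 + \<rho>}. - \<epsilon> * exp s \<le> Re (L (Complex s t) + of_real c * exp (Complex s t))"
proof (rule ccontr)
  define D where "D = (\<lambda>z. L z + of_real c * exp z)"
  assume "\<not> ?thesis"
  then have freq: "\<exists>\<^sub>F s in at_top. \<exists>t\<in>{\<theta>\<^sub>1 - \<rho>..\<theta>\<^sub>1 + \<rho>}. Re (D (Complex s t)) < - \<epsilon> * exp s"
    by (simp add: not_eventually D_def Bex_def not_le)
  have f_le: "norm (f z) \<le> M" if "0 \<le> Re z" for z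
  proof -
    have "norm (f z) * 1 \<le> norm (f z) * exp (c * Re z)" using c(1) that by (intro mult_left_mono) auto
    then show ?thesis using c(2)[OF that] by simp
  qed
  have ang: "- (pi / 2) < \<theta>\<^sub>1 - \<rho>" "\<theta>\<^sub>1 - \<rho> < \<theta>\<^sub>1 + \<rho>" "\<theta>\<^sub>1 + \<rho> < pi / 2" using \<theta>\<^sub>1 angles by linarith+
  obtain \<kappa> W where \<kappa>: "0 < \<kappa>" "0 < W"
    "\<And>g s m x. \<lbrakk>g holomorphic_on {z. 0 < Re z}; \<And>z. 0 < Re z \<Longrightarrow> norm (g z) \<le> 1; 0 \<le> m;
       \<And>u t. \<lbrakk>s \<le> u; u \<le> s + W; \<theta>\<^sub>1 - \<rho> \<le> t; t \<le> \<theta>\<^sub>1 + \<rho>\<rbrakk> \<Longrightarrow> norm (g (exp (Complex u t))) \<le> exp (- m);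
       0 < x; x \<le> \<kappa> * exp s\<rbrakk> \<Longrightarrow> norm (g (of_real x)) \<le> exp (- (\<kappa> * m * x / exp s))"
    using half_plane_decay_log[OF ang] by blast
  define K where "K = cbox (Complex 0 (\<theta>\<^sub>1 - \<rho>)) (Complex W (\<theta>\<^sub>1 + \<rho>))"
  have K: "compact K" "K \<subseteq> rect (W + 1) \<beta> (pi / 2)"
    using \<theta>\<^sub>1 \<kappa> by (auto simp: K_def in_cbox_complex_iff rect_iff)
  obtain C' where C': "0 < C'"
    "\<And>G z w. \<lbrakk>G holomorphic_on rect (W + 1) \<beta> (pi / 2); \<And>x. x \<in> rect (W + 1) \<beta> (pi / 2) \<Longrightarrow> 0 < Re (G x); z \<in> K; w \<in> K\<rbrakk>
      \<Longrightarrow> Re (G w) \<le> C' * Re (G z)"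
    using harnack_convex[OF open_convex_rect K] by blast
  define \<delta> where "\<delta> = \<kappa> * \<epsilon> / C'"
  have \<delta>: "0 < \<delta>" using \<kappa> \<epsilon> C' by (simp add: \<delta>_def)
  have holD: "D holomorphic_on T1" unfolding D_def by (intro holomorphic_intros holomorphic_on_subset[OF holL T1_subset(1)])
  have ReD: "exp (Re (D z)) = norm (f (exp z)) * exp (c * Re (exp z))" if "z \<in> T1" for z
  proof -
    have "exp (D z) = f (exp z) * exp (of_real c * exp z)" using expL T1_subset that by (auto simp: D_def exp_add)
    then have "norm (exp (D z)) = norm (f (exp z) * exp (of_real c * exp z))" by simp
    then show ?thesis by (simp add: norm_mult)
  qed
  have Re_pos: "0 < Re (exp z)" if "z \<in> T1" for z
    using that angles by (auto simp: strip_iff Re_exp intro!: mult_pos_pos cos_gt_zero_pi)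
  have axis: "norm (f (of_real x) * exp (of_real (c + \<delta>) * of_real x)) \<le> M * exp 1" if x: "0 < x" for x
  proof -
    have "\<forall>\<^sub>F s in at_top. x / \<kappa> \<le> exp s"
      using exp_at_top unfolding filterlim_at_top by blast
    then have "\<forall>\<^sub>F s in at_top. x / \<kappa> \<le> exp s \<and> s0 + (W + 1) \<le> s"
      using eventually_ge_at_top by (rule eventually_conj)
    from frequently_ex[OF frequently_eventually_frequently[OF freq this]]
    obtain s t where s: "x / \<kappa> \<le> exp s" "s0 + (W + 1) \<le> s" and t: "t \<in> {\<theta>\<^sub>1 - \<rho>..\<theta>\<^sub>1 + \<rho>}"
      and bad: "Re (D (Complex s t)) < - \<epsilon> * exp s"
      by blast
    \<comment> \<open>The bad scale \<open>s\<close> depends on \<open>x\<close>, but m / exp s does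
      not, so the rate \<delta> = \<kappa> m / exp s is the same for all \<open>x\<close>.\<close>
    define m where "m = \<epsilon> * exp s / C'"
    define G where "G = (\<lambda>z. of_real (ln M + 1) - D (z + of_real s))"
    have T: "z + of_real s \<in> T1" if "z \<in> rect (W + 1) \<beta> (pi / 2)" for z
      using that s by (simp add: strip_iff rect_iff)
    have holG: "G holomorphic_on rect (W + 1) \<beta> (pi / 2)"
      unfolding G_def by (intro holomorphic_intros holomorphic_window[OF holD s(2)])
    have D_le: "Re (D z) \<le> ln M" if "z \<in> T1" for z
    proof -
      have "exp (Re (D z)) \<le> exp (ln M)" using ReD[OF that] c(2)[of "exp z"] Re_pos[OF that] M by simp
      then show ?thesis by simp
    qed
    have G_pos: "0 < Re (G z)" if "z \<in> rect (W + 1) \<beta> (pi / 2)" for z using D_le[OF T[OF that]] by (simp add: G_def)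
    have "norm (f (of_real x) * exp (of_real c * of_real x) / of_real (M * exp 1)) \<le> exp (- (\<kappa> * m * x / exp s))"
    proof (rule \<kappa>(3)[where g = "\<lambda>z. f z * exp (of_real c * z) / of_real (M * exp 1)"])
      show "(\<lambda>z. f z * exp (of_real c * z) / of_real (M * exp 1)) holomorphic_on {z. 0 < Re z}"
        using M by (intro holomorphic_intros holomorphic_on_subset[OF holf]) auto
      show "norm (f z * exp (of_real c * z) / of_real (M * exp 1)) \<le> 1" if "0 < Re z" for z
      proof -
        have "norm (f z * exp (of_real c * z)) \<le> M * 1" using c(2)[of z] that by (simp add: norm_mult)
        also have "\<dots> \<le> M * exp 1" using M by (intro mult_left_mono) auto
        finally show ?thesis using M by (simp add: norm_divide norm_mult)
      qed
      show "0 \<le> m" using \<epsilon> C' by (simp add: m_def)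
      fix u v assume uv: "s \<le> u" "u \<le> s + W" "\<theta>\<^sub>1 - \<rho> \<le> v" "v \<le> \<theta>\<^sub>1 + \<rho>"
      have in_K: "Complex 0 t \<in> K" "Complex (u - s) v \<in> K" using t uv \<kappa> by (auto simp: K_def in_cbox_complex_iff)
      have shift: "Complex 0 t + of_real s = Complex s t" "Complex (u - s) v + of_real s = Complex u v"
        by (simp_all add: complex_eq_iff)
      have "0 \<le> ln M" using M by simp
      then have "\<epsilon> * exp s \<le> Re (G (Complex 0 t))" using bad by (simp add: G_def shift)
      also have "\<dots> \<le> C' * Re (G (Complex (u - s) v))" by (rule C'(2)[OF holG G_pos in_K(2,1)])
      finally have "m \<le> Re (G (Complex (u - s) v))" using C'(1) by (simp add: m_def field_simps)
      then have "Re (D (Complex u v)) \<le> ln M + 1 - m" by (simp add: G_def shift)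
      then have "exp (Re (D (Complex u v))) \<le> exp (ln M + 1 - m)" by simp
      also have "\<dots> = M * exp 1 * exp (- m)" using M by (simp add: exp_add exp_diff exp_minus field_simps)
      finally have "norm (f (exp (Complex u v)) * exp (of_real c * exp (Complex u v))) \<le> M * exp 1 * exp (- m)"
        using ReD[of "Complex u v"] T[OF subsetD[OF K(2) in_K(2)]] by (simp add: shift norm_mult)
      then show "norm (f (exp (Complex u v)) * exp (of_real c * exp (Complex u v)) / of_real (M * exp 1)) \<le> exp (- m)"
        using M by (simp add: norm_divide norm_mult field_simps)
    qed (use x s \<kappa> in \<open>auto simp: field_simps\<close>)
    moreover have rate: "\<kappa> * m * x / exp s = \<delta> * x" by (simp add: m_def \<delta>_def)
    ultimately have "norm (f (of_real x)) * exp (c * x) \<le> M * exp 1 * exp (- (\<delta> * x))"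
      unfolding rate using M by (simp add: norm_divide norm_mult divide_le_eq mult_ac)
    then have "norm (f (of_real x)) * exp (c * x) * exp (\<delta> * x) \<le> M * exp 1 * exp (- (\<delta> * x)) * exp (\<delta> * x)"
      by (intro mult_right_mono) auto
    then show ?thesis by (simp add: norm_mult exp_minus exp_add distrib_right mult.assoc)
  qed
  obtain w where w: "0 \<le> Re w" "M < norm (f w) * exp ((c + \<delta>) * Re w)" using sharp[of "c + \<delta>"] \<delta> by auto
  have "norm (f w * exp (of_real (c + \<delta>) * w)) \<le> M"
  proof (rule phragmen_lindelof_half_plane[where B = "M * exp 1" and C = "C + (c + \<delta>)" and h = "\<lambda>z. f z * exp (of_real (c + \<delta>) * z)"])
    show "(\<lambda>z. f z * exp (of_real (c + \<delta>) * z)) holomorphic_on UNIV" by (intro holomorphic_intros holf)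
    fix z :: complex assume "0 \<le> Re z"
    have "norm (f z * exp (of_real (c + \<delta>) * z)) \<le> exp (C * (1 + norm z)) * exp ((c + \<delta>) * Re z)"
      using C(2)[of z] by (simp add: norm_mult)
    also have "\<dots> = exp (C * (1 + norm z) + (c + \<delta>) * Re z)" by (simp add: exp_add)
    also have "(c + \<delta>) * Re z \<le> (c + \<delta>) * (1 + norm z)"
      using c(1) \<delta> complex_Re_le_cmod[of z] by (intro mult_left_mono) auto
    finally show "norm (f z * exp (of_real (c + \<delta>) * z)) \<le> exp ((C + (c + \<delta>)) * (1 + norm z))"
      by (simp add: distrib_right)
  next
    show "norm (f z * exp (of_real (c + \<delta>) * z)) \<le> M" if "Re z = 0" for z
      using f_le[of z] that by (simp add: norm_mult)
    show "norm (f (of_real x) * exp (of_real (c + \<delta>) * of_real x)) \<le> M * exp 1" if "0 \<le> x" for x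
    proof (cases "x = 0")
      case True
      have "M * 1 \<le> M * exp 1" using M by (intro mult_left_mono) auto
      then show ?thesis using f_le[of 0] True by simp
    qed (use axis that in simp)
  qed (use M w in auto)
  then show False using w by (simp add: norm_mult)
qed

text \<open>Near \<open>\<theta>\<^sub>1\<close> log |g| is bounded above and, by
  \<open>decay_sharp\<close>, at least - \<epsilon> exp s. Two constants with the majorant B exp s
  carry |log |g|| = o(exp s) to the angle \<open>pi\<close>. So g (- z) exp (- \<epsilon> z) is
  bounded on the positive axis; on the imaginary axis |g| = |f| \<le> M, and Phragmen-Lindelof
  followed by \<epsilon> \<rightarrow> 0 bounds g on the left half-plane as well.\<close>

lemma conclusion_zero:
  assumes st: "state1 (\<lambda>z. 1 / E z)" "state2 (\<lambda>z. 1 / E z)"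
  shows "\<exists>P a. \<forall>z. f z = poly P z * exp (a * z)"
proof -
  obtain M where M: "1 \<le> M" "\<And>z. 0 \<le> Re z \<Longrightarrow> norm (f z) \<le> M" using bounded_right_half_plane[OF st] by blast
  obtain C where C: "0 \<le> C" "\<And>z. norm (f z) \<le> exp (C * (1 + norm z))" using exponential_type[OF st(1) M] by blast
  obtain c where c: "0 \<le> c" "\<And>z. 0 \<le> Re z \<Longrightarrow> norm (f z) * exp (c * Re z) \<le> M"
    "\<And>c'. c < c' \<Longrightarrow> \<exists>z. 0 \<le> Re z \<and> M < norm (f z) * exp (c' * Re z)"
    using maximal_decay[OF M] by blast
  define g where "g = (\<lambda>z. f z * exp (of_real c * z))"
  have holg: "g holomorphic_on UNIV" unfolding g_def by (intro holomorphic_intros holf)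
  have norm_g: "norm (g z) = norm (f z) * exp (c * Re z)" for z by (simp add: g_def norm_mult)
  have g_growth: "norm (g z) \<le> exp ((C + c) * (1 + norm z))" for z
  proof -
    have "norm (g z) \<le> exp (C * (1 + norm z)) * exp (c * Re z)" using C(2)[of z] by (simp add: norm_g)
    also have "\<dots> = exp (C * (1 + norm z) + c * Re z)" by (simp add: exp_add)
    also have "c * Re z \<le> c * (1 + norm z)" using c(1) complex_Re_le_cmod[of z] by (intro mult_left_mono) auto
    finally show ?thesis by (simp add: distrib_right)
  qed
  define D where "D = (\<lambda>z. L z + of_real c * exp z)"
  have holD: "D holomorphic_on strip s0 \<beta> (\<alpha> + 2 * pi)" unfolding D_def by (intro holomorphic_intros holL)
  have ReD: "exp (Re (D z)) = norm (g (exp z))" if "z \<in> strip s0 \<beta> (\<alpha> + 2 * pi)" for z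
  proof -
    have "exp (D z) = g (exp z)" using expL that by (simp add: D_def g_def exp_add)
    then show ?thesis by (metis norm_exp_eq_Re)
  qed
  \<comment> \<open>\<open>exp 1\<close> covers the window of half-width 1 about \<open>s\<close>,
    the 2 replaces 1 + exp (Re z) by 2 exp (Re z), and the last summand makes \<open>B\<close>
    positive.\<close>
  define B where "B = exp 1 * (2 * (C + c) + 1)"
  have B: "0 < B" using C c by (simp add: B_def add_nonneg_pos)
  have D_le: "Re (D z) \<le> B * exp s" if z: "z \<in> strip s0 \<beta> (\<alpha> + 2 * pi)" "\<bar>Re z - s\<bar> < 1" for z s
  proof -
    have "exp (Re (D z)) \<le> exp ((C + c) * (1 + exp (Re z)))" using ReD[OF z(1)] g_growth[of "exp z"] by simp
    then have "Re (D z) \<le> (C + c) * (1 + exp (Re z))" by simp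
    also have "\<dots> \<le> (C + c) * (2 * exp (1 + s))"
    proof (rule mult_left_mono)
      have "0 \<le> Re z" using z(1) s0 by (simp add: strip_iff)
      then have "1 \<le> exp (Re z)" by simp
      moreover have "exp (Re z) \<le> exp (1 + s)" using z(2) by simp
      ultimately show "1 + exp (Re z) \<le> 2 * exp (1 + s)" by linarith
    qed (use C c in simp)
    also have "\<dots> \<le> B * exp s" by (simp add: B_def exp_add algebra_simps)
    finally show ?thesis .
  qed
  have small_pi: "\<forall>\<^sub>F s in at_top. \<bar>Re (D (Complex s pi))\<bar> \<le> \<epsilon> * exp s" if \<epsilon>: "0 < \<epsilon>" for \<epsilon>
  proof -
    have ang: "\<beta> < \<theta>\<^sub>1" "\<theta>\<^sub>1 < \<alpha> + 2 * pi" "\<beta> < pi" "pi < \<alpha> + 2 * pi" using \<theta>\<^sub>1 angles pi_gt3 by linarith+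
    have \<epsilon>B: "0 < \<epsilon> / B" using \<epsilon> B by simp
    obtain \<delta> where \<delta>: "0 < \<delta>"
      "\<And>G s0 s M t. \<lbrakk>G holomorphic_on strip s0 \<beta> (\<alpha> + 2 * pi); s0 + 1 \<le> s; 0 < M;
         \<And>z. \<lbrakk>z \<in> strip s0 \<beta> (\<alpha> + 2 * pi); \<bar>Re z - s\<bar> < 1\<rbrakk> \<Longrightarrow> Re (G z) \<le> M;
         \<And>z. \<lbrakk>z \<in> strip s0 \<beta> (\<alpha> + 2 * pi); dist (Complex s \<theta>\<^sub>1) z < \<rho>\<rbrakk> \<Longrightarrow> \<bar>Re (G z)\<bar> \<le> \<delta> * M; pi \<le> t; t \<le> pi\<rbrakk>
         \<Longrightarrow> \<bar>Re (G (Complex s t))\<bar> \<le> \<epsilon> / B * M"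
      using two_constants_window[OF ang(1,2) \<theta>\<^sub>1(3) ang(3,4) \<epsilon>B] by blast
    define \<epsilon>' where "\<epsilon>' = \<delta> * B / exp 1"
    have \<epsilon>': "0 < \<epsilon>'" using \<delta> B by (simp add: \<epsilon>'_def)
    obtain S where S: "\<And>u t. S \<le> u \<Longrightarrow> t \<in> {\<theta>\<^sub>1 - \<rho>..\<theta>\<^sub>1 + \<rho>} \<Longrightarrow> - \<epsilon>' * exp u \<le> Re (D (Complex u t))"
      using decay_sharp[OF M(1) c C \<epsilon>'] unfolding eventually_at_top_linorder D_def by blast
    have "\<forall>\<^sub>F s in at_top. ln M / (\<delta> * B) \<le> exp s" using exp_at_top unfolding filterlim_at_top by blast
    then show ?thesis
      using eventually_ge_at_top[of "max (s0 + 1) (S + 1)"]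
    proof eventually_elim
      case (elim s)
      have s: "s0 + 1 \<le> s" "S + 1 \<le> s" using elim(2) by auto
      have "\<bar>Re (D (Complex s pi))\<bar> \<le> \<epsilon> / B * (B * exp s)"
      proof (rule \<delta>(2)[OF holD s(1) _ D_le])
        show "0 < B * exp s" using B by simp
        show "\<bar>Re (D z)\<bar> \<le> \<delta> * (B * exp s)" if z: "z \<in> strip s0 \<beta> (\<alpha> + 2 * pi)" "dist (Complex s \<theta>\<^sub>1) z < \<rho>" for z
        proof -
          have "\<bar>Re (Complex s \<theta>\<^sub>1 - z)\<bar> < \<rho>" "\<bar>Im (Complex s \<theta>\<^sub>1 - z)\<bar> < \<rho>"
            using z(2) abs_Re_le_cmod[of "Complex s \<theta>\<^sub>1 - z"] abs_Im_le_cmod[of "Complex s \<theta>\<^sub>1 - z"] by (simp_all add: dist_norm)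
          then have r: "\<bar>s - Re z\<bar> < \<rho>" "\<bar>\<theta>\<^sub>1 - Im z\<bar> < \<rho>" by simp_all
          have bd: "S \<le> Re z" "Re z \<le> s + 1" "Im z \<in> {\<theta>\<^sub>1 - \<rho>..\<theta>\<^sub>1 + \<rho>}" "s0 < Re z" "\<beta> < Im z" "Im z < pi / 2"
            using r \<theta>\<^sub>1 s z(1) by (auto simp: abs_less_iff strip_iff)
          have "- (\<epsilon>' * exp (Re z)) \<le> Re (D z)" using S[OF bd(1,3)] by simp
          moreover have "\<epsilon>' * exp (Re z) \<le> \<epsilon>' * exp (s + 1)" using \<epsilon>' bd by (intro mult_left_mono) auto
          moreover have "\<epsilon>' * exp (s + 1) = \<delta> * (B * exp s)" by (simp add: \<epsilon>'_def exp_add)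
          moreover have "Re (D z) \<le> ln M"
          proof -
            have "0 \<le> Re (exp z)" using bd angles by (auto simp: Re_exp intro!: mult_nonneg_nonneg cos_ge_zero)
            then have "exp (Re (D z)) \<le> exp (ln M)" using ReD[OF z(1)] c(2)[of "exp z"] M(1) by (simp add: norm_g)
            then show ?thesis by simp
          qed
          moreover have "ln M \<le> \<delta> * (B * exp s)" using elim(1) \<delta>(1) B by (simp add: field_simps)
          ultimately show ?thesis by linarith
        qed
      qed auto
      then show "\<bar>Re (D (Complex s pi))\<bar> \<le> \<epsilon> * exp s" using B by simp
    qed
  qed
  have left: "norm (g (- z)) \<le> M" if z: "0 \<le> Re z" for z
  proof -
    have le: "norm (g (- z)) \<le> M * exp (\<epsilon> * Re z)" if \<epsilon>: "0 < \<epsilon>" for \<epsilon>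
    proof -
      obtain S where S: "\<And>s. S \<le> s \<Longrightarrow> \<bar>Re (D (Complex s pi))\<bar> \<le> \<epsilon> * exp s"
        using small_pi[OF \<epsilon>] unfolding eventually_at_top_linorder by blast
      define R where "R = exp (max S (s0 + 1))"
      have axis: "norm (g (- of_real x)) * exp (- \<epsilon> * x) \<le> max 1 (exp ((C + c) * (1 + R)))" if x: "0 \<le> x" for x
      proof (cases "x \<le> R")
        case True
        have "norm (g (- of_real x)) * exp (- \<epsilon> * x) \<le> norm (g (- of_real x)) * 1"
          using x \<epsilon> by (intro mult_left_mono) auto
        also have "\<dots> \<le> exp ((C + c) * (1 + x))" using g_growth[of "- of_real x"] x by simp
        also have "\<dots> \<le> exp ((C + c) * (1 + R))" using True C c by (simp add: mult_left_mono)
        finally show ?thesis by simp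
      next
        case False
        then have x0: "0 < x" using exp_gt_zero[of "max S (s0 + 1)"] unfolding R_def by linarith
        have lx: "max S (s0 + 1) \<le> ln x" using False x0 by (simp add: R_def ln_ge_iff del: max.bounded_iff)
        have pt: "Complex (ln x) pi \<in> strip s0 \<beta> (\<alpha> + 2 * pi)" using lx angles pi_gt3 by (simp add: strip_iff)
        have "exp (Complex (ln x) pi) = - of_real x" using x0 by (simp add: exp_eq_polar)
        then have "norm (g (- of_real x)) = exp (Re (D (Complex (ln x) pi)))" using ReD[OF pt] by simp
        also have "\<dots> \<le> exp (\<epsilon> * x)" using S[of "ln x"] lx x0 by simp
        finally have "norm (g (- of_real x)) * exp (- \<epsilon> * x) \<le> exp (\<epsilon> * x) * exp (- \<epsilon> * x)"
          by (intro mult_right_mono) auto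
        then show ?thesis by (simp add: exp_minus)
      qed
      have "norm (g (- z) * exp (- (of_real \<epsilon> * z))) \<le> M"
      proof (rule phragmen_lindelof_half_plane[where h = "\<lambda>z. g (- z) * exp (- (of_real \<epsilon> * z))" and C = "C + c"])
        have "(g \<circ> uminus) holomorphic_on UNIV"
          by (intro holomorphic_on_compose holomorphic_intros holomorphic_on_subset[OF holg]) auto
        then have "(\<lambda>z. g (- z)) holomorphic_on UNIV" by (simp add: o_def)
        then show "(\<lambda>z. g (- z) * exp (- (of_real \<epsilon> * z))) holomorphic_on UNIV" by (intro holomorphic_intros)
        show "norm (g (- z) * exp (- (of_real \<epsilon> * z))) \<le> exp ((C + c) * (1 + norm z))" if "0 \<le> Re z" for z
        proof -
          have "norm (g (- z) * exp (- (of_real \<epsilon> * z))) \<le> norm (g (- z)) * 1"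
            unfolding norm_mult using that \<epsilon> by (intro mult_left_mono) auto
          then show ?thesis using g_growth[of "- z"] by simp
        qed
        show "norm (g (- z) * exp (- (of_real \<epsilon> * z))) \<le> M" if "Re z = 0" for z
          using M(2)[of "- z"] that by (simp add: norm_mult norm_g)
        show "norm (g (- of_real x) * exp (- (of_real \<epsilon> * of_real x))) \<le> max 1 (exp ((C + c) * (1 + R)))" if "0 \<le> x" for x
          using axis[OF that] by (simp add: norm_mult)
      qed (use M z in auto)
      then have "norm (g (- z)) * exp (- (\<epsilon> * Re z)) \<le> M" by (simp add: norm_mult)
      then show ?thesis by (simp add: exp_minus field_simps)
    qed
    have "((\<lambda>\<epsilon>. M * exp (\<epsilon> * Re z)) \<longlongrightarrow> M * exp (0 * Re z)) (at_right 0)" by (intro tendsto_intros)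
    moreover have "\<forall>\<^sub>F \<epsilon> in at_right 0. norm (g (- z)) \<le> M * exp (\<epsilon> * Re z)"
      using le by (intro eventually_at_right_less[THEN eventually_mono]) auto
    ultimately have "norm (g (- z)) \<le> M * exp (0 * Re z)"
      by (intro tendsto_lowerbound[where F = "at_right (0 :: real)"]) auto
    then show ?thesis by simp
  qed
  have "norm (g z) \<le> M" for z
  proof (cases "0 \<le> Re z")
    case True
    then show ?thesis using c(2)[of z] by (simp add: norm_g)
  next
    case False
    then show ?thesis using left[of "- z"] by simp
  qed
  then have "bounded (range g)" by (auto simp: bounded_iff)
  then obtain k where k: "\<And>z. g z = k" using Liouville_theorem[OF holg] by (metis constant_on_def UNIV_I)
  have "f z = poly [:k:] z * exp (- of_real c * z)" for z
  proof -
    have "f z * exp (of_real c * z) = k" using k[of z] by (simp add: g_def)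
    then have "f z * (exp (of_real c * z) * exp (- of_real c * z)) = k * exp (- of_real c * z)" by (simp add: mult.assoc[symmetric])
    then show ?thesis by (simp add: exp_minus)
  qed
  then show ?thesis by blast
qed

lemma exponential_polynomial:
  assumes "\<beta> < pi / 6" "\<beta> - \<alpha> < pi / 3"
  shows "\<exists>P a. \<forall>z. f z = poly P z * exp (a * z)"
  using same_state conclusion_infinity[OF assms] conclusion_zero not_state_one[OF assms] by blast

end

section \<open>Reduction to normal position\<close>

lemma finite_order_logmax:
  assumes "growth_order f < \<infinity>" and large: "\<forall>\<^sub>F s in at_top. 1 \<le> logmax f s"
  shows "\<exists>N. \<forall>\<^sub>F s in at_top. logmax f s \<le> exp (N * s)"
proof -
  obtain N :: nat where "growth_order f < ereal (real N)" using assms(1) less_PInf_Ex_of_nat by auto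
  then have "\<forall>\<^sub>F r in at_top. ereal (ln (ln (max_modulus f r)) / ln r) < ereal (real N)"
    unfolding growth_order_def by (rule Limsup_lessD)
  then have "\<forall>\<^sub>F s in at_top. ln (ln (max_modulus f (exp s))) / ln (exp s) < real N"
    by (intro eventually_compose_filterlim[OF _ exp_at_top]) simp
  with large have "\<forall>\<^sub>F s in at_top. logmax f s \<le> exp (real N * s)"
    using eventually_gt_at_top[of 0]
  proof eventually_elim
    case (elim s)
    then have "ln (logmax f s) < real N * s" by (simp add: logmax_def divide_less_eq)
    then have "exp (ln (logmax f s)) \<le> exp (real N * s)" by simp
    then show ?case using elim by simp
  qed
  then show ?thesis by blast
qed

lemma exponential_polynomial_normalised:
  assumes hol: "f holomorphic_on UNIV" and nc: "\<not> f constant_on UNIV"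
    and ang: "- (pi / 2) < \<alpha>" "\<alpha> \<le> \<beta>" "\<beta> < pi / 2" "\<beta> - \<alpha> < pi / 3"
    and zeros: "finite {z. f z = 0 \<and> z \<notin> closed_sector \<alpha> \<beta>}" and ones: "finite {z. f z = 1 \<and> 0 < Re z}"
    and order: "growth_order f < \<infinity>"
  shows "\<exists>P a. \<forall>z. f z = poly P z * exp (a * z)"
proof -
  obtain R1 where R1: "\<And>z. f z = 0 \<Longrightarrow> z \<notin> closed_sector \<alpha> \<beta> \<Longrightarrow> norm z \<le> R1"
    using finite_imp_bounded[OF zeros] unfolding bounded_iff by blast
  obtain R2 where R2: "\<And>z. f z = 1 \<Longrightarrow> 0 < Re z \<Longrightarrow> norm z \<le> R2"
    using finite_imp_bounded[OF ones] unfolding bounded_iff by blast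
  obtain R3 where R3: "0 \<le> R3" "\<And>r. R3 \<le> r \<Longrightarrow> exp 1 < max_modulus f r"
    using max_modulus_unbounded[OF hol nc] by blast
  have A_ge: "1 \<le> logmax f s" if "R3 \<le> exp s" for s
  proof -
    have "exp 1 < max_modulus f (exp s)" by (rule R3(2)[OF that])
    then have "ln (exp 1) \<le> ln (max_modulus f (exp s))" by (intro ln_mono) auto
    then show ?thesis by (simp add: logmax_def)
  qed
  have "\<forall>\<^sub>F s in at_top. R3 \<le> exp s" using exp_at_top unfolding filterlim_at_top by blast
  then have "\<forall>\<^sub>F s in at_top. 1 \<le> logmax f s" using A_ge by (rule eventually_mono)
  then obtain N where N: "\<forall>\<^sub>F s in at_top. logmax f s \<le> exp (N * s)" using finite_order_logmax[OF order] by blast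
  have "\<forall>\<^sub>F s in at_top. max R1 (max R2 R3) \<le> exp s" using exp_at_top unfolding filterlim_at_top by blast
  from eventually_conj[OF N this]
  obtain s1 where s1: "\<forall>s\<ge>s1. logmax f s \<le> exp (N * s) \<and> max R1 (max R2 R3) \<le> exp s"
    unfolding eventually_at_top_linorder by (rule exE)
  define s0 where "s0 = max 0 s1"
  have s0: "logmax f s \<le> exp (N * s)" "R1 < exp s" "R2 < exp s" "1 \<le> logmax f s" if "s0 < s" for s
  proof -
    have "exp s1 < exp s" using that by (simp add: s0_def)
    moreover have "R1 \<le> exp s1" "R2 \<le> exp s1" using s1[rule_format, of s1] by auto
    ultimately show "R1 < exp s" "R2 < exp s" by linarith+
    show "logmax f s \<le> exp (N * s)" "1 \<le> logmax f s" using s1[rule_format, of s] A_ge[of s] that by (auto simp: s0_def)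
  qed
  have f0: "f (exp z) \<noteq> 0" if z: "z \<in> strip s0 \<beta> (\<alpha> + 2 * pi)" for z
  proof
    assume "f (exp z) = 0"
    moreover have "R1 < norm (exp z)" using s0(2) z by (simp add: strip_iff)
    ultimately have "exp z \<in> closed_sector \<alpha> \<beta>" using R1[of "exp z"] by force
    then obtain r t where rt: "exp z = of_real r * cis t" "0 \<le> r" "\<alpha> \<le> t" "t \<le> \<beta>" by (auto simp: closed_sector_def)
    have "r \<noteq> 0" using rt(1) exp_not_eq_zero[of z] by force
    then have "exp z = exp (Complex (ln r) t)" using rt by (simp add: exp_eq_polar)
    then obtain k :: int where "z = Complex (ln r) t + of_int (2 * k) * of_real pi * \<i>"
      unfolding exp_eq by auto
    then have k: "Im z = t + 2 * of_int k * pi" by simp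
    have "\<beta> < Im z" "Im z < \<alpha> + 2 * pi" using z by (auto simp: strip_iff)
    then have "0 < of_int k * pi" "of_int k * pi < 1 * pi" using k rt by linarith+
    then have "(0::real) < of_int k" "of_int k < (1::real)"
      by (auto simp: zero_less_mult_iff mult_less_cancel_right_pos)
    then show False by simp
  qed
  have f1: "1 - f (exp z) \<noteq> 0" if z: "z \<in> strip s0 (- (pi / 2)) (pi / 2)" for z
  proof -
    have "0 < Re (exp z)" using z by (auto simp: strip_iff Re_exp intro!: mult_pos_pos cos_gt_zero_pi)
    moreover have "R2 < norm (exp z)" using s0(3) z by (simp add: strip_iff)
    ultimately show ?thesis using R2[of "exp z"] by force
  qed
  have hf: "(\<lambda>z. f (exp z)) holomorphic_on X" for X
  proof -
    have "(f \<circ> exp) holomorphic_on X"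
      by (intro holomorphic_on_compose holomorphic_intros holomorphic_on_subset[OF hol]) auto
    then show ?thesis by (simp add: o_def)
  qed
  have "Complex (s0 + 1) pi \<in> strip s0 \<beta> (\<alpha> + 2 * pi)" using ang pi_gt_zero by (simp add: strip_iff)
  then obtain L where L: "L holomorphic_on strip s0 \<beta> (\<alpha> + 2 * pi)"
    "\<And>z. z \<in> strip s0 \<beta> (\<alpha> + 2 * pi) \<Longrightarrow> exp (L z) = f (exp z)"
    using holomorphic_logarithm_exists[OF open_convex_strip(2,1) hf f0] by metis
  have "Complex (s0 + 1) 0 \<in> strip s0 (- (pi / 2)) (pi / 2)" by (simp add: strip_iff)
  then obtain L1 where L1: "L1 holomorphic_on strip s0 (- (pi / 2)) (pi / 2)"
    "\<And>z. z \<in> strip s0 (- (pi / 2)) (pi / 2) \<Longrightarrow> exp (L1 z) = 1 - f (exp z)"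
    using holomorphic_logarithm_exists[OF open_convex_strip(2,1) holomorphic_on_diff[OF holomorphic_on_const hf] f1] by metis
  interpret separated_values f L L1 \<alpha> \<beta> s0 N
    by unfold_locales (use hol nc ang L L1 s0 in \<open>auto simp: s0_def\<close>)
  show ?thesis
  \<comment> \<open>As \<open>\<beta> - \<alpha> < pi / 3\<close>, one of \<beta> and - \<alpha> is
    below \<open>pi / 6\<close>: one of the two gaps is wider than \<open>pi / 3\<close>. In the
    second case conjugation makes it the upper one.\<close>
  proof (cases "\<beta> < pi / 6")
    case True
    then show ?thesis using exponential_polynomial ang(4) by blast
  next
    case False
    then have "\<exists>P a. \<forall>z. cnj (f (cnj z)) = poly P z * exp (a * z)"
      by (intro separated_values.exponential_polynomial[OF reflected]) (use ang in auto)
    then obtain P a where P: "\<And>z. cnj (f (cnj z)) = poly P z * exp (a * z)" by blast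
    have "f z = poly (map_poly cnj P) z * exp (cnj a * z)" for z
      using arg_cong[OF P[of "cnj z"], of cnj] by (simp add: exp_cnj)
    then show ?thesis by blast
  qed
qed

lemma inner_rotated: "inner (of_real r * cis \<phi>) (cis \<phi> * z) = r * Re z"
proof -
  have "inner (of_real r * cis \<phi>) (cis \<phi> * z) = r * Re z * ((cos \<phi>)\<^sup>2 + (sin \<phi>)\<^sup>2)"
    by (simp add: inner_complex_def algebra_simps power2_eq_square del: sin_cos_squared_add2 sin_cos_squared_add sin_cos_squared_add3)
  then show ?thesis by simp
qed

text \<open>The boundary line of \<open>H\<close> must pass through 0: \<open>0 \<in> H\<close>
  gives \<open>b \<ge> 0\<close>, and points of the sector arbitrarily close to 0 lie outside
  \<open>H\<close>, which gives \<open>b \<le> 0\<close>. The rotation then takes the normal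
  \<open>u\<close> to the positive axis.\<close>

lemma half_plane_avoiding_sector:
  assumes H: "closed_half_plane H" and HS: "H \<inter> closed_sector \<alpha> \<beta> = {0}" and ab: "\<alpha> < \<beta>"
  obtains \<phi> where "- (pi / 2) < \<alpha> - \<phi>" "\<beta> - \<phi> < pi / 2" "\<And>z. cis \<phi> * z \<in> H \<Longrightarrow> Re z \<le> 0"
proof -
  obtain u b where u: "u \<noteq> 0" and Hu: "H = {z. inner u z \<le> b}" using H unfolding closed_half_plane_def by blast
  have "0 \<in> H" using HS by blast
  then have b0: "0 \<le> b" by (simp add: Hu)
  have gt: "b < r * inner u (cis t)" if "0 < r" "\<alpha> \<le> t" "t \<le> \<beta>" for r t
  proof -
    have "of_real r * cis t \<in> closed_sector \<alpha> \<beta>" using that unfolding closed_sector_def by fastforce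
    moreover have "of_real r * cis t \<noteq> 0" using that by simp
    ultimately have "of_real r * cis t \<notin> H" using HS by blast
    moreover have "inner u (of_real r * cis t) = r * inner u (cis t)" by (metis inner_scaleR_right scaleR_conv_of_real)
    ultimately show ?thesis by (simp add: Hu)
  qed
  have pos: "0 < inner u (cis t)" if "\<alpha> \<le> t" "t \<le> \<beta>" for t using gt[of 1 t] that b0 by simp
  have "b \<le> 0"
  proof (rule field_le_epsilon)
    fix e :: real assume e: "0 < e"
    have p: "0 < inner u (cis \<alpha>)" using pos ab by simp
    show "b \<le> 0 + e" using gt[of "e / inner u (cis \<alpha>)" \<alpha>] ab e p by simp
  qed
  with b0 have b: "b = 0" by simp
  \<comment> \<open>Measuring the argument of \<open>u\<close> from \<alpha> selects the value
    \<phi> closest to \<alpha>; then \<alpha> - \<phi> is below \<open>pi / 2\<close> in modulus,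
    and \<beta> cannot pass \<phi> + \<open>pi / 2\<close>, where the cosine would vanish.\<close>
  define y where "y = Im (Ln (cis \<alpha> / u))"
  define \<phi> where "\<phi> = \<alpha> - y"
  have nz: "cis \<alpha> / u \<noteq> 0" using u by simp
  have "cis \<alpha> / u = of_real (norm (cis \<alpha> / u)) * cis y"
    using nz by (metis exp_Ln exp_eq_polar norm_exp_eq_Re y_def)
  then have "u = of_real (norm u) * (cis \<alpha> / cis y)" using u by (simp add: norm_divide field_simps)
  then have u_eq: "u = of_real (norm u) * cis \<phi>" by (simp add: \<phi>_def cis_divide)
  have inner_u: "inner u (cis \<phi> * z) = norm u * Re z" for z by (subst u_eq) (rule inner_rotated)
  have cos_pos: "0 < cos (t - \<phi>)" if "\<alpha> \<le> t" "t \<le> \<beta>" for t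
  proof -
    have "cis t = cis \<phi> * cis (t - \<phi>)" by (simp add: cis_mult)
    then show ?thesis using pos[OF that] inner_u[of "cis (t - \<phi>)"] u by (simp add: zero_less_mult_iff)
  qed
  have y: "\<bar>y\<bar> < pi / 2"
  proof -
    have "0 < Re (cis \<alpha> / u)"
    proof -
      have "Re (cis \<alpha> / u) = inner u (cis \<alpha>) / (norm u)\<^sup>2"
        by (simp add: Re_divide inner_complex_def cmod_power2 mult.commute)
      then show ?thesis using pos[of \<alpha>] ab u by simp
    qed
    then show ?thesis using Re_Ln_pos_lt[OF nz] by (simp add: y_def)
  qed
  show thesis
  proof (rule that[of \<phi>])
    show "- (pi / 2) < \<alpha> - \<phi>" using y by (simp add: \<phi>_def abs_less_iff)
    show "\<beta> - \<phi> < pi / 2"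
    proof (rule ccontr)
      assume "\<not> \<beta> - \<phi> < pi / 2"
      then have "0 < cos (\<phi> + pi / 2 - \<phi>)" using y by (intro cos_pos) (auto simp: \<phi>_def abs_less_iff)
      then show False by simp
    qed
    show "Re z \<le> 0" if "cis \<phi> * z \<in> H" for z
      using that u by (simp add: Hu b inner_u mult_le_0_iff)
  qed
qed

theorem theorem1p2:
  fixes f :: "complex \<Rightarrow> complex" and S H :: "complex set" and \<alpha> \<beta> :: real
  assumes "S = closed_sector \<alpha> \<beta>" and "\<alpha> < \<beta>" and "\<beta> - \<alpha> < pi / 3"
    and "closed_half_plane H" and "H \<inter> S = {0}"
    and "transcendental_entire f" and "growth_order f < \<infinity>"
    and "finite ({z. f z = 0} - S)"
    and "finite ({z. f z = 1} - H)"
  shows "\<exists>(P :: complex poly) (a :: complex). \<forall>z. f z = poly P z * exp (a * z)"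
proof -
  have hol: "f holomorphic_on UNIV" and np: "\<not> (\<exists>p. \<forall>z. f z = poly p z)"
    using assms(6) by (auto simp: transcendental_entire_def)
  obtain \<phi> where \<phi>: "- (pi / 2) < \<alpha> - \<phi>" "\<beta> - \<phi> < pi / 2" "\<And>z. cis \<phi> * z \<in> H \<Longrightarrow> Re z \<le> 0"
    using half_plane_avoiding_sector[OF assms(4) assms(5)[unfolded assms(1)] assms(2)] by blast
  define g where "g = (\<lambda>z. f (cis \<phi> * z))"
  have f_g: "f z = g (cis (- \<phi>) * z)" for z by (simp add: g_def mult.assoc[symmetric] cis_mult)
  have inj: "inj ((*) (cis \<phi>))" by (simp add: inj_on_def)
  have "\<exists>P a. \<forall>z. g z = poly P z * exp (a * z)"
  proof (rule exponential_polynomial_normalised)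
    have "(f \<circ> (*) (cis \<phi>)) holomorphic_on UNIV"
      by (intro holomorphic_on_compose holomorphic_intros holomorphic_on_subset[OF hol]) auto
    then show "g holomorphic_on UNIV" by (simp add: g_def o_def)
    show "\<not> g constant_on UNIV"
    proof
      assume "g constant_on UNIV"
      then obtain k where "\<And>z. g z = k" by (auto simp: constant_on_def)
      then have "\<forall>z. f z = poly [:k:] z" by (simp add: f_g)
      then show False using np by blast
    qed
    have "max_modulus g r = max_modulus f r" for r
    proof -
      have "(*) (cis \<phi>) ` sphere 0 r = sphere 0 r"
      proof (intro equalityI subsetI)
        fix z :: complex assume "z \<in> sphere 0 r"
        then have "cis (- \<phi>) * z \<in> sphere 0 r" "z = cis \<phi> * (cis (- \<phi>) * z)"
          by (simp_all add: norm_mult mult.assoc[symmetric] cis_mult)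
        then show "z \<in> (*) (cis \<phi>) ` sphere 0 r" by blast
      qed (auto simp: norm_mult)
      then show ?thesis unfolding max_modulus_def g_def by (metis (mono_tags, lifting) SUP_cong image_image)
    qed
    then show "growth_order g < \<infinity>" using assms(7) by (simp add: growth_order_def)
    have sector: "cis \<phi> * z \<notin> S" if "z \<notin> closed_sector (\<alpha> - \<phi>) (\<beta> - \<phi>)" for z
    proof
      assume "cis \<phi> * z \<in> S"
      then obtain r t where rt: "cis \<phi> * z = of_real r * cis t" "0 \<le> r" "\<alpha> \<le> t" "t \<le> \<beta>"
        by (auto simp: assms(1) closed_sector_def)
      have "z = cis (- \<phi>) * (cis \<phi> * z)" by (simp add: mult.assoc[symmetric] cis_mult)
      also have "\<dots> = of_real r * (cis (- \<phi>) * cis t)" by (simp add: rt(1) mult.left_commute)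
      also have "cis (- \<phi>) * cis t = cis (t - \<phi>)" by (simp add: cis_mult)
      finally have "z = of_real r * cis (t - \<phi>)" .
      moreover have "\<alpha> - \<phi> \<le> t - \<phi>" "t - \<phi> \<le> \<beta> - \<phi>" using rt by auto
      ultimately have "z \<in> closed_sector (\<alpha> - \<phi>) (\<beta> - \<phi>)" using rt(2) unfolding closed_sector_def by blast
      then show False using that by blast
    qed
    show "finite {z. g z = 0 \<and> z \<notin> closed_sector (\<alpha> - \<phi>) (\<beta> - \<phi>)}"
      by (rule finite_subset[OF _ finite_vimageI[OF assms(8) inj]]) (use sector in \<open>auto simp: g_def\<close>)
    show "finite {z. g z = 1 \<and> 0 < Re z}"
      by (rule finite_subset[OF _ finite_vimageI[OF assms(9) inj]]) (use \<phi>(3) in \<open>fastforce simp: g_def\<close>)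
  qed (use \<phi> assms in auto)
  then obtain P a where P: "\<And>z. g z = poly P z * exp (a * z)" by blast
  have "f z = poly (pcompose P [:0, cis (- \<phi>):]) z * exp (a * cis (- \<phi>) * z)" for z
    by (simp add: f_g P poly_pcompose mult_ac)
  then show ?thesis by blast
qed

end
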